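(* Let $\mathbb K$ be an algebraically closed field of characteristic $3$. Let $\mathfrak e_8=\mathfrak g(A)$ with purely even Cartan matrix $$A=\begin{pmatrix}2&0&-1&0&0&0&0&0\\0&2&0&-1&0&0&0&0\\-1&0&2&-1&0&0&0&0\\0&-1&-1&2&-1&0&0&0\\0&0&0&-1&2&-1&0&0\\0&0&0&0&-1&2&-1&0\\0&0&0&0&0&-1&2&-1\\0&0&0&0&0&0&-1&2\end{pmatrix}.$$ Let $\mathfrak g(8,3)=\mathfrak g(\widetilde A)$ be the Elduque and Cunha Lie superalgebra with Cartan matrix $$\widetilde A=\begin{pmatrix}0&-1&0&0&0\\-1&0&-1&0&0\\0&-1&2&-1&0\\0&0&-1&2&-1\\0&0&0&-1&0\end{pmatrix}$$ in which indices $1,2,5$ are odd and indices $3,4$ are even. Then the semisimplification of $\mathfrak e_8$, as an object in $\mathrm{Rep}\,\alpha_3$ under the adjoint action of $e_1+e_2+e_8$, is (isomorphic as a Lie superalgebra to) $\mathfrak g(8,3)$.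
   Context: **Contragredient Lie superalgebras.** Lie superalgebras in characteristic $3$ are required to satisfy $[x,[x,x]]=0$ for odd $x$. Let $A=(a_{ij})$ be an $n\times n$ integer matrix (a Cartan matrix) with a parity $\mathrm{par}(i)\in\mathbb Z/2$ for each index; let $\overline A=(\overline a_{ij})$ be its reduction mod $3$, of rank $s$. Let $\widetilde{\mathfrak h}$ be a $\mathbb K$-vector space of dimension $2n-s$ with linearly independent $h_1,\dots,h_n\in\widetilde{\mathfrak h}$ and linearly independent $\alpha_1,\dots,\alpha_n\in\widetilde{\mathfrak h}^*$ such that $\alpha_j(h_i)=\overline a_{ij}$. $\widetilde{\mathfrak g}(A)$ is the Lie superalgebra generated by $\widetilde{\mathfrak h}$ (even) and $e_i,f_i$ ($1\le i\le n$) of parity $\mathrm{par}(i)$, with relations $[e_i,f_j]=\delta_{ij}h_i$, $[h,e_j]=\alpha_j(h)e_j$, $[h,f_j]=-\alpha_j(h)f_j$, $[\widetilde{\mathfrak h},\widetilde{\mathfrak h}]=0$. It is graded by the free abelian group $Q=\bigoplus_k\mathbb Z\alpha_k$ with $\deg e_i=\alpha_i$, $\deg f_i=-\alpha_i$, $\deg h=0$. $\mathfrak g(A)=\widetilde{\mathfrak g}(A)/\mathfrak r$, where $\mathfrak r$ is the largest $Q$-graded ideal meeting $\widetilde{\mathfrak h}$ trivially; images of $e_i,f_i,h_i$ keep their names. If all parities are $0$, $\mathfrak g(A)$ is a Lie algebra. **Semisimplification.** $\mathrm{Rep}\,\alpha_3$ (representations of the Frobenius kernel of $\mathbb G_a$)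 is the symmetric tensor category of finite-dimensional $\mathbb K[t]/(t^3)$-modules, with $t$ acting on $V\otimes W$ by $t\otimes1+1\otimes t$ and the flip as braiding. Its indecomposables are $J_1,J_2,J_3$, where $t$ acts on $J_n=\mathbb K^n$ as one nilpotent Jordan block. A Lie algebra $\mathfrak g$ with a derivation $d$, $d^3=0$, is a Lie algebra in $\mathrm{Rep}\,\alpha_3$ with $t$ acting by $d$; "under the adjoint action of $x$" means $d=\mathrm{ad}\,x$. The semisimplification functor $V\mapsto\overline V$ is the quotient of $\mathrm{Rep}\,\alpha_3$ by negligible morphisms ($u:V\to W$ with $\mathrm{tr}(u\circ v)=0$ for all $v:W\to V$), with target the Verlinde category $\mathrm{Ver}_3$, whose simple objects are $L_1=\overline{J_1}$, $L_2=\overline{J_2}$ ($\overline{J_3}=0$); $\mathrm{Ver}_3$ is identified with super vector spaces, $L_1$ being an even line and $L_2$ an odd line, so $\overline{\mathfrak g}$ is a Lie superalgebra. Explicitly, decompose $\mathfrak g$ into Jordan blocks $x_i$ ($i\le n_1$), $x_i\mapsto x_i'$ ($n_1<i\le n_1+n_2$), and blocks $x_i\mapsto x_i'\mapsto x_i''$ (arrows are the action of $d$). Then $\overline{\mathfrak g}$ has basis $y_i$ ($i\le n_1+n_2$), even for $i\le n_1$ and odd for $i>n_1$; the coefficient of $y_k$ in $[y_i,y_j]$ is the coefficient of $x_k$ in $[x_i,x_j]$ if the parities of $y_i,y_j,y_k$ are compatible and $y_i,y_j$ are not both odd; it is the coefficient of $x_k$ in $-[x_i,x_j']+[x_i',x_j]$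 if $i,j>n_1$, $k\le n_1$; and $0$ otherwise. *)

theory Defs
  imports
    "HOL-Analysis.Cartesian_Space"
    "HOL-Algebra.Algebraic_Closure_Type"
    "HOL-Library.Poly_Mapping"
    "HOL-Library.Z2"
begin

unbundle no fps_syntax

section \<open>Lie superalgebras\<close>

text \<open>
  Superalgebras over a field type are records with an explicit carrier. The bracket is the
  \<open>mult\<close> field of the underlying record, written \<open>x \<otimes> y\<close>; the field \<open>one\<close> has no meaning and is
  left undefined. \<open>part L 0\<close> and \<open>part L 1\<close> are the even and the odd part.
\<close>

abbreviation scalars :: "'k::field ring"
  where "scalars \<equiv> ring_of_type_algebra"

record ('k, 'a) superalgebra = "('k, 'a) module" +
  part :: "bit \<Rightarrow> 'a set"

definition koszul_sign :: "bit \<Rightarrow> bit \<Rightarrow> 'k::field"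
  where "koszul_sign p q = (if p = 1 \<and> q = 1 then - 1 else 1)"

text \<open>Super skew-symmetry, the super Jacobi identity, and \<open>[x,[x,x]] = 0\<close> for odd \<open>x\<close>; the last
  one does not follow from the Jacobi identity in characteristic 3.\<close>

definition lie_relators :: "('k::field, 'a) superalgebra \<Rightarrow> 'a set"
  where "lie_relators L =
    {x \<otimes>\<^bsub>L\<^esub> y \<oplus>\<^bsub>L\<^esub> (koszul_sign p q \<odot>\<^bsub>L\<^esub> (y \<otimes>\<^bsub>L\<^esub> x)) | p q x y.
       x \<in> part L p \<and> y \<in> part L q}
    \<union> {x \<otimes>\<^bsub>L\<^esub> (y \<otimes>\<^bsub>L\<^esub> z) \<ominus>\<^bsub>L\<^esub> ((x \<otimes>\<^bsub>L\<^esub> y) \<otimes>\<^bsub>L\<^esub> z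
         \<oplus>\<^bsub>L\<^esub> (koszul_sign p q \<odot>\<^bsub>L\<^esub> (y \<otimes>\<^bsub>L\<^esub> (x \<otimes>\<^bsub>L\<^esub> z)))) | p q s x y z.
       x \<in> part L p \<and> y \<in> part L q \<and> z \<in> part L s}
    \<union> {x \<otimes>\<^bsub>L\<^esub> (x \<otimes>\<^bsub>L\<^esub> x) | x. x \<in> part L 1}"

definition lie_superalgebra :: "('k::field, 'a) superalgebra \<Rightarrow> bool"
  where "lie_superalgebra L \<longleftrightarrow>
    Module.module scalars L \<and>
    (\<forall>p. submodule (part L p) scalars L) \<and>
    part L 0 \<inter> part L 1 = {\<zero>\<^bsub>L\<^esub>} \<and> part L 0 <+>\<^bsub>L\<^esub> part L 1 = carrier L \<and>
    (\<forall>p q. \<forall>x\<in>part L p. \<forall>y\<in>part L q. x \<otimes>\<^bsub>L\<^esub> y \<in> part L (p + q)) \<and>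
    (\<forall>x\<in>carrier L. \<forall>y\<in>carrier L. \<forall>z\<in>carrier L.
       (x \<oplus>\<^bsub>L\<^esub> y) \<otimes>\<^bsub>L\<^esub> z = x \<otimes>\<^bsub>L\<^esub> z \<oplus>\<^bsub>L\<^esub> y \<otimes>\<^bsub>L\<^esub> z \<and>
       x \<otimes>\<^bsub>L\<^esub> (y \<oplus>\<^bsub>L\<^esub> z) = x \<otimes>\<^bsub>L\<^esub> y \<oplus>\<^bsub>L\<^esub> x \<otimes>\<^bsub>L\<^esub> z) \<and>
    (\<forall>c. \<forall>x\<in>carrier L. \<forall>y\<in>carrier L.
       (c \<odot>\<^bsub>L\<^esub> x) \<otimes>\<^bsub>L\<^esub> y = c \<odot>\<^bsub>L\<^esub> (x \<otimes>\<^bsub>L\<^esub> y) \<and>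
       x \<otimes>\<^bsub>L\<^esub> (c \<odot>\<^bsub>L\<^esub> y) = c \<odot>\<^bsub>L\<^esub> (x \<otimes>\<^bsub>L\<^esub> y)) \<and>
    lie_relators L \<subseteq> {\<zero>\<^bsub>L\<^esub>}"

definition lie_ideal :: "('k::field, 'a) superalgebra \<Rightarrow> 'a set \<Rightarrow> bool"
  where "lie_ideal L I \<longleftrightarrow> submodule I scalars L \<and>
    (\<forall>x\<in>carrier L. \<forall>a\<in>I. x \<otimes>\<^bsub>L\<^esub> a \<in> I \<and> a \<otimes>\<^bsub>L\<^esub> x \<in> I)"

definition rcoset_smult :: "('k, 'a, 'z) module_scheme \<Rightarrow> 'a set \<Rightarrow> 'k \<Rightarrow> 'a set \<Rightarrow> 'a set"
  where "rcoset_smult M I c C = (\<Union>x\<in>C. I +>\<^bsub>M\<^esub> (c \<odot>\<^bsub>M\<^esub> x))"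

definition quotient_superalgebra ::
    "('k, 'a) superalgebra \<Rightarrow> 'a set \<Rightarrow> ('k, 'a set) superalgebra"
  where "quotient_superalgebra L I =
    \<lparr>carrier = a_rcosets\<^bsub>L\<^esub> I, monoid.mult = rcoset_mult L I, one = undefined, ring.zero = I,
      add = set_add L, module.smult = rcoset_smult L I,
      part = (\<lambda>p. (\<lambda>x. I +>\<^bsub>L\<^esub> x) ` part L p)\<rparr>"

definition isomorphic_superalgebras ::
    "('k, 'a) superalgebra \<Rightarrow> ('k, 'b) superalgebra \<Rightarrow> bool"
  where "isomorphic_superalgebras L M \<longleftrightarrow> (\<exists>\<phi>.
    bij_betw \<phi> (carrier L) (carrier M) \<and>
    (\<forall>x\<in>carrier L. \<forall>y\<in>carrier L. \<phi> (x \<oplus>\<^bsub>L\<^esub> y) = \<phi> x \<oplus>\<^bsub>M\<^esub> \<phi> y) \<and>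
    (\<forall>c. \<forall>x\<in>carrier L. \<phi> (c \<odot>\<^bsub>L\<^esub> x) = c \<odot>\<^bsub>M\<^esub> \<phi> x) \<and>
    (\<forall>x\<in>carrier L. \<forall>y\<in>carrier L. \<phi> (x \<otimes>\<^bsub>L\<^esub> y) = \<phi> x \<otimes>\<^bsub>M\<^esub> \<phi> y) \<and>
    (\<forall>p. \<phi> ` part L p = part M p))"


section \<open>Contragredient Lie superalgebras\<close>

text \<open>The free nonassociative superalgebra on \<open>'x\<close>: finite linear combinations of bracketed words.\<close>

datatype 'x bracketing = Letter 'x | Br "'x bracketing" "'x bracketing"

primrec word_parity :: "('x \<Rightarrow> bit) \<Rightarrow> 'x bracketing \<Rightarrow> bit" where
  "word_parity par (Letter x) = par x"
| "word_parity par (Br u v) = word_parity par u + word_parity par v"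

definition free_superalgebra ::
    "('x \<Rightarrow> bit) \<Rightarrow> ('k::field, 'x bracketing \<Rightarrow>\<^sub>0 'k) superalgebra"
  where "free_superalgebra par =
    \<lparr>carrier = UNIV,
      monoid.mult = (\<lambda>a b. \<Sum>u\<in>Poly_Mapping.keys a. \<Sum>v\<in>Poly_Mapping.keys b.
        Poly_Mapping.single (Br u v) (Poly_Mapping.lookup a u * Poly_Mapping.lookup b v)),
      one = undefined, ring.zero = 0, add = (+),
      module.smult = (\<lambda>c. Poly_Mapping.map ((*) c)),
      part = (\<lambda>p. {a. \<forall>w\<in>Poly_Mapping.keys a. word_parity par w = p})\<rparr>"

text \<open>
  The index set is a finite type \<open>'n\<close> and the space \<open>\<hh>\<close> is a whole type \<open>'v\<close> with scalar
  multiplication \<open>scale\<close>; \<open>coroot i\<close> is \<open>h\<^sub>i\<close> and \<open>root j\<close> is the functional \<open>\<alpha>\<^sub>j\<close>.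
\<close>

record ('k, 'n, 'v) realization =
  scale :: "'k \<Rightarrow> 'v \<Rightarrow> 'v"
  coroot :: "'n \<Rightarrow> 'v"
  root :: "'n \<Rightarrow> 'v \<Rightarrow> 'k"

text \<open>The rank is taken over \<open>'k\<close>; in characteristic 3 it is the rank of the reduction modulo 3.\<close>

definition is_realization ::
    "int^'n^'n \<Rightarrow> ('k::field, 'n::finite, 'v::ab_group_add) realization \<Rightarrow> bool"
  where "is_realization A R \<longleftrightarrow>
    (\<exists>B. finite_dimensional_vector_space (scale R) B \<and>
         card B = 2 * CARD('n) - rank (\<chi> i j. (of_int (A $ i $ j) :: 'k))) \<and>
    (\<forall>j. Vector_Spaces.linear (scale R) (*) (root R j)) \<and>
    (\<forall>c. (\<Sum>i\<in>UNIV. scale R (c i) (coroot R i)) = 0 \<longrightarrow> (\<forall>i. c i = 0)) \<and>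
    (\<forall>c. (\<forall>v. (\<Sum>j\<in>UNIV. c j * root R j v) = 0) \<longrightarrow> (\<forall>j. c j = 0)) \<and>
    (\<forall>i j. root R j (coroot R i) = of_int (A $ i $ j))"

text \<open>Every vector of \<open>\<hh>\<close> is a generator; the linear structure of \<open>\<hh>\<close> is imposed by relators.\<close>

datatype ('n, 'v) generator = E 'n | F 'n | H 'v

primrec generator_parity :: "('n \<Rightarrow> bit) \<Rightarrow> ('n, 'v) generator \<Rightarrow> bit" where
  "generator_parity par (E i) = par i"
| "generator_parity par (F i) = par i"
| "generator_parity par (H v) = 0"

primrec generator_degree :: "('n::finite, 'v) generator \<Rightarrow> int^'n" where
  "generator_degree (E i) = axis i 1"
| "generator_degree (F i) = - axis i 1"
| "generator_degree (H v) = 0"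

primrec word_degree :: "('n::finite, 'v) generator bracketing \<Rightarrow> int^'n" where
  "word_degree (Letter x) = generator_degree x"
| "word_degree (Br u v) = word_degree u + word_degree v"

abbreviation free_chevalley ::
    "('n \<Rightarrow> bit) \<Rightarrow> ('k::field, ('n, 'v) generator bracketing \<Rightarrow>\<^sub>0 'k) superalgebra"
  where "free_chevalley par \<equiv> free_superalgebra (generator_parity par)"

definition gen :: "'x \<Rightarrow> 'x bracketing \<Rightarrow>\<^sub>0 'k::field"
  where "gen x = Poly_Mapping.single (Letter x) 1"

definition chevalley_relators ::
    "('n \<Rightarrow> bit) \<Rightarrow> ('k::field, 'n, 'v::ab_group_add) realization
      \<Rightarrow> (('n, 'v) generator bracketing \<Rightarrow>\<^sub>0 'k) set"
  where "chevalley_relators par R = (let L = free_chevalley par in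
    (\<Union>u v. {gen (H (u + v)) - (gen (H u) + gen (H v))})
    \<union> (\<Union>c v. {gen (H (scale R c v)) - c \<odot>\<^bsub>L\<^esub> gen (H v)})
    \<union> (\<Union>i j. {gen (E i) \<otimes>\<^bsub>L\<^esub> gen (F j) - (if i = j then gen (H (coroot R i)) else 0)})
    \<union> (\<Union>v j. {gen (H v) \<otimes>\<^bsub>L\<^esub> gen (E j) - root R j v \<odot>\<^bsub>L\<^esub> gen (E j)})
    \<union> (\<Union>v j. {gen (H v) \<otimes>\<^bsub>L\<^esub> gen (F j) + root R j v \<odot>\<^bsub>L\<^esub> gen (F j)})
    \<union> (\<Union>u v. {gen (H u) \<otimes>\<^bsub>L\<^esub> gen (H v)}))"

definition presentation_ideal ::
    "('n \<Rightarrow> bit) \<Rightarrow> ('k::field, 'n, 'v::ab_group_add) realization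
      \<Rightarrow> (('n, 'v) generator bracketing \<Rightarrow>\<^sub>0 'k) set"
  where "presentation_ideal par R =
    lie_ideal (free_chevalley par) hull
      (lie_relators (free_chevalley par) \<union> chevalley_relators par R)"

definition universal_contragredient ::
    "('n \<Rightarrow> bit) \<Rightarrow> ('k::field, 'n, 'v::ab_group_add) realization
      \<Rightarrow> ('k, (('n, 'v) generator bracketing \<Rightarrow>\<^sub>0 'k) set) superalgebra"
  where "universal_contragredient par R =
    quotient_superalgebra (free_chevalley par) (presentation_ideal par R)"

definition to_universal ::
    "('n \<Rightarrow> bit) \<Rightarrow> ('k::field, 'n, 'v::ab_group_add) realization
      \<Rightarrow> (('n, 'v) generator bracketing \<Rightarrow>\<^sub>0 'k) \<Rightarrow> (('n, 'v) generator bracketing \<Rightarrow>\<^sub>0 'k) set"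
  where "to_universal par R a =
    presentation_ideal par R +>\<^bsub>(free_chevalley par :: ('k, _) superalgebra)\<^esub> a"

definition graded_piece ::
    "('n::finite \<Rightarrow> bit) \<Rightarrow> ('k::field, 'n, 'v::ab_group_add) realization \<Rightarrow> int^'n
      \<Rightarrow> (('n, 'v) generator bracketing \<Rightarrow>\<^sub>0 'k) set set"
  where "graded_piece par R q =
    to_universal par R ` {a. \<forall>w\<in>Poly_Mapping.keys a. word_degree w = q}"

definition graded_ideal ::
    "('n::finite \<Rightarrow> bit) \<Rightarrow> ('k::field, 'n, 'v::ab_group_add) realization
      \<Rightarrow> (('n, 'v) generator bracketing \<Rightarrow>\<^sub>0 'k) set set \<Rightarrow> bool"
  where "graded_ideal par R J \<longleftrightarrow>
    lie_ideal (universal_contragredient par R) J \<and>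
    (\<forall>x\<in>J. \<exists>S c. finite S \<and> (\<forall>q\<in>S. c q \<in> J \<inter> graded_piece par R q) \<and>
       x = finsum (universal_contragredient par R) c S)"

definition contragredient_radical ::
    "('n::finite \<Rightarrow> bit) \<Rightarrow> ('k::field, 'n, 'v::ab_group_add) realization
      \<Rightarrow> (('n, 'v) generator bracketing \<Rightarrow>\<^sub>0 'k) set set"
  where "contragredient_radical par R =
    (GREATEST J. graded_ideal par R J \<and>
       J \<inter> range (\<lambda>v. to_universal par R (gen (H v))) = {\<zero>\<^bsub>universal_contragredient par R\<^esub>})"

definition contragredient ::
    "('n::finite \<Rightarrow> bit) \<Rightarrow> ('k::field, 'n, 'v::ab_group_add) realization
      \<Rightarrow> ('k, (('n, 'v) generator bracketing \<Rightarrow>\<^sub>0 'k) set set) superalgebra"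
  where "contragredient par R =
    quotient_superalgebra (universal_contragredient par R) (contragredient_radical par R)"

definition chevalley_e ::
    "('n::finite \<Rightarrow> bit) \<Rightarrow> ('k::field, 'n, 'v::ab_group_add) realization
      \<Rightarrow> 'n \<Rightarrow> (('n, 'v) generator bracketing \<Rightarrow>\<^sub>0 'k) set set"
  where "chevalley_e par R i =
    contragredient_radical par R +>\<^bsub>universal_contragredient par R\<^esub> to_universal par R (gen (E i))"


section \<open>Semisimplification\<close>

definition linear_basis :: "('k::field, 'a, 'z) module_scheme \<Rightarrow> 'a set \<Rightarrow> bool"
  where "linear_basis M B \<longleftrightarrow> B \<subseteq> carrier M \<and>
    (\<forall>x\<in>carrier M. \<exists>!c. c \<in> B \<rightarrow>\<^sub>E UNIV \<and> x = (\<Oplus>\<^bsub>M\<^esub>b\<in>B. c b \<odot>\<^bsub>M\<^esub> b))"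

definition finite_dimensional :: "('k::field, 'a, 'z) module_scheme \<Rightarrow> bool"
  where "finite_dimensional M \<longleftrightarrow> (\<exists>B. finite B \<and> linear_basis M B)"

definition coordinates :: "('k::field, 'a, 'z) module_scheme \<Rightarrow> 'a set \<Rightarrow> 'a \<Rightarrow> 'a \<Rightarrow> 'k"
  where "coordinates M B x =
    (THE c. c \<in> B \<rightarrow>\<^sub>E UNIV \<and> x = (\<Oplus>\<^bsub>M\<^esub>b\<in>B. c b \<odot>\<^bsub>M\<^esub> b))"

text \<open>The trace of an endomorphism of a finite-dimensional space, computed in an arbitrary finite basis.\<close>

definition linear_trace :: "('k::field, 'a, 'z) module_scheme \<Rightarrow> ('a \<Rightarrow> 'a) \<Rightarrow> 'k"
  where "linear_trace M u =
    (let B = (SOME B. finite B \<and> linear_basis M B) in \<Sum>b\<in>B. coordinates M B (u b) b)"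

text \<open>
  An object of \<open>Rep \<alpha>\<^sub>3\<close> is a finite-dimensional space \<open>V\<close> with an endomorphism \<open>t\<close> such that
  \<open>t\<^sup>3 = 0\<close>. Morphisms are extensional functions, so that they form a vector space.
\<close>

definition rep_hom ::
    "('k::field, 'a, 'y) module_scheme \<Rightarrow> ('a \<Rightarrow> 'a) \<Rightarrow> ('k, 'b, 'z) module_scheme \<Rightarrow> ('b \<Rightarrow> 'b)
      \<Rightarrow> ('k, 'a \<Rightarrow> 'b) module"
  where "rep_hom V t W s =
    \<lparr>carrier = {u \<in> carrier V \<rightarrow>\<^sub>E carrier W.
        (\<forall>x\<in>carrier V. \<forall>y\<in>carrier V. u (x \<oplus>\<^bsub>V\<^esub> y) = u x \<oplus>\<^bsub>W\<^esub> u y) \<and>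
        (\<forall>c. \<forall>x\<in>carrier V. u (c \<odot>\<^bsub>V\<^esub> x) = c \<odot>\<^bsub>W\<^esub> u x) \<and>
        (\<forall>x\<in>carrier V. u (t x) = s (u x))},
      monoid.mult = undefined, one = undefined,
      ring.zero = (\<lambda>x\<in>carrier V. \<zero>\<^bsub>W\<^esub>),
      add = (\<lambda>u w. \<lambda>x\<in>carrier V. u x \<oplus>\<^bsub>W\<^esub> w x),
      module.smult = (\<lambda>c u. \<lambda>x\<in>carrier V. c \<odot>\<^bsub>W\<^esub> u x)\<rparr>"

definition negligible_homs ::
    "('k::field, 'a, 'y) module_scheme \<Rightarrow> ('a \<Rightarrow> 'a) \<Rightarrow> ('k, 'b, 'z) module_scheme \<Rightarrow> ('b \<Rightarrow> 'b)
      \<Rightarrow> ('a \<Rightarrow> 'b) set"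
  where "negligible_homs V t W s =
    {u \<in> carrier (rep_hom V t W s).
       \<forall>v\<in>carrier (rep_hom W s V t). linear_trace W (compose (carrier W) u v) = 0}"

text \<open>The indecomposable \<open>J\<^sub>n\<close> is \<open>'k\<^sup>n\<close>, realised as the sequences vanishing from index \<open>n\<close> on,
  with \<open>t\<close> the shift.\<close>

definition jordan_space :: "nat \<Rightarrow> ('k::field, nat \<Rightarrow> 'k) module"
  where "jordan_space n =
    \<lparr>carrier = {v. \<forall>i\<ge>n. v i = 0}, monoid.mult = undefined, one = undefined,
      ring.zero = (\<lambda>_. 0), add = (\<lambda>v w i. v i + w i), module.smult = (\<lambda>c v i. c * v i)\<rparr>"

definition jordan_shift :: "nat \<Rightarrow> (nat \<Rightarrow> 'k::field) \<Rightarrow> (nat \<Rightarrow> 'k)"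
  where "jordan_shift n v = (\<lambda>i. if 0 < i \<and> i < n then v (i - 1) else 0)"

definition jordan_vec :: "nat \<Rightarrow> (nat \<Rightarrow> 'k::field)"
  where "jordan_vec i = (\<lambda>j. if j = i then 1 else 0)"

text \<open>
  The simple objects of \<open>Ver\<^sub>3\<close> are the images of \<open>J\<^sub>1\<close> (even) and \<open>J\<^sub>2\<close> (odd). Under the
  identification of \<open>Ver\<^sub>3\<close> with super vector spaces, the part of parity \<open>p\<close> of the image of \<open>V\<close> is
  its multiplicity space, that is, the space \<open>Hom(J, V)\<close> modulo negligible morphisms with
  \<open>J = J\<^sub>1\<close> for \<open>p = 0\<close> and \<open>J = J\<^sub>2\<close> for \<open>p = 1\<close>.
\<close>

definition block_size :: "bit \<Rightarrow> nat"
  where "block_size p = (if p = 0 then 1 else 2)"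

definition block_homs ::
    "('k::field, 'a, 'z) module_scheme \<Rightarrow> ('a \<Rightarrow> 'a) \<Rightarrow> bit \<Rightarrow> ('k, (nat \<Rightarrow> 'k) \<Rightarrow> 'a) module"
  where "block_homs V t p =
    rep_hom (jordan_space (block_size p)) (jordan_shift (block_size p)) V t"

definition block_negligible ::
    "('k::field, 'a, 'z) module_scheme \<Rightarrow> ('a \<Rightarrow> 'a) \<Rightarrow> bit \<Rightarrow> ((nat \<Rightarrow> 'k) \<Rightarrow> 'a) set"
  where "block_negligible V t p =
    negligible_homs (jordan_space (block_size p)) (jordan_shift (block_size p)) V t"

text \<open>
  Write \<open>J(p)\<close> for the block of size \<open>block_size p\<close>. The following morphisms
  \<open>J(p + q) \<rightarrow> J(p) \<otimes> J(q)\<close> become isomorphisms in \<open>Ver\<^sub>3\<close>; the value is the matrix of coordinates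
  in the basis of tensors. If \<open>p = 0\<close> or \<open>q = 0\<close> this is a unit constraint. If \<open>p = q = 1\<close>, then
  \<open>J\<^sub>2 \<otimes> J\<^sub>2\<close> is the sum of a copy of \<open>J\<^sub>3\<close> and of the copy of \<open>J\<^sub>1\<close> spanned by \<open>x' \<otimes> x - x \<otimes> x'\<close>,
  where \<open>x' = t x\<close>; this gives the bracket \<open>[x', y] - [x, y']\<close> of two odd classes.
\<close>

definition block_fusion :: "bit \<Rightarrow> bit \<Rightarrow> (nat \<Rightarrow> 'k::field) \<Rightarrow> nat \<Rightarrow> nat \<Rightarrow> 'k"
  where "block_fusion p q v a b =
    (if p = 0 then (if a = 0 then v b else 0)
     else if q = 0 then (if b = 0 then v a else 0)
     else if a = 1 \<and> b = 0 then v 0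
     else if a = 0 \<and> b = 1 then - v 0
     else 0)"

text \<open>The composite of \<open>J(p + q) \<rightarrow> J(p) \<otimes> J(q)\<close>, \<open>u \<otimes> w\<close> and the bracket of \<open>\<gg>\<close>.\<close>

definition fused_bracket ::
    "('k::field, 'a, 'z) module_scheme \<Rightarrow> bit \<Rightarrow> bit \<Rightarrow> ((nat \<Rightarrow> 'k) \<Rightarrow> 'a) \<Rightarrow> ((nat \<Rightarrow> 'k) \<Rightarrow> 'a)
      \<Rightarrow> ((nat \<Rightarrow> 'k) \<Rightarrow> 'a)"
  where "fused_bracket g p q u w =
    (\<lambda>v\<in>carrier (jordan_space (block_size (p + q))).
       \<Oplus>\<^bsub>g\<^esub>a\<in>{..<block_size p}. \<Oplus>\<^bsub>g\<^esub>b\<in>{..<block_size q}.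
         block_fusion p q v a b \<odot>\<^bsub>g\<^esub> (u (jordan_vec a) \<otimes>\<^bsub>g\<^esub> w (jordan_vec b)))"

definition class_bracket ::
    "('k::field, 'a, 'z) module_scheme \<Rightarrow> ('a \<Rightarrow> 'a) \<Rightarrow> bit \<Rightarrow> bit
      \<Rightarrow> ((nat \<Rightarrow> 'k) \<Rightarrow> 'a) set \<Rightarrow> ((nat \<Rightarrow> 'k) \<Rightarrow> 'a) set \<Rightarrow> ((nat \<Rightarrow> 'k) \<Rightarrow> 'a) set"
  where "class_bracket g d p q C D =
    (\<Union>u\<in>C. \<Union>w\<in>D. block_negligible g d (p + q)
       +>\<^bsub>block_homs g d (p + q)\<^esub> fused_bracket g p q u w)"

definition semisimplification ::
    "('k::field, 'a) superalgebra \<Rightarrow> ('a \<Rightarrow> 'a)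
      \<Rightarrow> ('k, ((nat \<Rightarrow> 'k) \<Rightarrow> 'a) set \<times> ((nat \<Rightarrow> 'k) \<Rightarrow> 'a) set) superalgebra"
  where "semisimplification g d =
    (let hom = block_homs g d; neg = block_negligible g d;
         quot = (\<lambda>p. a_rcosets\<^bsub>hom p\<^esub> neg p) in
    \<lparr>carrier = quot 0 \<times> quot 1,
      monoid.mult = (\<lambda>(C0, C1) (D0, D1).
        (class_bracket g d 0 0 C0 D0 <+>\<^bsub>hom 0\<^esub> class_bracket g d 1 1 C1 D1,
         class_bracket g d 0 1 C0 D1 <+>\<^bsub>hom 1\<^esub> class_bracket g d 1 0 C1 D0)),
      one = undefined,
      ring.zero = (neg 0, neg 1),
      add = (\<lambda>(C0, C1) (D0, D1). (C0 <+>\<^bsub>hom 0\<^esub> D0, C1 <+>\<^bsub>hom 1\<^esub> D1)),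
      module.smult = (\<lambda>c (C0, C1).
        (rcoset_smult (hom 0) (neg 0) c C0, rcoset_smult (hom 1) (neg 1) c C1)),
      part = (\<lambda>p. if p = 0 then quot 0 \<times> {neg 1} else {neg 0} \<times> quot 1)\<rparr>)"

definition lie_algebra_in_Rep_alpha3 :: "('k::field, 'a) superalgebra \<Rightarrow> ('a \<Rightarrow> 'a) \<Rightarrow> bool"
  where "lie_algebra_in_Rep_alpha3 g d \<longleftrightarrow>
    lie_superalgebra g \<and> part g 1 = {\<zero>\<^bsub>g\<^esub>} \<and> finite_dimensional g \<and>
    (\<forall>x\<in>carrier g. d x \<in> carrier g \<and> d (d (d x)) = \<zero>\<^bsub>g\<^esub>) \<and>
    (\<forall>x\<in>carrier g. \<forall>y\<in>carrier g. d (x \<oplus>\<^bsub>g\<^esub> y) = d x \<oplus>\<^bsub>g\<^esub> d y) \<and>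
    (\<forall>c. \<forall>x\<in>carrier g. d (c \<odot>\<^bsub>g\<^esub> x) = c \<odot>\<^bsub>g\<^esub> d x) \<and>
    (\<forall>x\<in>carrier g. \<forall>y\<in>carrier g. d (x \<otimes>\<^bsub>g\<^esub> y) = d x \<otimes>\<^bsub>g\<^esub> y \<oplus>\<^bsub>g\<^esub> x \<otimes>\<^bsub>g\<^esub> d y)"


section \<open>The two Cartan matrices\<close>

text \<open>In the types \<open>8\<close> and \<open>5\<close> the last index is the numeral \<open>8\<close>, resp. \<open>5\<close>, which equals \<open>0\<close>.\<close>

definition cartan_e8 :: "int^8^8"
  where "cartan_e8 = vector [
    vector [ 2,  0, -1,  0,  0,  0,  0,  0],
    vector [ 0,  2,  0, -1,  0,  0,  0,  0],
    vector [-1,  0,  2, -1,  0,  0,  0,  0],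
    vector [ 0, -1, -1,  2, -1,  0,  0,  0],
    vector [ 0,  0,  0, -1,  2, -1,  0,  0],
    vector [ 0,  0,  0,  0, -1,  2, -1,  0],
    vector [ 0,  0,  0,  0,  0, -1,  2, -1],
    vector [ 0,  0,  0,  0,  0,  0, -1,  2]]"

definition parity_e8 :: "8 \<Rightarrow> bit"
  where "parity_e8 i = 0"

definition cartan_g83 :: "int^5^5"
  where "cartan_g83 = vector [
    vector [ 0, -1,  0,  0,  0],
    vector [-1,  0, -1,  0,  0],
    vector [ 0, -1,  2, -1,  0],
    vector [ 0,  0, -1,  2, -1],
    vector [ 0,  0,  0, -1,  0]]"

definition parity_g83 :: "5 \<Rightarrow> bit"
  where "parity_g83 i = (if i \<in> {1, 2, 5} then 1 else 0)"

end

theory Submission imports Defs begin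

unbundle no Formal_Power_Series.fps_syntax

text \<open>
  A contragredient Lie superalgebra can be recognised as follows. Let \<open>L\<close> be a Lie superalgebra with
  elements \<open>e\<^sub>j\<close>, \<open>f\<^sub>j\<close> and \<open>h \<in> \<hh>\<close> that satisfy the Chevalley relations, graded by the root lattice with
  the expected pieces in the degrees \<open>0\<close> and \<open>\<plusminus>\<alpha>\<^sub>j\<close> and none in degrees of mixed sign. Suppose that
  for every other positive degree \<open>q\<close> some \<open>j\<close> with \<open>q\<^sub>j > 0\<close> and some \<open>c \<noteq> 0\<close> satisfy \<open>[e\<^sub>j, x] = 0\<close> and
  \<open>[h\<^sub>j, x] = c x\<close> for all \<open>x\<close> of degree \<open>q\<close>, and dually for negative degrees. Then
  \<open>[e\<^sub>j, [f\<^sub>j, x]] = c x\<close>, so by induction on the degree \<open>L\<close> is generated by the Chevalley generators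
  and has no nonzero graded ideal that avoids \<open>\<hh>\<close>; hence \<open>L\<close> is \<open>\<gg>(A)\<close>.

  For \<open>E\<^sub>8\<close> this applies to the model built from the root lattice and a sign cocycle: a positive root
  that is not simple has a simple root at an angle of 60 degrees. For the semisimplification, classes of the even part
  are represented by \<open>x\<close> with \<open>d x = 0\<close>, classes of the odd part by \<open>y\<close> with \<open>d\<^sup>2 y = 0\<close>. The derivation
  \<open>d = ad (e\<^sub>1 + e\<^sub>2 + e\<^sub>8)\<close> preserves the degree modulo \<open>\<alpha>\<^sub>1, \<alpha>\<^sub>2, \<alpha>\<^sub>8\<close>, which are pairwise orthogonal.
  The generators of \<open>g(8,3)\<close> are the classes of \<open>e\<^sub>3, \<dots>, e\<^sub>7\<close>, three of which head a block \<open>J\<^sub>2\<close>, and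
  the index \<open>j\<close> for a degree is found at its lowest root \<open>\<beta>\<close>, where \<open>(\<beta> | \<alpha>\<^sub>j) = 1\<close> is only possible
  for \<open>j \<notin> {1, 2, 8}\<close>.
\<close>

text \<open>The criterion has to hold on a whole degree at once, but a degree modulo alpha_1,
  alpha_2, alpha_8 carries several roots of E_8. The lowest root controls all of them: as far as
  index j can see, another root of the degree differs from it by at most one copy of the neighbour
  of node j among 1, 2, 8, and this changes the pairing with \<open>kappa j\<close> by a multiple of
  3. The eigenvalue on the degree is therefore well defined; up to sign it is 1 or 2, and both are
  nonzero in characteristic 3. A second obstacle is [y,[y,y]] = 0 for odd classes, which the Jacobi
  identity does not give in characteristic 3. It rests on a fact about the lattice: if a nonzero
  degree carries a root, its triple carries none. In degree 0 there are no odd classes, because the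
  sl_2 triples at 1, 2, 8 are blocks J_3. Third, to see that an ideal avoiding the Cartan subalgebra
  vanishes in degree 0, one must know that this piece of the algebra given by generators and
  relations is no larger than the Cartan subalgebra; this is read off from the triangular
  decomposition.\<close>

section \<open>Superalgebras presented by subquotients\<close>

text \<open>All computations take place in a type \<open>'x\<close> with a scalar multiplication \<open>s\<close> and a bilinear
  product \<open>b\<close>. A record \<open>L\<close> is presented by a subalgebra \<open>C\<close> and an ideal \<open>Z\<close> of \<open>C\<close> if it is
  \<open>C / Z\<close>, the class of \<open>x\<close> being \<open>f x\<close>; \<open>P p\<close> consists of representatives of the part of parity \<open>p\<close>.\<close>

definition presents ::
    "('k \<Rightarrow> 'x \<Rightarrow> 'x) \<Rightarrow> ('x \<Rightarrow> 'x \<Rightarrow> 'x) \<Rightarrow> 'x set \<Rightarrow> (bit \<Rightarrow> 'x set) \<Rightarrow> 'x set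
      \<Rightarrow> ('x::ab_group_add \<Rightarrow> 'a) \<Rightarrow> ('k::field, 'a) superalgebra \<Rightarrow> bool"
  where "presents s b C P Z f L \<longleftrightarrow>
    f ` C = carrier L \<and> (\<forall>p. f ` P p = part L p) \<and> f 0 = \<zero>\<^bsub>L\<^esub> \<and>
    (\<forall>x\<in>C. \<forall>y\<in>C. f x = f y \<longleftrightarrow> x - y \<in> Z) \<and>
    (\<forall>x\<in>C. \<forall>y\<in>C. f (x + y) = f x \<oplus>\<^bsub>L\<^esub> f y \<and> f (b x y) = f x \<otimes>\<^bsub>L\<^esub> f y) \<and>
    (\<forall>c. \<forall>x\<in>C. f (s c x) = c \<odot>\<^bsub>L\<^esub> f x)"

text \<open>Stated for module records, so that it serves quotients of superalgebras as well as
  spaces of morphisms modulo negligible ones, which have no product. Because Z lies in K, the coset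
  of \<open>f x\<close> is the image of x + K, and the operations on cosets do not depend on
  representatives.\<close>

lemma (in vector_space) presented_cosets:
  fixes L :: "('a, 'c, 'z) module_scheme" and f :: "'b \<Rightarrow> 'c"
  assumes add: "\<And>x y. x \<in> C \<Longrightarrow> y \<in> C \<Longrightarrow> f (x + y) = f x \<oplus>\<^bsub>L\<^esub> f y"
    and scl: "\<And>c x. x \<in> C \<Longrightarrow> f (scale c x) = c \<odot>\<^bsub>L\<^esub> f x"
    and inj: "\<And>x y. x \<in> C \<Longrightarrow> y \<in> C \<Longrightarrow> f x = f y \<longleftrightarrow> x - y \<in> Z"
    and C: "subspace C" and K: "subspace K" "K \<subseteq> C" "Z \<subseteq> K"
  shows "x \<in> C \<Longrightarrow> f ` K +>\<^bsub>L\<^esub> f x = {f y | y. y \<in> C \<and> y - x \<in> K}" (is "_ \<Longrightarrow> ?g x = _")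
    and "x \<in> C \<Longrightarrow> y \<in> C \<Longrightarrow> f ` K +>\<^bsub>L\<^esub> f x = f ` K +>\<^bsub>L\<^esub> f y \<longleftrightarrow> x - y \<in> K"
    and "x \<in> C \<Longrightarrow> y \<in> C \<Longrightarrow> f ` K +>\<^bsub>L\<^esub> f (x + y) = (f ` K +>\<^bsub>L\<^esub> f x) <+>\<^bsub>L\<^esub> (f ` K +>\<^bsub>L\<^esub> f y)"
    and "x \<in> C \<Longrightarrow> f ` K +>\<^bsub>L\<^esub> f (scale c x) = rcoset_smult L (f ` K) c (f ` K +>\<^bsub>L\<^esub> f x)"
proof -
  let ?g = "\<lambda>x. f ` K +>\<^bsub>L\<^esub> f x"
  have KC: "k \<in> C" if "k \<in> K" for k using that K(2) by blast
  have K0: "0 \<in> K" using K(1) subspace_0 by blast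
  note [simp] = subspace_add[OF C] subspace_scale[OF C] KC
  have g: "?g x = {f y | y. y \<in> C \<and> y - x \<in> K}" if x: "x \<in> C" for x
  proof -
    have "?g x = {f k \<oplus>\<^bsub>L\<^esub> f x | k. k \<in> K}"
      unfolding a_r_coset_def' by blast
    also have "\<dots> = {f (k + x) | k. k \<in> K}" using x add by (metis KC)
    also have "\<dots> = {f y | y. y \<in> C \<and> y - x \<in> K}"
    proof (intro equalityI subsetI; clarsimp)
      fix k assume "k \<in> K" thus "\<exists>y. f (k + x) = f y \<and> y \<in> C \<and> y - x \<in> K"
        using x by (intro exI[of _ "k + x"]) auto
    next
      fix y assume "y \<in> C" "y - x \<in> K" thus "\<exists>k. f y = f (k + x) \<and> k \<in> K"
        by (intro exI[of _ "y - x"]) auto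
    qed
    finally show ?thesis .
  qed
  have self: "f x \<in> ?g x" if "x \<in> C" for x using g[OF that] that K0 by auto
  have eqI: "?g x = ?g y" if "x \<in> C" "y \<in> C" "x - y \<in> K" for x y
  proof -
    have "z - x \<in> K \<longleftrightarrow> z - y \<in> K" for z
      using subspace_add[OF K(1), of "z - x" "x - y"] subspace_diff[OF K(1), of "z - y" "x - y"] that
      by auto
    thus ?thesis using g that by simp
  qed
  have eqD: "x - y \<in> K" if xy: "x \<in> C" "y \<in> C" "?g x = ?g y" for x y
  proof -
    obtain z where z: "f x = f z" "z \<in> C" "z - y \<in> K"
      using self[OF xy(1)] g[OF xy(2)] xy(3) by auto
    hence "x - z \<in> K" using inj[of x z] xy K(3) by auto
    from subspace_add[OF K(1) this z(3)] show ?thesis by simp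
  qed
  show "x \<in> C \<Longrightarrow> ?g x = {f y | y. y \<in> C \<and> y - x \<in> K}" by (rule g)
  show "x \<in> C \<Longrightarrow> y \<in> C \<Longrightarrow> ?g x = ?g y \<longleftrightarrow> x - y \<in> K" using eqI eqD by blast
  show "?g (x + y) = ?g x <+>\<^bsub>L\<^esub> ?g y" if xy: "x \<in> C" "y \<in> C"
  proof (intro equalityI subsetI)
    fix U assume "U \<in> ?g (x + y)"
    then obtain z where z: "U = f z" "z \<in> C" "z - (x + y) \<in> K" using g[of "x+y"] xy by auto
    have zx: "z - x \<in> C" using z xy subspace_diff[OF C] by blast
    have "f (x + (z - x)) = f x \<oplus>\<^bsub>L\<^esub> f (z - x)" using add[OF xy(1) zx] .
    hence U: "U = f x \<oplus>\<^bsub>L\<^esub> f (z - x)" using z by simp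
    have "f (z - x) \<in> ?g y" using g[OF xy(2)] z zx by (auto simp: algebra_simps)
    thus "U \<in> ?g x <+>\<^bsub>L\<^esub> ?g y" unfolding set_add_def' U using self[OF xy(1)] by blast
  next
    fix U assume "U \<in> ?g x <+>\<^bsub>L\<^esub> ?g y"
    then obtain u v where "U = f u \<oplus>\<^bsub>L\<^esub> f v" "u \<in> C" "v \<in> C" "u - x \<in> K" "v - y \<in> K"
      unfolding set_add_def' using g xy by auto
    thus "U \<in> ?g (x + y)" using g[of "x + y"] xy add[of u v]
        subspace_add[OF K(1), of "u - x" "v - y"]
      by (auto simp: algebra_simps intro!: exI[of _ "u + v"])
  qed
  show "?g (scale c x) = rcoset_smult L (f ` K) c (?g x)" if x: "x \<in> C"
  proof -
    have "f ` K +>\<^bsub>L\<^esub> (c \<odot>\<^bsub>L\<^esub> U) = ?g (scale c x)" if Ug: "U \<in> ?g x" for U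
    proof -
      obtain u where uv: "U = f u" "u \<in> C" "u - x \<in> K" using Ug g x by auto
      have "scale c u - scale c x = scale c (u - x)" by (simp add: scale_right_diff_distrib)
      hence "?g (scale c u) = ?g (scale c x)" using uv x subspace_scale[OF K(1)] by (intro eqI) auto
      thus ?thesis using uv scl[of u c] by simp
    qed
    thus ?thesis unfolding rcoset_smult_def using self[OF x] by blast
  qed
qed

locale bilinear_algebra = vector_space s
  for s :: "'k::field \<Rightarrow> 'x::ab_group_add \<Rightarrow> 'x" +
  fixes b :: "'x \<Rightarrow> 'x \<Rightarrow> 'x"
  assumes b_add_left: "b (x + y) z = b x z + b y z"
    and b_add_right: "b x (y + z) = b x y + b x z"
    and b_scale_left: "b (s c x) y = s c (b x y)"
    and b_scale_right: "b x (s c y) = s c (b x y)"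
begin

lemma b_zero_left [simp]: "b 0 y = 0"
  using b_scale_left[of 0 0 y] by simp

lemma b_zero_right [simp]: "b x 0 = 0"
  using b_scale_right[of x 0 0] by simp

lemma b_minus_left: "b (- x) y = - b x y"
  using b_add_left[of "- x" x y] by (simp add: eq_neg_iff_add_eq_0)

lemma b_minus_right: "b x (- y) = - b x y"
  using b_add_right[of x "- y" y] by (simp add: eq_neg_iff_add_eq_0)

lemma b_diff_left: "b (x - y) z = b x z - b y z"
  using b_add_left[of x "- y" z] by (simp add: b_minus_left)

lemma b_diff_right: "b x (y - z) = b x y - b x z"
  using b_add_right[of x y "- z"] by (simp add: b_minus_right)

lemmas b_simps = b_add_left b_add_right b_scale_left b_scale_right b_minus_left b_minus_right
  b_diff_left b_diff_right

definition subalgebra :: "'x set \<Rightarrow> bool"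
  where "subalgebra C \<longleftrightarrow> subspace C \<and> (\<forall>x\<in>C. \<forall>y\<in>C. b x y \<in> C)"

definition ideal_of :: "'x set \<Rightarrow> 'x set \<Rightarrow> bool"
  where "ideal_of C Z \<longleftrightarrow> subspace Z \<and> Z \<subseteq> C \<and> (\<forall>x\<in>C. \<forall>z\<in>Z. b x z \<in> Z \<and> b z x \<in> Z)"

lemma ideal_ofD:
  assumes "ideal_of C Z"
  shows "subspace Z" "Z \<subseteq> C" "\<And>x z. x \<in> C \<Longrightarrow> z \<in> Z \<Longrightarrow> b x z \<in> Z" "\<And>x z. x \<in> C \<Longrightarrow> z \<in> Z \<Longrightarrow> b z x \<in> Z"
  using assms by (auto simp: ideal_of_def)

end

lemma presentsD:
  assumes "presents s b C P Z f L"
  shows "f ` C = carrier L" "f ` P p = part L p" "f 0 = \<zero>\<^bsub>L\<^esub>"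
    "\<And>x y. x \<in> C \<Longrightarrow> y \<in> C \<Longrightarrow> f x = f y \<longleftrightarrow> x - y \<in> Z"
    "\<And>x y. x \<in> C \<Longrightarrow> y \<in> C \<Longrightarrow> f (x + y) = f x \<oplus>\<^bsub>L\<^esub> f y"
    "\<And>x y. x \<in> C \<Longrightarrow> y \<in> C \<Longrightarrow> f (b x y) = f x \<otimes>\<^bsub>L\<^esub> f y"
    "\<And>c x. x \<in> C \<Longrightarrow> f (s c x) = c \<odot>\<^bsub>L\<^esub> f x"
  using assms unfolding presents_def by auto

text \<open>This produces the final isomorphism: it sends \<open>f x\<close> to \<open>g x\<close>.
  The representative picked by SOME is harmless because f and g have the same fibres, the classes
  modulo Z.\<close>

lemma presents_isomorphic:
  assumes f: "presents s b C P Z f L" and g: "presents s b C P Z g M"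
    and add: "\<And>x y. x \<in> C \<Longrightarrow> y \<in> C \<Longrightarrow> x + y \<in> C"
    and scl: "\<And>c x. x \<in> C \<Longrightarrow> s c x \<in> C"
    and mul: "\<And>x y. x \<in> C \<Longrightarrow> y \<in> C \<Longrightarrow> b x y \<in> C"
    and P: "\<And>p. P p \<subseteq> C"
  shows "isomorphic_superalgebras L M"
proof -
  define \<phi> where "\<phi> U = g (SOME x. x \<in> C \<and> f x = U)" for U
  have \<phi>: "\<phi> (f x) = g x" if "x \<in> C" for x
  proof -
    have "\<exists>y. y \<in> C \<and> f y = f x" using that by blast
    hence *: "(SOME y. y \<in> C \<and> f y = f x) \<in> C \<and> f (SOME y. y \<in> C \<and> f y = f x) = f x"
      by (rule someI_ex)
    hence "(SOME y. y \<in> C \<and> f y = f x) - x \<in> Z"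
      using presentsD(4)[OF f, of "SOME y. y \<in> C \<and> f y = f x" x] that by simp
    thus ?thesis using * that presentsD(4)[OF g, of "SOME y. y \<in> C \<and> f y = f x" x]
      unfolding \<phi>_def by simp
  qed
  have bij: "bij_betw \<phi> (carrier L) (carrier M)"
  proof (rule bij_betwI')
    fix U V assume "U \<in> carrier L" "V \<in> carrier L"
    then obtain x y where "x \<in> C" "y \<in> C" "U = f x" "V = f y"
      unfolding presentsD(1)[OF f, symmetric] by blast
    thus "\<phi> U = \<phi> V \<longleftrightarrow> U = V"
      by (simp add: \<phi> presentsD(4)[OF f] presentsD(4)[OF g])
  next
    show "\<phi> U \<in> carrier M" if "U \<in> carrier L" for U
      using that \<phi> unfolding presentsD(1)[OF f, symmetric] presentsD(1)[OF g, symmetric] by auto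
  next
    fix V assume "V \<in> carrier M"
    then obtain x where "x \<in> C" "V = g x"
      unfolding presentsD(1)[OF g, symmetric] by blast
    thus "\<exists>U\<in>carrier L. V = \<phi> U"
      using \<phi> unfolding presentsD(1)[OF f, symmetric] by (intro bexI[of _ "f x"]) auto
  qed
  have parts: "\<phi> ` part L p = part M p" for p
    unfolding presentsD(2)[OF f, symmetric] presentsD(2)[OF g, symmetric]
    unfolding image_image using \<phi> P by (intro image_cong refl) blast
  have "\<phi> (U \<oplus>\<^bsub>L\<^esub> Y) = \<phi> U \<oplus>\<^bsub>M\<^esub> \<phi> Y \<and> \<phi> (U \<otimes>\<^bsub>L\<^esub> Y) = \<phi> U \<otimes>\<^bsub>M\<^esub> \<phi> Y"
    if "U \<in> carrier L" "Y \<in> carrier L" for U Y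
  proof -
    obtain x y where "x \<in> C" "y \<in> C" "U = f x" "Y = f y"
      using \<open>U \<in> carrier L\<close> \<open>Y \<in> carrier L\<close> unfolding presentsD(1)[OF f, symmetric] by blast
    thus ?thesis
      by (simp add: \<phi> add mul presentsD(5,6)[OF f, symmetric] presentsD(5,6)[OF g, symmetric])
  qed
  moreover have "\<phi> (c \<odot>\<^bsub>L\<^esub> U) = c \<odot>\<^bsub>M\<^esub> \<phi> U" if UL: "U \<in> carrier L" for c U
  proof -
    obtain x where "x \<in> C" "U = f x"
      using UL unfolding presentsD(1)[OF f, symmetric] by blast
    thus ?thesis
      by (simp add: \<phi> scl presentsD(7)[OF f, symmetric] presentsD(7)[OF g, symmetric])
  qed
  ultimately show ?thesis
    unfolding isomorphic_superalgebras_def using bij parts by (intro exI[of _ \<phi>]) blast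
qed

lemma cring_scalars: "cring (scalars :: 'k::field ring)"
  by (rule cring_from_type_algebra)

lemma scalars_simps [simp]:
  "carrier (scalars :: 'k::field ring) = UNIV" "a \<oplus>\<^bsub>scalars\<^esub> c = a + (c::'k)"
  "a \<otimes>\<^bsub>scalars\<^esub> c = a * (c::'k)" "\<one>\<^bsub>scalars\<^esub> = (1::'k)" "\<zero>\<^bsub>scalars\<^esub> = (0::'k)"
  by (simp_all add: ring_of_type_algebra_def)

context bilinear_algebra
begin

lemma presents_module:
  assumes L: "presents s b C P Z f L" and C: "subspace C"
  shows "Module.module scalars L"
proof -
  note D = presentsD[OF L] and add = subspace_add[OF C] and scl = subspace_scale[OF C]
  have car: "\<exists>x\<in>C. U = f x" if "U \<in> carrier L" for U
    using that D(1) by blast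
  have inC: "f x \<in> carrier L" if "x \<in> C" for x
    using that D(1) by blast
  have zero: "0 \<in> C" using C subspace_0 by blast
  have ab: "abelian_group L"
  proof (rule abelian_groupI)
    fix U Y assume "U \<in> carrier L" "Y \<in> carrier L"
    then obtain x y where *: "x \<in> C" "y \<in> C" "U = f x" "Y = f y" using car by blast
    show "U \<oplus>\<^bsub>L\<^esub> Y \<in> carrier L" using * add inC D(5) by metis
    show "U \<oplus>\<^bsub>L\<^esub> Y = Y \<oplus>\<^bsub>L\<^esub> U" using * D(5) by (metis add.commute)
  next
    show "\<zero>\<^bsub>L\<^esub> \<in> carrier L" using inC[OF zero] D(3) by simp
  next
    fix U Y W assume "U \<in> carrier L" "Y \<in> carrier L" "W \<in> carrier L"
    then obtain x y w where *: "x \<in> C" "y \<in> C" "w \<in> C" "U = f x" "Y = f y" "W = f w"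
      using car by metis
    have "U \<oplus>\<^bsub>L\<^esub> Y \<oplus>\<^bsub>L\<^esub> W = f (x + y + w)" using * add D(5) by simp
    also have "\<dots> = f (x + (y + w))" by (simp add: add.assoc)
    also have "\<dots> = U \<oplus>\<^bsub>L\<^esub> (Y \<oplus>\<^bsub>L\<^esub> W)" using * add D(5) by simp
    finally show "U \<oplus>\<^bsub>L\<^esub> Y \<oplus>\<^bsub>L\<^esub> W = U \<oplus>\<^bsub>L\<^esub> (Y \<oplus>\<^bsub>L\<^esub> W)" .
  next
    fix U assume "U \<in> carrier L"
    then obtain x where *: "x \<in> C" "U = f x" using car by blast
    show "\<zero>\<^bsub>L\<^esub> \<oplus>\<^bsub>L\<^esub> U = U" using * D(5)[OF zero, of x] D(3) by simp
    have m: "- x \<in> C" using C * subspace_neg by blast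
    have "f (- x) \<oplus>\<^bsub>L\<^esub> U = \<zero>\<^bsub>L\<^esub>" using * D(5)[OF m, of x] D(3) by simp
    thus "\<exists>Y\<in>carrier L. Y \<oplus>\<^bsub>L\<^esub> U = \<zero>\<^bsub>L\<^esub>" using inC[OF m] by blast
  qed
  show ?thesis
  proof (rule moduleI[OF cring_scalars ab])
    fix a :: 'k and U assume "U \<in> carrier L"
    then obtain x where *: "x \<in> C" "U = f x" using car by blast
    show "a \<odot>\<^bsub>L\<^esub> U \<in> carrier L" using * D(7) scl inC by metis
    show "\<one>\<^bsub>scalars\<^esub> \<odot>\<^bsub>L\<^esub> U = U" using * D(7)[of x 1] by simp
    fix c :: 'k
    show "(a \<oplus>\<^bsub>scalars\<^esub> c) \<odot>\<^bsub>L\<^esub> U = a \<odot>\<^bsub>L\<^esub> U \<oplus>\<^bsub>L\<^esub> c \<odot>\<^bsub>L\<^esub> U"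
      using * D(5)[OF scl scl, of x x a c] D(7)[of x] by (simp flip: scale_left_distrib)
    show "(a \<otimes>\<^bsub>scalars\<^esub> c) \<odot>\<^bsub>L\<^esub> U = a \<odot>\<^bsub>L\<^esub> (c \<odot>\<^bsub>L\<^esub> U)"
      using * D(7)[of x] D(7)[of "s c x" a] scl by simp
  next
    fix a :: 'k and U Y assume "U \<in> carrier L" "Y \<in> carrier L"
    then obtain x y where *: "x \<in> C" "y \<in> C" "U = f x" "Y = f y" using car by blast
    have "a \<odot>\<^bsub>L\<^esub> (U \<oplus>\<^bsub>L\<^esub> Y) = f (s a (x + y))" using * D(5,7) add by simp
    also have "\<dots> = f (s a x + s a y)" by (simp add: scale_right_distrib)
    also have "\<dots> = a \<odot>\<^bsub>L\<^esub> U \<oplus>\<^bsub>L\<^esub> a \<odot>\<^bsub>L\<^esub> Y" using * D(5,7) scl by simp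
    finally show "a \<odot>\<^bsub>L\<^esub> (U \<oplus>\<^bsub>L\<^esub> Y) = a \<odot>\<^bsub>L\<^esub> U \<oplus>\<^bsub>L\<^esub> a \<odot>\<^bsub>L\<^esub> Y" .
  qed
qed

lemma submodule_iff:
  assumes M: "Module.module (scalars :: 'k ring) L"
  shows "submodule I (scalars :: 'k ring) L \<longleftrightarrow> I \<subseteq> carrier L \<and> \<zero>\<^bsub>L\<^esub> \<in> I \<and>
    (\<forall>U\<in>I. \<forall>Y\<in>I. U \<oplus>\<^bsub>L\<^esub> Y \<in> I) \<and> (\<forall>c. \<forall>U\<in>I. c \<odot>\<^bsub>L\<^esub> U \<in> I)"
proof
  assume *: "submodule I (scalars :: 'k ring) L"
  have "\<zero>\<^bsub>L\<^esub> \<in> I" using *[unfolded submodule_def] subgroup.one_closed[of I "add_monoid L"] by simp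
  thus "I \<subseteq> carrier L \<and> \<zero>\<^bsub>L\<^esub> \<in> I \<and> (\<forall>U\<in>I. \<forall>Y\<in>I. U \<oplus>\<^bsub>L\<^esub> Y \<in> I) \<and> (\<forall>c. \<forall>U\<in>I. c \<odot>\<^bsub>L\<^esub> U \<in> I)"
    using module.submoduleE[OF M *] by auto
next
  assume *: "I \<subseteq> carrier L \<and> \<zero>\<^bsub>L\<^esub> \<in> I \<and>
    (\<forall>U\<in>I. \<forall>Y\<in>I. U \<oplus>\<^bsub>L\<^esub> Y \<in> I) \<and> (\<forall>c. \<forall>U\<in>I. c \<odot>\<^bsub>L\<^esub> U \<in> I)"
  interpret module "scalars :: 'k ring" L by fact
  have neg: "\<ominus>\<^bsub>L\<^esub> U = (-1) \<odot>\<^bsub>L\<^esub> U" if "U \<in> carrier L" for U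
  proof -
    have "(-1) \<odot>\<^bsub>L\<^esub> U \<oplus>\<^bsub>L\<^esub> U = ((-1) \<oplus>\<^bsub>scalars\<^esub> 1) \<odot>\<^bsub>L\<^esub> U"
      using that smult_one[OF that] by (subst smult_l_distr) simp_all
    also have "\<dots> = \<zero>\<^bsub>L\<^esub>" using smult_l_null[OF that] by simp
    finally show ?thesis using that M.minus_equality smult_closed[of "-1" U] by simp
  qed
  show "submodule I (scalars :: 'k ring) L"
    using * neg by (intro submoduleI) auto
qed

lemma presents_submodule:
  assumes L: "presents s b C P Z f L" and C: "subspace C" and I: "subspace I" "I \<subseteq> C"
  shows "submodule (f ` I) (scalars :: 'k ring) L"
  unfolding submodule_iff[OF presents_module[OF L C]]
proof (intro conjI ballI allI)
  note D = presentsD[OF L]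
  show "f ` I \<subseteq> carrier L" using I(2) D(1) by blast
  show "\<zero>\<^bsub>L\<^esub> \<in> f ` I" using D(3) subspace_0[OF I(1)] by force
  show "U \<oplus>\<^bsub>L\<^esub> Y \<in> f ` I" if XY: "U \<in> f ` I" "Y \<in> f ` I" for U Y
  proof -
    obtain x y where "x \<in> I" "y \<in> I" "U = f x" "Y = f y" using XY by blast
    thus ?thesis using D(5)[of x y] I(2) subspace_add[OF I(1), of x y] by (metis imageI subsetD)
  qed
  show "c \<odot>\<^bsub>L\<^esub> U \<in> f ` I" if XI: "U \<in> f ` I" for c U
  proof -
    obtain x where "x \<in> I" "U = f x" using XI by blast
    thus ?thesis using D(7)[of x c] I(2) subspace_scale[OF I(1), of x c] by (metis imageI subsetD)
  qed
qed

text \<open>The third isomorphism theorem: the quotient of C / Z by the image of K is C / K. It is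
  applied twice to the free superalgebra, once for the presentation ideal and once for the
  radical.\<close>

lemma presents_quotient:
  assumes L: "presents s b C P Z f L" and C: "subalgebra C" and K: "ideal_of C K" and ZK: "Z \<subseteq> K"
  shows "presents s b C P K (\<lambda>x. (f ` K) +>\<^bsub>L\<^esub> f x) (quotient_superalgebra L (f ` K))"
proof -
  note D = presentsD[OF L] and K' = ideal_ofD[OF K]
  have Cs: "subspace C" and Cb: "\<And>x y. x \<in> C \<Longrightarrow> y \<in> C \<Longrightarrow> b x y \<in> C"
    using C by (auto simp: subalgebra_def)
  define g where "g x = (f ` K) +>\<^bsub>L\<^esub> f x" for x
  have KC: "k \<in> C" if "k \<in> K" for k using that K'(2) by blast
  have K0: "0 \<in> K" using K'(1) subspace_0 by blast
  note [simp] = subspace_add[OF K'(1)] subspace_scale[OF K'(1)] subspace_scale[OF Cs] KC Cb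
  note cosets = presented_cosets[OF D(5) D(7) D(4) Cs K'(1,2) ZK]
  have g: "g x = {f y | y. y \<in> C \<and> y - x \<in> K}" if "x \<in> C" for x
    unfolding g_def by (rule cosets(1)) (assumption | rule that)+
  have g_eq: "g x = g y \<longleftrightarrow> x - y \<in> K" if "x \<in> C" "y \<in> C" for x y
    unfolding g_def by (rule cosets(2)) (assumption | rule that)+
  have g_add: "g (x + y) = g x <+>\<^bsub>L\<^esub> g y" if "x \<in> C" "y \<in> C" for x y
    unfolding g_def by (rule cosets(3)) (assumption | rule that)+
  have self: "f x \<in> g x" if "x \<in> C" for x using g[OF that] that K0 by auto
  have img: "f ` K = g 0" using g[of 0] Cs subspace_0 K'(2) by auto
  have mulg: "g (b x y) = rcoset_mult L (f ` K) (g x) (g y)" if xy: "x \<in> C" "y \<in> C" for x y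
  proof -
    have "f ` K +>\<^bsub>L\<^esub> (U \<otimes>\<^bsub>L\<^esub> Y) = g (b x y)" if XY: "U \<in> g x" "Y \<in> g y" for U Y
    proof -
      obtain u v where uv: "U = f u" "Y = f v" "u \<in> C" "v \<in> C" "u - x \<in> K" "v - y \<in> K"
        using XY g xy by auto
      have "b u v - b x y = b u (v - y) + b (u - x) y"
        by (simp add: b_simps)
      hence "b u v - b x y \<in> K" using uv xy K'(3,4) by simp
      hence "g (b u v) = g (b x y)" using uv xy g_eq[of "b u v" "b x y"] by simp
      thus ?thesis using uv D(6)[of u v] by (simp add: g_def)
    qed
    thus ?thesis unfolding rcoset_mult_def using self[OF xy(1)] self[OF xy(2)] by blast
  qed
  have "g ` C = a_rcosets\<^bsub>L\<^esub> (f ` K)"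
    unfolding A_RCOSETS_def' g_def D(1)[symmetric] by blast
  moreover have "g ` P p = (\<lambda>U. f ` K +>\<^bsub>L\<^esub> U) ` part L p" for p
    unfolding g_def D(2)[symmetric] by blast
  ultimately have "presents s b C P K g (quotient_superalgebra L (f ` K))"
    unfolding presents_def quotient_superalgebra_def superalgebra.simps module.simps ring.simps
      monoid.simps partial_object.simps
  proof (intro conjI ballI allI)
    fix x y assume "x \<in> C" "y \<in> C"
    thus "g x = g y \<longleftrightarrow> x - y \<in> K" using g_eq by blast
    show "g (x + y) = g x <+>\<^bsub>L\<^esub> g y" "g (b x y) = rcoset_mult L (f ` K) (g x) (g y)"
      by (rule g_add mulg, fact, fact)+
  next
    show "g (s c x) = rcoset_smult L (f ` K) c (g x)" if "x \<in> C" for c x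
      unfolding g_def by (rule cosets(4)) (assumption | rule that)+
  qed (simp_all only: img)
  thus ?thesis by (simp only: g_def[abs_def])
qed

end

text \<open>The first isomorphism theorem, which moves a presentation from the free superalgebra to
  a concrete model. \<open>\<Psi>\<close> is onto only modulo Z, and this is asked in each parity
  separately, so that the parts correspond too.\<close>

lemma presents_transport:
  assumes h: "presents s1 b1 UNIV P1 K h L"
    and linear: "\<And>x y. \<Psi> (x + y) = \<Psi> x + \<Psi> y" "\<And>c x. \<Psi> (s1 c x) = s2 c (\<Psi> x)"
    and mult: "\<And>x y. \<Psi> (b1 x y) = b2 (\<Psi> x) (\<Psi> y)"
    and C: "bilinear_algebra s2 b2" "bilinear_algebra.subalgebra s2 b2 C" "bilinear_algebra.ideal_of s2 b2 C Z"
      "\<And>x. \<Psi> x \<in> C" "\<And>x. x \<in> C \<Longrightarrow> \<exists>a. \<Psi> a - x \<in> Z"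
    and P: "\<And>p. P2 p \<subseteq> C" "\<And>p a. a \<in> P1 p \<Longrightarrow> \<Psi> a \<in> P2 p" "\<And>p x. x \<in> P2 p \<Longrightarrow> \<exists>a\<in>P1 p. \<Psi> a - x \<in> Z"
    and K: "\<And>a. a \<in> K \<longleftrightarrow> \<Psi> a \<in> Z"
  obtains f where "presents s2 b2 C P2 Z f L" "\<And>a. f (\<Psi> a) = h a"
proof -
  interpret bilinear_algebra s2 b2 by fact
  note I = ideal_ofD[OF C(3)] and D = presentsD[OF h]
  have Cs: "subspace C" and Cb: "\<And>x y. x \<in> C \<Longrightarrow> y \<in> C \<Longrightarrow> b2 x y \<in> C"
    using C(2) by (auto simp: subalgebra_def)
  note [simp] = subspace_add[OF I(1)] subspace_diff[OF I(1)] subspace_neg[OF I(1)]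
    subspace_scale[OF I(1)] subspace_add[OF Cs] subspace_scale[OF Cs] Cb
  have dif: "\<Psi> (x - y) = \<Psi> x - \<Psi> y" for x y
    using linear(1)[of "x - y" y] by (simp add: algebra_simps)
  have zero: "\<Psi> 0 = 0" using dif[of 0 0] by simp
  define f where "f x = h (SOME a. \<Psi> a - x \<in> Z)" for x
  have f: "f x = h a" if "\<Psi> a - x \<in> Z" for x a
  proof -
    have *: "\<Psi> (SOME a. \<Psi> a - x \<in> Z) - x \<in> Z" using that by (rule someI)
    have "\<Psi> ((SOME a. \<Psi> a - x \<in> Z) - a) \<in> Z"
      using subspace_diff[OF I(1) * that] by (simp add: dif)
    thus ?thesis unfolding f_def using D(4) K by simp
  qed
  have Z0: "0 \<in> Z" using I(1) subspace_0 by blast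
  have eq: "f (\<Psi> a) = h a" for a using f[of a "\<Psi> a"] Z0 by simp
  have "presents s2 b2 C P2 Z f L"
    unfolding presents_def
  proof (intro conjI ballI allI)
    show "f ` C = carrier L"
    proof
      show "f ` C \<subseteq> carrier L" using C(5) f D(1) by (metis image_subsetI rangeI)
      show "carrier L \<subseteq> f ` C" using D(1) eq C(4) by (metis image_eqI image_subsetI)
    qed
    show "f ` P2 p = part L p" for p
    proof
      show "f ` P2 p \<subseteq> part L p" using P(3) f D(2)[of p] by (metis (no_types, lifting) image_subsetI imageI)
      show "part L p \<subseteq> f ` P2 p" using D(2)[of p] eq P(2) by (metis image_eqI image_subsetI)
    qed
    show "f 0 = \<zero>\<^bsub>L\<^esub>" using eq[of 0] zero D(3) by simp
  next
    fix x y assume xy: "x \<in> C" "y \<in> C"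
    then obtain a c where a: "\<Psi> a - x \<in> Z" and c: "\<Psi> c - y \<in> Z" using C(5) by blast
    have "f x = f y \<longleftrightarrow> \<Psi> a - \<Psi> c \<in> Z" using f[OF a] f[OF c] D(4) K dif by simp
    also have "\<dots> \<longleftrightarrow> x - y \<in> Z"
    proof
      assume "\<Psi> a - \<Psi> c \<in> Z"
      from subspace_diff[OF I(1) this subspace_diff[OF I(1) a c]] show "x - y \<in> Z" by (simp add: algebra_simps)
    next
      assume "x - y \<in> Z"
      from subspace_add[OF I(1) this subspace_diff[OF I(1) a c]] show "\<Psi> a - \<Psi> c \<in> Z" by (simp add: algebra_simps)
    qed
    finally show "f x = f y \<longleftrightarrow> x - y \<in> Z" .
    have "\<Psi> (a + c) - (x + y) \<in> Z" using subspace_add[OF I(1) a c] by (simp add: linear algebra_simps)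
    thus "f (x + y) = f x \<oplus>\<^bsub>L\<^esub> f y" using f[OF a] f[OF c] f[of "a + c" "x + y"] D(5) by simp
    have "\<Psi> (b1 a c) - b2 x y = b2 (\<Psi> a) (\<Psi> c - y) + b2 (\<Psi> a - x) y"
      by (simp add: mult b_simps)
    moreover have "\<dots> \<in> Z" using a c I(3,4) xy C(4) by simp
    ultimately show "f (b2 x y) = f x \<otimes>\<^bsub>L\<^esub> f y"
      using f[OF a] f[OF c] f[of "b1 a c" "b2 x y"] D(6) by simp
  next
    fix c x assume "x \<in> C"
    then obtain a where a: "\<Psi> a - x \<in> Z" using C(5) by blast
    have "\<Psi> (s1 c a) - s2 c x \<in> Z"
      using subspace_scale[OF I(1) a, of c] by (simp add: linear scale_right_diff_distrib)
    thus "f (s2 c x) = c \<odot>\<^bsub>L\<^esub> f x" using f[OF a] f[of "s1 c a" "s2 c x"] D(7) by simp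
  qed
  thus ?thesis using eq that by blast
qed

context bilinear_algebra
begin

text \<open>These are the axioms for the quotient of \<open>total P\<close> by Z to be a Lie
  superalgebra. The clause about x + y in Z makes Z a graded subspace and the sum of the two parts
  direct modulo Z. Stability of Z under right multiplication follows from skew symmetry.\<close>

definition lie_mod :: "(bit \<Rightarrow> 'x set) \<Rightarrow> 'x set \<Rightarrow> bool"
  where "lie_mod P Z \<longleftrightarrow> subspace Z \<and> (\<forall>p. subspace (P p)) \<and>
    (\<forall>z\<in>Z. \<exists>x\<in>P 0. \<exists>y\<in>P 1. z = x + y) \<and>
    (\<forall>x\<in>P 0. \<forall>y\<in>P 1. x + y \<in> Z \<longrightarrow> x \<in> Z) \<and>
    (\<forall>p q. \<forall>x\<in>P p. \<forall>y\<in>P q. b x y \<in> P (p + q) \<and>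
       b x y + s (koszul_sign p q) (b y x) \<in> Z) \<and>
    (\<forall>p. \<forall>x\<in>P p. \<forall>z\<in>Z. b x z \<in> Z) \<and>
    (\<forall>p q r. \<forall>x\<in>P p. \<forall>y\<in>P q. \<forall>z\<in>P r.
       b x (b y z) - (b (b x y) z + s (koszul_sign p q) (b y (b x z))) \<in> Z) \<and>
    (\<forall>x\<in>P 1. b x (b x x) \<in> Z)"

lemma lie_modD:
  assumes "lie_mod P Z"
  shows "subspace Z" "subspace (P p)" "z \<in> Z \<Longrightarrow> \<exists>x\<in>P 0. \<exists>y\<in>P 1. z = x + y"
    "x \<in> P 0 \<Longrightarrow> y \<in> P 1 \<Longrightarrow> x + y \<in> Z \<Longrightarrow> x \<in> Z"
    "x \<in> P p \<Longrightarrow> y \<in> P q \<Longrightarrow> b x y \<in> P (p + q)"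
    "x \<in> P p \<Longrightarrow> y \<in> P q \<Longrightarrow> b x y + s (koszul_sign p q) (b y x) \<in> Z"
    "x \<in> P p \<Longrightarrow> z \<in> Z \<Longrightarrow> b x z \<in> Z"
    "x \<in> P p \<Longrightarrow> y \<in> P q \<Longrightarrow> w \<in> P r \<Longrightarrow>
       b x (b y w) - (b (b x y) w + s (koszul_sign p q) (b y (b x w))) \<in> Z"
    "x \<in> P 1 \<Longrightarrow> b x (b x x) \<in> Z"
  using assms unfolding lie_mod_def by blast+

definition total :: "(bit \<Rightarrow> 'x set) \<Rightarrow> 'x set"
  where "total P = {x + y | x y. x \<in> P 0 \<and> y \<in> P 1}"

lemma total_subspace:
  assumes "\<And>p. subspace (P p)" shows "subspace (total P)" and "P p \<subseteq> total P"
proof -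
  show "subspace (total P)"
    unfolding total_def using subspace_sums[OF assms[of 0] assms[of 1]] by simp
  have "0 \<in> P q" for q using assms subspace_0 by blast
  thus "P p \<subseteq> total P" unfolding total_def
    by (cases p) (force intro: exI[of _ 0])+
qed

lemma lie_mod_total:
  assumes L: "lie_mod P Z"
  shows "subalgebra (total P)" "ideal_of (total P) Z" "P p \<subseteq> total P"
proof -
  note D = lie_modD[OF L]
  have S: "subspace (total P)" and PS: "P p \<subseteq> total P" for p
    using total_subspace[of P] D(2) by auto
  show "P p \<subseteq> total P" by (rule PS)
  have bit: "p = 0 \<or> p = 1" for p :: bit by (cases p) auto
  have cl: "b x y \<in> total P" if "x \<in> P p" "y \<in> P q" for x y p q
    using D(5)[OF that] PS by blast
  show "subalgebra (total P)"
    unfolding subalgebra_def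
  proof (intro conjI S ballI)
    fix x y assume "x \<in> total P" "y \<in> total P"
    then obtain x0 x1 y0 y1 where *: "x0 \<in> P 0" "x1 \<in> P 1" "y0 \<in> P 0" "y1 \<in> P 1"
      "x = x0 + x1" "y = y0 + y1" unfolding total_def by blast
    show "b x y \<in> total P" unfolding *(5,6) b_add_left b_add_right
      using cl * subspace_add[OF S] by metis
  qed
  have par: "z0 \<in> Z \<and> z1 \<in> Z" if "z0 \<in> P 0" "z1 \<in> P 1" "z0 + z1 \<in> Z" for z0 z1
    using D(4)[OF that] subspace_diff[OF D(1) that(3), of z0] by simp
  \<comment> \<open>Skew symmetry is available for homogeneous elements only, so a general z in Z is
    first split into homogeneous parts; by \<open>par\<close> these lie in Z again.\<close>
  have right: "b z x \<in> Z" if "x \<in> P p" "z \<in> P q" "z \<in> Z" for x z p q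
  proof -
    have "b z x + s (koszul_sign q p) (b x z) \<in> Z" using D(6) that by blast
    moreover have "s (koszul_sign q p) (b x z) \<in> Z" using D(7) that subspace_scale[OF D(1)] by blast
    ultimately show ?thesis using subspace_diff[OF D(1)] by fastforce
  qed
  show "ideal_of (total P) Z"
    unfolding ideal_of_def
  proof (intro conjI D(1) ballI)
    show "Z \<subseteq> total P" unfolding total_def using D(3) by blast
    fix x z assume "x \<in> total P" and z: "z \<in> Z"
    then obtain x0 x1 where *: "x0 \<in> P 0" "x1 \<in> P 1" "x = x0 + x1" unfolding total_def by blast
    show "b x z \<in> Z" unfolding *(3) b_add_left using D(7) * z subspace_add[OF D(1)] by blast
    obtain z0 z1 where zz: "z0 \<in> P 0" "z1 \<in> P 1" "z = z0 + z1" using D(3)[OF z] by blast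
    hence "z0 \<in> Z" "z1 \<in> Z" using par z by auto
    thus "b z x \<in> Z" unfolding *(3) zz(3) b_add_left b_add_right
      using right * zz subspace_add[OF D(1)] by metis
  qed
qed

lemma presents_lie_superalgebra:
  assumes L: "presents s b (total P) P Z f L" and lie: "lie_mod P Z"
  shows "lie_superalgebra L"
proof -
  note D = presentsD[OF L] and Q = lie_modD[OF lie] and T = lie_mod_total[OF lie]
  have S: "subspace (total P)" using T(1) by (simp add: subalgebra_def)
  have B: "b x y \<in> total P" if "x \<in> total P" "y \<in> total P" for x y
    using T(1) that by (auto simp: subalgebra_def)
  have M: "Module.module (scalars :: 'k ring) L" by (rule presents_module[OF L S])
  interpret M: Module.module "scalars :: 'k ring" L by (rule M)
  have PT: "x \<in> total P" if "x \<in> P p" for x p using T(3) that by blast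
  note add = subspace_add[OF S] and scl = subspace_scale[OF S]
  have car: "\<exists>x\<in>total P. U = f x" if "U \<in> carrier L" for U using that D(1) by blast
  have parE: "\<exists>x\<in>P p. U = f x" if "U \<in> part L p" for U p using that D(2)[of p] by blast
  have inC: "f x \<in> carrier L" if "x \<in> total P" for x using that D(1) by blast
  have inP: "f x \<in> part L p" if "x \<in> P p" for x p using that D(2) by blast
  have zero: "f x = \<zero>\<^bsub>L\<^esub> \<longleftrightarrow> x \<in> Z" if "x \<in> total P" for x
    using D(4)[OF that subspace_0[OF S]] D(3) by simp
  have minus: "f (x - y) = f x \<ominus>\<^bsub>L\<^esub> f y" if "x \<in> total P" "y \<in> total P" for x y
  proof -
    have d: "x - y \<in> total P" using subspace_diff[OF S] that by blast
    have "f x = f (x - y) \<oplus>\<^bsub>L\<^esub> f y" using D(5)[OF d that(2)] by simp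
    thus ?thesis using inC that d by (simp add: M.M.minus_eq M.M.add.m_assoc M.M.r_neg)
  qed
  show ?thesis
    unfolding lie_superalgebra_def
  proof (intro conjI allI ballI)
    show "Module.module (scalars :: 'k ring) L" by (rule M)
    show "submodule (part L p) (scalars :: 'k ring) L" for p
      using presents_submodule[OF L S Q(2)[of p] T(3)] D(2)[of p] by simp
    show "part L 0 \<inter> part L 1 = {\<zero>\<^bsub>L\<^esub>}"
    proof (intro equalityI subsetI)
      fix U assume "U \<in> part L 0 \<inter> part L 1"
      then obtain x y where *: "x \<in> P 0" "y \<in> P 1" "U = f x" "f x = f y" using parE by (metis IntD1 IntD2)
      have "x + - y \<in> Z" using D(4)[of x y] * PT by simp
      hence "x \<in> Z" using Q(4)[of x "- y"] * subspace_neg[OF Q(2)] by blast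
      hence "f x = \<zero>\<^bsub>L\<^esub>" using zero[OF PT[OF *(1)]] by blast
      thus "U \<in> {\<zero>\<^bsub>L\<^esub>}" using * by simp
    next
      fix U assume "U \<in> {\<zero>\<^bsub>L\<^esub>}"
      thus "U \<in> part L 0 \<inter> part L 1" using inP[of 0 0] inP[of 0 1] D(3) subspace_0[OF Q(2)] by auto
    qed
    show "part L 0 <+>\<^bsub>L\<^esub> part L 1 = carrier L"
    proof (intro equalityI subsetI)
      fix U assume "U \<in> part L 0 <+>\<^bsub>L\<^esub> part L 1"
      then obtain x y where *: "x \<in> P 0" "y \<in> P 1" "U = f x \<oplus>\<^bsub>L\<^esub> f y"
        unfolding set_add_def' using parE by blast
      show "U \<in> carrier L" unfolding *(3) using * PT inC by blast
    next
      fix U assume "U \<in> carrier L"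
      then obtain x y where *: "x \<in> P 0" "y \<in> P 1" "U = f (x + y)"
        using car[of U] unfolding total_def by blast
      hence "U = f x \<oplus>\<^bsub>L\<^esub> f y" using D(5) PT by simp
      thus "U \<in> part L 0 <+>\<^bsub>L\<^esub> part L 1" unfolding set_add_def' using * inP by blast
    qed
    show "U \<otimes>\<^bsub>L\<^esub> V \<in> part L (p + q)" if UV: "U \<in> part L p" "V \<in> part L q" for p q U V
    proof -
      obtain x y where *: "x \<in> P p" "y \<in> P q" "U = f x" "V = f y" using UV parE by metis
      thus ?thesis using D(6)[of x y] PT inP Q(5) by metis
    qed
    show "lie_relators L \<subseteq> {\<zero>\<^bsub>L\<^esub>}"
    proof
      fix W assume "W \<in> lie_relators L"
      then consider
          (skew) p q U V where "W = U \<otimes>\<^bsub>L\<^esub> V \<oplus>\<^bsub>L\<^esub> (koszul_sign p q \<odot>\<^bsub>L\<^esub> (V \<otimes>\<^bsub>L\<^esub> U))" "U \<in> part L p" "V \<in> part L q"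
        | (jac) p q r U V Y where "W = U \<otimes>\<^bsub>L\<^esub> (V \<otimes>\<^bsub>L\<^esub> Y) \<ominus>\<^bsub>L\<^esub> ((U \<otimes>\<^bsub>L\<^esub> V) \<otimes>\<^bsub>L\<^esub> Y
           \<oplus>\<^bsub>L\<^esub> (koszul_sign p q \<odot>\<^bsub>L\<^esub> (V \<otimes>\<^bsub>L\<^esub> (U \<otimes>\<^bsub>L\<^esub> Y))))" "U \<in> part L p" "V \<in> part L q" "Y \<in> part L r"
        | (cube) U where "W = U \<otimes>\<^bsub>L\<^esub> (U \<otimes>\<^bsub>L\<^esub> U)" "U \<in> part L 1"
        unfolding lie_relators_def by blast
      thus "W \<in> {\<zero>\<^bsub>L\<^esub>}"
      proof cases
        case skew
        then obtain x y where *: "x \<in> P p" "y \<in> P q" "U = f x" "V = f y" using parE by metis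
        hence xy: "x \<in> total P" "y \<in> total P" using PT by auto
        have "W = f (b x y + s (koszul_sign p q) (b y x))"
          unfolding skew(1) * using xy by (simp add: D(5-7) B scl)
        thus ?thesis using zero[of "b x y + s (koszul_sign p q) (b y x)"] Q(6) * xy B add scl by simp
      next
        case jac
        then obtain x y z where *: "x \<in> P p" "y \<in> P q" "z \<in> P r" "U = f x" "V = f y" "Y = f z" using parE by metis
        hence xy: "x \<in> total P" "y \<in> total P" "z \<in> total P" using PT by auto
        let ?w = "b x (b y z) - (b (b x y) z + s (koszul_sign p q) (b y (b x z)))"
        have "W = f ?w" unfolding jac(1) * using xy by (simp add: D(5-7) B scl add minus)
        moreover have "?w \<in> total P" using xy B add scl subspace_diff[OF S] by simp
        ultimately show ?thesis using zero[of ?w] Q(8)[OF *(1-3)] by simp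
      next
        case cube
        then obtain x where *: "x \<in> P 1" "U = f x" using parE by metis
        have "x \<in> total P" using * PT by simp
        thus ?thesis using zero[of "b x (b x x)"] Q(9)[OF *(1)] by (simp add: cube * D(6) B)
      qed
    qed
  next
    fix U V W assume "U \<in> carrier L" "V \<in> carrier L" "W \<in> carrier L"
    then obtain x y z where *: "x \<in> total P" "y \<in> total P" "z \<in> total P" "U = f x" "V = f y" "W = f z" using car by metis
    have "f (b (x + y) z) = f (b x z + b y z)" "f (b x (y + z)) = f (b x y + b x z)" by (simp_all add: b_simps)
    thus "(U \<oplus>\<^bsub>L\<^esub> V) \<otimes>\<^bsub>L\<^esub> W = U \<otimes>\<^bsub>L\<^esub> W \<oplus>\<^bsub>L\<^esub> V \<otimes>\<^bsub>L\<^esub> W" "U \<otimes>\<^bsub>L\<^esub> (V \<oplus>\<^bsub>L\<^esub> W) = U \<otimes>\<^bsub>L\<^esub> V \<oplus>\<^bsub>L\<^esub> U \<otimes>\<^bsub>L\<^esub> W"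
      using * add B by (simp_all add: D(5,6))
  next
    fix c U V assume "U \<in> carrier L" "V \<in> carrier L"
    then obtain x y where *: "x \<in> total P" "y \<in> total P" "U = f x" "V = f y" using car by metis
    have "f (b (s c x) y) = f (s c (b x y))" "f (b x (s c y)) = f (s c (b x y))" by (simp_all add: b_simps)
    thus "(c \<odot>\<^bsub>L\<^esub> U) \<otimes>\<^bsub>L\<^esub> V = c \<odot>\<^bsub>L\<^esub> (U \<otimes>\<^bsub>L\<^esub> V)" "U \<otimes>\<^bsub>L\<^esub> (c \<odot>\<^bsub>L\<^esub> V) = c \<odot>\<^bsub>L\<^esub> (U \<otimes>\<^bsub>L\<^esub> V)"
      using * scl B by (simp_all add: D(6,7))
  qed
qed

lemma presents_finsum:
  assumes L: "presents s b C P Z f L" and C: "subspace C" and "finite A" "\<And>i. i \<in> A \<Longrightarrow> g i \<in> C"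
  shows "finsum L (\<lambda>i. f (g i)) A = f (sum g A)"
proof -
  note D = presentsD[OF L]
  interpret M: Module.module "scalars :: 'k ring" L by (rule presents_module[OF L C])
  show ?thesis using assms(3,4)
  proof (induction A)
    case empty thus ?case by (simp add: D(3))
  next
    case (insert a A)
    have "finsum L (\<lambda>i. f (g i)) (insert a A) = f (g a) \<oplus>\<^bsub>L\<^esub> finsum L (\<lambda>i. f (g i)) A"
      using insert D(1) by (intro M.M.finsum_insert) auto
    also have "\<dots> = f (g a + sum g A)" using insert D(5)[of "g a" "sum g A"] subspace_sum[OF C, of A g] by simp
    finally show ?case using insert by simp
  qed
qed

end

section \<open>The free superalgebra\<close>

abbreviation pm_scale :: "'k::field \<Rightarrow> ('w \<Rightarrow>\<^sub>0 'k) \<Rightarrow> ('w \<Rightarrow>\<^sub>0 'k)"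
  where "pm_scale c \<equiv> Poly_Mapping.map ((*) c)"

definition free_mult ::
    "('x bracketing \<Rightarrow>\<^sub>0 'k::field) \<Rightarrow> ('x bracketing \<Rightarrow>\<^sub>0 'k) \<Rightarrow> ('x bracketing \<Rightarrow>\<^sub>0 'k)"
  where "free_mult a b = (\<Sum>u\<in>Poly_Mapping.keys a. \<Sum>v\<in>Poly_Mapping.keys b.
        Poly_Mapping.single (Br u v) (Poly_Mapping.lookup a u * Poly_Mapping.lookup b v))"

definition supported :: "'x bracketing set \<Rightarrow> ('x bracketing \<Rightarrow>\<^sub>0 'k::field) set"
  where "supported W = {a. Poly_Mapping.keys a \<subseteq> W}"

lemma lookup_pm_scale [simp]: "Poly_Mapping.lookup (pm_scale c a) w = c * Poly_Mapping.lookup a w"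
  by (auto simp: Poly_Mapping.map.rep_eq when_def in_keys_iff)

text \<open>A bracketing factors in exactly one way, so at most one term of the double sum
  contributes to a given word.\<close>

lemma lookup_free_mult:
  "Poly_Mapping.lookup (free_mult a b) w = (case w of Letter x \<Rightarrow> 0
     | Br u v \<Rightarrow> Poly_Mapping.lookup a u * Poly_Mapping.lookup b v)"
proof (cases w)
  case (Br u v)
  have "Poly_Mapping.lookup (free_mult a b) w =
    (\<Sum>u'\<in>Poly_Mapping.keys a. \<Sum>v'\<in>Poly_Mapping.keys b.
       if u' = u then if v' = v then Poly_Mapping.lookup a u' * Poly_Mapping.lookup b v' else 0 else 0)"
    unfolding free_mult_def Br
    by (auto simp: Poly_Mapping.lookup_sum Poly_Mapping.lookup_single when_def intro!: sum.cong)
  also have "\<dots> = (\<Sum>u'\<in>Poly_Mapping.keys a. if u' = u then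
      (\<Sum>v'\<in>Poly_Mapping.keys b. if v' = v then Poly_Mapping.lookup a u' * Poly_Mapping.lookup b v' else 0) else 0)"
    by (intro sum.cong) auto
  also have "\<dots> = Poly_Mapping.lookup a u * Poly_Mapping.lookup b v"
    by (simp add: sum.delta in_keys_iff)
  finally show ?thesis using Br by simp
qed (auto simp: free_mult_def Poly_Mapping.lookup_sum Poly_Mapping.lookup_single when_def)

interpretation pm: bilinear_algebra "pm_scale :: 'k::field \<Rightarrow> _" free_mult
  by unfold_locales
    (auto intro!: poly_mapping_eqI simp: lookup_free_mult lookup_add algebra_simps split: bracketing.splits)

lemma free_mult_single: "free_mult (Poly_Mapping.single u c) (Poly_Mapping.single v d)
    = Poly_Mapping.single (Br u v) (c * d)"
  by (rule poly_mapping_eqI) (auto simp: lookup_free_mult Poly_Mapping.lookup_single when_def split: bracketing.splits)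

lemma pm_decompose:
  assumes "finite A" "Poly_Mapping.keys a \<subseteq> A"
  shows "a = (\<Sum>w\<in>A. Poly_Mapping.single w (Poly_Mapping.lookup a w))"
proof (rule poly_mapping_eqI)
  fix k
  have "(\<Sum>w\<in>A. Poly_Mapping.lookup (Poly_Mapping.single w (Poly_Mapping.lookup a w)) k) =
     (\<Sum>w\<in>A. if w = k then Poly_Mapping.lookup a w else 0)"
    by (intro sum.cong) (auto simp: Poly_Mapping.lookup_single when_def)
  thus "Poly_Mapping.lookup a k = Poly_Mapping.lookup (\<Sum>w\<in>A. Poly_Mapping.single w (Poly_Mapping.lookup a w)) k"
    using assms by (auto simp: Poly_Mapping.lookup_sum in_keys_iff)
qed

lemma supported_subspace: "pm.subspace (supported W)"
proof (rule pm.subspaceI)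
  show "a + b \<in> supported W" if "a \<in> supported W" "b \<in> supported W" for a b
    using that Poly_Mapping.keys_add[of a b] unfolding supported_def by blast
qed (auto simp: supported_def in_keys_iff subset_iff)

lemma supported_induct [consumes 1, case_names zero single add]:
  assumes "a \<in> supported W" and "Q 0"
    and "\<And>w c. w \<in> W \<Longrightarrow> Q (Poly_Mapping.single w c)"
    and "\<And>a b. a \<in> supported W \<Longrightarrow> b \<in> supported W \<Longrightarrow> Q a \<Longrightarrow> Q b \<Longrightarrow> Q (a + b)"
  shows "Q a"
proof -
  have "(\<Sum>w\<in>A. Poly_Mapping.single w (Poly_Mapping.lookup a w)) \<in> supported W \<and>
      Q (\<Sum>w\<in>A. Poly_Mapping.single w (Poly_Mapping.lookup a w))" if "finite A" "A \<subseteq> W" for A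
    using that
  proof (induction A)
    case empty thus ?case using assms(2) by (simp add: supported_def)
  next
    case (insert w A)
    have "Poly_Mapping.single w (Poly_Mapping.lookup a w) \<in> supported W"
      using insert by (auto simp: supported_def)
    moreover have "Q (Poly_Mapping.single w (Poly_Mapping.lookup a w))" using insert assms(3) by blast
    ultimately show ?case
      using insert assms(4) by (simp add: pm.subspace_add[OF supported_subspace])
  qed
  from this[of "Poly_Mapping.keys a"] show ?thesis
    using assms(1) pm_decompose[of "Poly_Mapping.keys a" a] by (simp add: supported_def)
qed

lemma supported_UNIV [simp]: "supported UNIV = UNIV"
  by (simp add: supported_def)

lemma single_supported: "w \<in> W \<Longrightarrow> Poly_Mapping.single w c \<in> supported W"
  by (auto simp: supported_def)

primrec word_eval :: "('y \<Rightarrow> 'y \<Rightarrow> 'y) \<Rightarrow> ('x \<Rightarrow> 'y) \<Rightarrow> 'x bracketing \<Rightarrow> 'y" where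
  "word_eval b g (Letter x) = g x"
| "word_eval b g (Br u v) = b (word_eval b g u) (word_eval b g v)"

context bilinear_algebra
begin

definition extend :: "('w bracketing \<Rightarrow> 'x) \<Rightarrow> ('w bracketing \<Rightarrow>\<^sub>0 'k) \<Rightarrow> 'x"
  where "extend g a = (\<Sum>w\<in>Poly_Mapping.keys a. s (Poly_Mapping.lookup a w) (g w))"

lemma extend_superset:
  "finite A \<Longrightarrow> Poly_Mapping.keys a \<subseteq> A \<Longrightarrow> extend g a = (\<Sum>w\<in>A. s (Poly_Mapping.lookup a w) (g w))"
  unfolding extend_def by (intro sum.mono_neutral_left) (auto simp: in_keys_iff)

lemma extend_add: "extend g (a + c) = extend g a + extend g c"
proof -
  let ?A = "Poly_Mapping.keys a \<union> Poly_Mapping.keys c"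
  have "extend g a + extend g c = (\<Sum>w\<in>?A. s (Poly_Mapping.lookup (a + c) w) (g w))"
    by (simp add: extend_superset[of ?A a] extend_superset[of ?A c] lookup_add scale_left_distrib sum.distrib)
  also have "\<dots> = extend g (a + c)"
    using Poly_Mapping.keys_add[of a c] by (intro extend_superset[symmetric]) auto
  finally show ?thesis by simp
qed

lemma extend_scale: "extend g (pm_scale c a) = s c (extend g a)"
proof -
  have "Poly_Mapping.keys (pm_scale c a) \<subseteq> Poly_Mapping.keys a" by (auto simp: in_keys_iff)
  hence "extend g (pm_scale c a) = (\<Sum>w\<in>Poly_Mapping.keys a. s (Poly_Mapping.lookup (pm_scale c a) w) (g w))"
    by (intro extend_superset) auto
  thus ?thesis by (simp add: extend_def scale_sum_right)
qed

lemma extend_single [simp]: "extend g (Poly_Mapping.single w c) = s c (g w)"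
  by (subst extend_superset[of "{w}"]) auto

lemma extend_diff: "extend g (a - c) = extend g a - extend g c"
  using extend_add[of g "a - c" c] by (simp add: algebra_simps)

lemma extend_zero [simp]: "extend g 0 = 0"
  by (simp add: extend_def)

lemma extend_sum: "extend g (sum a A) = (\<Sum>i\<in>A. extend g (a i))"
  by (induction A rule: infinite_finite_induct) (auto simp: extend_add)

lemma extend_mult: "extend (word_eval b g) (free_mult a c)
    = b (extend (word_eval b g) a) (extend (word_eval b g) c)"
proof -
  have "a \<in> supported UNIV" by simp
  thus ?thesis
  proof (induction a rule: supported_induct)
    case (single u k)
    have "c \<in> supported UNIV" by simp
    thus ?case
      by (induction c rule: supported_induct)
        (auto simp: pm.b_simps b_simps extend_add free_mult_single)
  qed (auto simp: pm.b_simps b_simps extend_add)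
qed

lemma extend_in:
  assumes "subspace S" "a \<in> supported W" "\<And>w. w \<in> W \<Longrightarrow> g w \<in> S"
  shows "extend g a \<in> S"
  using assms unfolding extend_def supported_def by (intro subspace_sum subspace_scale) auto

end

lemma free_presents:
  "presents pm_scale free_mult UNIV (\<lambda>p. supported {w. word_parity par w = p}) {0} id
     (free_superalgebra par :: ('k::field, _) superalgebra)"
  unfolding presents_def free_superalgebra_def
  by (auto simp: free_mult_def supported_def subset_iff)

lemma total_free: "pm.total (\<lambda>p. supported {w. word_parity par w = p}) = UNIV"
proof -
  let ?P = "\<lambda>p. supported {w. word_parity par w = p}"
  have "a \<in> pm.total ?P" for a
  proof -
    have "a \<in> supported UNIV" by simp
    thus ?thesis
    proof (induction a rule: supported_induct)
      case (single w c)
      have "Poly_Mapping.single w c \<in> ?P (word_parity par w)" by (intro single_supported) auto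
      thus ?case using pm.total_subspace(2)[of ?P] supported_subspace by blast
    next
      case (add a b) thus ?case using pm.subspace_add[OF pm.total_subspace(1)[of ?P]] supported_subspace by blast
    next
      case zero thus ?case using pm.subspace_0[OF pm.total_subspace(1)[of ?P]] supported_subspace by blast
    qed
  qed
  thus ?thesis by blast
qed

section \<open>The presentation ideal\<close>

lemma free_superalgebra_simps [simp]:
  fixes par :: "'x \<Rightarrow> bit"
  defines "L \<equiv> free_superalgebra par :: ('k::field, 'x bracketing \<Rightarrow>\<^sub>0 'k) superalgebra"
  shows "carrier L = UNIV" "\<zero>\<^bsub>L\<^esub> = 0" "x \<oplus>\<^bsub>L\<^esub> y = x + y" "x \<otimes>\<^bsub>L\<^esub> y = free_mult x y"
    "c \<odot>\<^bsub>L\<^esub> x = pm_scale c x" "part L p = supported {w. word_parity par w = p}"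
    "x \<ominus>\<^bsub>L\<^esub> y = x - y"
proof -
  show *: "carrier L = UNIV" "\<zero>\<^bsub>L\<^esub> = 0" "\<And>x y. x \<oplus>\<^bsub>L\<^esub> y = x + y" "x \<otimes>\<^bsub>L\<^esub> y = free_mult x y"
    "c \<odot>\<^bsub>L\<^esub> x = pm_scale c x" "part L p = supported {w. word_parity par w = p}"
    by (auto simp: L_def free_superalgebra_def free_mult_def supported_def)
  interpret M: Module.module "scalars :: 'k ring" L
    unfolding L_def by (rule pm.presents_module[OF free_presents pm.subspace_UNIV])
  have "\<ominus>\<^bsub>L\<^esub> y = - y" by (rule M.M.minus_equality) (simp_all add: *)
  thus "x \<ominus>\<^bsub>L\<^esub> y = x - y" by (simp add: M.M.minus_eq *)
qed

lemma lie_ideal_free: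
  "lie_ideal (free_superalgebra par :: ('k::field, _) superalgebra) I \<longleftrightarrow> pm.ideal_of UNIV I"
  unfolding lie_ideal_def pm.submodule_iff[OF pm.presents_module[OF free_presents pm.subspace_UNIV]]
    free_superalgebra_simps pm.ideal_of_def pm.subspace_def by simp

abbreviation parity_part :: "('n \<Rightarrow> bit) \<Rightarrow> bit \<Rightarrow> (('n, 'v) generator bracketing \<Rightarrow>\<^sub>0 'k::field) set"
  where "parity_part par p \<equiv> supported {w. word_parity (generator_parity par) w = p}"

lemma gen_parity: "gen x \<in> parity_part par (generator_parity par x)"
  unfolding gen_def by (rule single_supported) simp

lemma word_parity_part: "Poly_Mapping.single w c \<in> parity_part par (word_parity (generator_parity par) w)"
  by (rule single_supported) simp

lemma presentation_ideal_ideal: "pm.ideal_of UNIV (presentation_ideal par R)"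
proof -
  have "lie_ideal (free_chevalley par) (presentation_ideal par R)"
    unfolding presentation_ideal_def
    by (rule hull_in) (auto simp: lie_ideal_free pm.ideal_of_def intro!: pm.subspace_Inter)
  thus ?thesis by (simp add: lie_ideal_free)
qed

lemmas presentation_idealD = pm.ideal_ofD[OF presentation_ideal_ideal]

lemma presentation_ideal_subset:
  "lie_relators (free_chevalley par) \<union> chevalley_relators par R \<subseteq> presentation_ideal par R"
  unfolding presentation_ideal_def by (rule hull_subset)

lemma presentation_ideal_least:
  assumes "pm.ideal_of UNIV I" "lie_relators (free_chevalley par) \<subseteq> I" "chevalley_relators par R \<subseteq> I"
  shows "presentation_ideal par R \<subseteq> I"
  unfolding presentation_ideal_def using assms by (intro hull_minimal) (auto simp: lie_ideal_free)

lemma presentation_ideal_skew: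
  assumes "x \<in> parity_part par p" "y \<in> parity_part par q"
  shows "free_mult x y + pm_scale (koszul_sign p q) (free_mult y x) \<in> presentation_ideal par R"
proof -
  have "free_mult x y + pm_scale (koszul_sign p q) (free_mult y x) \<in> lie_relators (free_chevalley par)"
    unfolding lie_relators_def free_superalgebra_simps using assms by blast
  thus ?thesis using presentation_ideal_subset by blast
qed

text \<open>The relators cover homogeneous z only. The expression is linear in z and every word is
  homogeneous, so arbitrary z follow.\<close>

lemma presentation_ideal_jacobi:
  assumes "x \<in> parity_part par p" "y \<in> parity_part par q"
  shows "free_mult x (free_mult y z) - (free_mult (free_mult x y) z
     + pm_scale (koszul_sign p q) (free_mult y (free_mult x z))) \<in> presentation_ideal par R"
proof -
  note I = pm.subspace_add[OF presentation_idealD(1)]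
  let ?J = "\<lambda>z. free_mult x (free_mult y z) - (free_mult (free_mult x y) z
     + pm_scale (koszul_sign p q) (free_mult y (free_mult x z)))"
  have hom: "?J z \<in> presentation_ideal par R" if "z \<in> parity_part par r" for z r
  proof -
    have "?J z \<in> lie_relators (free_chevalley par)"
      unfolding lie_relators_def free_superalgebra_simps using assms that by blast
    thus ?thesis using presentation_ideal_subset by blast
  qed
  have "z \<in> supported UNIV" by simp
  thus ?thesis
  proof (induction z rule: supported_induct)
    case zero thus ?case using hom[of 0 0] by (simp add: supported_def)
  next
    case (single w c) show ?case by (rule hom[OF word_parity_part])
  next
    case (add a b)
    have "?J (a + b) = ?J a + ?J b" by (simp add: pm.b_simps pm.scale_right_distrib)
    thus ?case using I[OF add(3,4)] by simp
  qed
qed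

lemma presentation_ideal_chevalley:
  "gen (H (u + v)) - (gen (H u) + gen (H v)) \<in> presentation_ideal par R"
  "gen (H (scale R c v)) - pm_scale c (gen (H v)) \<in> presentation_ideal par R"
  "free_mult (gen (E i)) (gen (F j)) - (if i = j then gen (H (coroot R i)) else 0) \<in> presentation_ideal par R"
  "free_mult (gen (H v)) (gen (E j)) - pm_scale (root R j v) (gen (E j)) \<in> presentation_ideal par R"
  "free_mult (gen (H v)) (gen (F j)) + pm_scale (root R j v) (gen (F j)) \<in> presentation_ideal par R"
  "free_mult (gen (H u)) (gen (H v)) \<in> presentation_ideal par R"
proof -
  have "chevalley_relators par R \<subseteq> presentation_ideal par R"
    using presentation_ideal_subset by blast
  note * = this[unfolded chevalley_relators_def Let_def free_superalgebra_simps Un_subset_iff UN_subset_iff]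
  show "gen (H (u + v)) - (gen (H u) + gen (H v)) \<in> presentation_ideal par R"
    "gen (H (scale R c v)) - pm_scale c (gen (H v)) \<in> presentation_ideal par R"
    "free_mult (gen (E i)) (gen (F j)) - (if i = j then gen (H (coroot R i)) else 0) \<in> presentation_ideal par R"
    "free_mult (gen (H v)) (gen (E j)) - pm_scale (root R j v) (gen (E j)) \<in> presentation_ideal par R"
    "free_mult (gen (H v)) (gen (F j)) + pm_scale (root R j v) (gen (F j)) \<in> presentation_ideal par R"
    "free_mult (gen (H u)) (gen (H v)) \<in> presentation_ideal par R"
    using * by (simp_all only: insert_subset ball_UNIV)
qed

abbreviation degree_piece :: "int^'n \<Rightarrow> (('n::finite, 'v) generator bracketing \<Rightarrow>\<^sub>0 'k::field) set"
  where "degree_piece q \<equiv> supported {w. word_degree w = q}"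

section \<open>Triangular decomposition and the degree 0 piece of the presented algebra\<close>

locale chevalley_presentation =
  fixes par :: "'n::finite \<Rightarrow> bit" and R :: "('k::field, 'n, 'v::ab_group_add) realization"
begin

abbreviation "I0 \<equiv> presentation_ideal par R"

lemma skew_in:
  assumes S: "pm.subspace S" "I0 \<subseteq> S" and "x \<in> parity_part par p" "y \<in> parity_part par q" "free_mult y x \<in> S"
  shows "free_mult x y \<in> S"
proof -
  have "free_mult x y + pm_scale (koszul_sign p q) (free_mult y x) \<in> S"
    using presentation_ideal_skew assms by blast
  from pm.subspace_diff[OF S(1) this pm.subspace_scale[OF S(1) assms(5)]]
  show ?thesis by (metis add_diff_cancel_right')
qed

lemma jacobi_in:
  assumes S: "pm.subspace S" "I0 \<subseteq> S" and xy: "x \<in> parity_part par p" "y \<in> parity_part par q"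
    and "free_mult y (free_mult x z) \<in> S"
  shows "free_mult x (free_mult y z) \<in> S \<longleftrightarrow> free_mult (free_mult x y) z \<in> S"
proof -
  let ?t = "pm_scale (koszul_sign p q) (free_mult y (free_mult x z))"
  let ?j = "free_mult x (free_mult y z) - (free_mult (free_mult x y) z + ?t)"
  have j: "?j \<in> S" using presentation_ideal_jacobi[OF xy] S(2) by blast
  have t: "?t \<in> S" by (rule pm.subspace_scale[OF S(1) assms(5)])
  have 1: "free_mult x (free_mult y z) = ?j + ?t + free_mult (free_mult x y) z"
    and 2: "free_mult (free_mult x y) z = free_mult x (free_mult y z) - (?j + ?t)" by simp_all
  have jt: "?j + ?t \<in> S" by (rule pm.subspace_add[OF S(1) j t])
  show ?thesis
    using pm.subspace_add[OF S(1) jt] pm.subspace_diff[OF S(1) _ jt] 1 2 by metis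
qed

text \<open>The Cartan part in degree q, taken together with the ideal: in degree 0 it is the image
  of the Cartan subalgebra plus \<open>I0\<close>, in any other degree it is \<open>I0\<close>.
  Carrying the degree along allows [e_i, f_j], which is h_i or 0, to be treated uniformly.\<close>

definition HH :: "int^'n \<Rightarrow> (('n, 'v) generator bracketing \<Rightarrow>\<^sub>0 'k) set"
  where "HH q = {a. \<exists>v. (q \<noteq> 0 \<longrightarrow> v = 0) \<and> a - gen (H v) \<in> I0}"

lemma gen_H_0: "gen (H 0) \<in> I0"
proof -
  \<comment> \<open>The additivity relator at u = v = 0 is gen (H 0) - 2 gen (H 0).\<close>
  have "- gen (H 0) \<in> I0" using presentation_ideal_chevalley(1)[of 0 0 par R] by simp
  from pm.subspace_neg[OF presentation_idealD(1) this] show ?thesis by simp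
qed

lemma HH_nonzero: "q \<noteq> 0 \<Longrightarrow> a \<in> HH q \<Longrightarrow> a \<in> I0"
  unfolding HH_def
proof clarify
  assume "a - gen (H 0) \<in> I0"
  from pm.subspace_add[OF presentation_idealD(1) this gen_H_0] show "a \<in> I0" by simp
qed

lemma I0_HH: "I0 \<subseteq> HH q"
proof
  fix a assume "a \<in> I0"
  from pm.subspace_diff[OF presentation_idealD(1) this gen_H_0] show "a \<in> HH q"
    unfolding HH_def by blast
qed

lemma gen_H_HH: "gen (H v) \<in> HH 0"
  unfolding HH_def by (intro CollectI exI[of _ v]) (simp add: pm.subspace_0[OF presentation_idealD(1)])

lemma HH_subspace: "pm.subspace (HH q)"
proof (cases "q = 0")
  case False
  hence "HH q = I0" using HH_nonzero I0_HH by blast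
  thus ?thesis using presentation_idealD(1) by simp
next
  case True
  note I = presentation_idealD(1)
  show ?thesis
  proof (rule pm.subspaceI)
    show "0 \<in> HH q" using I0_HH pm.subspace_0[OF I] by blast
  next
    fix x y assume "x \<in> HH q" "y \<in> HH q"
    then obtain u v where uv: "x - gen (H u) \<in> I0" "y - gen (H v) \<in> I0" unfolding HH_def by blast
    have "x + y - gen (H (u + v)) = (x - gen (H u)) + (y - gen (H v))
       - (gen (H (u + v)) - (gen (H u) + gen (H v)))" by simp
    also have "\<dots> \<in> I0"
      by (rule pm.subspace_diff[OF I pm.subspace_add[OF I uv] presentation_ideal_chevalley(1)])
    finally show "x + y \<in> HH q" unfolding HH_def using True by blast
  next
    fix c x assume "x \<in> HH q"
    then obtain u where u: "x - gen (H u) \<in> I0" unfolding HH_def by blast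
    have "pm_scale c x - gen (H (scale R c u)) = pm_scale c (x - gen (H u))
       - (gen (H (scale R c u)) - pm_scale c (gen (H u)))" by (simp add: pm.scale_right_diff_distrib)
    also have "\<dots> \<in> I0"
      by (rule pm.subspace_diff[OF I pm.subspace_scale[OF I u] presentation_ideal_chevalley(2)])
    finally show "pm_scale c x \<in> HH q" unfolding HH_def using True by blast
  qed
qed

lemma parity_H: "gen (H v) \<in> parity_part par 0"
  unfolding gen_def by (rule single_supported) simp

text \<open>For Y equal to \<open>E\<close> or \<open>F\<close> these words span the degree q piece
  of the subalgebra generated by all e_i, or by all f_i.\<close>

definition words_in :: "('n \<Rightarrow> ('n, 'v) generator) \<Rightarrow> int^'n \<Rightarrow> ('n, 'v) generator bracketing set"
  where "words_in Y q = {w. set_bracketing w \<subseteq> range Y \<and> word_degree w = q}"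

lemma mult_words_in:
  assumes "a \<in> supported (words_in Y p)" "c \<in> supported (words_in Y q)"
  shows "free_mult a c \<in> supported (words_in Y (p + q))"
proof -
  have "w \<in> words_in Y (p + q)" if w: "w \<in> Poly_Mapping.keys (free_mult a c)" for w
  proof -
    obtain u v where "w = Br u v" "u \<in> Poly_Mapping.keys a" "v \<in> Poly_Mapping.keys c"
      using w by (cases w) (auto simp: in_keys_iff lookup_free_mult)
    thus ?thesis using assms by (auto simp: supported_def words_in_def)
  qed
  thus ?thesis by (auto simp: supported_def)
qed

lemma sum_subspace: "pm.subspace S \<Longrightarrow> pm.subspace T \<Longrightarrow> pm.subspace {x + y | x y. x \<in> S \<and> y \<in> T}"
  by (rule pm.subspace_sums)

lemma sum_subspaceI1:
  assumes "pm.subspace T" "x \<in> S" shows "x \<in> {x + y | x y. x \<in> S \<and> y \<in> T}"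
  using assms pm.subspace_0[OF assms(1)] by (intro CollectI exI[of _ x] exI[of _ 0]) simp

lemma sum_subspaceI2:
  assumes "pm.subspace S" "x \<in> T" shows "x \<in> {x + y | x y. x \<in> S \<and> y \<in> T}"
  using assms pm.subspace_0[OF assms(1)] by (intro CollectI exI[of _ x] exI[of _ 0]) simp

text \<open>By the Jacobi identity h acts as a derivation modulo \<open>I0\<close>, so the
  eigenvalue of a bracket is the sum of the eigenvalues of its factors.\<close>

lemma H_word:
  assumes HY: "\<forall>v j. \<exists>c. free_mult (gen (H v)) (gen (Y j)) - pm_scale c (gen (Y j)) \<in> I0"
    and w: "set_bracketing w \<subseteq> range Y"
  shows "\<exists>c. free_mult (gen (H v)) (Poly_Mapping.single w 1) - pm_scale c (Poly_Mapping.single w 1) \<in> I0"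
  using w
proof (induction w)
  case (Letter x)
  thus ?case using HY by (auto simp: gen_def)
next
  case (Br u w)
  let ?h = "gen (H v)" and ?u = "Poly_Mapping.single u 1" and ?w = "Poly_Mapping.single w 1"
  note I = presentation_idealD
  obtain c where c: "free_mult ?h ?u - pm_scale c ?u \<in> I0" using Br by auto
  obtain d where d: "free_mult ?h ?w - pm_scale d ?w \<in> I0" using Br by auto
  have "free_mult ?h (free_mult ?u ?w) - pm_scale (c + d) (free_mult ?u ?w)
    = (free_mult ?h (free_mult ?u ?w) - (free_mult (free_mult ?h ?u) ?w
         + pm_scale (koszul_sign 0 (word_parity (generator_parity par) u)) (free_mult ?u (free_mult ?h ?w))))
      + free_mult (free_mult ?h ?u - pm_scale c ?u) ?w + free_mult ?u (free_mult ?h ?w - pm_scale d ?w)"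
    by (simp add: pm.b_simps koszul_sign_def pm.scale_left_distrib del: map_single)
  also have "\<dots> \<in> I0"
    using presentation_ideal_jacobi[OF parity_H word_parity_part] c d
    by (intro pm.subspace_add[OF I(1)] I(3,4)) auto
  finally show ?case by (auto simp: free_mult_single simp del: map_single)
qed

lemma HH_word:
  assumes HY: "\<forall>v j. \<exists>c. free_mult (gen (H v)) (gen (Y j)) - pm_scale c (gen (Y j)) \<in> I0"
    and w: "w \<in> words_in Y q" and t: "t \<in> HH p"
    and S: "pm.subspace S" "I0 \<subseteq> S" "supported (words_in Y (p + q)) \<subseteq> S"
  shows "free_mult t (Poly_Mapping.single w 1) \<in> S" "free_mult (Poly_Mapping.single w 1) t \<in> S"
proof -
  let ?w = "Poly_Mapping.single w 1"
  note I = presentation_idealD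
  obtain v where v: "p \<noteq> 0 \<longrightarrow> v = 0" "t - gen (H v) \<in> I0" using t by (auto simp: HH_def)
  have hw: "free_mult (gen (H v)) ?w \<in> S"
  proof (cases "p = 0")
    case True
    obtain c where "free_mult (gen (H v)) ?w - pm_scale c ?w \<in> I0"
      using H_word[OF HY] w unfolding words_in_def by blast
    moreover have "pm_scale c ?w \<in> S"
      using pm.subspace_scale[OF S(1)] S(3) single_supported[OF w] True by auto
    ultimately show ?thesis using pm.subspace_add[OF S(1)] S(2)
      by (metis diff_add_cancel subsetD)
  next
    case False
    hence "gen (H v) \<in> I0" using v gen_H_0 by simp
    thus ?thesis using I(4)[OF UNIV_I] S(2) by blast
  qed
  have e: "free_mult t ?w = free_mult (t - gen (H v)) ?w + free_mult (gen (H v)) ?w"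
    "free_mult ?w t = free_mult ?w (t - gen (H v)) + free_mult ?w (gen (H v))"
    by (simp_all add: pm.b_simps)
  have wh: "free_mult ?w (gen (H v)) \<in> S"
    by (rule skew_in[OF S(1,2) word_parity_part parity_H hw])
  have "free_mult (t - gen (H v)) ?w \<in> S" "free_mult ?w (t - gen (H v)) \<in> S"
    using I(3,4)[OF UNIV_I v(2)] S(2) by blast+
  thus "free_mult t ?w \<in> S" "free_mult ?w t \<in> S"
    unfolding e by (simp_all add: pm.subspace_add[OF S(1)] hw wh)
qed

text \<open>Think of [f_i, w] for a word w in the e_j. Modulo the ideal, the Jacobi identity moves
  f_i into the factors of w until it meets a single e_j and gives an element of the Cartan part;
  that element acts on the remaining words by scalars. The result is again a Cartan element plus
  words in the e_j.\<close>

lemma ad_opposite_word: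
  assumes HY: "\<forall>v j. \<exists>c. free_mult (gen (H v)) (gen (Y j)) - pm_scale c (gen (Y j)) \<in> I0"
    and XY: "\<forall>i j. free_mult (gen (X' i)) (gen (Y j)) \<in> HH (generator_degree (X' i) + generator_degree (Y j))"
    and w: "set_bracketing w \<subseteq> range Y"
  shows "free_mult (gen (X' i)) (Poly_Mapping.single w 1)
    \<in> {x + y | x y. x \<in> HH (generator_degree (X' i) + word_degree w) \<and>
          y \<in> supported (words_in Y (generator_degree (X' i) + word_degree w))}" (is "_ \<in> ?S w")
  using w
proof (induction w)
  case (Letter x)
  then obtain j where "x = Y j" by auto
  show ?case
    using sum_subspaceI1[OF supported_subspace XY[rule_format, of i j]] by (simp add: gen_def \<open>x = Y j\<close>)
next
  case (Br u w)
  have S: "pm.subspace (?S x)" "I0 \<subseteq> ?S x" for x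
    by (rule sum_subspace[OF HH_subspace supported_subspace])
      (rule subsetI, rule sum_subspaceI1[OF supported_subspace subsetD[OF I0_HH]])
  let ?x = "gen (X' i)" and ?u = "Poly_Mapping.single u 1" and ?w = "Poly_Mapping.single w 1"
  let ?d = "generator_degree (X' i)"
  have uw: "u \<in> words_in Y (word_degree u)" "w \<in> words_in Y (word_degree w)"
    using Br.prems by (auto simp: words_in_def)
  have IH: "free_mult ?x ?u \<in> ?S u" "free_mult ?x ?w \<in> ?S w"
    using Br.prems by (intro Br.IH; simp)+
  have sub: "supported (words_in Y (?d + word_degree u + word_degree w)) \<subseteq> ?S (Br u w)"
    by (rule subsetI, rule sum_subspaceI2[OF HH_subspace]) (simp add: add.assoc)
  have 1: "free_mult (free_mult ?x ?u) ?w \<in> ?S (Br u w)"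
  proof -
    obtain t y where ty: "free_mult ?x ?u = t + y" "t \<in> HH (?d + word_degree u)"
      "y \<in> supported (words_in Y (?d + word_degree u))" using IH(1) by blast
    have "free_mult t ?w \<in> ?S (Br u w)"
      using HH_word(1)[OF HY uw(2) ty(2) S sub] .
    moreover have "free_mult y ?w \<in> ?S (Br u w)"
      by (rule subsetD[OF sub mult_words_in[OF ty(3) single_supported[OF uw(2)]]])
    ultimately show ?thesis unfolding ty(1) pm.b_simps by (rule pm.subspace_add[OF S(1)])
  qed
  have 2: "free_mult ?u (free_mult ?x ?w) \<in> ?S (Br u w)"
  proof -
    obtain t y where ty: "free_mult ?x ?w = t + y" "t \<in> HH (?d + word_degree w)"
      "y \<in> supported (words_in Y (?d + word_degree w))" using IH(2) by blast
    have "free_mult ?u t \<in> ?S (Br u w)"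
      by (rule HH_word(2)[OF HY uw(1) ty(2) S]) (use sub in \<open>simp only: add_ac\<close>)
    moreover have "free_mult ?u y \<in> ?S (Br u w)"
      by (rule subsetD[OF sub]) (use mult_words_in[OF single_supported[OF uw(1)] ty(3)] in \<open>simp only: add_ac\<close>)
    ultimately show ?thesis unfolding ty(1) pm.b_simps by (rule pm.subspace_add[OF S(1)])
  qed
  have "free_mult ?x (free_mult ?u ?w) \<in> ?S (Br u w)"
    using jacobi_in[OF S gen_parity word_parity_part 2] 1 by blast
  thus ?case by (simp add: free_mult_single)
qed

text \<open>The degree q piece of n- + h + n+, lifted to the free superalgebra together with
  \<open>I0\<close>. The aim is to show that every word lies in the piece of its degree.\<close>

definition tri :: "int^'n \<Rightarrow> (('n, 'v) generator bracketing \<Rightarrow>\<^sub>0 'k) set"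
  where "tri q = {x + y | x y. x \<in> {x + y | x y. x \<in> HH q \<and> y \<in> supported (words_in E q)} \<and>
    y \<in> supported (words_in F q)}"

lemma tri_subspace: "pm.subspace (tri q)"
  unfolding tri_def
  by (rule sum_subspace[OF sum_subspace[OF HH_subspace supported_subspace] supported_subspace])

lemma tri_I:
  "x \<in> HH q \<Longrightarrow> x \<in> tri q" "x \<in> supported (words_in E q) \<Longrightarrow> x \<in> tri q"
  "x \<in> supported (words_in F q) \<Longrightarrow> x \<in> tri q"
  unfolding tri_def
  by (rule sum_subspaceI1[OF supported_subspace sum_subspaceI1[OF supported_subspace]], assumption)
    (rule sum_subspaceI1[OF supported_subspace sum_subspaceI2[OF HH_subspace]], assumption,
     rule sum_subspaceI2[OF sum_subspace[OF HH_subspace supported_subspace]], assumption)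

lemma I0_tri: "I0 \<subseteq> tri q"
  by (rule subsetI, rule tri_I(1), rule subsetD[OF I0_HH])

lemma HE: "\<forall>v j. \<exists>c. free_mult (gen (H v)) (gen (E j)) - pm_scale c (gen (E j)) \<in> I0"
  by (intro allI exI, rule presentation_ideal_chevalley(4))

lemma HF: "\<forall>v j. \<exists>c. free_mult (gen (H v)) (gen (F j)) - pm_scale c (gen (F j)) \<in> I0"
proof (intro allI)
  fix v j
  show "\<exists>c. free_mult (gen (H v)) (gen (F j)) - pm_scale c (gen (F j)) \<in> I0"
  proof (rule exI[of _ "- root R j v"])
    show "free_mult (gen (H v)) (gen (F j)) - pm_scale (- root R j v) (gen (F j)) \<in> I0"
      using presentation_ideal_chevalley(5) by (simp add: pm.scale_minus_left)
  qed
qed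

lemma EF: "\<forall>i j. free_mult (gen (E i)) (gen (F j)) \<in> HH (generator_degree (E i) + generator_degree (F j))"
proof (intro allI)
  fix i j
  show "free_mult (gen (E i)) (gen (F j)) \<in> HH (generator_degree (E i) + generator_degree (F j))"
  proof (cases "i = j")
    case True
    thus ?thesis using presentation_ideal_chevalley(3)[of i j R par] by (auto simp: HH_def)
  next
    case False
    thus ?thesis using presentation_ideal_chevalley(3)[of i j R par] subsetD[OF I0_HH] by simp
  qed
qed

lemma FE: "\<forall>i j. free_mult (gen (F i)) (gen (E j)) \<in> HH (generator_degree (F i) + generator_degree (E j))"
proof (intro allI)
  fix i j
  have "free_mult (gen (E j)) (gen (F i)) \<in> HH (generator_degree (F i) + generator_degree (E j))"
    by (subst add.commute) (rule EF[rule_format])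
  thus "free_mult (gen (F i)) (gen (E j)) \<in> HH (generator_degree (F i) + generator_degree (E j))"
    by (rule skew_in[OF HH_subspace I0_HH gen_parity gen_parity])
qed

lemma word_preimage:
  assumes "pm.subspace S" "a \<in> supported W" "\<And>w. w \<in> W \<Longrightarrow> free_mult x (Poly_Mapping.single w 1) \<in> S"
  shows "free_mult x a \<in> S"
  using assms(2)
proof (induction a rule: supported_induct)
  case (single w c)
  have "Poly_Mapping.single w c = pm_scale c (Poly_Mapping.single w 1)" by simp
  thus ?case using assms(3)[OF single] pm.subspace_scale[OF assms(1)] by (simp only: pm.b_simps)
qed (use pm.subspace_0[OF assms(1)] pm.subspace_add[OF assms(1)] in \<open>auto simp: pm.b_simps\<close>)

lemma generator_tri:
  assumes "a \<in> tri q"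
  shows "free_mult (gen x) a \<in> tri (generator_degree x + q)"
proof -
  obtain t n m where a: "a = t + n + m" and t: "t \<in> HH q" and n: "n \<in> supported (words_in E q)"
    and m: "m \<in> supported (words_in F q)" using assms unfolding tri_def by blast
  let ?T = "tri (generator_degree x + q)"
  note T = tri_subspace I0_tri
  have HHl: "free_mult (gen (H v)) t \<in> tri q" for v
  proof -
    obtain u where "t - gen (H u) \<in> I0" using t by (auto simp: HH_def)
    hence "free_mult (gen (H v)) (t - gen (H u)) + free_mult (gen (H v)) (gen (H u)) \<in> I0"
      using presentation_idealD(3)[OF UNIV_I]
      by (intro pm.subspace_add[OF presentation_idealD(1)] presentation_ideal_chevalley(6)) blast
    thus ?thesis using subsetD[OF I0_tri] by (simp add: pm.b_simps)
  qed
  have one: "gen y = Poly_Mapping.single (Letter y) 1" for y :: "('n, 'v) generator" by (simp add: gen_def)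
  have "free_mult (gen x) t \<in> ?T"
  proof (cases x)
    case (E i)
    have "Letter x \<in> words_in E (generator_degree x)" by (simp add: words_in_def E)
    thus ?thesis unfolding one
      by (rule HH_word(2)[OF HE _ t T]) (auto simp: add.commute intro: tri_I)
  next
    case (F i)
    have "Letter x \<in> words_in F (generator_degree x)" by (simp add: words_in_def F)
    thus ?thesis unfolding one
      by (rule HH_word(2)[OF HF _ t T]) (auto simp: add.commute intro: tri_I)
  qed (use HHl in simp)
  moreover have "free_mult (gen x) n \<in> ?T"
  proof (rule word_preimage[OF T(1) n])
    fix w assume w: "w \<in> words_in E q"
    show "free_mult (gen x) (Poly_Mapping.single w 1) \<in> ?T"
    proof (cases x)
      case (E i)
      have "Letter x \<in> words_in E (generator_degree x)" by (simp add: words_in_def E)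
      from mult_words_in[OF single_supported[OF this] single_supported[OF w]]
      show ?thesis unfolding one by (rule tri_I(2))
    next
      case (F i)
      have "free_mult (gen x) (Poly_Mapping.single w 1)
        \<in> {a + c | a c. a \<in> HH (generator_degree x + q) \<and> c \<in> supported (words_in E (generator_degree x + q))}"
        using ad_opposite_word[OF HE FE, of w i] w by (simp add: words_in_def F)
      then obtain a c where "free_mult (gen x) (Poly_Mapping.single w 1) = a + c"
        "a \<in> HH (generator_degree x + q)" "c \<in> supported (words_in E (generator_degree x + q))" by blast
      thus ?thesis using pm.subspace_add[OF T(1) tri_I(1) tri_I(2)] by simp
    next
      case (H v)
      have "gen x \<in> HH 0" using H gen_H_HH by simp
      from HH_word(1)[OF HE w this T] show ?thesis using H by (auto intro: tri_I)
    qed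
  qed
  moreover have "free_mult (gen x) m \<in> ?T"
  proof (rule word_preimage[OF T(1) m])
    fix w assume w: "w \<in> words_in F q"
    show "free_mult (gen x) (Poly_Mapping.single w 1) \<in> ?T"
    proof (cases x)
      case (F i)
      have "Letter x \<in> words_in F (generator_degree x)" by (simp add: words_in_def F)
      from mult_words_in[OF single_supported[OF this] single_supported[OF w]]
      show ?thesis unfolding one by (rule tri_I(3))
    next
      case (E i)
      have "free_mult (gen x) (Poly_Mapping.single w 1)
        \<in> {a + c | a c. a \<in> HH (generator_degree x + q) \<and> c \<in> supported (words_in F (generator_degree x + q))}"
        using ad_opposite_word[OF HF EF, of w i] w by (simp add: words_in_def E)
      then obtain a c where "free_mult (gen x) (Poly_Mapping.single w 1) = a + c"
        "a \<in> HH (generator_degree x + q)" "c \<in> supported (words_in F (generator_degree x + q))" by blast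
      thus ?thesis using pm.subspace_add[OF T(1) tri_I(1) tri_I(3)] by simp
    next
      case (H v)
      have "gen x \<in> HH 0" using H gen_H_HH by simp
      from HH_word(1)[OF HF w this T] show ?thesis using H by (auto intro: tri_I)
    qed
  qed
  ultimately show ?thesis unfolding a pm.b_simps by (intro pm.subspace_add[OF T(1)])
qed

text \<open>By the Jacobi identity, multiplication by a bracket reduces to successive
  multiplications by its two factors, so stability under the generators is enough.\<close>

lemma word_tri_mult:
  "a \<in> tri q \<Longrightarrow> free_mult (Poly_Mapping.single w 1) a \<in> tri (word_degree w + q)"
proof (induction w arbitrary: a q)
  case (Letter x)
  thus ?case using generator_tri by (simp add: gen_def)
next
  case (Br u v)
  let ?u = "Poly_Mapping.single u 1" and ?v = "Poly_Mapping.single v 1"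
  have "free_mult ?u (free_mult ?v a) \<in> tri (word_degree (Br u v) + q)"
    "free_mult ?v (free_mult ?u a) \<in> tri (word_degree (Br u v) + q)"
    using Br.IH(1)[OF Br.IH(2)[OF Br.prems]] Br.IH(2)[OF Br.IH(1)[OF Br.prems]] by (simp_all add: add_ac)
  hence "free_mult (free_mult ?u ?v) a \<in> tri (word_degree (Br u v) + q)"
    by (simp only: jacobi_in[OF tri_subspace I0_tri word_parity_part word_parity_part])
  thus ?case by (simp add: free_mult_single)
qed

lemma word_tri: "Poly_Mapping.single w 1 \<in> tri (word_degree w)"
proof (induction w)
  case (Letter x)
  show ?case
  proof (cases x)
    case (E i) thus ?thesis by (intro tri_I(2) single_supported) (simp add: words_in_def)
  next
    case (F i) thus ?thesis by (intro tri_I(3) single_supported) (simp add: words_in_def)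
  next
    case (H v)
    have "gen x \<in> HH 0" using H gen_H_HH by simp
    thus ?thesis using tri_I(1) H by (simp add: gen_def)
  qed
next
  case (Br u v)
  from word_tri_mult[OF Br(2), of u] show ?case by (simp add: free_mult_single)
qed

lemma word_degree_E: "set_bracketing w \<subseteq> range E \<Longrightarrow> (\<Sum>i\<in>UNIV. word_degree w $ i) > 0"
  by (induction w) (auto simp: axis_def sum.distrib)

lemma word_degree_F: "set_bracketing w \<subseteq> range F \<Longrightarrow> (\<Sum>i\<in>UNIV. word_degree w $ i) < 0"
  by (induction w) (auto simp: axis_def sum.distrib sum_negf)

text \<open>A word in the e_i has positive height and a word in the f_i negative height, so only the
  Cartan summand of the triangular decomposition survives in degree 0.\<close>

lemma degree_zero:
  assumes "a \<in> degree_piece 0"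
  shows "\<exists>v. a - gen (H v) \<in> I0"
proof -
  have "words_in E 0 = {}" "words_in F 0 = {}"
    using word_degree_E word_degree_F by (fastforce simp: words_in_def)+
  hence "supported (words_in E 0) = {0 :: _ \<Rightarrow>\<^sub>0 'k}" "supported (words_in F 0) = {0 :: _ \<Rightarrow>\<^sub>0 'k}"
    by (auto simp: supported_def)
  hence tri0: "tri 0 = HH 0" unfolding tri_def by auto
  have "a \<in> tri 0" using assms
  proof (induction a rule: supported_induct)
    case (single w c)
    have "Poly_Mapping.single w c = pm_scale c (Poly_Mapping.single w 1)" by simp
    thus ?case using word_tri[of w] single pm.subspace_scale[OF tri_subspace, of "Poly_Mapping.single w 1" 0 c]
      by simp
  qed (use pm.subspace_0[OF tri_subspace] pm.subspace_add[OF tri_subspace] in auto)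
  thus ?thesis using tri0 by (auto simp: HH_def)
qed

end

section \<open>Homogeneous components and the radical, described in the free superalgebra\<close>

definition degree_part :: "int^'n \<Rightarrow> (('n::finite, 'v) generator bracketing \<Rightarrow>\<^sub>0 'k::field)
    \<Rightarrow> (('n, 'v) generator bracketing \<Rightarrow>\<^sub>0 'k)"
  where "degree_part q = pm.extend (\<lambda>w. if word_degree w = q then Poly_Mapping.single w 1 else 0)"

lemma degree_part_in: "degree_part q a \<in> degree_piece q"
  unfolding degree_part_def
  by (rule pm.extend_in[OF supported_subspace, of _ UNIV])
    (auto simp: supported_def)

lemma degree_part_sum:
  assumes "finite S" "word_degree ` Poly_Mapping.keys a \<subseteq> S"
  shows "(\<Sum>q\<in>S. degree_part q a) = a"
proof -
  have "(\<Sum>q\<in>S. degree_part q a) = (\<Sum>w\<in>Poly_Mapping.keys a. \<Sum>q\<in>S.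
      pm_scale (Poly_Mapping.lookup a w) (if word_degree w = q then Poly_Mapping.single w 1 else 0))"
    unfolding degree_part_def pm.extend_def by (rule sum.swap)
  also have "\<dots> = (\<Sum>w\<in>Poly_Mapping.keys a. Poly_Mapping.single w (Poly_Mapping.lookup a w))"
  proof (rule sum.cong[OF refl])
    fix w assume "w \<in> Poly_Mapping.keys a"
    hence w: "word_degree w \<in> S" using assms by blast
    have "(\<Sum>q\<in>S. pm_scale (Poly_Mapping.lookup a w) (if word_degree w = q then Poly_Mapping.single w 1 else 0))
      = (\<Sum>q\<in>S. if word_degree w = q then Poly_Mapping.single w (Poly_Mapping.lookup a w) else 0)"
      by (intro sum.cong) auto
    thus "(\<Sum>q\<in>S. pm_scale (Poly_Mapping.lookup a w) (if word_degree w = q then Poly_Mapping.single w 1 else 0))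
      = Poly_Mapping.single w (Poly_Mapping.lookup a w)" using w assms(1) by simp
  qed
  also have "\<dots> = a" by (rule pm_decompose[symmetric]) auto
  finally show ?thesis .
qed

context chevalley_presentation
begin

abbreviation "ualg \<equiv> universal_contragredient par R"
abbreviation "tu \<equiv> to_universal par R"

lemma universal_presents: "presents pm_scale free_mult UNIV (parity_part par) I0 tu ualg"
proof -
  have "presents pm_scale free_mult UNIV (parity_part par) I0
    (\<lambda>x. id ` I0 +>\<^bsub>(free_chevalley par :: ('k, _) superalgebra)\<^esub> id x)
    (quotient_superalgebra (free_chevalley par) (id ` I0))"
    by (rule pm.presents_quotient[OF free_presents _ presentation_ideal_ideal])
      (auto simp: pm.subalgebra_def pm.subspace_0[OF presentation_idealD(1)])
  thus ?thesis by (simp add: universal_contragredient_def to_universal_def[abs_def])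
qed

lemma universal_module: "Module.module scalars ualg"
  by (rule pm.presents_module[OF universal_presents pm.subspace_UNIV])

lemma lie_ideal_universal:
  assumes "pm.ideal_of UNIV K"
  shows "lie_ideal ualg (tu ` K)"
proof -
  note D = presentsD[OF universal_presents]
  have "submodule (tu ` K) scalars ualg"
    by (rule pm.presents_submodule[OF universal_presents pm.subspace_UNIV]) (use assms in \<open>auto simp: pm.ideal_of_def\<close>)
  moreover have "tu a \<otimes>\<^bsub>ualg\<^esub> tu k \<in> tu ` K \<and> tu k \<otimes>\<^bsub>ualg\<^esub> tu a \<in> tu ` K" if "k \<in> K" for a k
    using pm.ideal_ofD(3,4)[OF assms UNIV_I that, of a] D(6)[of a k] D(6)[of k a] by (simp flip: D(6))
  ultimately show ?thesis
    unfolding lie_ideal_def D(1)[symmetric] by blast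
qed

lemma ideal_of_preimage:
  assumes "lie_ideal ualg J"
  shows "pm.ideal_of UNIV {a. tu a \<in> J}" "I0 \<subseteq> {a. tu a \<in> J}" "tu ` {a. tu a \<in> J} = J"
proof -
  note D = presentsD[OF universal_presents]
  have J: "J \<subseteq> carrier ualg" "\<zero>\<^bsub>ualg\<^esub> \<in> J" "\<And>U V. U \<in> J \<Longrightarrow> V \<in> J \<Longrightarrow> U \<oplus>\<^bsub>ualg\<^esub> V \<in> J"
    "\<And>c U. U \<in> J \<Longrightarrow> c \<odot>\<^bsub>ualg\<^esub> U \<in> J"
    using assms unfolding lie_ideal_def pm.submodule_iff[OF universal_module] by blast+
  have J': "\<And>U V. U \<in> carrier ualg \<Longrightarrow> V \<in> J \<Longrightarrow> U \<otimes>\<^bsub>ualg\<^esub> V \<in> J"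
    "\<And>U V. U \<in> carrier ualg \<Longrightarrow> V \<in> J \<Longrightarrow> V \<otimes>\<^bsub>ualg\<^esub> U \<in> J"
    using assms unfolding lie_ideal_def by blast+
  have car: "tu a \<in> carrier ualg" for a using D(1) by blast
  show "pm.ideal_of UNIV {a. tu a \<in> J}"
    unfolding pm.ideal_of_def pm.subspace_def
    using J J' car by (simp add: D(3,5,6,7))
  show "I0 \<subseteq> {a. tu a \<in> J}"
  proof
    fix a assume "a \<in> I0"
    hence "tu a = tu 0" using D(4)[of a 0] by simp
    thus "a \<in> {a. tu a \<in> J}" using J(2) D(3) by simp
  qed
  have "tu ` {a. tu a \<in> J} = carrier ualg \<inter> J" unfolding D(1)[symmetric] by auto
  thus "tu ` {a. tu a \<in> J} = J" using J(1) by (simp add: Int_absorb1)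
qed

lemma graded_piece_eq: "graded_piece par R q = tu ` degree_piece q"
  unfolding graded_piece_def supported_def by (rule arg_cong[where f = "image tu"]) auto

text \<open>Transfers the definition of the radical to ideals of the free superalgebra that contain
  \<open>I0\<close>. A homogeneous decomposition in the quotient lifts only up to an element of
  \<open>I0\<close>, which explains the form of the grading condition on I.\<close>

lemma radical_eqI:
  assumes K: "pm.ideal_of UNIV K" "I0 \<subseteq> K" "\<And>a q. a \<in> K \<Longrightarrow> degree_part q a \<in> K"
      "\<And>v. gen (H v) \<in> K \<Longrightarrow> gen (H v) \<in> I0"
    and max: "\<And>I. pm.ideal_of UNIV I \<Longrightarrow> I0 \<subseteq> I \<Longrightarrow>
      (\<forall>a\<in>I. \<exists>S g. finite S \<and> (\<forall>q\<in>S. g q \<in> I \<and> g q \<in> degree_piece q) \<and> a - sum g S \<in> I0) \<Longrightarrow>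
      (\<forall>v. gen (H v) \<in> I \<longrightarrow> gen (H v) \<in> I0) \<Longrightarrow> I \<subseteq> K"
  shows "contragredient_radical par R = tu ` K"
  unfolding contragredient_radical_def
proof (rule Greatest_equality)
  note D = presentsD[OF universal_presents]
  have "graded_ideal par R (tu ` K)"
    unfolding graded_ideal_def
  proof (intro conjI ballI lie_ideal_universal K(1))
    fix y assume "y \<in> tu ` K"
    then obtain a where a: "a \<in> K" "y = tu a" by blast
    define S where "S = word_degree ` Poly_Mapping.keys a"
    have S: "finite S" unfolding S_def by simp
    have "finsum ualg (\<lambda>q. tu (degree_part q a)) S = tu a"
      using pm.presents_finsum[OF universal_presents pm.subspace_UNIV S, of "\<lambda>q. degree_part q a"]
        degree_part_sum[OF S, of a] by (simp add: S_def)
    moreover have "\<forall>q\<in>S. tu (degree_part q a) \<in> tu ` K \<inter> graded_piece par R q"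
      unfolding graded_piece_eq using K(3)[OF a(1)] degree_part_in by blast
    ultimately show "\<exists>S c. finite S \<and> (\<forall>q\<in>S. c q \<in> tu ` K \<inter> graded_piece par R q) \<and> y = finsum ualg c S"
      using S a(2) by metis
  qed
  moreover have "tu ` K \<inter> range (\<lambda>v. tu (gen (H v))) = {\<zero>\<^bsub>ualg\<^esub>}"
  proof (intro equalityI subsetI)
    fix y assume "y \<in> tu ` K \<inter> range (\<lambda>v. tu (gen (H v)))"
    then obtain a v where av: "a \<in> K" "y = tu a" "y = tu (gen (H v))" by blast
    hence "gen (H v) - a \<in> K" using D(4)[of "gen (H v)" a] K(2) by auto
    from pm.subspace_add[OF pm.ideal_ofD(1)[OF K(1)] this av(1)]
    have "gen (H v) \<in> K" by simp
    hence "tu (gen (H v)) = tu 0" using K(4) D(4)[of "gen (H v)" 0] by simp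
    thus "y \<in> {\<zero>\<^bsub>ualg\<^esub>}" using av D(3) by simp
  next
    fix y assume "y \<in> {\<zero>\<^bsub>ualg\<^esub>}"
    hence "y = tu (gen (H 0))" using gen_H_0 D(3) D(4)[of "gen (H 0)" 0] by simp
    thus "y \<in> tu ` K \<inter> range (\<lambda>v. tu (gen (H v)))" using gen_H_0 K(2) by blast
  qed
  ultimately show "graded_ideal par R (tu ` K) \<and> tu ` K \<inter> range (\<lambda>v. tu (gen (H v))) = {\<zero>\<^bsub>ualg\<^esub>}" by blast
next
  note D = presentsD[OF universal_presents]
  fix J assume J: "graded_ideal par R J \<and> J \<inter> range (\<lambda>v. tu (gen (H v))) = {\<zero>\<^bsub>ualg\<^esub>}"
  hence "lie_ideal ualg J" unfolding graded_ideal_def by blast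
  note I = ideal_of_preimage[OF this]
  have "{a. tu a \<in> J} \<subseteq> K"
  proof (rule max[OF I(1,2)], intro ballI)
    fix a assume "a \<in> {a. tu a \<in> J}"
    hence "tu a \<in> J" by simp
    from bspec[OF J[THEN conjunct1, unfolded graded_ideal_def, THEN conjunct2] this]
    obtain S c where c: "finite S" "\<forall>q\<in>S. c q \<in> J \<inter> graded_piece par R q" "tu a = finsum ualg c S"
      by (elim exE conjE) (rule that)
    have "\<forall>q\<in>S. \<exists>x. c q = tu x \<and> x \<in> degree_piece q"
      using c(2) unfolding graded_piece_eq by blast
    then obtain g where g: "\<forall>q\<in>S. c q = tu (g q) \<and> g q \<in> degree_piece q" by metis
    interpret M: Module.module "scalars :: 'k ring" ualg by (rule universal_module)
    have car: "tu a \<in> carrier ualg" for a using D(1) by blast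
    have "finsum ualg c S = finsum ualg (\<lambda>q. tu (g q)) S"
      using g car by (intro M.M.finsum_cong') auto
    also have "\<dots> = tu (sum g S)"
      by (rule pm.presents_finsum[OF universal_presents pm.subspace_UNIV c(1)]) simp
    finally have "a - sum g S \<in> I0" using D(4)[of a "sum g S"] c(3) by simp
    thus "\<exists>S g. finite S \<and> (\<forall>q\<in>S. g q \<in> {a. tu a \<in> J} \<and> g q \<in> degree_piece q) \<and> a - sum g S \<in> I0"
      using c g by (intro exI[of _ S] exI[of _ g]) auto
  next
    show "\<forall>v. gen (H v) \<in> {a. tu a \<in> J} \<longrightarrow> gen (H v) \<in> I0"
    proof (intro allI impI)
      fix v assume "gen (H v) \<in> {a. tu a \<in> J}"
      hence "tu (gen (H v)) \<in> {\<zero>\<^bsub>ualg\<^esub>}" using J by blast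
      thus "gen (H v) \<in> I0" using D(3) D(4)[of "gen (H v)" 0] by simp
    qed
  qed
  thus "J \<subseteq> tu ` K" using I(3) by blast
qed

lemma contragredient_presents:
  assumes "contragredient_radical par R = tu ` K" "pm.ideal_of UNIV K" "I0 \<subseteq> K"
  shows "presents pm_scale free_mult UNIV (parity_part par) K
    (\<lambda>a. contragredient_radical par R +>\<^bsub>ualg\<^esub> tu a) (contragredient par R)"
  unfolding contragredient_def assms(1)
  by (rule pm.presents_quotient[OF universal_presents _ assms(2,3)]) (auto simp: pm.subalgebra_def)

end

section \<open>Recognition of contragredient Lie superalgebras\<close>

text \<open>The hypotheses \<open>T_pos\<close> and \<open>T_neg\<close> replace the usual arguments: they make
  \<open>[e\<^sub>j, [f\<^sub>j, x]]\<close> a nonzero multiple of \<open>x\<close>, which shows at once that \<open>C / Z\<close> is generated by the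
  Chevalley generators and that no graded ideal avoids \<open>h\<close>.\<close>

locale contragredient_model = bilinear_algebra s b
  for s :: "'k::field \<Rightarrow> 'x::ab_group_add \<Rightarrow> 'x" and b +
  fixes P :: "bit \<Rightarrow> 'x set" and Z :: "'x set"
    and par :: "'n::finite \<Rightarrow> bit" and R :: "('k, 'n, 'v::ab_group_add) realization"
    and e f :: "'n \<Rightarrow> 'x" and h :: "'v \<Rightarrow> 'x"
    and G :: "int^'n \<Rightarrow> 'x set" and pr :: "int^'n \<Rightarrow> 'x \<Rightarrow> 'x"
  assumes lie: "lie_mod P Z"
    and e_par: "e i \<in> P (par i)" and f_par: "f i \<in> P (par i)" and h_par: "h v \<in> P 0"
    and h_add: "h (u + v) = h u + h v" and h_scale: "h (scale R c v) = s c (h v)"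
    and ef: "b (e i) (f j) - (if i = j then h (coroot R i) else 0) \<in> Z"
    and he: "b (h v) (e j) - s (root R j v) (e j) \<in> Z"
    and hf: "b (h v) (f j) + s (root R j v) (f j) \<in> Z"
    and hh: "b (h u) (h v) \<in> Z"
    and h_inj: "h v \<in> Z \<Longrightarrow> v = 0"
    and coroot: "scale R c (coroot R i) = 0 \<Longrightarrow> c = 0"
    and G_subspace: "subspace (G q)" and G_total: "G q \<subseteq> total P"
    and e_G: "e i \<in> G (axis i 1)" and f_G: "f i \<in> G (- axis i 1)" and h_G: "h v \<in> G 0"
    and G_mult: "x \<in> G p \<Longrightarrow> y \<in> G q \<Longrightarrow> b x y \<in> G (p + q)"
    and pr_add: "pr q (x + y) = pr q x + pr q y"
    and pr_same: "x \<in> G q \<Longrightarrow> pr q x = x"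
    and pr_other: "x \<in> G p \<Longrightarrow> p \<noteq> q \<Longrightarrow> pr q x = 0"
    and pr_Z: "z \<in> Z \<Longrightarrow> pr q z \<in> Z"
    and decomp: "x \<in> total P \<Longrightarrow> \<exists>S g. finite S \<and> (\<forall>q\<in>S. g q \<in> G q) \<and> x = sum g S"
    and G_zero: "x \<in> G 0 \<Longrightarrow> \<exists>v. x - h v \<in> Z"
    and G_pos: "x \<in> G (axis i 1) \<Longrightarrow> \<exists>c. x - s c (e i) \<in> Z"
    and G_neg: "x \<in> G (- axis i 1) \<Longrightarrow> \<exists>c. x - s c (f i) \<in> Z"
    and G_mixed: "q $ i > 0 \<Longrightarrow> q $ j < 0 \<Longrightarrow> G q \<subseteq> Z"
    and T_pos: "q \<noteq> 0 \<Longrightarrow> \<forall>i. q $ i \<ge> 0 \<Longrightarrow> \<forall>i. q \<noteq> axis i 1 \<Longrightarrow>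
      \<exists>j c. q $ j > 0 \<and> c \<noteq> 0 \<and> (\<forall>x\<in>G q. b (e j) x \<in> Z \<and> b (h (coroot R j)) x - s c x \<in> Z)"
    and T_neg: "q \<noteq> 0 \<Longrightarrow> \<forall>i. q $ i \<le> 0 \<Longrightarrow> \<forall>i. q \<noteq> - axis i 1 \<Longrightarrow>
      \<exists>j c. q $ j < 0 \<and> c \<noteq> 0 \<and> (\<forall>x\<in>G q. b (f j) x \<in> Z \<and> b (h (coroot R j)) x - s c x \<in> Z)"
begin

lemmas lieD = lie_modD[OF lie]
lemmas Z_add = subspace_add[OF lieD(1)] and Z_diff = subspace_diff[OF lieD(1)]
  and Z_scale = subspace_scale[OF lieD(1)] and Z_neg = subspace_neg[OF lieD(1)]
  and Z_zero = subspace_0[OF lieD(1)] and Z_sum = subspace_sum[OF lieD(1)]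
lemmas totalD = lie_mod_total[OF lie]
lemmas Z_idealD = ideal_ofD[OF totalD(2)]

lemma total_simps: "x \<in> total P \<Longrightarrow> y \<in> total P \<Longrightarrow> b x y \<in> total P" "subspace (total P)"
  using totalD(1) by (auto simp: subalgebra_def)

lemma gens_total: "e i \<in> total P" "f i \<in> total P" "h v \<in> total P"
  using e_par f_par h_par totalD(3) by blast+

lemma jacobi_total:
  assumes "x \<in> P p" "y \<in> P q" "z \<in> total P"
  shows "b x (b y z) - (b (b x y) z + s (koszul_sign p q) (b y (b x z))) \<in> Z"
proof -
  obtain z0 z1 where z: "z0 \<in> P 0" "z1 \<in> P 1" "z = z0 + z1" using assms(3) unfolding total_def by blast
  from Z_add[OF lieD(8)[OF assms(1,2) z(1)] lieD(8)[OF assms(1,2) z(2)]]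
  show ?thesis unfolding z(3) by (simp add: b_simps scale_right_distrib algebra_simps)
qed

lemma scaleZ_cancel: "s c x \<in> Z \<Longrightarrow> c \<noteq> 0 \<Longrightarrow> x \<in> Z"
  using Z_scale[of "s c x" "inverse c"] by simp

lemma ef_same: "b (e i) (f i) - h (coroot R i) \<in> Z"
  using ef[of i i] by simp

lemma ef_other: "i \<noteq> j \<Longrightarrow> b (e i) (f j) \<in> Z"
  using ef[of i j] by simp

lemma ef_eigen:
  assumes "x \<in> total P" "b (e j) x \<in> Z" "b (h (coroot R j)) x - s c x \<in> Z"
  shows "b (e j) (b (f j) x) - s c x \<in> Z"
proof -
  let ?k = "koszul_sign (par j) (par j)"
  have "b (e j) (b (f j) x) - s c x = (b (e j) (b (f j) x) - (b (b (e j) (f j)) x + s ?k (b (f j) (b (e j) x))))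
      + b (b (e j) (f j) - h (coroot R j)) x + (b (h (coroot R j)) x - s c x) + s ?k (b (f j) (b (e j) x))"
    by (simp add: b_simps)
  also have "\<dots> \<in> Z"
    by (intro Z_add jacobi_total[OF e_par f_par assms(1)] Z_scale assms(3)
        Z_idealD(4)[OF assms(1) ef_same] Z_idealD(3)[OF gens_total(2) assms(2)])
  finally show ?thesis .
qed

text \<open>Skew symmetry gives [f_j, e_j] = - k h_j, where k is the Koszul sign of the pair. Hence
  the eigenvalue is - c for even j and c for odd j.\<close>

lemma fe_eigen:
  assumes "x \<in> total P" "b (f j) x \<in> Z" "b (h (coroot R j)) x - s c x \<in> Z"
  shows "b (f j) (b (e j) x) - s (- koszul_sign (par j) (par j) * c) x \<in> Z"
proof -
  let ?k = "koszul_sign (par j) (par j)"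
  have fe: "b (f j) (e j) + s ?k (h (coroot R j)) \<in> Z"
  proof -
    have "b (f j) (e j) + s ?k (h (coroot R j)) = (b (f j) (e j) + s ?k (b (e j) (f j)))
        - s ?k (b (e j) (f j) - h (coroot R j))" by (simp add: scale_right_diff_distrib)
    also have "\<dots> \<in> Z" by (rule Z_diff[OF lieD(6)[OF f_par e_par] Z_scale[OF ef_same]])
    finally show ?thesis .
  qed
  have "b (f j) (b (e j) x) - s (- ?k * c) x
     = (b (f j) (b (e j) x) - (b (b (f j) (e j)) x + s ?k (b (e j) (b (f j) x))))
      + b (b (f j) (e j) + s ?k (h (coroot R j))) x - s ?k (b (h (coroot R j)) x - s c x) + s ?k (b (e j) (b (f j) x))"
    by (simp add: b_simps scale_right_diff_distrib scale_left_distrib)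
  also have "\<dots> \<in> Z"
    by (intro Z_add Z_diff jacobi_total[OF f_par e_par assms(1)] Z_scale assms(3)
        Z_idealD(4)[OF assms(1) fe] Z_idealD(3)[OF gens_total(1) assms(2)])
  finally show ?thesis .
qed

text \<open>Induction on the sum of the absolute values of the coordinates. A degree of one sign
  that is neither 0 nor plus or minus a simple root falls under \<open>T_pos\<close> or
  \<open>T_neg\<close>, and moving one step along the index j found there lowers the sum. The step
  is handed the eigenvalue identity, from which both generation and maximality follow.\<close>

lemma degree_induct:
  fixes Q :: "int^'n \<Rightarrow> bool"
  assumes "Q 0" "\<And>i. Q (axis i 1)" "\<And>i. Q (- axis i 1)" "\<And>q i j. q $ i > 0 \<Longrightarrow> q $ j < 0 \<Longrightarrow> Q q"
    and pos: "\<And>q j c. c \<noteq> 0 \<Longrightarrow> (\<And>x. x \<in> G q \<Longrightarrow> b (e j) (b (f j) x) - s c x \<in> Z) \<Longrightarrow> Q (- axis j 1 + q) \<Longrightarrow> Q q"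
    and neg: "\<And>q j c. c \<noteq> 0 \<Longrightarrow> (\<And>x. x \<in> G q \<Longrightarrow> b (f j) (b (e j) x) - s c x \<in> Z) \<Longrightarrow> Q (axis j 1 + q) \<Longrightarrow> Q q"
  shows "Q q"
proof (induction "nat (\<Sum>i\<in>UNIV. \<bar>q $ i\<bar>)" arbitrary: q rule: less_induct)
  case (less q)
  consider "q = 0" | i where "q = axis i 1" | i where "q = - axis i 1" | i j where "q $ i > 0" "q $ j < 0"
    | "q \<noteq> 0" "\<forall>i. q $ i \<ge> 0" "\<forall>i. q \<noteq> axis i 1" | "q \<noteq> 0" "\<forall>i. q $ i \<le> 0" "\<forall>i. q \<noteq> - axis i 1"
    by (metis not_le)
  thus ?case
  proof cases
    case 5
    then obtain j c where j: "q $ j > 0" "c \<noteq> 0" "\<forall>x\<in>G q. b (e j) x \<in> Z \<and> b (h (coroot R j)) x - s c x \<in> Z"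
      using T_pos by blast
    have "(\<Sum>i\<in>UNIV. \<bar>(- axis j 1 + q) $ i\<bar>) < (\<Sum>i\<in>UNIV. \<bar>q $ i\<bar>)"
      using j(1) by (intro sum_strict_mono_ex1) (auto simp: axis_def intro!: bexI[of _ j])
    hence "Q (- axis j 1 + q)" by (intro less) (simp only: nat_less_eq_zless sum_nonneg abs_ge_zero)
    thus ?thesis using pos[OF j(2) ef_eigen] j(3) G_total by blast
  next
    case 6
    then obtain j c where j: "q $ j < 0" "c \<noteq> 0" "\<forall>x\<in>G q. b (f j) x \<in> Z \<and> b (h (coroot R j)) x - s c x \<in> Z"
      using T_neg by blast
    have "(\<Sum>i\<in>UNIV. \<bar>(axis j 1 + q) $ i\<bar>) < (\<Sum>i\<in>UNIV. \<bar>q $ i\<bar>)"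
      using j(1) by (intro sum_strict_mono_ex1) (auto simp: axis_def intro!: bexI[of _ j])
    hence Q: "Q (axis j 1 + q)" by (intro less) (simp only: nat_less_eq_zless sum_nonneg abs_ge_zero)
    have "- koszul_sign (par j) (par j) * c \<noteq> 0" using j(2) by (simp add: koszul_sign_def)
    thus ?thesis using neg[OF _ fe_eigen Q] j(3) G_total by blast
  qed (use assms in auto)
qed

definition \<Psi> :: "(('n, 'v) generator bracketing \<Rightarrow>\<^sub>0 'k) \<Rightarrow> 'x"
  where "\<Psi> = extend (word_eval b (case_generator e f h))"

lemma \<Psi>_simps: "\<Psi> (a + c) = \<Psi> a + \<Psi> c" "\<Psi> (a - c) = \<Psi> a - \<Psi> c" "\<Psi> (pm_scale k a) = s k (\<Psi> a)"
  "\<Psi> (free_mult a c) = b (\<Psi> a) (\<Psi> c)" "\<Psi> 0 = 0"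
  by (simp_all add: \<Psi>_def extend_add extend_diff extend_scale extend_mult)

lemma \<Psi>_sum: "\<Psi> (sum g S) = (\<Sum>i\<in>S. \<Psi> (g i))"
  by (simp add: \<Psi>_def extend_sum)

lemma \<Psi>_gen: "\<Psi> (gen (E i)) = e i" "\<Psi> (gen (F i)) = f i" "\<Psi> (gen (H v)) = h v"
  by (simp_all add: \<Psi>_def gen_def)

lemma word_eval_parity: "word_eval b (case_generator e f h) w \<in> P (word_parity (generator_parity par) w)"
proof (induction w)
  case (Letter x) thus ?case by (cases x) (auto simp: e_par f_par h_par)
qed (simp only: word_eval.simps word_parity.simps lieD(5))

lemma word_eval_degree: "word_eval b (case_generator e f h) w \<in> G (word_degree w)"
proof (induction w)
  case (Letter x) thus ?case by (cases x) (auto simp: e_G f_G h_G)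
qed (simp only: word_eval.simps word_degree.simps G_mult)

lemma \<Psi>_parity: "a \<in> parity_part par p \<Longrightarrow> \<Psi> a \<in> P p"
  unfolding \<Psi>_def using word_eval_parity by (intro extend_in[OF lieD(2)]) auto

lemma \<Psi>_degree: "a \<in> degree_piece q \<Longrightarrow> \<Psi> a \<in> G q"
  unfolding \<Psi>_def using word_eval_degree by (intro extend_in[OF G_subspace]) auto

lemma \<Psi>_total: "\<Psi> a \<in> total P"
  unfolding \<Psi>_def using word_eval_parity totalD(3)
  by (intro extend_in[OF total_simps(2), of a UNIV]) auto

lemma \<Psi>_degree_part: "\<Psi> (degree_part q a) = pr q (\<Psi> a)"
proof -
  \<comment> \<open>q is inserted so that the sum over S has a term for q even if no word of a has
    this degree.\<close>
  define S where "S = insert q (word_degree ` Poly_Mapping.keys a)"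
  have S: "finite S" "q \<in> S" by (auto simp: S_def)
  have pr0: "pr q 0 = 0" using pr_add[of q 0 0] by simp
  have prsum: "pr q (sum g A) = (\<Sum>i\<in>A. pr q (g i))" for g :: "int^'n \<Rightarrow> 'x" and A
    by (induction A rule: infinite_finite_induct) (auto simp: pr0 pr_add)
  have "pr q (\<Psi> a) = pr q (\<Psi> (\<Sum>p\<in>S. degree_part p a))"
    using degree_part_sum[OF S(1), of a] by (simp add: S_def subset_insertI)
  also have "\<dots> = (\<Sum>p\<in>S. if p = q then \<Psi> (degree_part q a) else 0)"
    unfolding \<Psi>_sum prsum
    by (intro sum.cong) (simp_all add: pr_same \<Psi>_degree[OF degree_part_in] pr_other[OF \<Psi>_degree[OF degree_part_in]])
  finally show ?thesis using S by simp
qed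

definition K :: "(('n, 'v) generator bracketing \<Rightarrow>\<^sub>0 'k) set"
  where "K = {a. \<Psi> a \<in> Z}"

lemma K_ideal: "pm.ideal_of UNIV K"
  unfolding pm.ideal_of_def pm.subspace_def K_def
  by (auto simp: \<Psi>_simps Z_zero intro: Z_add Z_scale Z_idealD(3,4) \<Psi>_total)

lemma presentation_ideal_K: "presentation_ideal par R \<subseteq> K"
proof (rule presentation_ideal_least[OF K_ideal])
  show "lie_relators (free_chevalley par) \<subseteq> K"
  proof
    fix w assume "w \<in> lie_relators (free_chevalley par :: ('k, ('n, 'v) generator bracketing \<Rightarrow>\<^sub>0 'k) superalgebra)"
    then consider
        (skew) p q x y where "w = free_mult x y + pm_scale (koszul_sign p q) (free_mult y x)"
          "x \<in> parity_part par p" "y \<in> parity_part par q"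
      | (jac) p q r x y z where "w = free_mult x (free_mult y z) - (free_mult (free_mult x y) z
           + pm_scale (koszul_sign p q) (free_mult y (free_mult x z)))"
          "x \<in> parity_part par p" "y \<in> parity_part par q" "z \<in> parity_part par r"
      | (cube) x where "w = free_mult x (free_mult x x)" "x \<in> parity_part par 1"
      unfolding lie_relators_def free_superalgebra_simps by blast
    thus "w \<in> K"
    proof cases
      case skew
      show ?thesis unfolding skew(1) K_def using lieD(6)[OF skew(2,3)[THEN \<Psi>_parity]] by (simp add: \<Psi>_simps)
    next
      case jac
      show ?thesis unfolding jac(1) K_def using lieD(8)[OF jac(2-4)[THEN \<Psi>_parity]] by (simp add: \<Psi>_simps)
    next
      case cube
      show ?thesis unfolding cube(1) K_def using lieD(9)[OF cube(2)[THEN \<Psi>_parity]] by (simp add: \<Psi>_simps)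
    qed
  qed
  show "chevalley_relators par R \<subseteq> K"
    unfolding chevalley_relators_def Let_def free_superalgebra_simps Un_subset_iff UN_subset_iff
    using ef_same ef_other he hf hh
    by (simp add: K_def \<Psi>_simps \<Psi>_gen h_add h_scale Z_zero)
qed

text \<open>In the inductive step x is congruent to c^-1 [e_j, [f_j, x]], or to the same with e_j
  and f_j exchanged, and the inner bracket lies in a smaller degree, where preimages are already
  known.\<close>

lemma generation: "x \<in> G q \<Longrightarrow> \<exists>a. \<Psi> a - x \<in> Z"
proof -
  have "\<forall>x\<in>G q. \<exists>a. \<Psi> a - x \<in> Z"
  proof (induction q rule: degree_induct)
    case 1
    show ?case
    proof
      fix x assume "x \<in> G 0"
      then obtain v where "x - h v \<in> Z" using G_zero by blast
      from Z_neg[OF this] show "\<exists>a. \<Psi> a - x \<in> Z" by (intro exI[of _ "gen (H v)"]) (simp add: \<Psi>_gen)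
    qed
  next
    case (2 i)
    show ?case
    proof
      fix x assume "x \<in> G (axis i 1)"
      then obtain c where "x - s c (e i) \<in> Z" using G_pos by blast
      from Z_neg[OF this] show "\<exists>a. \<Psi> a - x \<in> Z"
        by (intro exI[of _ "pm_scale c (gen (E i))"]) (simp only: \<Psi>_simps \<Psi>_gen minus_diff_eq)
    qed
  next
    case (3 i)
    show ?case
    proof
      fix x assume "x \<in> G (- axis i 1)"
      then obtain c where "x - s c (f i) \<in> Z" using G_neg by blast
      from Z_neg[OF this] show "\<exists>a. \<Psi> a - x \<in> Z"
        by (intro exI[of _ "pm_scale c (gen (F i))"]) (simp only: \<Psi>_simps \<Psi>_gen minus_diff_eq)
    qed
  next
    case (4 q i j)
    show ?case
    proof
      fix x assume "x \<in> G q"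
      hence "x \<in> Z" using G_mixed[OF 4] by blast
      from Z_neg[OF this] show "\<exists>a. \<Psi> a - x \<in> Z" by (intro exI[of _ 0]) (simp add: \<Psi>_simps)
    qed
  next
    case (5 q j c)
    show ?case
    proof
      fix x assume x: "x \<in> G q"
      obtain a where a: "\<Psi> a - b (f j) x \<in> Z" using 5(3) G_mult[OF f_G x] by blast
      have "\<Psi> (pm_scale (inverse c) (free_mult (gen (E j)) a)) - x
        = s (inverse c) (b (e j) (\<Psi> a - b (f j) x) + (b (e j) (b (f j) x) - s c x))"
        using 5(1) by (simp only: \<Psi>_simps \<Psi>_gen) (simp add: b_simps scale_right_diff_distrib)
      also have "\<dots> \<in> Z"
        by (intro Z_scale Z_add Z_idealD(3)[OF gens_total(1) a] 5(2)[OF x])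
      finally show "\<exists>a. \<Psi> a - x \<in> Z" by blast
    qed
  next
    case (6 q j c)
    show ?case
    proof
      fix x assume x: "x \<in> G q"
      obtain a where a: "\<Psi> a - b (e j) x \<in> Z" using 6(3) G_mult[OF e_G x] by blast
      have "\<Psi> (pm_scale (inverse c) (free_mult (gen (F j)) a)) - x
        = s (inverse c) (b (f j) (\<Psi> a - b (e j) x) + (b (f j) (b (e j) x) - s c x))"
        using 6(1) by (simp only: \<Psi>_simps \<Psi>_gen) (simp add: b_simps scale_right_diff_distrib)
      also have "\<dots> \<in> Z"
        by (intro Z_scale Z_add Z_idealD(3)[OF gens_total(2) a] 6(2)[OF x])
      finally show "\<exists>a. \<Psi> a - x \<in> Z" by blast
    qed
  qed
  thus "x \<in> G q \<Longrightarrow> \<exists>a. \<Psi> a - x \<in> Z" by blast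
qed

lemma generation_total:
  assumes "x \<in> total P" shows "\<exists>a. \<Psi> a - x \<in> Z"
proof -
  obtain S g where g: "finite S" "\<forall>q\<in>S. g q \<in> G q" "x = sum g S" using decomp[OF assms] by blast
  have "\<forall>q\<in>S. \<exists>a. \<Psi> a - g q \<in> Z" using g(2) generation by blast
  then obtain a where a: "\<forall>q\<in>S. \<Psi> (a q) - g q \<in> Z" using bchoice by meson
  have "\<Psi> (sum a S) - x = (\<Sum>q\<in>S. \<Psi> (a q) - g q)" by (simp add: g(3) \<Psi>_sum sum_subtractf)
  also have "\<dots> \<in> Z" using a by (intro Z_sum) auto
  finally show ?thesis by blast
qed

lemma generation_parity:
  assumes x: "x \<in> P p" shows "\<exists>a\<in>parity_part par p. \<Psi> a - x \<in> Z"
proof -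
  have "x \<in> total P" using x totalD(3) by blast
  then obtain a where a: "\<Psi> a - x \<in> Z" using generation_total by blast
  have "a \<in> pm.total (parity_part par)" using total_free by blast
  then obtain a0 a1 where a01: "a0 \<in> parity_part par 0" "a1 \<in> parity_part par 1" "a = a0 + a1"
    unfolding pm.total_def by blast
  note Pd = subspace_diff[OF lieD(2)]
  show ?thesis
  proof (cases p)
    case zero
    have "\<Psi> a0 - x \<in> P 0" "\<Psi> a1 \<in> P 1" "(\<Psi> a0 - x) + \<Psi> a1 \<in> Z"
      using Pd a01 x zero a \<Psi>_parity by (auto simp: \<Psi>_simps algebra_simps)
    hence "\<Psi> a0 - x \<in> Z" by (rule lieD(4))
    thus ?thesis using a01 zero by auto
  next
    case one
    have 1: "\<Psi> a0 \<in> P 0" "\<Psi> a1 - x \<in> P 1" "\<Psi> a0 + (\<Psi> a1 - x) \<in> Z"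
      using Pd a01 x one a \<Psi>_parity by (auto simp: \<Psi>_simps algebra_simps)
    from Z_diff[OF 1(3) lieD(4)[OF 1]] have "\<Psi> a1 - x \<in> Z" by simp
    thus ?thesis using a01 one by auto
  qed
qed

text \<open>For a in I of degree q, the bracket [f_j, a] is in I as well, so by induction it
  vanishes modulo Z; then c a = [e_j, [f_j, a]] vanishes too. Degree 0 rests on
  \<open>degree_zero\<close>. In degree alpha_i the element is a multiple c e_i, and its bracket
  with f_i is, up to sign, c h_i, which must be zero.\<close>

lemma maximality:
  assumes I: "pm.ideal_of UNIV I" "presentation_ideal par R \<subseteq> I"
      "\<forall>v. gen (H v) \<in> I \<longrightarrow> gen (H v) \<in> presentation_ideal par R"
  shows "\<forall>a\<in>I. a \<in> degree_piece q \<longrightarrow> \<Psi> a \<in> Z"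
proof -
  interpret cp: chevalley_presentation par R .
  note II = pm.ideal_ofD[OF I(1)]
  have mult: "free_mult (gen x) a \<in> I \<and> free_mult (gen x) a \<in> degree_piece (generator_degree x + q)"
    if "a \<in> I" "a \<in> degree_piece q" for x a q
  proof -
    have "w \<in> {w. word_degree w = generator_degree x + q}" if w: "w \<in> Poly_Mapping.keys (free_mult (gen x) a)" for w
    proof -
      obtain v where "w = Br (Letter x) v" "v \<in> Poly_Mapping.keys a"
        using w by (cases w) (auto simp: in_keys_iff lookup_free_mult gen_def
          Poly_Mapping.lookup_single when_def split: if_splits)
      thus ?thesis using \<open>a \<in> degree_piece q\<close> by (auto simp: supported_def)
    qed
    hence "free_mult (gen x) a \<in> degree_piece (generator_degree x + q)" unfolding supported_def by blast
    thus ?thesis using \<open>a \<in> I\<close> II(3)[OF UNIV_I] by blast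
  qed
  have zero: "\<Psi> a \<in> Z" if a0: "a \<in> I" "a \<in> degree_piece 0" for a
  proof -
    obtain v where v: "a - gen (H v) \<in> presentation_ideal par R" using cp.degree_zero[OF a0(2)] by blast
    hence "gen (H v) \<in> I" using pm.subspace_diff[OF II(1) a0(1), of "a - gen (H v)"] I(2) by auto
    hence "gen (H v) \<in> presentation_ideal par R" using I(3) by blast
    from pm.subspace_add[OF presentation_idealD(1) v this] have "a \<in> presentation_ideal par R" by simp
    thus ?thesis using presentation_ideal_K K_def by auto
  qed
  have hz: "c = 0" if "s c (h (coroot R i)) \<in> Z" for c i
    using h_inj[of "scale R c (coroot R i)"] that coroot by (simp add: h_scale)
  show ?thesis
  proof (induction q rule: degree_induct)
    case 1 show ?case using zero by blast
  next
    case (2 i)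
    show ?case
    proof (intro ballI impI)
      fix a assume a: "a \<in> I" "a \<in> degree_piece (axis i 1)"
      obtain c where c: "\<Psi> a - s c (e i) \<in> Z" using G_pos \<Psi>_degree[OF a(2)] by blast
      let ?k = "koszul_sign (par i) (par i)"
      have "b (f i) (\<Psi> a) \<in> Z" using zero[of "free_mult (gen (F i)) a"] mult[OF a, of "F i"] by (simp add: \<Psi>_simps \<Psi>_gen)
      moreover have "b (f i) (\<Psi> a - s c (e i)) \<in> Z" by (rule Z_idealD(3)[OF gens_total(2) c])
      ultimately have "s c (b (f i) (e i)) \<in> Z" using Z_diff by (fastforce simp: b_simps)
      \<comment> \<open>All three terms on the right lie in Z: a multiple of the skew symmetry
        relator, c [f_i, e_i], and a multiple of the relator for [e_i, f_i] = h_i.\<close>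
      moreover have "s (?k * c) (h (coroot R i)) = s c (b (f i) (e i) + s ?k (b (e i) (f i))) - s c (b (f i) (e i))
          - s (?k * c) (b (e i) (f i) - h (coroot R i))"
        by (simp add: scale_right_diff_distrib scale_right_distrib mult.commute)
      moreover have "s c (b (f i) (e i) + s ?k (b (e i) (f i))) \<in> Z" "s (?k * c) (b (e i) (f i) - h (coroot R i)) \<in> Z"
        using lieD(6)[OF f_par e_par] ef[of i i] by (auto intro: Z_scale)
      ultimately have "s (?k * c) (h (coroot R i)) \<in> Z" by (simp add: Z_diff)
      hence "?k * c = 0" by (rule hz)
      hence "c = 0" by (simp add: koszul_sign_def split: if_splits)
      thus "\<Psi> a \<in> Z" using c by simp
    qed
  next
    case (3 i)
    show ?case
    proof (intro ballI impI)
      fix a assume a: "a \<in> I" "a \<in> degree_piece (- axis i 1)"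
      obtain c where c: "\<Psi> a - s c (f i) \<in> Z" using G_neg \<Psi>_degree[OF a(2)] by blast
      have "b (e i) (\<Psi> a) \<in> Z" using zero[of "free_mult (gen (E i)) a"] mult[OF a, of "E i"] by (simp add: \<Psi>_simps \<Psi>_gen)
      moreover have "b (e i) (\<Psi> a - s c (f i)) \<in> Z" by (rule Z_idealD(3)[OF gens_total(1) c])
      ultimately have "s c (b (e i) (f i)) \<in> Z" using Z_diff by (fastforce simp: b_simps)
      moreover have "s c (b (e i) (f i) - h (coroot R i)) \<in> Z" using ef[of i i] by (auto intro: Z_scale)
      ultimately have "s c (h (coroot R i)) \<in> Z" using Z_diff by (fastforce simp: scale_right_diff_distrib)
      hence "c = 0" by (rule hz)
      thus "\<Psi> a \<in> Z" using c by simp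
    qed
  next
    case (4 q i j) thus ?case using G_mixed[OF 4] \<Psi>_degree by blast
  next
    case (5 q j c)
    show ?case
    proof (intro ballI impI)
      fix a assume a: "a \<in> I" "a \<in> degree_piece q"
      have "b (f j) (\<Psi> a) \<in> Z" using 5(3)[rule_format, of "free_mult (gen (F j)) a"] mult[OF a, of "F j"] by (simp add: \<Psi>_simps \<Psi>_gen)
      from Z_diff[OF Z_idealD(3)[OF gens_total(1)[of j] this] 5(2)[OF \<Psi>_degree[OF a(2)]]]
      have "s c (\<Psi> a) \<in> Z" by simp
      thus "\<Psi> a \<in> Z" using 5(1) by (rule scaleZ_cancel)
    qed
  next
    case (6 q j c)
    show ?case
    proof (intro ballI impI)
      fix a assume a: "a \<in> I" "a \<in> degree_piece q"
      have "b (e j) (\<Psi> a) \<in> Z" using 6(3)[rule_format, of "free_mult (gen (E j)) a"] mult[OF a, of "E j"] by (simp add: \<Psi>_simps \<Psi>_gen)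
      from Z_diff[OF Z_idealD(3)[OF gens_total(2)[of j] this] 6(2)[OF \<Psi>_degree[OF a(2)]]]
      have "s c (\<Psi> a) \<in> Z" by simp
      thus "\<Psi> a \<in> Z" using 6(1) by (rule scaleZ_cancel)
    qed
  qed
qed

text \<open>The images of the e_i are recorded because the derivation in the final statement is
  expressed through \<open>chevalley_e\<close>.\<close>

theorem contragredient_presented:
  obtains \<phi> where "presents s b (total P) P Z \<phi> (contragredient par R)" "\<And>i. \<phi> (e i) = chevalley_e par R i"
proof -
  interpret cp: chevalley_presentation par R .
  have radical: "contragredient_radical par R = cp.tu ` K"
  proof (rule cp.radical_eqI[OF K_ideal presentation_ideal_K])
    show "degree_part q a \<in> K" if "a \<in> K" for a q
      using that pr_Z by (simp add: K_def \<Psi>_degree_part)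
    show "gen (H v) \<in> presentation_ideal par R" if "gen (H v) \<in> K" for v
    proof -
      have "v = 0" using that h_inj by (simp add: K_def \<Psi>_gen)
      thus ?thesis using cp.gen_H_0 by simp
    qed
    fix I assume I: "pm.ideal_of UNIV I" "presentation_ideal par R \<subseteq> I"
      "\<forall>a\<in>I. \<exists>S g. finite S \<and> (\<forall>q\<in>S. g q \<in> I \<and> g q \<in> degree_piece q) \<and> a - sum g S \<in> presentation_ideal par R"
      "\<forall>v. gen (H v) \<in> I \<longrightarrow> gen (H v) \<in> presentation_ideal par R"
    show "I \<subseteq> K"
    proof
      fix a assume "a \<in> I"
      then obtain S g where g: "\<forall>q\<in>S. g q \<in> I \<and> g q \<in> degree_piece q" "a - sum g S \<in> presentation_ideal par R"
        using I(3) by blast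
      have "\<Psi> (a - sum g S) \<in> Z" using g(2) presentation_ideal_K by (auto simp: K_def)
      moreover have "\<Psi> (sum g S) \<in> Z"
        unfolding \<Psi>_sum using g(1) maximality[OF I(1,2,4)] by (intro Z_sum) blast
      ultimately have "\<Psi> (a - sum g S) + \<Psi> (sum g S) \<in> Z" by (rule Z_add)
      thus "a \<in> K" by (simp add: K_def \<Psi>_simps)
    qed
  qed
  from presents_transport[OF cp.contragredient_presents[OF radical K_ideal presentation_ideal_K],
      of \<Psi> s b "total P" Z P]
  obtain \<phi> where "presents s b (total P) P Z \<phi> (contragredient par R)"
    and \<phi>: "\<And>a. \<phi> (\<Psi> a) = contragredient_radical par R +>\<^bsub>cp.ualg\<^esub> cp.tu a"
    using \<Psi>_simps \<Psi>_total \<Psi>_parity generation_total generation_parity totalD bilinear_algebra_axioms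
    by (auto simp: K_def)
  moreover have "\<phi> (e i) = chevalley_e par R i" for i
    using \<phi>[of "gen (E i)"] by (simp add: \<Psi>_gen chevalley_e_def)
  ultimately show ?thesis using that by blast
qed

end

section \<open>The semisimplification of a Lie algebra with a derivation\<close>

locale lie_derivation = bilinear_algebra s b
  for s :: "'k::field \<Rightarrow> 'm::ab_group_add \<Rightarrow> 'm" and b +
  fixes D :: "'m \<Rightarrow> 'm"
  assumes three: "x + x + x = (0 :: 'm)"
    and skew: "b x y = - b y x"
    and jacobi: "b x (b y z) = b (b x y) z + b y (b x z)"
    and D_add: "D (x + y) = D x + D y"
    and D_scale: "D (s c x) = s c (D x)"
    and D_mult: "D (b x y) = b (D x) y + b x (D y)"
    and D_cube: "D (D (D x)) = 0"
begin

lemma D_zero [simp]: "D 0 = 0"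
  using D_add[of 0 0] by simp

lemma D_minus: "D (- x) = - D x"
  using D_add[of x "- x"] by (simp add: eq_neg_iff_add_eq_0 add.commute)

lemma D_diff: "D (x - y) = D x - D y"
  using D_add[of x "- y"] by (simp add: D_minus)

lemmas D_simps = D_add D_scale D_diff D_minus

lemma double: "x + x = - (x :: 'm)"
  using three[of x] by (simp add: eq_neg_iff_add_eq_0)

lemma neg_double: "- x - x = (x :: 'm)"
  using double[of "- x"] by simp

definition ss :: "'k \<Rightarrow> 'm \<times> 'm \<Rightarrow> 'm \<times> 'm"
  where "ss c z = (s c (fst z), s c (snd z))"

text \<open>The bracket of the semisimplification on representatives (even, odd). For two odd
  entries y, w it is [D y, w] - [y, D w], the contraction with the copy of J_1 in J_2 tensor J_2
  that \<open>block_fusion\<close> selects.\<close>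

definition bb :: "'m \<times> 'm \<Rightarrow> 'm \<times> 'm \<Rightarrow> 'm \<times> 'm"
  where "bb z w = (b (fst z) (fst w) + (b (D (snd z)) (snd w) - b (snd z) (D (snd w))),
     b (fst z) (snd w) + b (snd z) (fst w))"

definition SP :: "bit \<Rightarrow> ('m \<times> 'm) set"
  where "SP p = (if p = 0 then {(x, 0) | x. D x = 0} else {(0, y) | y. D (D y) = 0})"

text \<open>The representatives of negligible classes. A kernel element in the image of D is the
  tail of a longer block. In the odd component, D y = D (D u) says that y differs from D u by a
  kernel element, so y does not head a block J_2.\<close>

definition SZ :: "('m \<times> 'm) set"
  where "SZ = {(x, y) | x y. D x = 0 \<and> x \<in> range D \<and> D y \<in> range (\<lambda>u. D (D u))}"

lemma SP_simps: "SP 0 = {(x, 0) | x. D x = 0}" "SP 1 = {(0, y) | y. D (D y) = 0}"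
  by (simp_all add: SP_def)

lemma in_SZ: "(x, y) \<in> SZ \<longleftrightarrow> D x = 0 \<and> (\<exists>u. x = D u) \<and> (\<exists>u. D y = D (D u))"
  by (auto simp: SZ_def)

lemma pair_bilinear: "bilinear_algebra ss bb"
  by unfold_locales
    (auto simp: ss_def bb_def scale_right_distrib scale_left_distrib b_simps D_simps scale_right_diff_distrib algebra_simps)

interpretation pair: bilinear_algebra ss bb by (rule pair_bilinear)

lemma SP_subspace: "pair.subspace (SP p)"
proof (cases p)
  case zero thus ?thesis
    by (intro pair.subspaceI) (auto simp: SP_def ss_def D_simps zero_prod_def)
next
  case one thus ?thesis
    by (intro pair.subspaceI) (auto simp: SP_def ss_def D_simps zero_prod_def)
qed

lemma range_D_subspace: "subspace (range D)" "subspace (range (\<lambda>u. D (D u)))"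
proof -
  have *: "subspace (range f)"
    if add: "\<And>x y. f (x + y) = f x + f y" and scale: "\<And>c x. f (s c x) = s c (f x)" and zero: "f 0 = 0"
    for f :: "'m \<Rightarrow> 'm"
  proof (rule subspaceI)
    show "0 \<in> range f" using zero by (metis rangeI)
  next
    fix x y assume "x \<in> range f" "y \<in> range f"
    thus "x + y \<in> range f" by (auto simp flip: add)
  next
    fix c x assume "x \<in> range f"
    thus "s c x \<in> range f" by (auto simp flip: scale)
  qed
  show "subspace (range D)" "subspace (range (\<lambda>u. D (D u)))"
    by (rule *; simp add: D_simps)+
qed

lemma SZ_subspace: "pair.subspace SZ"
proof (rule pair.subspaceI)
  show "0 \<in> SZ" using subspace_0[OF range_D_subspace(1)] subspace_0[OF range_D_subspace(2)]
    by (simp add: SZ_def zero_prod_def)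
  show "z + w \<in> SZ" if "z \<in> SZ" "w \<in> SZ" for z w
    using that subspace_add[OF range_D_subspace(1)] subspace_add[OF range_D_subspace(2)]
    by (auto simp: SZ_def D_simps simp del: image_iff)
  show "ss c z \<in> SZ" if "z \<in> SZ" for c z
    using that subspace_scale[OF range_D_subspace(1)] subspace_scale[OF range_D_subspace(2)]
    by (auto simp: SZ_def ss_def D_simps simp del: image_iff)
qed

lemma bb_closed:
  assumes "z \<in> SP p" "w \<in> SP q"
  shows "bb z w \<in> SP (p + q)"
  using assms by (cases p; cases q) (auto simp: SP_def bb_def D_simps D_mult D_cube)

lemma bb_skew:
  assumes "z \<in> SP p" "w \<in> SP q"
  shows "bb z w + ss (koszul_sign p q) (bb w z) = 0"
proof -
  obtain x y where z: "z = (x, y)" by (cases z)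
  obtain x' y' where w: "w = (x', y')" by (cases w)
  show ?thesis
  using assms unfolding z w
  apply (cases p; cases q)
  by (auto simp: SP_def bb_def ss_def koszul_sign_def zero_prod_def skew[of x' x] skew[of x' y] skew[of y' x] skew[of y' "D y"] skew[of "D y'" y])
qed

lemma SZ_ideal_left:
  assumes "w \<in> SP p" "z \<in> SZ"
  shows "bb w z \<in> SZ"
proof -
  obtain x y where z: "z = (x, y)" by (cases z)
  obtain a where a: "x = D a" and x0: "D x = 0" using assms(2) z by (auto simp: in_SZ)
  obtain c where c: "D y = D (D c)" using assms(2) z by (auto simp: in_SZ)
  have xa: "D (D a) = 0" using x0 a by simp
  show ?thesis
  proof (cases p)
    case zero
    then obtain x' where w: "w = (x', 0)" "D x' = 0" using assms(1) by (auto simp: SP_def)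
    have "b x' x = D (b x' a)" "D (b x' y) = D (D (b x' c))" "D (b x' x) = 0"
      using w x0 by (simp_all add: a c D_mult D_simps)
    thus ?thesis unfolding z w bb_def by (auto simp: in_SZ intro: exI[of _ "b x' a"] exI[of _ "b x' c"])
  next
    case one
    then obtain y' where w: "w = (0, y')" "D (D y') = 0" using assms(1) by (auto simp: SP_def)
    \<comment> \<open>y is replaced by \<open>D c\<close> plus a kernel element, and the two
      summands are treated separately.\<close>
    define k where "k = y - D c"
    have k: "D k = 0" "y = D c + k" using c by (auto simp: k_def D_simps)
    have "b (D y') y - b y' (D y) = D (b y' k) + (b (D y') (D c) - b y' (D (D c)))"
      using k by (simp add: D_mult D_simps D_cube b_simps)
    \<comment> \<open>An explicit preimage under D: since D (D y') = 0, applying D to 2 [D y', c] -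
      [y', D c] gives 2 [D y', D c] - [D y', D c] - [y', D (D c)].\<close>
    also have "b (D y') (D c) - b y' (D (D c)) = D (b (D y') c + b (D y') c - b y' (D c))"
      using w by (simp add: D_mult D_simps double b_simps)
        (use double[of "b (D y') (D c)"] in \<open>simp add: algebra_simps\<close>)
    finally have 1: "b (D y') y - b y' (D y) = D (b y' k + (b (D y') c + b (D y') c - b y' (D c)))"
      by (simp only: D_add)
    have 2: "D (b (D y') y - b y' (D y)) = 0"
      using w c by (simp add: D_mult D_simps D_cube)
    \<comment> \<open>The second derivative is 2 [D y', D a], whereas D [y', x] is [D y', D a].
      Since 2 = -1, the witness is built from - a.\<close>
    have "D (D (b y' a)) = b (D y') (D a) + b (D y') (D a)"
      using w xa by (simp add: D_mult D_simps)
    hence "D (b y' x) = D (D (b y' (- a)))"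
      using w xa a neg_double[of "b (D y') (D a)"] by (simp add: D_mult D_simps b_simps)
    thus ?thesis unfolding z w bb_def using 1 2 by (auto simp: in_SZ)
  qed
qed

text \<open>The identity holds exactly unless all three elements are odd. In that case
  characteristic 3 turns the defect into D of an element, placed in the odd component, and such a
  pair is negligible.\<close>

lemma bb_jacobi:
  assumes "z \<in> SP p" "w \<in> SP q" "v \<in> SP r"
  shows "bb z (bb w v) - (bb (bb z w) v + ss (koszul_sign p q) (bb w (bb z v))) \<in> SZ"
proof -
  have 0: "0 \<in> SZ" by (rule pair.subspace_0[OF SZ_subspace])
  consider "p = 0" "q = 0" | "p = 0" "q = 1" | "p = 1" "q = 0" | "p = 1" "q = 1" "r = 0" | "p = 1" "q = 1" "r = 1"
    by (metis bit_not_zero_iff)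
  thus ?thesis
  proof cases
    case 1
    then obtain x y c d where *: "z = (x, 0)" "D x = 0" "w = (y, 0)" "D y = 0" "v = (c, d)"
      using assms by (cases v) (auto simp: SP_def)
    have "bb z (bb w v) - (bb (bb z w) v + ss (koszul_sign p q) (bb w (bb z v))) = 0"
      unfolding * using 1 by (simp add: bb_def ss_def koszul_sign_def zero_prod_def jacobi[of x y])
    thus ?thesis using 0 by simp
  next
    case 2
    then obtain x y c d where *: "z = (x, 0)" "D x = 0" "w = (0, y)" "D (D y) = 0" "v = (c, d)"
      using assms by (cases v) (auto simp: SP_def)
    have "bb z (bb w v) - (bb (bb z w) v + ss (koszul_sign p q) (bb w (bb z v))) = 0"
      unfolding * using 2 *(2) by (simp add: bb_def ss_def koszul_sign_def zero_prod_def jacobi[of x y]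
          jacobi[of x "D y"] D_mult b_simps)
    thus ?thesis using 0 by simp
  next
    case 3
    then obtain x y c d where *: "z = (0, x)" "D (D x) = 0" "w = (y, 0)" "D y = 0" "v = (c, d)"
      using assms by (cases v) (auto simp: SP_def)
    have "bb z (bb w v) - (bb (bb z w) v + ss (koszul_sign p q) (bb w (bb z v))) = 0"
      unfolding * using 3 *(4) by (simp add: bb_def ss_def koszul_sign_def zero_prod_def jacobi[of x y]
          jacobi[of "D x" y] D_mult b_simps)
    thus ?thesis using 0 by simp
  next
    case 4
    then obtain x y c where *: "z = (0, x)" "D (D x) = 0" "w = (0, y)" "D (D y) = 0" "v = (c, 0)" "D c = 0"
      using assms by (auto simp: SP_def)
    have "bb z (bb w v) - (bb (bb z w) v + ss (koszul_sign p q) (bb w (bb z v))) = 0"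
      unfolding * using 4 *(6) by (simp add: bb_def ss_def koszul_sign_def zero_prod_def jacobi[of x "D y"]
          jacobi[of "D x" y] skew[of "b x c"] skew[of "b y c"] D_mult b_simps)
    thus ?thesis using 0 by simp
  next
    case 5
    then obtain x y c where *: "z = (0, x)" "D (D x) = 0" "w = (0, y)" "D (D y) = 0" "v = (0, c)" "D (D c) = 0"
      using assms by (auto simp: SP_def)
    define P where "P = b x (b (D y) c)" define Q where "Q = b y (b (D x) c)"
    have 1: "b (b (D x) y) c = b (D x) (b y c) - Q" "b (b x (D y)) c = P - b (D y) (b x c)"
      by (simp_all add: P_def Q_def jacobi[of "D x" y c] jacobi[of x "D y" c])
    have "snd (bb z (bb w v) - (bb (bb z w) v + ss (koszul_sign p q) (bb w (bb z v))))
      = (P + P) + (Q + Q) - b x (b y (D c)) - b (D x) (b y c) - b (D y) (b x c) - b y (b x (D c))"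
      unfolding * using 5 by (simp add: bb_def ss_def koszul_sign_def b_simps 1) (simp add: P_def Q_def)
    also have "\<dots> = D (- b x (b y c) - b y (b x c))"
      by (simp add: double D_simps D_mult b_simps P_def Q_def)
    finally have s: "snd (bb z (bb w v) - (bb (bb z w) v + ss (koszul_sign p q) (bb w (bb z v))))
      = D (- b x (b y c) - b y (b x c))" .
    moreover have "fst (bb z (bb w v) - (bb (bb z w) v + ss (koszul_sign p q) (bb w (bb z v)))) = 0"
      unfolding * by (simp add: bb_def ss_def)
    ultimately show ?thesis
      by (metis (no_types, lifting) D_zero in_SZ prod.collapse)
  qed
qed

lemma pair_total: "(x, y) \<in> pair.total SP \<longleftrightarrow> D x = 0 \<and> D (D y) = 0"
  by (auto simp: pair.total_def SP_def)

lemma pair_lie_mod: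
  assumes "\<And>y. D (D y) = 0 \<Longrightarrow> bb (0, y) (bb (0, y) (0, y)) \<in> SZ"
  shows "pair.lie_mod SP SZ"
  unfolding pair.lie_mod_def
proof (intro conjI allI ballI impI)
  show "pair.subspace SZ" "\<And>p. pair.subspace (SP p)" by (rule SZ_subspace SP_subspace)+
  show "\<exists>x\<in>SP 0. \<exists>y\<in>SP 1. z = x + y" if "z \<in> SZ" for z
  proof -
    obtain x y where "z = (x, y)" by (cases z)
    thus ?thesis using that D_cube
      by (intro bexI[of _ "(x, 0)"] bexI[of _ "(0, y)"]) (auto simp: SP_def in_SZ)
  qed
  show "z \<in> SZ" if "z \<in> SP 0" "w \<in> SP 1" "z + w \<in> SZ" for z w
    using that by (auto simp: SP_def in_SZ intro: exI[of _ 0])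
  show "bb z w \<in> SP (p + q)" if "z \<in> SP p" "w \<in> SP q" for z w p q
    using that by (rule bb_closed)
  show "bb z w + ss (koszul_sign p q) (bb w z) \<in> SZ" if "z \<in> SP p" "w \<in> SP q" for z w p q
    using bb_skew[OF that] pair.subspace_0[OF SZ_subspace] by simp
  show "bb w z \<in> SZ" if "w \<in> SP p" "z \<in> SZ" for w z p
    using that by (rule SZ_ideal_left)
  show "bb z (bb w v) - (bb (bb z w) v + ss (koszul_sign p q) (bb w (bb z v))) \<in> SZ"
    if "z \<in> SP p" "w \<in> SP q" "v \<in> SP r" for z w v p q r
    using that by (rule bb_jacobi)
  show "bb z (bb z z) \<in> SZ" if "z \<in> SP 1" for z
    using that assms by (auto simp: SP_def)
qed

end

section \<open>Negligible morphisms out of J_1 and J_2, and the semisimplification record\<close>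

lemma (in vector_space) separating_functional:
  assumes S: "subspace S" "x \<notin> S"
  obtains f where "\<And>y z. f (y + z) = f y + f z" "\<And>c y. f (scale c y) = c * f y"
    "\<And>y. y \<in> S \<Longrightarrow> f y = 0" "f x = 1"
proof -
  obtain B where B: "B \<subseteq> S" "independent B" "S \<subseteq> span B" using basis_exists[of S] by metis
  have sB: "span B = S" using B span_minimal[OF B(1) S(1)] by blast
  have ind: "independent (insert x B)" using B(2) S(2) sB by (simp add: independent_insert)
  have "vector_space ((*) :: 'a \<Rightarrow> 'a \<Rightarrow> 'a)" by unfold_locales (auto simp: algebra_simps)
  then interpret p: vector_space_pair scale "(*) :: 'a \<Rightarrow> 'a \<Rightarrow> 'a"
    unfolding vector_space_pair_def using vector_space_axioms by blast
  obtain f where f: "Vector_Spaces.linear scale (*) f" "\<forall>y\<in>insert x B. f y = (if y = x then 1 else 0)"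
    using p.linear_independent_extend[OF ind, of "\<lambda>y. if y = x then 1 else 0"] by blast
  have add: "f (y + z) = f y + f z" for y z using f(1) p.linear_add by blast
  have scl: "f (scale c y) = c * f y" for c y using f(1) p.linear_scale by blast
  have xB: "x \<notin> B" using B(1) S(2) by blast
  have zero: "f y = 0" if "y \<in> span B" for y
    using that
  proof (induction rule: span_induct_alt)
    case base thus ?case using scl[of 0 0] by simp
  next
    case (step c a y)
    hence "f a = 0" using f(2) xB by auto
    thus ?case using step by (simp add: add scl)
  qed
  show ?thesis by (rule that[of f]) (use add scl zero sB f(2) in auto)
qed

locale semisimplification_model = lie_derivation s b D
  for s :: "'k::field \<Rightarrow> 'm::ab_group_add \<Rightarrow> 'm" and b D +
  fixes g :: "('k, 'a) superalgebra" and P0 and \<phi> :: "'m \<Rightarrow> 'a" and d :: "'a \<Rightarrow> 'a"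
  assumes two: "(2 :: 'k) \<noteq> 0"
    and g: "presents s b UNIV P0 {0} \<phi> g"
    and d: "d (\<phi> x) = \<phi> (D x)"
    and fin: "finite_dimensional g"
    and cube: "D (D y) = 0 \<Longrightarrow> bb (0, y) (bb (0, y) (0, y)) \<in> SZ"
begin

interpretation pair: bilinear_algebra ss bb by (rule pair_bilinear)

lemma \<phi>_simps: "\<phi> (x + y) = \<phi> x \<oplus>\<^bsub>g\<^esub> \<phi> y" "\<phi> (s c x) = c \<odot>\<^bsub>g\<^esub> \<phi> x" "\<phi> (b x y) = \<phi> x \<otimes>\<^bsub>g\<^esub> \<phi> y"
  "\<phi> x = \<phi> y \<longleftrightarrow> x = y" "\<phi> x \<in> carrier g"
  using presentsD[OF g] by auto

lemmas \<phi>_hom = \<phi>_simps(1-3)[symmetric]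

lemma carrier_\<phi>: "carrier g = range \<phi>"
  using presentsD(1)[OF g] by simp

lemma inv_\<phi>: "inv_into UNIV \<phi> (\<phi> x) = x"
  by (rule inv_f_f) (simp add: inj_def \<phi>_simps)

text \<open>The morphism from the block of parity p that sends its generator
  \<open>jordan_vec 0\<close> to x. On J_1 the coordinate \<open>v 1\<close> vanishes, so one
  formula serves both blocks.\<close>

definition hm :: "bit \<Rightarrow> 'm \<Rightarrow> (nat \<Rightarrow> 'k) \<Rightarrow> 'a"
  where "hm p x = (\<lambda>v\<in>carrier (jordan_space (block_size p)). \<phi> (s (v 0) x + s (v 1) (D x)))"

text \<open>The possible images of the generator of the block under a morphism. \<open>N p\<close>
  will turn out to be the images under negligible morphisms.\<close>

definition T :: "bit \<Rightarrow> 'm set"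
  where "T p = {x. if p = 0 then D x = 0 else D (D x) = 0}"

definition N :: "bit \<Rightarrow> 'm set"
  where "N p = {x. if p = 0 then D x = 0 \<and> x \<in> range D else D x \<in> range (\<lambda>u. D (D u))}"

definition \<iota> :: "bit \<Rightarrow> 'm \<Rightarrow> 'm \<times> 'm"
  where "\<iota> p x = (if p = 0 then (x, 0) else (0, x))"

lemma jordan_carrier: "v \<in> carrier (jordan_space n) \<longleftrightarrow> (\<forall>i\<ge>n. v i = 0)"
  by (simp add: jordan_space_def)

lemma jordan_simps: "v \<oplus>\<^bsub>jordan_space n\<^esub> w = (\<lambda>i. v i + w i)" "c \<odot>\<^bsub>jordan_space n\<^esub> v = (\<lambda>i. c * v i)"
  by (simp_all add: jordan_space_def)

lemma T_subspace: "subspace (T p)"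
  by (rule subspaceI) (auto simp: T_def D_simps)

lemma N_subspace: "subspace (N p)"
proof (rule subspaceI)
  show "0 \<in> N p" using subspace_0[OF range_D_subspace(1)] subspace_0[OF range_D_subspace(2)]
    by (simp add: N_def)
  show "x + y \<in> N p" if "x \<in> N p" "y \<in> N p" for x y
    using that subspace_add[OF range_D_subspace(1)] subspace_add[OF range_D_subspace(2)]
    by (simp add: N_def D_simps split: if_splits)
  show "s c x \<in> N p" if "x \<in> N p" for c x
    using that subspace_scale[OF range_D_subspace(1)] subspace_scale[OF range_D_subspace(2)]
    by (simp add: N_def D_simps split: if_splits)
qed

lemma N_T: "N p \<subseteq> T p"
  by (auto simp: N_def T_def D_cube)

lemma \<iota>_SZ: "\<iota> p x \<in> SZ \<longleftrightarrow> x \<in> N p"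
  by (auto simp: \<iota>_def in_SZ N_def intro: exI[of _ 0])

lemma \<iota>_SP: "x \<in> T p \<Longrightarrow> \<iota> p x \<in> SP p"
  by (cases p) (auto simp: \<iota>_def SP_def T_def)

lemma \<iota>_diff: "\<iota> p (x - y) = \<iota> p x - \<iota> p y"
  by (simp add: \<iota>_def)

lemma hm_apply: "v \<in> carrier (jordan_space (block_size p)) \<Longrightarrow> hm p x v = \<phi> (s (v 0) x + s (v 1) (D x))"
  by (simp add: hm_def)

lemma jordan_vec_0: "jordan_vec 0 \<in> carrier (jordan_space (block_size p))"
  by (simp add: jordan_carrier jordan_vec_def block_size_def)

lemma hm_0: "hm p x (jordan_vec 0) = \<phi> x"
  by (simp add: hm_apply jordan_vec_0) (simp add: jordan_vec_def)

lemma hm_inj: "hm p x = hm p y \<longleftrightarrow> x = y"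
  using hm_0 \<phi>_simps(4) by metis

lemma hm_add: "hm p (x + y) = hm p x \<oplus>\<^bsub>block_homs g d p\<^esub> hm p y"
  by (rule ext) (simp add: hm_def block_homs_def rep_hom_def \<phi>_hom D_simps scale_right_distrib add_ac restrict_def)

lemma hm_scale: "hm p (s c x) = c \<odot>\<^bsub>block_homs g d p\<^esub> hm p x"
  by (rule ext) (simp add: hm_def block_homs_def rep_hom_def \<phi>_hom D_simps scale_right_distrib restrict_def mult.commute)

text \<open>A block is generated by \<open>jordan_vec 0\<close> under the shift, so a morphism is
  determined by the image x of this vector; compatibility with the last application of the shift is
  the condition on x.\<close>

lemma hm_carrier: "carrier (block_homs g d p) = hm p ` T p"
proof (intro equalityI subsetI)
  fix u assume "u \<in> hm p ` T p"
  then obtain x where x: "u = hm p x" "x \<in> T p" by blast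
  let ?J = "jordan_space (block_size p) :: ('k, nat \<Rightarrow> 'k) module"
  have shift: "jordan_shift (block_size p) v \<in> carrier ?J" for v :: "nat \<Rightarrow> 'k"
    by (simp add: jordan_carrier jordan_shift_def)
  have cl: "(\<lambda>i. v i + w i) \<in> carrier ?J" "(\<lambda>i. c * v i) \<in> carrier ?J"
    if "v \<in> carrier ?J" "w \<in> carrier ?J" for v w c
    using that by (simp_all add: jordan_carrier)
  have "u (jordan_shift (block_size p) v) = d (u v)" if "v \<in> carrier ?J" for v
    unfolding x(1) hm_apply[OF that] hm_apply[OF shift] d
    using x(2) that by (auto simp: jordan_shift_def block_size_def D_simps T_def \<phi>_simps(4) jordan_carrier)
  moreover have "u (v \<oplus>\<^bsub>?J\<^esub> w) = u v \<oplus>\<^bsub>g\<^esub> u w" if "v \<in> carrier ?J" "w \<in> carrier ?J" for v w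
    using cl[OF that] that unfolding x(1) jordan_simps
    by (simp add: hm_apply \<phi>_hom scale_left_distrib add_ac)
  moreover have "u (c \<odot>\<^bsub>?J\<^esub> v) = c \<odot>\<^bsub>g\<^esub> u v" if "v \<in> carrier ?J" for c v
    using cl(2)[OF that that] that unfolding x(1) jordan_simps
    by (simp add: hm_apply \<phi>_hom scale_right_distrib)
  moreover have "u \<in> carrier ?J \<rightarrow>\<^sub>E carrier g"
    unfolding x(1) hm_def using \<phi>_simps(5) by auto
  ultimately show "u \<in> carrier (block_homs g d p)"
    by (simp add: block_homs_def rep_hom_def)
next
  fix u assume "u \<in> carrier (block_homs g d p)"
  let ?J = "jordan_space (block_size p) :: ('k, nat \<Rightarrow> 'k) module"
  have u: "u \<in> carrier ?J \<rightarrow>\<^sub>E carrier g" "\<And>v w. v \<in> carrier ?J \<Longrightarrow> w \<in> carrier ?J \<Longrightarrow> u (v \<oplus>\<^bsub>?J\<^esub> w) = u v \<oplus>\<^bsub>g\<^esub> u w"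
    "\<And>c v. v \<in> carrier ?J \<Longrightarrow> u (c \<odot>\<^bsub>?J\<^esub> v) = c \<odot>\<^bsub>g\<^esub> u v"
    "\<And>v. v \<in> carrier ?J \<Longrightarrow> u (jordan_shift (block_size p) v) = d (u v)"
    using \<open>u \<in> carrier (block_homs g d p)\<close> by (auto simp: block_homs_def rep_hom_def)
  have "u (jordan_vec 0) \<in> range \<phi>" using u(1) jordan_vec_0 carrier_\<phi> by (metis PiE_mem)
  then obtain x where x: "u (jordan_vec 0) = \<phi> x" by blast
  have zero: "u (\<lambda>_. 0) = \<phi> 0"
    using u(3)[OF jordan_vec_0, of 0] by (simp add: jordan_simps x \<phi>_hom)
  show "u \<in> hm p ` T p"
  proof (cases p)
    case zero
    have "jordan_shift (block_size p) (jordan_vec 0) = (\<lambda>_. 0 :: 'k)"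
      using zero by (auto simp: jordan_shift_def block_size_def)
    hence "\<phi> (D x) = \<phi> 0" using u(4)[OF jordan_vec_0] x d \<open>u (\<lambda>_. 0) = \<phi> 0\<close> by metis
    hence "x \<in> T p" using zero by (simp add: T_def \<phi>_simps(4))
    moreover have "u = hm p x"
    proof (rule extensionalityI[of _ "carrier ?J"])
      show "u \<in> extensional (carrier ?J)" using u(1) by (simp add: PiE_def)
      show "hm p x \<in> extensional (carrier ?J)" by (simp add: hm_def)
      fix v assume v: "v \<in> carrier ?J"
      have "v = v 0 \<odot>\<^bsub>?J\<^esub> jordan_vec 0" "v 1 = 0"
        using v zero by (auto simp: jordan_simps jordan_carrier jordan_vec_def block_size_def)
      hence "u v = v 0 \<odot>\<^bsub>g\<^esub> \<phi> x" using u(3)[OF jordan_vec_0] x by metis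
      thus "u v = hm p x v" using v \<open>v 1 = 0\<close> by (simp add: hm_apply \<phi>_hom)
    qed
    ultimately show ?thesis by blast
  next
    case one
    have e1: "jordan_vec 1 \<in> carrier ?J" using one by (auto simp: jordan_carrier jordan_vec_def block_size_def)
    have "jordan_shift (block_size p) (jordan_vec 0) = (jordan_vec 1 :: nat \<Rightarrow> 'k)"
      "jordan_shift (block_size p) (jordan_vec 1) = (\<lambda>_. 0 :: 'k)"
      using one by (auto simp: jordan_shift_def block_size_def jordan_vec_def)
    hence u1: "u (jordan_vec 1) = \<phi> (D x)" and "\<phi> (D (D x)) = \<phi> 0"
      using u(4)[OF jordan_vec_0] u(4)[OF e1] x d \<open>u (\<lambda>_. 0) = \<phi> 0\<close> by metis+
    hence "x \<in> T p" using one by (simp add: T_def \<phi>_simps(4))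
    moreover have "u = hm p x"
    proof (rule extensionalityI[of _ "carrier ?J"])
      show "u \<in> extensional (carrier ?J)" using u(1) by (simp add: PiE_def)
      show "hm p x \<in> extensional (carrier ?J)" by (simp add: hm_def)
      fix v assume v: "v \<in> carrier ?J"
      have v01: "v = (v 0 \<odot>\<^bsub>?J\<^esub> jordan_vec 0) \<oplus>\<^bsub>?J\<^esub> (v 1 \<odot>\<^bsub>?J\<^esub> jordan_vec 1)"
        using v one by (auto simp: jordan_simps jordan_carrier jordan_vec_def block_size_def less_2_cases_iff not_less[symmetric])
      have cl: "v 0 \<odot>\<^bsub>?J\<^esub> jordan_vec 0 \<in> carrier ?J" "v 1 \<odot>\<^bsub>?J\<^esub> jordan_vec 1 \<in> carrier ?J"
        using jordan_vec_0[of p] e1 by (auto simp: jordan_carrier jordan_simps)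
      have "u v = (v 0 \<odot>\<^bsub>g\<^esub> \<phi> x) \<oplus>\<^bsub>g\<^esub> (v 1 \<odot>\<^bsub>g\<^esub> \<phi> (D x))"
        using u(2)[OF cl] u(3)[OF jordan_vec_0, of "v 0"] u(3)[OF e1, of "v 1"] x u1 v01 by metis
      thus "u v = hm p x v" using v by (simp add: hm_apply \<phi>_hom)
    qed
    ultimately show ?thesis by blast
  qed
qed

text \<open>An endomorphism factoring through J_1 or J_2 is a sum of two maps of the form m -> F(m)
  x, and such a map has trace F(x) whatever basis \<open>linear_trace\<close> has chosen.\<close>

lemma trace_rank_two:
  assumes w: "\<And>m. w (\<phi> m) = \<phi> (s (F1 m) x + s (F2 m) y)"
    and F1: "\<And>m n. F1 (m + n) = F1 m + F1 n" "\<And>c m. F1 (s c m) = c * F1 m"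
    and F2: "\<And>m n. F2 (m + n) = F2 m + F2 n" "\<And>c m. F2 (s c m) = c * F2 m"
  shows "linear_trace g w = F1 x + F2 y"
proof -
  define B where "B = (SOME B. finite B \<and> linear_basis g B)"
  have "finite B \<and> linear_basis g B"
    unfolding B_def using fin unfolding finite_dimensional_def by (rule someI_ex)
  hence B: "finite B" "B \<subseteq> carrier g"
    "\<And>a. a \<in> carrier g \<Longrightarrow> \<exists>!c. c \<in> B \<rightarrow>\<^sub>E UNIV \<and> a = (\<Oplus>\<^bsub>g\<^esub>b\<in>B. c b \<odot>\<^bsub>g\<^esub> b)"
    by (auto simp: linear_basis_def)
  define \<beta> where "\<beta> = inv_into UNIV \<phi>"
  have \<beta>: "\<phi> (\<beta> a) = a" if "a \<in> B" for a
    using that B(2) carrier_\<phi> unfolding \<beta>_def by (metis f_inv_into_f subsetD)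
  interpret M: Module.module "scalars :: 'k ring" g by (rule presents_module[OF g subspace_UNIV])
  have fs: "(\<Oplus>\<^bsub>g\<^esub>a\<in>B. c a \<odot>\<^bsub>g\<^esub> a) = \<phi> (\<Sum>a\<in>B. s (c a) (\<beta> a))" for c
  proof -
    have "(\<Oplus>\<^bsub>g\<^esub>a\<in>B. c a \<odot>\<^bsub>g\<^esub> a) = (\<Oplus>\<^bsub>g\<^esub>a\<in>B. \<phi> (s (c a) (\<beta> a)))"
    proof (rule M.M.finsum_cong'[OF refl])
      show "c a \<odot>\<^bsub>g\<^esub> a = \<phi> (s (c a) (\<beta> a))" if "a \<in> B" for a
        using that by (simp add: \<phi>_simps(2) \<beta>)
    qed (use \<phi>_simps(5) in auto)
    also have "\<dots> = \<phi> (\<Sum>a\<in>B. s (c a) (\<beta> a))"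
      by (rule presents_finsum[OF g subspace_UNIV B(1)]) simp
    finally show ?thesis .
  qed
  define co where "co m = coordinates g B (\<phi> m)" for m
  have ex: "\<exists>!c. c \<in> B \<rightarrow>\<^sub>E UNIV \<and> m = (\<Sum>a\<in>B. s (c a) (\<beta> a))" for m
    using B(3)[OF \<phi>_simps(5)[of m]] unfolding fs \<phi>_simps(4) .
  have co_def': "co m = (THE c. c \<in> B \<rightarrow>\<^sub>E UNIV \<and> m = (\<Sum>a\<in>B. s (c a) (\<beta> a)))" for m
    unfolding co_def coordinates_def fs \<phi>_simps(4) ..
  have co: "m = (\<Sum>a\<in>B. s (co m a) (\<beta> a))" for m
    using theI'[OF ex[of m]] unfolding co_def' by blast
  have uniq: "co m a = c a" if m: "m = (\<Sum>a\<in>B. s (c a) (\<beta> a))" and a: "a \<in> B" for m c a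
  proof -
    have *: "m = (\<Sum>a\<in>B. s (restrict c B a) (\<beta> a))" unfolding m by (rule sum.cong) auto
    have "co m = restrict c B"
      unfolding co_def' by (rule the1_equality[OF ex]) (use * in auto)
    thus ?thesis using a by simp
  qed
  have co_lin: "co (s c m + s c' n) a = c * co m a + c' * co n a" if "a \<in> B" for c c' m n a
  proof (rule uniq[OF _ that])
    have "s c m + s c' n = s c (\<Sum>a\<in>B. s (co m a) (\<beta> a)) + s c' (\<Sum>a\<in>B. s (co n a) (\<beta> a))"
      using co by simp
    thus "s c m + s c' n = (\<Sum>a\<in>B. s (c * co m a + c' * co n a) (\<beta> a))"
      by (simp add: scale_sum_right scale_left_distrib sum.distrib)
  qed
  have Fsum: "F m = (\<Sum>a\<in>B. F (\<beta> a) * co m a)"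
    if F: "\<And>m n. F (m + n) = F m + F n" "\<And>c m. F (s c m) = c * F m" for F :: "'m \<Rightarrow> 'k" and m
  proof -
    have z: "F 0 = 0" using F(2)[of 0 0] by simp
    have "F (sum h A) = (\<Sum>a\<in>A. F (h a))" for h :: "'a \<Rightarrow> 'm" and A
      by (induction A rule: infinite_finite_induct) (auto simp: z F)
    hence "F (\<Sum>a\<in>B. s (co m a) (\<beta> a)) = (\<Sum>a\<in>B. F (\<beta> a) * co m a)" by (simp add: F mult.commute)
    thus ?thesis using co[of m] by simp
  qed
  have "linear_trace g w = (\<Sum>a\<in>B. coordinates g B (w a) a)"
    by (simp add: linear_trace_def B_def Let_def)
  also have "\<dots> = (\<Sum>a\<in>B. co (s (F1 (\<beta> a)) x + s (F2 (\<beta> a)) y) a)"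
    unfolding co_def by (intro sum.cong refl) (metis \<beta> w)
  also have "\<dots> = (\<Sum>a\<in>B. F1 (\<beta> a) * co x a + F2 (\<beta> a) * co y a)"
    by (intro sum.cong refl) (simp add: co_lin)
  also have "\<dots> = F1 x + F2 y" using Fsum[OF F1, of x] Fsum[OF F2, of y] by (simp add: sum.distrib)
  finally show ?thesis .
qed

text \<open>The trace of the composite with v is v(x)_0 + v(D x)_1. For x in \<open>N p\<close>
  compatibility of v with the shift makes it 0. Otherwise a functional that vanishes on the image of
  D (or of D^2) and is 1 at x (or at D x) yields a morphism v with trace 1 (or 2), and 2 is not
  zero.\<close>

lemma negligible_iff:
  assumes x: "x \<in> T p"
  shows "hm p x \<in> block_negligible g d p \<longleftrightarrow> x \<in> N p"
proof
  let ?n = "block_size p"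
  let ?J = "jordan_space (block_size p) :: ('k, nat \<Rightarrow> 'k) module"
  let ?H = "rep_hom g d ?J (jordan_shift ?n)"
  {
    fix v assume "v \<in> carrier ?H"
    hence v: "\<And>m. v (\<phi> m) \<in> carrier ?J" "\<And>m n. v (\<phi> m \<oplus>\<^bsub>g\<^esub> \<phi> n) = v (\<phi> m) \<oplus>\<^bsub>?J\<^esub> v (\<phi> n)"
      "\<And>c m. v (c \<odot>\<^bsub>g\<^esub> \<phi> m) = c \<odot>\<^bsub>?J\<^esub> v (\<phi> m)" "\<And>m. v (d (\<phi> m)) = jordan_shift ?n (v (\<phi> m))"
      using \<phi>_simps(5) by (auto simp: rep_hom_def)
    have add: "v (\<phi> (m + n)) i = v (\<phi> m) i + v (\<phi> n) i" and scl: "v (\<phi> (s c m)) i = c * v (\<phi> m) i" for m n c i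
      using v(2)[of m n] v(3)[of c m] by (simp_all add: \<phi>_simps(1,2) jordan_simps)
    have "compose (carrier g) (hm p x) v (\<phi> m) = \<phi> (s (v (\<phi> m) 0) x + s (v (\<phi> m) 1) (D x))" for m
      using v(1)[of m] \<phi>_simps(5) by (simp add: compose_def hm_apply)
    hence "linear_trace g (compose (carrier g) (hm p x) v) = v (\<phi> x) 0 + v (\<phi> (D x)) 1"
      by (intro trace_rank_two) (simp_all add: add scl)
  } note trace = this
  have hom: "hm p x \<in> carrier (rep_hom ?J (jordan_shift ?n) g d)"
    using x hm_carrier[of p] by (auto simp: block_homs_def)
  {
    assume xN: "x \<in> N p"
    have "linear_trace g (compose (carrier g) (hm p x) v) = 0" if "v \<in> carrier ?H" for v
    proof -
      have v: "\<And>m. v (\<phi> m) \<in> carrier ?J" "\<And>m. v (\<phi> (D m)) = jordan_shift ?n (v (\<phi> m))"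
        using \<phi>_simps(5) that by (auto simp: rep_hom_def simp flip: d)
      have "v (\<phi> x) 0 + v (\<phi> (D x)) 1 = 0"
      proof (cases p)
        case zero
        then obtain u where "x = D u" using xN by (auto simp: N_def)
        thus ?thesis using v(1)[of "D x"] v(2)[of u] zero
          by (simp add: jordan_shift_def jordan_carrier block_size_def)
      next
        case one
        then obtain u where u: "D x = D (D u)" using xN by (auto simp: N_def)
        have "v (\<phi> (D x)) 1 = v (\<phi> (D u)) 0" using v(2)[of "D u"] u one
          by (simp add: jordan_shift_def block_size_def)
        also have "\<dots> = 0" using v(2)[of u] by (simp add: jordan_shift_def)
        finally have "v (\<phi> (D x)) 1 = 0" .
        moreover have "v (\<phi> (D x)) 1 = v (\<phi> x) 0"
          using v(2)[of x] one by (simp add: jordan_shift_def block_size_def)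
        ultimately show ?thesis by simp
      qed
      thus ?thesis using trace[OF that] by simp
    qed
    thus "hm p x \<in> block_negligible g d p"
      using hom by (simp add: block_negligible_def negligible_homs_def)
  }
  {
    assume "hm p x \<in> block_negligible g d p"
    hence neg: "\<And>v. v \<in> carrier ?H \<Longrightarrow> v (\<phi> x) 0 + v (\<phi> (D x)) 1 = 0"
      using trace by (simp add: block_negligible_def negligible_homs_def)
    show "x \<in> N p"
    proof (rule ccontr)
      assume xN: "x \<notin> N p"
      show False
      proof (cases p)
        case zero
        have "x \<notin> range D" using x xN zero by (simp add: N_def T_def)
        from separating_functional[OF range_D_subspace(1) this]
        obtain f where f: "\<And>y z. f (y + z) = f y + f z" "\<And>c y. f (s c y) = c * f y"
          "\<And>y. y \<in> range D \<Longrightarrow> f y = 0" "f x = 1" by metis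
        define v where "v = (\<lambda>a\<in>carrier g. (\<lambda>i::nat. if i = 0 then f (inv_into UNIV \<phi> a) else (0::'k)))"
        have "v (\<phi> m) = (\<lambda>i. if i = 0 then f m else 0)" for m
          using \<phi>_simps(5) by (auto simp: v_def inv_\<phi> fun_eq_iff)
        note v = this
        have "v \<in> extensional (carrier g)" by (simp add: v_def)
        hence "v \<in> carrier ?H"
          unfolding rep_hom_def carrier_\<phi>
          by (auto simp: PiE_def v \<phi>_hom d f jordan_simps jordan_carrier jordan_shift_def block_size_def zero)
        from neg[OF this] show False by (simp add: v f(4))
      next
        case one
        have "D x \<notin> range (\<lambda>u. D (D u))" using x xN one by (simp add: N_def T_def)
        from separating_functional[OF range_D_subspace(2) this]
        obtain f where f: "\<And>y z. f (y + z) = f y + f z" "\<And>c y. f (s c y) = c * f y"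
          "\<And>y. y \<in> range (\<lambda>u. D (D u)) \<Longrightarrow> f y = 0" "f (D x) = 1" by metis
        \<comment> \<open>f vanishes on the image of D^2, so m -> (f (D m), f m) sends D m to (0, f
          (D m)) and commutes with the shift.\<close>
        define v where "v = (\<lambda>a\<in>carrier g. (\<lambda>i::nat. if i = 0 then f (D (inv_into UNIV \<phi> a)) else if i = 1 then f (inv_into UNIV \<phi> a) else (0::'k)))"
        have "v (\<phi> m) = (\<lambda>i. if i = 0 then f (D m) else if i = 1 then f m else 0)" for m
          using \<phi>_simps(5) by (auto simp: v_def inv_\<phi> fun_eq_iff)
        note v = this
        have "v \<in> extensional (carrier g)" by (simp add: v_def)
        hence "v \<in> carrier ?H"
          unfolding rep_hom_def carrier_\<phi>
          by (auto simp: PiE_def v \<phi>_hom d f D_simps jordan_simps jordan_carrier jordan_shift_def block_size_def one)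
        from neg[OF this] have "(1::'k) + 1 = 0" by (simp add: v f(4))
        thus False using two by simp
      qed
    qed
  }
qed

lemma block_negligible_eq: "block_negligible g d p = hm p ` N p"
proof -
  have "block_negligible g d p \<subseteq> hm p ` T p"
    using hm_carrier[of p] by (auto simp: block_negligible_def negligible_homs_def block_homs_def)
  thus ?thesis using negligible_iff N_T by blast
qed

definition cls :: "bit \<Rightarrow> 'm \<Rightarrow> ((nat \<Rightarrow> 'k) \<Rightarrow> 'a) set"
  where "cls p x = block_negligible g d p +>\<^bsub>block_homs g d p\<^esub> hm p x"

lemma cls_simps:
  shows cls_mem: "x \<in> T p \<Longrightarrow> cls p x = {hm p y | y. y \<in> T p \<and> y - x \<in> N p}"
    and cls_eq: "x \<in> T p \<Longrightarrow> y \<in> T p \<Longrightarrow> cls p x = cls p y \<longleftrightarrow> x - y \<in> N p"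
    and cls_add: "x \<in> T p \<Longrightarrow> y \<in> T p \<Longrightarrow> cls p (x + y) = cls p x <+>\<^bsub>block_homs g d p\<^esub> cls p y"
    and cls_scale: "x \<in> T p \<Longrightarrow> cls p (s c x) = rcoset_smult (block_homs g d p) (block_negligible g d p) c (cls p x)"
proof -
  have N0: "{0} \<subseteq> N p" using N_subspace subspace_0 by blast
  note * = presented_cosets[where f = "hm p" and L = "block_homs g d p" and C = "T p" and K = "N p" and Z = "{0}",
      OF hm_add hm_scale _ T_subspace N_subspace N_T N0]
  show "x \<in> T p \<Longrightarrow> cls p x = {hm p y | y. y \<in> T p \<and> y - x \<in> N p}"
    unfolding cls_def block_negligible_eq by (rule *(1)) (simp_all add: hm_inj)
  show "x \<in> T p \<Longrightarrow> y \<in> T p \<Longrightarrow> cls p x = cls p y \<longleftrightarrow> x - y \<in> N p"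
    unfolding cls_def block_negligible_eq by (rule *(2)) (simp_all add: hm_inj)
  show "x \<in> T p \<Longrightarrow> y \<in> T p \<Longrightarrow> cls p (x + y) = cls p x <+>\<^bsub>block_homs g d p\<^esub> cls p y"
    unfolding cls_def block_negligible_eq by (rule *(3)) (simp_all add: hm_inj)
  show "x \<in> T p \<Longrightarrow> cls p (s c x) = rcoset_smult (block_homs g d p) (block_negligible g d p) c (cls p x)"
    unfolding cls_def block_negligible_eq by (rule *(4)) (simp_all add: hm_inj)
qed

definition bx :: "bit \<Rightarrow> bit \<Rightarrow> 'm \<Rightarrow> 'm \<Rightarrow> 'm"
  where "bx p q x y = (if p = 1 \<and> q = 1 then b (D x) y - b x (D y) else b x y)"

lemma bb_\<iota>: "bb (\<iota> p x) (\<iota> q y) = \<iota> (p + q) (bx p q x y)"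
  by (cases p; cases q) (simp_all add: bb_def \<iota>_def bx_def)

lemma bx_T: "x \<in> T p \<Longrightarrow> y \<in> T q \<Longrightarrow> bx p q x y \<in> T (p + q)"
  by (cases p; cases q) (simp_all add: T_def bx_def D_simps D_mult D_cube)

text \<open>For mixed parities the value on the second basis vector comes out right because the even
  factor is killed by D, so that D of the bracket only differentiates the odd factor.\<close>

lemma fused_bracket_hm:
  assumes "x \<in> T p" "y \<in> T q"
  shows "fused_bracket g p q (hm p x) (hm q y) = hm (p + q) (bx p q x y)"
proof (rule extensionalityI[of _ "carrier (jordan_space (block_size (p + q)))"])
  show "fused_bracket g p q (hm p x) (hm q y) \<in> extensional (carrier (jordan_space (block_size (p + q))))"
    by (simp add: fused_bracket_def)
  show "hm (p + q) (bx p q x y) \<in> extensional (carrier (jordan_space (block_size (p + q))))" by (simp add: hm_def)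
  fix v :: "nat \<Rightarrow> 'k" assume v: "v \<in> carrier (jordan_space (block_size (p + q)))"
  define dd where "dd a x = (if a = 0 then x else D x)" for a :: nat and x
  have e: "hm r z (jordan_vec a) = \<phi> (dd a z)" if "a < block_size r" for r z a
  proof -
    have "jordan_vec a \<in> carrier (jordan_space (block_size r))"
      using that by (auto simp: jordan_carrier jordan_vec_def)
    from hm_apply[OF this] have "hm r z (jordan_vec a) = \<phi> (s (jordan_vec a 0) z + s (jordan_vec a 1) (D z))" .
    moreover have "a = 0 \<or> a = 1" using that by (auto simp: block_size_def split: if_splits)
    ultimately show ?thesis by (auto simp: jordan_vec_def dd_def)
  qed
  interpret M: Module.module "scalars :: 'k ring" g by (rule presents_module[OF g subspace_UNIV])
  have inner: "(\<Oplus>\<^bsub>g\<^esub>c\<in>{..<block_size q}. block_fusion p q v a c \<odot>\<^bsub>g\<^esub> (hm p x (jordan_vec a) \<otimes>\<^bsub>g\<^esub> hm q y (jordan_vec c)))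
     = \<phi> (\<Sum>c\<in>{..<block_size q}. s (block_fusion p q v a c) (b (dd a x) (dd c y)))" if "a < block_size p" for a
  proof -
    have "(\<Oplus>\<^bsub>g\<^esub>c\<in>{..<block_size q}. block_fusion p q v a c \<odot>\<^bsub>g\<^esub> (hm p x (jordan_vec a) \<otimes>\<^bsub>g\<^esub> hm q y (jordan_vec c)))
      = (\<Oplus>\<^bsub>g\<^esub>c\<in>{..<block_size q}. \<phi> (s (block_fusion p q v a c) (b (dd a x) (dd c y))))"
      using that \<phi>_simps(5) by (intro M.M.finsum_cong') (auto simp: e \<phi>_hom)
    also have "\<dots> = \<phi> (\<Sum>c\<in>{..<block_size q}. s (block_fusion p q v a c) (b (dd a x) (dd c y)))"
      by (rule presents_finsum[OF g subspace_UNIV]) simp_all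
    finally show ?thesis .
  qed
  have "fused_bracket g p q (hm p x) (hm q y) v = (\<Oplus>\<^bsub>g\<^esub>a\<in>{..<block_size p}.
      \<phi> (\<Sum>c\<in>{..<block_size q}. s (block_fusion p q v a c) (b (dd a x) (dd c y))))"
    unfolding fused_bracket_def using v inner \<phi>_simps(5) by simp (intro M.M.finsum_cong'; auto)
  also have "\<dots> = \<phi> (\<Sum>a\<in>{..<block_size p}. \<Sum>c\<in>{..<block_size q}. s (block_fusion p q v a c) (b (dd a x) (dd c y)))"
    by (rule presents_finsum[OF g subspace_UNIV]) simp_all
  also have "\<dots> = hm (p + q) (bx p q x y) v"
    using v assms by (cases p; cases q)
      (auto simp: hm_apply \<phi>_simps(4) bx_def block_fusion_def block_size_def dd_def T_def D_mult lessThan_Suc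
        numeral_2_eq_2 jordan_carrier scale_right_diff_distrib)
  finally show "fused_bracket g p q (hm p x) (hm q y) v = hm (p + q) (bx p q x y) v" .
qed

lemma pair_lie: "pair.lie_mod SP SZ"
  by (rule pair_lie_mod[OF cube])

text \<open>The union runs over representatives, and all of them give the same class since
  \<open>SZ\<close> is an ideal.\<close>

lemma class_bracket_cls:
  assumes x: "x \<in> T p" and y: "y \<in> T q"
  shows "class_bracket g d p q (cls p x) (cls q y) = cls (p + q) (bx p q x y)"
proof -
  have "block_negligible g d (p + q) +>\<^bsub>block_homs g d (p + q)\<^esub> fused_bracket g p q u w = cls (p + q) (bx p q x y)"
    if "u \<in> cls p x" "w \<in> cls q y" for u w
  proof -
    obtain x' where x': "u = hm p x'" "x' \<in> T p" "x' - x \<in> N p" using \<open>u \<in> cls p x\<close> cls_mem[OF x] by blast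
    obtain y' where y': "w = hm q y'" "y' \<in> T q" "y' - y \<in> N q" using \<open>w \<in> cls q y\<close> cls_mem[OF y] by blast
    note I = pair.ideal_ofD[OF pair.lie_mod_total(2)[OF pair_lie]]
    have tot: "\<iota> r z \<in> pair.total SP" if "z \<in> T r" for r z
      using \<iota>_SP[OF that] pair.lie_mod_total(3)[OF pair_lie] by blast
    have "\<iota> (p + q) (bx p q x' y' - bx p q x y) = bb (\<iota> p x') (\<iota> q (y' - y)) + bb (\<iota> p (x' - x)) (\<iota> q y)"
      unfolding \<iota>_diff bb_\<iota>[symmetric] by (simp add: pair.b_diff_right pair.b_diff_left)
    also have "\<dots> \<in> SZ"
      using x'(3) y'(3) by (intro pair.subspace_add[OF I(1)] I(3,4) tot x'(2) y) (simp_all add: \<iota>_SZ)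
    finally have "bx p q x' y' - bx p q x y \<in> N (p + q)" by (simp add: \<iota>_SZ)
    hence "cls (p + q) (bx p q x' y') = cls (p + q) (bx p q x y)"
      using cls_eq[OF bx_T[OF x'(2) y'(2)] bx_T[OF x y]] by blast
    thus ?thesis by (simp add: x' y' fused_bracket_hm cls_def)
  qed
  moreover have "hm p x \<in> cls p x" "hm q y \<in> cls q y"
    using cls_mem[OF x] cls_mem[OF y] x y subspace_0[OF N_subspace] by auto
  ultimately show ?thesis unfolding class_bracket_def by blast
qed

text \<open>From here on traces and morphisms are gone: the semisimplification is the quotient of
  the pairs by \<open>SZ\<close>.\<close>

theorem semisimplification_presented:
  "presents ss bb (pair.total SP) SP SZ (\<lambda>(x, y). (cls 0 x, cls 1 y)) (semisimplification g d)"
proof -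
  have tot: "(x, y) \<in> pair.total SP \<longleftrightarrow> x \<in> T 0 \<and> y \<in> T 1" for x y
    by (simp add: pair_total T_def)
  have SZ: "(x, y) \<in> SZ \<longleftrightarrow> x \<in> N 0 \<and> y \<in> N 1" for x y
    by (auto simp: SZ_def N_def)
  have quot: "a_rcosets\<^bsub>block_homs g d p\<^esub> (block_negligible g d p) = cls p ` T p" for p
    unfolding A_RCOSETS_def' hm_carrier cls_def by blast
  have cls0: "cls p 0 = block_negligible g d p" for p
  proof -
    have "cls p 0 = {hm p y | y. y \<in> T p \<and> y \<in> N p}"
      using cls_mem[OF subspace_0[OF T_subspace]] by simp
    thus ?thesis using N_T[of p] unfolding block_negligible_eq by blast
  qed
  have T0: "0 \<in> T p" for p using subspace_0[OF T_subspace] .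
  show ?thesis
    unfolding presents_def
  proof (intro conjI allI ballI)
    show "(\<lambda>(x, y). (cls 0 x, cls 1 y)) ` pair.total SP = carrier (semisimplification g d)"
      by (auto simp: semisimplification_def Let_def quot tot image_iff)
    show "(\<lambda>(x, y). (cls 0 x, cls 1 y)) ` SP p = part (semisimplification g d) p" for p
      by (cases p) (auto simp: semisimplification_def Let_def quot SP_def T_def cls0 image_iff)
    show "(case 0 of (x, y) \<Rightarrow> (cls 0 x, cls 1 y)) = \<zero>\<^bsub>semisimplification g d\<^esub>"
      by (simp add: zero_prod_def semisimplification_def Let_def cls0)
  next
    fix z w assume zw: "z \<in> pair.total SP" "w \<in> pair.total SP"
    obtain x y x' y' where e: "z = (x, y)" "w = (x', y')" by (cases z; cases w)
    have t: "x \<in> T 0" "y \<in> T 1" "x' \<in> T 0" "y' \<in> T 1" using zw by (simp_all add: e tot)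
    show "(case z of (x, y) \<Rightarrow> (cls 0 x, cls 1 y)) = (case w of (x, y) \<Rightarrow> (cls 0 x, cls 1 y)) \<longleftrightarrow> z - w \<in> SZ"
      by (simp add: e t cls_eq SZ)
    show "(case z + w of (x, y) \<Rightarrow> (cls 0 x, cls 1 y)) = (case z of (x, y) \<Rightarrow> (cls 0 x, cls 1 y))
        \<oplus>\<^bsub>semisimplification g d\<^esub> (case w of (x, y) \<Rightarrow> (cls 0 x, cls 1 y))"
      by (simp add: e t cls_add semisimplification_def Let_def)
    have "x \<in> T 0" "bx 0 0 x x' \<in> T 0" "bx 1 1 y y' \<in> T 0" "bx 0 1 x y' \<in> T 1" "bx 1 0 y x' \<in> T 1"
      using bx_T[OF t(1,3)] bx_T[OF t(2,4)] bx_T[OF t(1,4)] bx_T[OF t(2,3)] t(1) by simp_all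
    thus "(case bb z w of (x, y) \<Rightarrow> (cls 0 x, cls 1 y)) = (case z of (x, y) \<Rightarrow> (cls 0 x, cls 1 y))
        \<otimes>\<^bsub>semisimplification g d\<^esub> (case w of (x, y) \<Rightarrow> (cls 0 x, cls 1 y))"
      using class_bracket_cls[OF t(1,3)] class_bracket_cls[OF t(2,4)] class_bracket_cls[OF t(1,4)] class_bracket_cls[OF t(2,3)]
      by (simp add: e bb_def semisimplification_def Let_def flip: cls_add) (simp add: bx_def)
  next
    fix c z assume z: "z \<in> pair.total SP"
    obtain x y where e: "z = (x, y)" by (cases z)
    show "(case ss c z of (x, y) \<Rightarrow> (cls 0 x, cls 1 y)) = c \<odot>\<^bsub>semisimplification g d\<^esub> (case z of (x, y) \<Rightarrow> (cls 0 x, cls 1 y))"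
      using z by (simp add: e tot ss_def cls_scale semisimplification_def Let_def)
  qed
qed

end

section \<open>The root lattice of type E8\<close>

lemma exhaust_8:
  fixes i :: 8
  shows "i = 1 \<or> i = 2 \<or> i = 3 \<or> i = 4 \<or> i = 5 \<or> i = 6 \<or> i = 7 \<or> i = 8"
proof (induct i)
  case (of_int z)
  hence "0 \<le> z" "z < 8" by simp_all
  hence "z = 0 \<or> z = 1 \<or> z = 2 \<or> z = 3 \<or> z = 4 \<or> z = 5 \<or> z = 6 \<or> z = 7" by arith
  thus ?case by auto
qed

lemma UNIV_8: "(UNIV :: 8 set) = {1, 2, 3, 4, 5, 6, 7, 8}"
proof (rule Set.set_eqI)
  show "i \<in> UNIV \<longleftrightarrow> i \<in> {1, 2, 3, 4, 5, 6, 7, 8}" for i :: 8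
    using exhaust_8[of i] by simp
qed

lemma forall_8: "(\<forall>i::8. Q i) \<longleftrightarrow> Q 1 \<and> Q 2 \<and> Q 3 \<and> Q 4 \<and> Q 5 \<and> Q 6 \<and> Q 7 \<and> Q 8"
proof -
  have "(\<forall>i::8. Q i) \<longleftrightarrow> (\<forall>i\<in>(UNIV :: 8 set). Q i)" by simp
  thus ?thesis unfolding UNIV_8 by simp
qed

lemma sum_8: "(\<Sum>i\<in>UNIV. f (i::8)) = f 1 + f 2 + f 3 + f 4 + f 5 + f 6 + f 7 + f 8"
  unfolding UNIV_8 by (simp add: add.assoc)

lemma vector_8:
  "(vector [a, b, c, d, e, f, g, h] :: 'a::zero ^ 8) $ 1 = a" "(vector [a, b, c, d, e, f, g, h] :: 'a ^ 8) $ 2 = b"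
  "(vector [a, b, c, d, e, f, g, h] :: 'a ^ 8) $ 3 = c" "(vector [a, b, c, d, e, f, g, h] :: 'a ^ 8) $ 4 = d"
  "(vector [a, b, c, d, e, f, g, h] :: 'a ^ 8) $ 5 = e" "(vector [a, b, c, d, e, f, g, h] :: 'a ^ 8) $ 6 = f"
  "(vector [a, b, c, d, e, f, g, h] :: 'a ^ 8) $ 7 = g" "(vector [a, b, c, d, e, f, g, h] :: 'a ^ 8) $ 8 = h"
  unfolding vector_def by simp_all

lemmas cartan_e8_simps = cartan_e8_def vector_8

text \<open>\<open>e8half\<close> is a bilinear form with \<open>e8half x y + e8half y x = (x | y)\<close>; modulo 2 it is the
  exponent of the usual sign cocycle of the root lattice.\<close>

definition e8half :: "int^8 \<Rightarrow> int^8 \<Rightarrow> int"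
  where "e8half x y = x$1 * (y$1 - y$3) + x$2 * (y$2 - y$4) + x$3 * (y$3 - y$4) + x$4 * (y$4 - y$5)
    + x$5 * (y$5 - y$6) + x$6 * (y$6 - y$7) + x$7 * (y$7 - y$8) + x$8 * y$8"

definition e8form :: "int^8 \<Rightarrow> int^8 \<Rightarrow> int"
  where "e8form x y = e8half x y + e8half y x"

definition is_root :: "int^8 \<Rightarrow> bool"
  where "is_root a \<longleftrightarrow> e8half a a = 1"

lemma e8half_simps:
  "e8half (x + y) z = e8half x z + e8half y z" "e8half x (y + z) = e8half x y + e8half x z"
  "e8half (- x) y = - e8half x y" "e8half x (- y) = - e8half x y"
  "e8half (x - y) z = e8half x z - e8half y z" "e8half x (y - z) = e8half x y - e8half x z"
  "e8half 0 x = 0" "e8half x 0 = 0"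
proof -
  show *: "e8half (x + y) z = e8half x z + e8half y z" "e8half x (y + z) = e8half x y + e8half x z"
    "e8half (- x) y = - e8half x y" "e8half x (- y) = - e8half x y" for x y z
    unfolding e8half_def vector_add_component vector_uminus_component ring_distribs
    by (linarith, linarith, simp_all)
  show "e8half (x - y) z = e8half x z - e8half y z" "e8half x (y - z) = e8half x y - e8half x z"
    using *(1)[of x "- y" z] *(2)[of x y "- z"] by (simp_all add: *(3,4))
  show "e8half 0 x = 0" "e8half x 0 = 0"
    by (simp_all add: e8half_def)
qed

lemma e8form_simps:
  "e8form (x + y) z = e8form x z + e8form y z" "e8form x (y + z) = e8form x y + e8form x z"
  "e8form (- x) y = - e8form x y" "e8form x (- y) = - e8form x y"
  "e8form (x - y) z = e8form x z - e8form y z" "e8form x (y - z) = e8form x y - e8form x z"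
  "e8form 0 x = 0" "e8form x 0 = 0"
  by (simp_all add: e8form_def e8half_simps)

lemma e8form_sym: "e8form x y = e8form y x"
  by (simp add: e8form_def)

lemma e8form_self: "is_root a \<Longrightarrow> e8form a a = 2"
  by (simp add: is_root_def e8form_def)

lemma e8form_axis: "e8form (axis i 1) (axis j 1) = cartan_e8 $ i $ j"
proof -
  have "\<forall>i j. e8form (axis i 1) (axis j 1) = cartan_e8 $ i $ j"
    unfolding forall_8 by (simp add: e8form_def e8half_def axis_def cartan_e8_simps)
  thus ?thesis by blast
qed

lemma e8form_sum: "e8form x y = (\<Sum>i\<in>UNIV. x $ i * e8form (axis i 1) y)"
proof -
  have "(\<Sum>i\<in>UNIV. x $ i * e8form (axis i 1) y) = e8half x y + e8half y x"
    unfolding sum_8 e8form_def e8half_def axis_def by simp (unfold ring_distribs, simp)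
  thus ?thesis by (simp add: e8form_def)
qed

text \<open>Squares are completed from the leaves 1, 2 and 8 towards the branch node 4. What remains
  at node 4 is 1/60 of its square, and the factor 120 clears all denominators. Hence the form is
  positive definite.\<close>

lemma e8half_squares:
  "120 * e8half x x = 30 * (2 * x$1 - x$3)\<^sup>2 + 10 * (3 * x$3 - 2 * x$4)\<^sup>2 + 30 * (2 * x$2 - x$4)\<^sup>2
    + 30 * (2 * x$8 - x$7)\<^sup>2 + 10 * (3 * x$7 - 2 * x$6)\<^sup>2 + 5 * (4 * x$6 - 3 * x$5)\<^sup>2
    + 3 * (5 * x$5 - 4 * x$4)\<^sup>2 + 2 * (x$4)\<^sup>2"
  unfolding e8half_def power2_eq_square ring_distribs by (simp add: mult_ac)

lemma e8half_nonneg: "e8half x x \<ge> 0"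
proof -
  have "120 * e8half x x \<ge> 0" unfolding e8half_squares by simp
  thus ?thesis by simp
qed

lemma e8half_zero: "e8half x x = 0 \<longleftrightarrow> x = 0"
proof
  assume "e8half x x = 0"
  hence z: "30 * (2 * x$1 - x$3)\<^sup>2 + 10 * (3 * x$3 - 2 * x$4)\<^sup>2 + 30 * (2 * x$2 - x$4)\<^sup>2
    + 30 * (2 * x$8 - x$7)\<^sup>2 + 10 * (3 * x$7 - 2 * x$6)\<^sup>2 + 5 * (4 * x$6 - 3 * x$5)\<^sup>2
    + 3 * (5 * x$5 - 4 * x$4)\<^sup>2 + 2 * (x$4)\<^sup>2 = 0"
    using e8half_squares[of x] by simp
  have n: "(2 * x$1 - x$3)\<^sup>2 \<ge> 0" "(3 * x$3 - 2 * x$4)\<^sup>2 \<ge> 0" "(2 * x$2 - x$4)\<^sup>2 \<ge> 0" "(2 * x$8 - x$7)\<^sup>2 \<ge> 0"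
    "(3 * x$7 - 2 * x$6)\<^sup>2 \<ge> 0" "(4 * x$6 - 3 * x$5)\<^sup>2 \<ge> 0" "(5 * x$5 - 4 * x$4)\<^sup>2 \<ge> 0" "(x$4)\<^sup>2 \<ge> 0" by simp_all
  have "(2 * x$1 - x$3)\<^sup>2 = 0 \<and> (3 * x$3 - 2 * x$4)\<^sup>2 = 0 \<and> (2 * x$2 - x$4)\<^sup>2 = 0 \<and> (2 * x$8 - x$7)\<^sup>2 = 0 \<and>
    (3 * x$7 - 2 * x$6)\<^sup>2 = 0 \<and> (4 * x$6 - 3 * x$5)\<^sup>2 = 0 \<and> (5 * x$5 - 4 * x$4)\<^sup>2 = 0 \<and> (x$4)\<^sup>2 = 0"
    using z n by linarith
  hence "x$1 = 0 \<and> x$2 = 0 \<and> x$3 = 0 \<and> x$4 = 0 \<and> x$5 = 0 \<and> x$6 = 0 \<and> x$7 = 0 \<and> x$8 = 0" by simp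
  thus "x = 0" unfolding vec_eq_iff forall_8 by simp
qed (simp add: e8half_simps)

lemma is_root_nonzero: "is_root a \<Longrightarrow> a \<noteq> 0"
  by (auto simp: is_root_def e8half_simps)

lemma is_root_minus [simp]: "is_root (- a) \<longleftrightarrow> is_root a"
  by (simp add: is_root_def e8half_simps)

lemma e8half_add_self: "e8half (a + c) (a + c) = e8half a a + e8half c c + e8form a c"
  by (simp add: e8half_simps e8form_def)

lemma is_root_add: "is_root a \<Longrightarrow> is_root c \<Longrightarrow> is_root (a + c) \<longleftrightarrow> e8form a c = - 1"
  unfolding is_root_def e8half_add_self by auto

lemma is_root_diff: "is_root a \<Longrightarrow> is_root c \<Longrightarrow> is_root (a - c) \<longleftrightarrow> e8form a c = 1"
  using is_root_add[of a "- c"] by (auto simp: e8form_simps)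

lemma root_add_zero: "is_root a \<Longrightarrow> is_root c \<Longrightarrow> a + c = 0 \<longleftrightarrow> e8form a c = - 2"
  unfolding is_root_def using e8half_add_self[of a c] e8half_zero[of "a + c"] by auto

lemma root_eq: "is_root a \<Longrightarrow> is_root c \<Longrightarrow> a = c \<longleftrightarrow> e8form a c = 2"
  using root_add_zero[of a "- c"] by (auto simp: e8form_simps)

text \<open>Positivity at a + c and a - c, where \<open>e8half\<close> takes the values 2 + (a|c)
  and 2 - (a|c).\<close>

lemma root_form_bounds:
  assumes "is_root a" "is_root c" shows "- 2 \<le> e8form a c" "e8form a c \<le> 2"
  using assms e8half_nonneg[of "a + c"] e8half_nonneg[of "a + (- c)"]
  unfolding e8half_add_self is_root_def by (simp_all add: e8form_simps e8half_simps)

lemma is_root_axis [simp]: "is_root (axis i 1)"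
  unfolding is_root_def
proof -
  have "\<forall>i. cartan_e8 $ i $ i = 2" unfolding forall_8 by (simp add: cartan_e8_simps)
  thus "e8half (axis i 1) (axis i 1) = 1" using e8form_axis[of i i] by (simp add: e8form_def)
qed

text \<open>Write a = u - v with u, v nonnegative of disjoint support. Then (u|v) is at most 0,
  because off-diagonal entries of the Cartan matrix are not positive. So the integers
  \<open>e8half u u\<close> and \<open>e8half v v\<close> add up to at most 1, and one of them is
  0.\<close>

lemma root_one_sided:
  assumes a: "is_root a"
  shows "(\<forall>i. a $ i \<ge> 0) \<or> (\<forall>i. a $ i \<le> 0)"
proof -
  define u v :: "int^8" where "u = (\<chi> i. max (a $ i) 0)" and "v = (\<chi> i. max (- a $ i) 0)"
  have a_uv: "a = u + (- v)" by (auto simp: vec_eq_iff u_def v_def)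
  have z: "u $ i * v $ i = 0" for i by (auto simp: u_def v_def max_def)
  have n: "u $ i * v $ j \<ge> 0" for i j by (auto simp: u_def v_def)
  have "e8form u v \<le> 0"
  proof -
    have "e8form u v = 2 * (\<Sum>i\<in>UNIV. u $ i * v $ i) - (u$1 * v$3 + u$3 * v$1) - (u$2 * v$4 + u$4 * v$2)
      - (u$3 * v$4 + u$4 * v$3) - (u$4 * v$5 + u$5 * v$4) - (u$5 * v$6 + u$6 * v$5) - (u$6 * v$7 + u$7 * v$6)
      - (u$7 * v$8 + u$8 * v$7)"
      unfolding e8form_def e8half_def sum_8 ring_distribs by (simp add: mult.commute)
    also have "(\<Sum>i\<in>UNIV. u $ i * v $ i) = 0" by (simp add: z)
    finally show ?thesis
      using n[of 1 3] n[of 3 1] n[of 2 4] n[of 4 2] n[of 3 4] n[of 4 3] n[of 4 5] n[of 5 4] n[of 5 6] n[of 6 5]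
        n[of 6 7] n[of 7 6] n[of 7 8] n[of 8 7] by linarith
  qed
  moreover have "e8half u u + e8half v v - e8form u v = 1"
    using a unfolding is_root_def a_uv e8half_add_self by (simp add: e8form_simps e8half_simps)
  ultimately have "e8half u u = 0 \<or> e8half v v = 0"
    using e8half_nonneg[of u] e8half_nonneg[of v] by linarith
  hence "u = 0 \<or> v = 0" by (simp add: e8half_zero)
  thus ?thesis
  proof
    assume "u = 0"
    hence "max (a $ i) 0 = 0" for i unfolding u_def vec_eq_iff by simp
    hence "a $ i \<le> 0" for i by (metis max.cobounded1)
    thus ?thesis by blast
  next
    assume "v = 0"
    hence "max (- a $ i) 0 = 0" for i unfolding v_def vec_eq_iff by simp
    hence "a $ i \<ge> 0" for i by (metis max.cobounded1 neg_le_0_iff_le)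
    thus ?thesis by blast
  qed
qed

text \<open>The pairings of a root with the simple roots lie between -2 and 2, and by definiteness
  they determine the root.\<close>

lemma finite_roots: "finite {a. is_root a}"
proof -
  define c where "c a = (\<chi> i. e8form (axis i 1) a)" for a
  have "inj c"
  proof (rule injI)
    fix x y assume "c x = c y"
    hence "e8form (axis i 1) (x - y) = 0" for i
      by (simp add: c_def vec_eq_iff e8form_simps)
    hence "e8form (x - y) (x - y) = 0" by (subst e8form_sum) simp
    hence "e8half (x - y) (x - y) = 0" by (simp add: e8form_def)
    thus "x = y" by (simp add: e8half_zero)
  qed
  moreover have "c ` {a. is_root a} \<subseteq> vec_lambda ` (UNIV \<rightarrow>\<^sub>E {-2..2})"
  proof
    fix x assume "x \<in> c ` {a. is_root a}"
    then obtain a where "is_root a" "x = c a" by blast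
    hence "x = vec_lambda (\<lambda>i. e8form (axis i 1) a)" "(\<lambda>i. e8form (axis i 1) a) \<in> UNIV \<rightarrow>\<^sub>E {-2..2}"
      using root_form_bounds[OF is_root_axis] by (auto simp: c_def)
    thus "x \<in> vec_lambda ` (UNIV \<rightarrow>\<^sub>E {-2..2})" by blast
  qed
  moreover have "finite (vec_lambda ` (UNIV \<rightarrow>\<^sub>E {-2..2 :: int}) :: (int^8) set)"
    by (intro finite_imageI finite_PiE) auto
  ultimately show ?thesis by (metis finite_imageD finite_subset inj_on_subset subset_UNIV)
qed

text \<open>2 = (a|a) is the sum of the a_j (alpha_j|a), so some term is positive. The value
  (alpha_j|a) = 2 would make a simple, which leaves 1. The set S is empty for E_8 itself and {1, 2,
  8} for g(8,3).\<close>

lemma simple_neighbour: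
  assumes a: "is_root a" "\<forall>i. a $ i \<ge> 0" and "\<forall>i. a \<noteq> axis i 1" and S: "\<forall>i\<in>S. e8form (axis i 1) a \<le> 0"
  shows "\<exists>j. j \<notin> S \<and> a $ j > 0 \<and> e8form (axis j 1) a = 1"
proof -
  have "(\<Sum>i\<in>UNIV. a $ i * e8form (axis i 1) a) > 0"
    using e8form_self[OF a(1)] unfolding e8form_sum[of a a] by simp
  then obtain j where j: "a $ j * e8form (axis j 1) a > 0" by (meson sum_nonpos not_le)
  moreover have "a $ j \<ge> 0" using a(2) by blast
  ultimately have "a $ j > 0" "e8form (axis j 1) a > 0" by (auto simp: zero_less_mult_iff)
  moreover have "e8form (axis j 1) a \<noteq> 2" using root_eq[OF is_root_axis a(1)] assms(3) by metis
  ultimately show ?thesis using root_form_bounds(2)[OF is_root_axis a(1), of j] S by (intro exI[of _ j]) force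
qed

typedef e8_root = "{a :: int^8. is_root a}"
  morphisms root_vector Abs_root
  by (rule exI[of _ "axis 1 1"]) simp

instance e8_root :: finite
proof
  have "UNIV = Abs_root ` {a. is_root a}"
    using root_vector_inverse root_vector by (metis (no_types, lifting) UNIV_eq_I imageI)
  thus "finite (UNIV :: e8_root set)" using finite_roots by (metis finite_imageI)
qed

lemma is_root_root_vector [simp]: "is_root (root_vector \<alpha>)"
  using root_vector by simp

lemma root_vector_Abs: "is_root a \<Longrightarrow> root_vector (Abs_root a) = a"
  by (simp add: Abs_root_inverse)

definition e8sign :: "int^8 \<Rightarrow> int^8 \<Rightarrow> 'k::field"
  where "e8sign x y = (if even (e8half x y) then 1 else - 1)"

lemma e8sign_add: "e8sign (x + y) z = e8sign x z * e8sign y z" "e8sign x (y + z) = e8sign x y * e8sign x z"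
  by (auto simp: e8sign_def e8half_simps)

lemma e8sign_minus: "e8sign (- x) y = e8sign x y" "e8sign x (- y) = e8sign x y"
  by (auto simp: e8sign_def e8half_simps)

lemma e8sign_swap: "e8sign y x = (if even (e8form x y) then e8sign x y else - e8sign x y)"
  by (auto simp: e8sign_def e8form_def)

lemma e8sign_self: "is_root a \<Longrightarrow> e8sign a a = - 1"
  by (simp add: e8sign_def is_root_def)

lemma e8sign_square: "e8sign x y * e8sign x y = 1" "e8sign x y * (e8sign x y * c) = c"
  by (simp_all add: e8sign_def)

lemma e8sign_nonzero: "e8sign x y \<noteq> 0"
  by (simp add: e8sign_def)

section \<open>The Lie algebra of type E8\<close>

locale e8_realization =
  fixes R :: "('k::field, 8, 'v::ab_group_add) realization"
  assumes realization: "is_realization cartan_e8 R"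
begin

lemma scale_vector_space: "vector_space (scale R)"
  using realization unfolding is_realization_def finite_dimensional_vector_space_def by blast

sublocale V: vector_space "scale R" by (rule scale_vector_space)

lemma root_simps: "root R j (u + v) = root R j u + root R j v" "root R j (scale R c v) = c * root R j v"
proof -
  have "Vector_Spaces.linear (scale R) (*) (root R j)" using realization by (simp add: is_realization_def)
  then interpret L: Vector_Spaces.linear "scale R" "(*)" "root R j" .
  show "root R j (u + v) = root R j u + root R j v" "root R j (scale R c v) = c * root R j v"
    by (simp_all add: L.add L.scale)
qed

lemma root_coroot: "root R j (coroot R i) = of_int (cartan_e8 $ i $ j)"
  using realization by (simp add: is_realization_def)

lemma coroot_independent: "(\<Sum>i\<in>UNIV. scale R (c i) (coroot R i)) = 0 \<Longrightarrow> c i = 0"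
  using realization by (simp add: is_realization_def)

lemma cartan_e8_sym: "cartan_e8 $ i $ j = cartan_e8 $ j $ i"
  using e8form_axis[of i j] e8form_axis[of j i] e8form_sym by metis

lemma e8sign_diff: "e8sign (x - y) z = e8sign x z * e8sign y z" "e8sign x (y - z) = e8sign x y * e8sign x z"
  using e8sign_add(1)[of x "- y" z] e8sign_add(2)[of x y "- z"] by (simp_all add: e8sign_minus)

text \<open>The lattice is simply laced, so roots and coroots are identified: for a root a this is
  its coroot. \<open>rf\<close> extends the simple roots to the lattice in the same way.\<close>

definition hc :: "int^8 \<Rightarrow> 'v"
  where "hc a = (\<Sum>i\<in>UNIV. scale R (of_int (a $ i)) (coroot R i))"

definition rf :: "int^8 \<Rightarrow> 'v \<Rightarrow> 'k"
  where "rf a v = (\<Sum>i\<in>UNIV. of_int (a $ i) * root R i v)"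

lemma hc_simps: "hc (a + c) = hc a + hc c" "hc (- a) = - hc a" "hc 0 = 0"
  by (simp_all add: hc_def V.scale_left_distrib sum.distrib V.scale_minus_left sum_negf)

lemma rf_simps: "rf (a + c) v = rf a v + rf c v" "rf (- a) v = - rf a v" "rf 0 v = 0"
  "rf a (u + v) = rf a u + rf a v" "rf a (scale R k v) = k * rf a v"
  by (simp_all add: rf_def root_simps ring_distribs sum.distrib sum_negf sum_distrib_left mult.left_commute)

lemma rf_zero [simp]: "rf a 0 = 0"
  using rf_simps(5)[of a 0 0] by simp

lemma rf_minus: "rf a (- v) = - rf a v"
  using rf_simps(4)[of a v "- v"] by (simp add: eq_neg_iff_add_eq_0 add.commute)

lemma rf_sum: "rf a (sum f A) = (\<Sum>i\<in>A. rf a (f i))"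
  by (induction A rule: infinite_finite_induct) (simp_all add: rf_simps)

lemma hc_axis: "hc (axis i 1) = coroot R i"
proof -
  have "hc (axis i 1) = (\<Sum>j\<in>UNIV. if j = i then coroot R j else 0)"
    unfolding hc_def by (intro sum.cong) (auto simp: axis_def)
  thus ?thesis by simp
qed

lemma rf_axis: "rf (axis i 1) v = root R i v"
proof -
  have "rf (axis i 1) v = (\<Sum>j\<in>UNIV. if j = i then root R j v else 0)"
    unfolding rf_def by (intro sum.cong) (auto simp: axis_def)
  thus ?thesis by simp
qed

lemma rf_hc: "rf a (hc c) = of_int (e8form c a)"
proof -
  have "rf a (hc c) = (\<Sum>i\<in>UNIV. of_int (c $ i) * (\<Sum>j\<in>UNIV. of_int (a $ j) * of_int (cartan_e8 $ i $ j)))"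
    unfolding hc_def rf_sum rf_simps by (simp add: rf_def root_coroot)
  also have "\<dots> = of_int (\<Sum>i\<in>UNIV. c $ i * (\<Sum>j\<in>UNIV. a $ j * e8form (axis j 1) (axis i 1)))"
    by (simp add: e8form_axis cartan_e8_sym)
  also have "(\<Sum>i\<in>UNIV. c $ i * (\<Sum>j\<in>UNIV. a $ j * e8form (axis j 1) (axis i 1))) = e8form c a"
    unfolding e8form_sum[of c a] by (simp add: e8form_sum[of a] e8form_sym[of "axis _ 1" a])
  finally show ?thesis .
qed

definition sc :: "'k \<Rightarrow> 'v \<times> ('k^e8_root) \<Rightarrow> 'v \<times> ('k^e8_root)"
  where "sc c x = (scale R c (fst x), (\<chi> \<alpha>. c * snd x $ \<alpha>))"

text \<open>The lattice construction of a simply laced Lie algebra: [e_a, e_c] = +- e_{a+c} with the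
  cocycle sign, and [e_a, e_-a] = - h_a, where the minus is the sign of the pair (a, -a). It is the
  reason for taking f_i to be minus the vector of root - alpha_i later on.\<close>

definition br :: "'v \<times> ('k^e8_root) \<Rightarrow> 'v \<times> ('k^e8_root) \<Rightarrow> 'v \<times> ('k^e8_root)"
  where "br x y =
    (\<Sum>\<alpha>\<in>UNIV. scale R (snd x $ \<alpha> * snd y $ Abs_root (- root_vector \<alpha>)) (hc (- root_vector \<alpha>)),
     \<chi> \<gamma>. rf (root_vector \<gamma>) (fst x) * snd y $ \<gamma> - rf (root_vector \<gamma>) (fst y) * snd x $ \<gamma> +
      (\<Sum>\<alpha>\<in>UNIV. \<Sum>\<beta>\<in>UNIV. snd x $ \<alpha> * snd y $ \<beta> *
        (if root_vector \<alpha> + root_vector \<beta> = root_vector \<gamma> then e8sign (root_vector \<alpha>) (root_vector \<beta>) else 0)))"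

sublocale M: bilinear_algebra sc br
proof
  show "br (x + y) z = br x z + br y z" "br x (y + z) = br x y + br x z" for x y z
    by (simp_all add: br_def prod_eq_iff vec_eq_iff ring_distribs V.scale_left_distrib sum.distrib rf_simps)
  show "br (sc c x) y = sc c (br x y)" "br x (sc c y) = sc c (br x y)" for c x y
    by (simp_all add: br_def sc_def prod_eq_iff vec_eq_iff rf_simps V.scale_sum_right sum_distrib_left
        right_diff_distrib distrib_left mult_ac)
qed (simp_all add: sc_def prod_eq_iff vec_eq_iff V.scale_left_distrib V.scale_right_distrib ring_distribs)

definition hv :: "'v \<Rightarrow> 'v \<times> ('k^e8_root)"
  where "hv v = (v, 0)"

text \<open>The value 0 outside the roots lets the formula for [e_a, e_c] cover the case in which a
  + c is neither a root nor 0.\<close>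

definition ev :: "int^8 \<Rightarrow> 'v \<times> ('k^e8_root)"
  where "ev a = (if is_root a then (0, axis (Abs_root a) 1) else 0)"

lemma hv_simps: "hv (u + v) = hv u + hv v" "hv (scale R c v) = sc c (hv v)" "hv (- v) = - hv v" "hv 0 = 0"
  by (simp_all add: hv_def sc_def prod_eq_iff vec_eq_iff)

lemma ev_nonroot: "\<not> is_root a \<Longrightarrow> ev a = 0"
  by (simp add: ev_def)

lemma decompose: "x = hv (fst x) + (\<Sum>\<alpha>\<in>UNIV. sc (snd x $ \<alpha>) (ev (root_vector \<alpha>)))"
proof -
  have "(\<Sum>\<alpha>\<in>A. sc (snd x $ \<alpha>) (ev (root_vector \<alpha>))) = (0, \<chi> \<gamma>. \<Sum>\<alpha>\<in>A. if \<alpha> = \<gamma> then snd x $ \<alpha> else 0)" for A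
  proof (induction A rule: infinite_finite_induct)
    case (insert \<alpha> A)
    thus ?case by (auto simp: sc_def ev_def root_vector_inverse prod_eq_iff vec_eq_iff axis_def)
  qed (simp_all add: prod_eq_iff vec_eq_iff)
  thus ?thesis by (simp add: hv_def prod_eq_iff vec_eq_iff)
qed

lemma M_induct [case_names hv ev add scale]:
  assumes "\<And>v. Q (hv v)" "\<And>a. is_root a \<Longrightarrow> Q (ev a)"
    and add: "\<And>x y. Q x \<Longrightarrow> Q y \<Longrightarrow> Q (x + y)" and scale: "\<And>c x. Q x \<Longrightarrow> Q (sc c x)"
  shows "Q x"
proof -
  have "Q (\<Sum>\<alpha>\<in>A. sc (snd x $ \<alpha>) (ev (root_vector \<alpha>)))" for A
  proof (induction A rule: infinite_finite_induct)
    case (insert \<alpha> A) thus ?case using assms(2)[OF is_root_root_vector] add scale by simp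
  qed (use assms(1)[of 0] in \<open>simp_all add: hv_simps\<close>)
  thus ?thesis using add[OF assms(1)] decompose[of x] by metis
qed

lemma br_hh: "br (hv u) (hv v) = 0"
  by (simp add: br_def hv_def prod_eq_iff vec_eq_iff)

lemma br_he: "br (hv v) (ev a) = sc (rf a v) (ev a)"
  by (auto simp: br_def hv_def ev_def sc_def prod_eq_iff vec_eq_iff axis_def root_vector_Abs)

lemma br_eh: "br (ev a) (hv v) = - sc (rf a v) (ev a)"
  by (auto simp: br_def hv_def ev_def sc_def prod_eq_iff vec_eq_iff axis_def root_vector_Abs)

lemma br_ee:
  assumes a: "is_root a" and c: "is_root c"
  shows "br (ev a) (ev c) = (if a + c = 0 then hv (- hc a) else sc (e8sign a c) (ev (a + c)))"
proof -
  have fst: "fst (br (ev a) (ev c)) = (if a + c = 0 then - hc a else 0)"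
  proof -
    have "fst (br (ev a) (ev c)) = (\<Sum>\<alpha>\<in>UNIV. if \<alpha> = Abs_root a then if a + c = 0 then - hc a else 0 else 0)"
      unfolding br_def fst_conv
    proof (intro sum.cong refl)
      fix \<alpha>
      have "Abs_root (- a) = Abs_root c \<longleftrightarrow> a + c = 0"
        using Abs_root_inject[of "- a" c] a c by (auto simp: eq_neg_iff_add_eq_0 neg_eq_iff_add_eq_0)
      thus "scale R (snd (ev a) $ \<alpha> * snd (ev c) $ Abs_root (- root_vector \<alpha>)) (hc (- root_vector \<alpha>)) =
          (if \<alpha> = Abs_root a then if a + c = 0 then - hc a else 0 else 0)"
        using a c by (auto simp: ev_def axis_def root_vector_Abs hc_simps)
    qed
    thus ?thesis by simp
  qed
  have snd: "snd (br (ev a) (ev c)) $ \<gamma> = (if a + c = root_vector \<gamma> then e8sign a c else 0)" for \<gamma>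
  proof -
    have tm: "snd (ev a) $ \<alpha> * snd (ev c) $ \<beta> *
        (if root_vector \<alpha> + root_vector \<beta> = root_vector \<gamma> then e8sign (root_vector \<alpha>) (root_vector \<beta>) else 0)
      = (if \<beta> = Abs_root c then if \<alpha> = Abs_root a then if a + c = root_vector \<gamma> then e8sign a c else 0 else 0 else 0)"
      for \<alpha> \<beta>
      using a c by (auto simp: ev_def axis_def root_vector_Abs)
    have "fst (ev d) = 0" for d by (simp add: ev_def)
    hence "snd (br (ev a) (ev c)) $ \<gamma> = (\<Sum>\<alpha>\<in>UNIV. \<Sum>\<beta>\<in>UNIV. snd (ev a) $ \<alpha> * snd (ev c) $ \<beta> *
        (if root_vector \<alpha> + root_vector \<beta> = root_vector \<gamma> then e8sign (root_vector \<alpha>) (root_vector \<beta>) else 0))"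
      by (simp add: br_def)
    thus ?thesis unfolding tm by simp
  qed
  show ?thesis
  proof (cases "a + c = 0")
    case True
    hence "snd (br (ev a) (ev c)) = 0"
      using is_root_nonzero[OF is_root_root_vector] by (auto simp: vec_eq_iff snd)
    thus ?thesis using True fst by (simp add: hv_def prod_eq_iff)
  next
    case False
    have "snd (sc k (ev d)) $ \<gamma> = (if d = root_vector \<gamma> then k else 0)" for k d \<gamma>
      by (auto simp: sc_def ev_def axis_def root_vector_Abs root_vector_inverse)
    hence "snd (br (ev a) (ev c)) = snd (sc (e8sign a c) (ev (a + c)))"
      by (simp add: vec_eq_iff snd)
    moreover have "fst (sc (e8sign a c) (ev (a + c))) = 0" by (simp add: sc_def ev_def)
    ultimately show ?thesis using False fst by (simp add: prod_eq_iff)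
  qed
qed

lemma br_skew: "br x y = - br y x"
proof (induction x rule: M_induct)
  case (hv u)
  show ?case
    by (induction y rule: M_induct) (simp_all add: br_hh br_he br_eh M.b_simps)
next
  case (ev a)
  show ?case
  proof (induction y rule: M_induct)
    case (ev c)
    show ?case
    proof (cases "a + c = 0")
      case True
      hence "c = - a" by (simp add: eq_neg_iff_add_eq_0 add.commute)
      thus ?thesis using \<open>is_root a\<close> by (simp add: br_ee hc_simps hv_simps)
    next
      case False
      show ?thesis
      proof (cases "is_root (a + c)")
        case True
        hence "e8form a c = - 1" using is_root_add \<open>is_root a\<close> \<open>is_root c\<close> by blast
        hence "e8sign c a = - (e8sign a c :: 'k)" by (simp add: e8sign_swap[of c a])
        thus ?thesis using \<open>is_root a\<close> \<open>is_root c\<close> False by (simp add: br_ee add.commute[of c a])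
      next
        case nr: False
        thus ?thesis using \<open>is_root a\<close> \<open>is_root c\<close> False by (simp add: br_ee add.commute[of c a] ev_nonroot)
      qed
    qed
  qed (simp_all add: br_he br_eh M.b_simps)
qed (simp_all add: M.b_simps)

section \<open>The Jacobi identity for E_8\<close>

lemma br_ee_right:
  assumes "is_root a" "is_root c" "is_root d"
  shows "br (ev a) (br (ev c) (ev d)) =
    (if c + d = 0 then sc (of_int (e8form a c)) (ev a)
     else if a + c + d = 0 then sc (e8sign c d) (hv (- hc a))
     else if is_root (c + d) then sc (e8sign c d * e8sign a (c + d)) (ev (a + c + d)) else 0)"
proof (cases "c + d = 0")
  case True
  thus ?thesis using assms by (simp add: br_ee br_eh rf_minus rf_hc e8form_sym)
next
  case False
  show ?thesis
  proof (cases "a + c + d = 0")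
    case True
    hence "c + d = - a" by (simp add: eq_neg_iff_add_eq_0 add_ac)
    thus ?thesis using assms True is_root_nonzero[OF assms(1)] by (simp add: br_ee M.b_simps)
  next
    case nz: False
    show ?thesis
    proof (cases "is_root (c + d)")
      case True
      thus ?thesis using assms False nz by (simp add: br_ee M.b_simps add.assoc)
    next
      case nr: False
      thus ?thesis using assms False nz by (simp add: br_ee M.b_simps ev_nonroot)
    qed
  qed
qed

definition cyc :: "'v \<times> ('k^e8_root) \<Rightarrow> 'v \<times> ('k^e8_root) \<Rightarrow> 'v \<times> ('k^e8_root) \<Rightarrow> 'v \<times> ('k^e8_root)"
  where "cyc x y z = br x (br y z) + br y (br z x) + br z (br x y)"

lemma cyc_rotate: "cyc x y z = cyc y z x"
  by (simp add: cyc_def add_ac)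

text \<open>The number (a|c) decides which of a + c and a - c are roots or 0, so its five possible
  values exhaust the cases.\<close>

lemma cyc_opposite:
  assumes a: "is_root a" and c: "is_root c"
  shows "cyc (ev a) (ev c) (ev (- c)) = 0"
proof -
  have b: "- 2 \<le> e8form a c" "e8form a c \<le> 2" using root_form_bounds[OF a c] .
  have ac: "a + c = 0 \<longleftrightarrow> e8form a c = - 2" "a = c \<longleftrightarrow> e8form a c = 2"
    "is_root (a + c) \<longleftrightarrow> e8form a c = - 1" "is_root (a - c) \<longleftrightarrow> e8form a c = 1"
    using a c by (auto simp: root_add_zero root_eq is_root_add is_root_diff)
  have s: "e8sign c c = (- 1 :: 'k)" using e8sign_self[OF c] .
  consider "e8form a c = - 2" | "e8form a c = - 1" | "e8form a c = 0" | "e8form a c = 1" | "e8form a c = 2"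
    using b by force
  thus ?thesis
  proof cases
    case 1
    hence "c = - a" using ac(1) by (simp add: eq_neg_iff_add_eq_0 add.commute)
    thus ?thesis using a is_root_nonzero[OF a] is_root_add[OF a a] root_add_zero[OF a a] e8form_self[OF a]
      unfolding cyc_def by (simp add: br_ee_right e8form_simps add_eq_0_iff flip: M.scale_left_distrib)
  next
    case 2
    hence "e8sign c a = - (e8sign a c :: 'k)" by (simp add: e8sign_swap[of c a])
    thus ?thesis using a c 2 ac is_root_nonzero[OF a] unfolding cyc_def
      by (simp add: br_ee_right e8sign_add e8sign_diff e8sign_minus s e8sign_square mult_ac add_ac)
  next
    case 3
    thus ?thesis using a c ac is_root_nonzero[OF a] unfolding cyc_def
      by (simp add: br_ee_right add_ac)
  next
    case 4
    thus ?thesis using a c 4 ac is_root_nonzero[OF a] unfolding cyc_def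
      by (simp add: br_ee_right e8sign_add e8sign_diff e8sign_minus s e8sign_square mult_ac add_ac)
  next
    case 5
    hence "c = a" using ac(2) by simp
    thus ?thesis using a is_root_nonzero[OF a] is_root_add[OF a a] root_add_zero[OF a a] e8form_self[OF a]
      unfolding cyc_def by (simp add: br_ee_right e8form_simps add_eq_0_iff flip: M.scale_left_distrib)
  qed
qed

text \<open>a + c is not a root, so two of the three terms remain. By bimultiplicativity their signs
  differ by the factor relating the orders of a and d, which is -1, and by that for a and c, which
  is 1; hence they cancel.\<close>

lemma cyc_orthogonal:
  assumes r: "is_root a" "is_root c" "is_root d"
    and f: "e8form a c = 0" "e8form c d = - 1" "e8form a d = - 1"
  shows "cyc (ev a) (ev c) (ev d) = 0"
proof -
  have nz: "c + d \<noteq> 0" "d + a \<noteq> 0" "a + c \<noteq> 0"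
    using f root_add_zero[OF r(2,3)] root_add_zero[OF r(3,1)] root_add_zero[OF r(1,2)] e8form_sym[of d a] by auto
  have rt: "is_root (c + d)" "is_root (d + a)" "\<not> is_root (a + c)"
    using f is_root_add[OF r(2,3)] is_root_add[OF r(3,1)] is_root_add[OF r(1,2)] e8form_sym[of d a] by auto
  have nz3: "a + c + d \<noteq> 0"
    using root_add_zero[OF r(1) rt(1)] f by (auto simp: e8form_simps add.assoc)
  have "e8sign d a = - (e8sign a d :: 'k)" "e8sign c a = (e8sign a c :: 'k)"
    using f by (simp_all add: e8sign_swap[of d a] e8sign_swap[of c a])
  thus ?thesis using nz nz3 rt unfolding cyc_def
    by (simp add: br_ee_right r add_ac e8sign_add mult_ac)
qed

text \<open>The signs of the pairs (a, c), (c, d), (d, a) coincide, so the cyclic sum is a multiple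
  of h_a + h_c + h_d, which is h of a + c + d = 0.\<close>

lemma cyc_zero_sum:
  assumes r: "is_root a" "is_root c" "is_root d" and z: "a + c + d = 0"
  shows "cyc (ev a) (ev c) (ev d) = 0"
proof -
  have d: "d = - a - c" using z by (simp add: algebra_simps eq_neg_iff_add_eq_0)
  have ac: "is_root (a + c)" using r(3) is_root_minus[of "a + c"] unfolding d by simp
  have nz: "c + d \<noteq> 0" "d + a \<noteq> 0" "a + c \<noteq> 0"
    using is_root_nonzero[OF r(1)] is_root_nonzero[OF r(2)] is_root_nonzero[OF ac] unfolding d by auto
  have z': "c + d + a = 0" "d + a + c = 0" using z by (simp_all add: add_ac)
  have s: "e8sign c d = - (e8sign c a :: 'k)" "e8sign d a = - (e8sign c a :: 'k)" "e8sign a c = - (e8sign c a :: 'k)"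
  proof -
    have "e8form a c = - 1" using ac is_root_add[OF r(1,2)] by blast
    thus "e8sign a c = - (e8sign c a :: 'k)" by (simp add: e8sign_swap[of a c] e8form_sym[of c a])
    have "e8sign c d = e8sign c (- a) * (e8sign c (- c) :: 'k)" unfolding d
      using e8sign_add(2)[of c "- a" "- c"] by simp
    thus "e8sign c d = - (e8sign c a :: 'k)" by (simp add: e8sign_minus e8sign_self[OF r(2)])
    have "e8sign d a = e8sign (- a) a * (e8sign (- c) a :: 'k)" unfolding d
      using e8sign_add(1)[of "- a" "- c" a] by simp
    thus "e8sign d a = - (e8sign c a :: 'k)" by (simp add: e8sign_minus e8sign_self[OF r(1)])
  qed
  have "hv (hc a) + hv (hc c) + hv (hc d) = 0"
    using z by (simp flip: hv_simps hc_simps)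
  hence "sc (e8sign c a) (hv (hc a) + hv (hc c) + hv (hc d)) = 0" by simp
  thus ?thesis using nz z z' unfolding cyc_def
    by (simp add: br_ee_right r s hv_simps M.scale_minus_left M.scale_minus_right M.scale_right_distrib)
qed

text \<open>If a + c + d is neither a root nor 0 and no two of the roots are opposite, every term
  vanishes. If it is a root, its half norm 3 + (a|c) + (c|d) + (d|a) is 1. Opposite roots being set
  aside, the value 2 is impossible as well: for a = c the other two pairings agree and would both be
  -2. This leaves 0, -1, -1 in some order.\<close>

lemma cyc_ev:
  assumes r: "is_root a" "is_root c" "is_root d"
  shows "cyc (ev a) (ev c) (ev d) = 0"
proof -
  let ?p = "e8form a c" and ?q = "e8form c d" and ?r = "e8form d a"
  consider "a + c + d = 0" | "c + d = 0" | "d + a = 0" | "a + c = 0"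
    | "\<not> is_root (a + c + d)" "a + c + d \<noteq> 0" "c + d \<noteq> 0" "d + a \<noteq> 0" "a + c \<noteq> 0"
    | "is_root (a + c + d)" "a + c + d \<noteq> 0" "c + d \<noteq> 0" "d + a \<noteq> 0" "a + c \<noteq> 0"
    by blast
  thus ?thesis
  proof cases
    case 1 thus ?thesis using cyc_zero_sum r by blast
  next
    case 2
    hence "d = - c" by (simp add: eq_neg_iff_add_eq_0 add.commute)
    thus ?thesis using cyc_opposite r by simp
  next
    case 3
    hence "a = - d" by (simp add: eq_neg_iff_add_eq_0 add.commute)
    thus ?thesis using cyc_opposite[OF r(2,3)] cyc_rotate[of "ev a"] by simp
  next
    case 4
    hence "c = - a" by (simp add: eq_neg_iff_add_eq_0 add.commute)
    thus ?thesis using cyc_opposite[OF r(3,1)] cyc_rotate[of "ev d"] by simp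
  next
    case 5
    have "c + d + a \<noteq> 0" "d + a + c \<noteq> 0" "\<not> is_root (c + d + a)" "\<not> is_root (d + a + c)"
      using 5 by (simp_all add: add_ac)
    thus ?thesis using 5 unfolding cyc_def by (simp add: br_ee_right r ev_nonroot)
  next
    case 6
    have "e8half (a + c + d) (a + c + d) = 3 + ?p + ?q + ?r"
      using r unfolding is_root_def by (simp add: e8half_add_self e8form_simps e8form_sym)
    hence sum: "?p + ?q + ?r = - 2" using 6(1) by (simp add: is_root_def)
    have lower: "?p \<noteq> - 2" "?q \<noteq> - 2" "?r \<noteq> - 2"
      using 6 root_add_zero[OF r(1,2)] root_add_zero[OF r(2,3)] root_add_zero[OF r(3,1)] by auto
    have upper: "?p \<noteq> 2" "?q \<noteq> 2" "?r \<noteq> 2"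
      using lower sum root_eq[OF r(1,2)] root_eq[OF r(2,3)] root_eq[OF r(3,1)]
        root_form_bounds[OF r(1,2)] root_form_bounds[OF r(2,3)] root_form_bounds[OF r(3,1)]
        e8form_sym[of a d] e8form_sym[of c a] e8form_sym[of d c] e8form_self[OF r(1)] e8form_self[OF r(2)] e8form_self[OF r(3)]
      by (smt (verit))+
    consider "?p = 0" "?q = - 1" "?r = - 1" | "?q = 0" "?r = - 1" "?p = - 1" | "?r = 0" "?p = - 1" "?q = - 1"
      using sum lower upper root_form_bounds[OF r(1,2)] root_form_bounds[OF r(2,3)] root_form_bounds[OF r(3,1)]
      by (smt (verit))
    thus ?thesis
    proof cases
      case 1 thus ?thesis using cyc_orthogonal[OF r] e8form_sym by metis
    next
      case 2
      have "cyc (ev c) (ev d) (ev a) = 0" by (rule cyc_orthogonal[OF r(2,3,1)]) (use 2 e8form_sym in metis)+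
      thus ?thesis using cyc_rotate by metis
    next
      case 3
      have "cyc (ev d) (ev a) (ev c) = 0" by (rule cyc_orthogonal[OF r(3,1,2)]) (use 3 e8form_sym in metis)+
      thus ?thesis using cyc_rotate by metis
    qed
  qed
qed

lemma cyc_linear:
  "cyc (x + x') y z = cyc x y z + cyc x' y z" "cyc (sc c x) y z = sc c (cyc x y z)"
  "cyc x (y + y') z = cyc x y z + cyc x y' z" "cyc x (sc c y) z = sc c (cyc x y z)"
  "cyc x y (z + z') = cyc x y z + cyc x y z'" "cyc x y (sc c z) = sc c (cyc x y z)"
  by (simp_all add: cyc_def M.b_simps M.scale_right_distrib add_ac)

lemma cyc_hv: "cyc (hv v) y z = 0"
proof (induction y rule: M_induct)
  case (hv u)
  show ?case
    by (induction z rule: M_induct)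
      (simp_all add: cyc_linear, simp_all add: cyc_def br_hh br_he br_eh M.b_simps mult.commute)
next
  case (ev a)
  show ?case
  proof (induction z rule: M_induct)
    case (ev c)
    show ?case
    proof (cases "a + c = 0")
      case True
      hence c: "c = - a" by (simp add: eq_neg_iff_add_eq_0 add.commute)
      show ?thesis using \<open>is_root a\<close> unfolding cyc_def c
        by (simp add: br_ee br_hh br_he br_eh M.b_simps rf_simps hc_simps hv_simps M.scale_minus_left)
    next
      case False
      show ?thesis
      proof (cases "is_root (a + c)")
        case True
        hence "e8form a c = - 1" using is_root_add \<open>is_root a\<close> \<open>is_root c\<close> by blast
        hence "e8sign c a = - (e8sign a c :: 'k)" by (simp add: e8sign_swap[of c a])
        thus ?thesis using \<open>is_root a\<close> \<open>is_root c\<close> False unfolding cyc_def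
          by (simp add: br_ee br_he br_eh M.b_simps rf_simps add.commute[of c a] mult_ac ring_distribs
              M.scale_left_distrib M.scale_right_distrib M.scale_minus_left)
      next
        case nr: False
        thus ?thesis using \<open>is_root a\<close> \<open>is_root c\<close> False unfolding cyc_def
          by (simp add: br_ee br_he br_eh M.b_simps add.commute[of c a] ev_nonroot)
      qed
    qed
  qed (simp_all add: cyc_linear, simp_all add: cyc_def br_hh br_he br_eh M.b_simps mult.commute)
qed (simp_all add: cyc_linear)

lemma cyc_zero: "cyc x y z = 0"
proof (induction x rule: M_induct)
  case (ev a)
  show ?case
  proof (induction y rule: M_induct)
    case (hv v) show ?case using cyc_hv cyc_rotate by metis
  next
    case (ev c)
    show ?case
    proof (induction z rule: M_induct)
      case (hv v) show ?case using cyc_hv cyc_rotate by metis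
    next
      case (ev d) show ?case by (rule cyc_ev; fact)
    qed (simp_all add: cyc_linear)
  qed (simp_all add: cyc_linear)
qed (simp_all add: cyc_linear cyc_hv)

lemma br_jacobi: "br x (br y z) = br (br x y) z + br y (br x z)"
  using cyc_zero[of x y z] br_skew[of "br x y" z] br_skew[of x z]
  by (simp add: cyc_def M.b_simps) (simp add: eq_neg_iff_add_eq_0 add_ac algebra_simps)

end

lemma (in bilinear_algebra) presents_finite_dimensional:
  assumes L: "presents s b UNIV P {0} \<phi> L" and S: "finite S" "span S = UNIV"
  shows "finite_dimensional L"
proof -
  note D = presentsD[OF L]
  obtain B where B: "B \<subseteq> S" "independent B" "S \<subseteq> span B" using maximal_independent_subset by blast
  have finB: "finite B" using B(1) S(1) finite_subset by blast
  have span: "span B = UNIV" using S(2) span_mono[OF B(3)] by (simp add: span_span top.extremum_unique)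
  interpret M: Module.module "scalars :: 'k ring" L by (rule presents_module[OF L subspace_UNIV])
  have inj: "\<phi> x = \<phi> y \<longleftrightarrow> x = y" for x y using D(4) by simp
  have injB: "inj_on \<phi> B" by (simp add: inj_on_def inj)
  have car: "\<phi> x \<in> carrier L" for x using D(1) by blast
  have fs: "(\<Oplus>\<^bsub>L\<^esub>a\<in>\<phi> ` B. c a \<odot>\<^bsub>L\<^esub> a) = \<phi> (\<Sum>x\<in>B. s (c (\<phi> x)) x)" for c
  proof -
    let ?i = "inv_into B \<phi>"
    have "(\<Oplus>\<^bsub>L\<^esub>a\<in>\<phi> ` B. c a \<odot>\<^bsub>L\<^esub> a) = (\<Oplus>\<^bsub>L\<^esub>a\<in>\<phi> ` B. \<phi> (s (c a) (?i a)))"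
    proof (rule M.M.finsum_cong'[OF refl])
      show "c a \<odot>\<^bsub>L\<^esub> a = \<phi> (s (c a) (?i a))" if "a \<in> \<phi> ` B" for a
        using that by (simp add: D(7) f_inv_into_f)
    qed (use car in auto)
    also have "\<dots> = \<phi> (\<Sum>a\<in>\<phi> ` B. s (c a) (?i a))"
      by (rule presents_finsum[OF L subspace_UNIV]) (use finB in auto)
    also have "(\<Sum>a\<in>\<phi> ` B. s (c a) (?i a)) = (\<Sum>x\<in>B. s (c (\<phi> x)) x)"
      using injB by (simp add: sum.reindex inv_into_f_f)
    finally show ?thesis .
  qed
  have "linear_basis L (\<phi> ` B)"
    unfolding linear_basis_def
  proof (intro conjI ballI)
    show "\<phi> ` B \<subseteq> carrier L" using car by blast
    fix a assume "a \<in> carrier L"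
    then obtain x where x: "a = \<phi> x" using D(1) by blast
    obtain u where u: "x = (\<Sum>v\<in>B. s (u v) v)"
      using span span_finite[OF finB] by (metis (no_types, lifting) UNIV_I imageE)
    show "\<exists>!c. c \<in> \<phi> ` B \<rightarrow>\<^sub>E UNIV \<and> a = (\<Oplus>\<^bsub>L\<^esub>b\<in>\<phi> ` B. c b \<odot>\<^bsub>L\<^esub> b)"
    proof (rule ex1I[of _ "restrict (\<lambda>a. u (inv_into B \<phi> a)) (\<phi> ` B)"])
      have "x = (\<Sum>v\<in>B. s (restrict (\<lambda>a. u (inv_into B \<phi> a)) (\<phi> ` B) (\<phi> v)) v)"
        unfolding u using injB by (intro sum.cong) (simp_all add: inv_into_f_f)
      thus "restrict (\<lambda>a. u (inv_into B \<phi> a)) (\<phi> ` B) \<in> \<phi> ` B \<rightarrow>\<^sub>E UNIV \<and>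
          a = (\<Oplus>\<^bsub>L\<^esub>b\<in>\<phi> ` B. restrict (\<lambda>a. u (inv_into B \<phi> a)) (\<phi> ` B) b \<odot>\<^bsub>L\<^esub> b)"
        unfolding fs x by simp
    next
      fix c assume c: "c \<in> \<phi> ` B \<rightarrow>\<^sub>E UNIV \<and> a = (\<Oplus>\<^bsub>L\<^esub>b\<in>\<phi> ` B. c b \<odot>\<^bsub>L\<^esub> b)"
      hence "(\<Sum>v\<in>B. s (u v) v) = (\<Sum>v\<in>B. s (c (\<phi> v)) v)" using u unfolding fs x by (simp add: inj)
      hence "(\<Sum>v\<in>B. s (c (\<phi> v) - u v) v) = 0" by (simp add: scale_left_diff_distrib sum_subtractf)
      hence "\<forall>v\<in>B. c (\<phi> v) - u v = 0" using independentD[OF B(2) finB subset_refl, of "\<lambda>v. c (\<phi> v) - u v"] by blast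
      thus "c = restrict (\<lambda>a. u (inv_into B \<phi> a)) (\<phi> ` B)"
        using c injB by (intro extensionalityI[of _ "\<phi> ` B"]) (auto simp: PiE_def inv_into_f_f)
    qed
  qed
  thus ?thesis unfolding finite_dimensional_def using finB by blast
qed

lemma (in lie_derivation) lie_algebra_in_Rep_alpha3I:
  assumes g: "presents s b UNIV P {0} \<phi> g" and P: "P 1 = {0}" and lie: "lie_superalgebra g"
    and fin: "finite_dimensional g" and d: "\<And>x. d (\<phi> x) = \<phi> (D x)"
  shows "lie_algebra_in_Rep_alpha3 g d"
proof -
  note G = presentsD[OF g]
  have car: "\<exists>x. a = \<phi> x" if "a \<in> carrier g" for a using that G(1) by blast
  have inc: "\<phi> x \<in> carrier g" for x using G(1) by blast
  show ?thesis
    unfolding lie_algebra_in_Rep_alpha3_def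
  proof (intro conjI ballI allI lie fin)
    show "part g 1 = {\<zero>\<^bsub>g\<^esub>}" using G(2)[of 1] P G(3) by simp
  next
    fix x assume "x \<in> carrier g"
    then obtain u where u: "x = \<phi> u" using car by blast
    show "d x \<in> carrier g" "d (d (d x)) = \<zero>\<^bsub>g\<^esub>" using inc G(3) by (simp_all add: u d D_cube)
    show "d (c \<odot>\<^bsub>g\<^esub> x) = c \<odot>\<^bsub>g\<^esub> d x" for c
      using G(7)[of u c] G(7)[of "D u" c] d[of "s c u"] by (simp add: u d D_scale)
    fix y assume "y \<in> carrier g"
    then obtain v where v: "y = \<phi> v" using car by blast
    show "d (x \<oplus>\<^bsub>g\<^esub> y) = d x \<oplus>\<^bsub>g\<^esub> d y"
      using G(5)[of u v] G(5)[of "D u" "D v"] d[of "u + v"] by (simp add: u v d D_add)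
    show "d (x \<otimes>\<^bsub>g\<^esub> y) = d x \<otimes>\<^bsub>g\<^esub> y \<oplus>\<^bsub>g\<^esub> x \<otimes>\<^bsub>g\<^esub> d y"
      using G(6)[of u v] G(6)[of "D u" v] G(6)[of u "D v"] G(5)[of "b (D u) v" "b u (D v)"] d[of "b u v"]
      by (simp add: u v d D_mult)
  qed
qed

section \<open>The lattice model is the contragredient Lie algebra of type E_8\<close>

context e8_realization
begin

definition eP :: "bit \<Rightarrow> ('v \<times> ('k^e8_root)) set"
  where "eP p = (if p = 0 then UNIV else {0})"

definition eG :: "int^8 \<Rightarrow> ('v \<times> ('k^e8_root)) set"
  where "eG q = (if q = 0 then range hv else range (\<lambda>c. sc c (ev q)))"

definition epr :: "int^8 \<Rightarrow> 'v \<times> ('k^e8_root) \<Rightarrow> 'v \<times> ('k^e8_root)"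
  where "epr q x = (if q = 0 then fst x else 0, \<chi> \<alpha>. if root_vector \<alpha> = q then snd x $ \<alpha> else 0)"

lemma eP_simps: "eP 0 = UNIV" "eP 1 = {0}"
  by (simp_all add: eP_def)

lemma total_eP: "M.total eP = UNIV"
proof -
  have "x \<in> M.total eP" for x
    unfolding M.total_def eP_simps by (intro CollectI exI[of _ x] exI[of _ 0]) simp
  thus ?thesis by blast
qed

lemma lie_mod_e8: "M.lie_mod eP {0}"
proof -
  have in1: "x = 0" if "x \<in> eP p" "p \<noteq> 0" for x p using that by (simp add: eP_def)
  have z: "0 \<in> eP p" for p by (simp add: eP_def)
  have bit0: "p + q = 0 \<longleftrightarrow> p = q" for p q :: bit by (cases p; cases q) simp_all
  show ?thesis
    unfolding M.lie_mod_def
  proof (intro conjI allI ballI impI)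
    show "M.subspace (eP p)" for p by (cases "p = 0") (simp_all add: eP_def)
    fix p q x y assume x: "x \<in> eP p" and y: "y \<in> eP q"
    show "br x y \<in> eP (p + q)"
      using in1[OF x] in1[OF y] z by (cases "p = 0"; cases "q = 0") (auto simp: eP_simps)
    show "br x y + sc (koszul_sign p q) (br y x) \<in> {0}"
      using in1[OF x] in1[OF y] br_skew[of x y] by (cases "p = 0"; cases "q = 0") (auto simp: koszul_sign_def)
    fix r z assume "z \<in> eP r"
    show "br x (br y z) - (br (br x y) z + sc (koszul_sign p q) (br y (br x z))) \<in> {0}"
      using in1[OF x] in1[OF y] br_jacobi[of x y z] by (cases "p = 0"; cases "q = 0") (auto simp: koszul_sign_def)
  qed (auto simp: eP_simps)
qed

lemma ev_eG: "ev q \<in> eG q"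
proof (cases "q = 0")
  case True
  hence "\<not> is_root q" using is_root_nonzero by blast
  thus ?thesis using True hv_simps(4) by (metis eG_def ev_nonroot rangeI)
next
  case False thus ?thesis by (auto simp: eG_def intro!: image_eqI[of _ _ 1])
qed

lemma eG_subspace: "M.subspace (eG q)"
proof (rule M.subspaceI)
  show "0 \<in> eG q" by (auto simp: eG_def intro!: image_eqI[of _ _ 0] simp: hv_simps)
  show "x + y \<in> eG q" if "x \<in> eG q" "y \<in> eG q" for x y
    using that by (auto simp: eG_def simp flip: hv_simps M.scale_left_distrib split: if_splits)
  show "sc c x \<in> eG q" if "x \<in> eG q" for c x
    using that by (auto simp: eG_def simp flip: hv_simps split: if_splits)
qed

lemma eG_mult:
  assumes "x \<in> eG p" "y \<in> eG q"
  shows "br x y \<in> eG (p + q)"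
proof (cases "p = 0"; cases "q = 0")
  assume "p = 0" "q = 0"
  then obtain u v where "x = hv u" "y = hv v" using assms by (auto simp: eG_def)
  thus ?thesis using M.subspace_0[OF eG_subspace] by (simp add: br_hh)
next
  assume *: "p = 0" "q \<noteq> 0"
  then obtain v c where "x = hv v" "y = sc c (ev q)" using assms by (auto simp: eG_def)
  thus ?thesis using * M.subspace_scale[OF eG_subspace ev_eG[of q]] by (simp add: br_he M.b_simps)
next
  assume *: "p \<noteq> 0" "q = 0"
  then obtain v c where "x = sc c (ev p)" "y = hv v" using assms by (auto simp: eG_def)
  thus ?thesis using * M.subspace_neg[OF eG_subspace M.subspace_scale[OF eG_subspace ev_eG[of p]]]
    by (simp add: br_eh M.b_simps)
next
  assume *: "p \<noteq> 0" "q \<noteq> 0"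
  then obtain c d where xy: "x = sc c (ev p)" "y = sc d (ev q)" using assms by (auto simp: eG_def)
  have "br (ev p) (ev q) \<in> eG (p + q)"
  proof (cases "is_root p \<and> is_root q")
    case True
    thus ?thesis using M.subspace_scale[OF eG_subspace ev_eG[of "p + q"]]
      by (simp add: br_ee) (simp add: eG_def)
  next
    case False
    thus ?thesis using M.subspace_0[OF eG_subspace] by (auto simp: ev_nonroot)
  qed
  thus ?thesis using M.subspace_scale[OF eG_subspace] unfolding xy by (simp add: M.b_simps)
qed

lemma coroot_nonzero: "scale R c (coroot R i) = 0 \<Longrightarrow> c = 0"
proof -
  assume *: "scale R c (coroot R i) = 0"
  have "(\<Sum>j\<in>UNIV. scale R (if j = i then c else 0) (coroot R j)) = (\<Sum>j\<in>UNIV. if j = i then scale R c (coroot R j) else 0)"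
    by (intro sum.cong) auto
  also have "\<dots> = 0" using * by simp
  finally show "c = 0" using coroot_independent[of "\<lambda>j. if j = i then c else 0" i] by simp
qed

text \<open>If q is not a root, its piece is zero and any index with positive coordinate does.
  Otherwise (alpha_j|q) = 1 rules out that alpha_j + q is a root or 0.\<close>

lemma e8_raising_direction:
  assumes q: "q \<noteq> 0" "\<forall>i. q $ i \<ge> 0" "\<forall>i. q \<noteq> axis i 1"
  shows "\<exists>j. q $ j > 0 \<and> (is_root q \<longrightarrow> \<not> is_root (axis j 1 + q) \<and> axis j 1 + q \<noteq> 0 \<and> e8form (axis j 1) q = 1)"
proof (cases "is_root q")
  case True
  then obtain j where j: "q $ j > 0" "e8form (axis j 1) q = 1"
    using simple_neighbour[OF True q(2,3), of "{}"] by auto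
  thus ?thesis using is_root_add[OF is_root_axis True] root_add_zero[OF is_root_axis True, of j]
    by (intro exI[of _ j]) auto
next
  case False
  obtain j where "q $ j \<noteq> 0" using q(1) by (auto simp: vec_eq_iff)
  thus ?thesis using q(2) False by (intro exI[of _ j]) (auto simp: order_less_le)
qed

lemma e8_contragredient_model:
  "contragredient_model sc br eP {0} parity_e8 R (\<lambda>i. ev (axis i 1)) (\<lambda>i. - ev (- axis i 1)) hv eG epr"
proof
  show "M.lie_mod eP {0}" by (rule lie_mod_e8)
  show "ev (axis i 1) \<in> eP (parity_e8 i)" "- ev (- axis i 1) \<in> eP (parity_e8 i)" "hv v \<in> eP 0" for i v
    by (simp_all add: parity_e8_def eP_def)
  show "hv (u + v) = hv u + hv v" "hv (scale R c v) = sc c (hv v)" for u v c by (rule hv_simps)+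
  show "br (ev (axis i 1)) (- ev (- axis j 1)) - (if i = j then hv (coroot R i) else 0) \<in> {0}" for i j
  proof (cases "i = j")
    case True
    thus ?thesis by (simp add: M.b_minus_right br_ee hv_simps hc_axis)
  next
    case False
    hence "axis i (1::int) \<noteq> axis j 1" by (simp add: axis_eq_axis)
    moreover have "\<not> is_root (axis i 1 - axis j 1)"
    proof
      assume "is_root (axis i 1 - axis j 1)"
      from root_one_sided[OF this] show False using False
        by (auto simp: axis_def dest: spec[of _ i] spec[of _ j])
    qed
    ultimately show ?thesis using False by (simp add: M.b_minus_right br_ee ev_nonroot)
  qed
  show "br (hv v) (ev (axis j 1)) - sc (root R j v) (ev (axis j 1)) \<in> {0}" for v j
    by (simp add: br_he rf_axis)
  show "br (hv v) (- ev (- axis j 1)) + sc (root R j v) (- ev (- axis j 1)) \<in> {0}" for v j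
    by (simp add: br_he rf_axis rf_simps M.b_minus_right M.scale_minus_left M.scale_minus_right)
  show "br (hv u) (hv v) \<in> {0}" for u v by (simp add: br_hh)
  show "v = 0" if "hv v \<in> {0}" for v using that by (simp add: hv_def prod_eq_iff)
  show "c = 0" if "scale R c (coroot R i) = 0" for c i using that by (rule coroot_nonzero)
  show "M.subspace (eG q)" for q by (rule eG_subspace)
  show "eG q \<subseteq> M.total eP" for q by (simp add: total_eP)
  show "ev (axis i 1) \<in> eG (axis i 1)" "- ev (- axis i 1) \<in> eG (- axis i 1)" for i
    using ev_eG M.subspace_neg[OF eG_subspace] by blast+
  show "hv v \<in> eG 0" for v by (simp add: eG_def)
  show "br x y \<in> eG (p + q)" if "x \<in> eG p" "y \<in> eG q" for x y p q using that by (rule eG_mult)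
  show "epr q (x + y) = epr q x + epr q y" for q x y
    by (simp add: epr_def prod_eq_iff vec_eq_iff)
  show "epr q x = x" if "x \<in> eG q" for x q
    using that is_root_nonzero[OF is_root_root_vector]
    by (auto simp: eG_def epr_def hv_def sc_def ev_def prod_eq_iff vec_eq_iff axis_def root_vector_Abs root_vector_inverse split: if_splits)
  show "epr q x = 0" if "x \<in> eG p" "p \<noteq> q" for x p q
    using that is_root_nonzero[OF is_root_root_vector]
    by (auto simp: eG_def epr_def hv_def sc_def ev_def prod_eq_iff vec_eq_iff axis_def root_vector_Abs root_vector_inverse split: if_splits)
  show "epr q z \<in> {0}" if "z \<in> {0}" for z q using that by (simp add: epr_def prod_eq_iff vec_eq_iff)
  show "\<exists>S g. finite S \<and> (\<forall>q\<in>S. g q \<in> eG q) \<and> x = sum g S" if "x \<in> M.total eP" for x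
  proof -
    define g where "g q = (if q = 0 then hv (fst x) else sc (snd x $ Abs_root q) (ev q))" for q
    have "sum g (insert 0 (range root_vector)) = g 0 + sum g (range root_vector)"
      using is_root_nonzero[OF is_root_root_vector] by (intro sum.insert) auto
    also have "sum g (range root_vector) = (\<Sum>\<alpha>\<in>UNIV. g (root_vector \<alpha>))"
      by (rule sum.reindex_cong[of root_vector]) (auto simp: inj_def root_vector_inject)
    also have "\<dots> = (\<Sum>\<alpha>\<in>UNIV. sc (snd x $ \<alpha>) (ev (root_vector \<alpha>)))"
      using is_root_nonzero[OF is_root_root_vector] by (intro sum.cong) (auto simp: g_def root_vector_inverse)
    finally have "x = sum g (insert 0 (range root_vector))"
      using decompose[of x] by (simp add: g_def)
    moreover have "\<forall>q\<in>insert 0 (range root_vector). g q \<in> eG q"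
      using M.subspace_scale[OF eG_subspace ev_eG] by (auto simp: g_def eG_def)
    ultimately show ?thesis by (intro exI[of _ "insert 0 (range root_vector)"] exI[of _ g]) auto
  qed
  show "\<exists>v. x - hv v \<in> {0}" if "x \<in> eG 0" for x using that by (auto simp: eG_def)
  show "\<exists>c. x - sc c (ev (axis i 1)) \<in> {0}" if "x \<in> eG (axis i 1)" for x i
    using that by (auto simp: eG_def axis_eq_0_iff)
  show "\<exists>c. x - sc c (- ev (- axis i 1)) \<in> {0}" if x: "x \<in> eG (- axis i 1)" for x i
  proof -
    obtain c where "x = sc c (ev (- axis i 1))" using x by (auto simp: eG_def axis_eq_0_iff)
    thus ?thesis by (intro exI[of _ "- c"]) (simp add: M.scale_minus_left M.scale_minus_right)
  qed
  show "eG q \<subseteq> {0}" if "q $ i > 0" "q $ j < 0" for q i j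
  proof -
    have "\<not> is_root q" using root_one_sided[of q] that by (metis not_le)
    moreover have "q \<noteq> 0" using that by auto
    ultimately show ?thesis by (auto simp: eG_def ev_nonroot)
  qed
  show "\<exists>j c. q $ j > 0 \<and> c \<noteq> 0 \<and> (\<forall>x\<in>eG q. br (ev (axis j 1)) x \<in> {0} \<and> br (hv (coroot R j)) x - sc c x \<in> {0})"
    if q: "q \<noteq> 0" "\<forall>i. q $ i \<ge> 0" "\<forall>i. q \<noteq> axis i 1" for q
  proof -
    obtain j where j: "q $ j > 0" "is_root q \<longrightarrow> \<not> is_root (axis j 1 + q) \<and> axis j 1 + q \<noteq> 0 \<and> e8form (axis j 1) q = 1"
      using e8_raising_direction[OF q] by blast
    have "br (ev (axis j 1)) x = 0 \<and> br (hv (coroot R j)) x = x" if xq: "x \<in> eG q" for x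
    proof -
      obtain c where x: "x = sc c (ev q)" using xq q by (auto simp: eG_def)
      show ?thesis using j unfolding x
        by (cases "is_root q") (auto simp: M.b_simps br_ee br_he ev_nonroot rf_hc simp flip: hc_axis)
    qed
    \<comment> \<open>The eigenvalue of h_j is (alpha_j|q) = 1.\<close>
    thus ?thesis using j(1) by (intro exI[of _ j] exI[of _ 1]) auto
  qed
  show "\<exists>j c. q $ j < 0 \<and> c \<noteq> 0 \<and> (\<forall>x\<in>eG q. br (- ev (- axis j 1)) x \<in> {0} \<and> br (hv (coroot R j)) x - sc c x \<in> {0})"
    if q: "q \<noteq> 0" "\<forall>i. q $ i \<le> 0" "\<forall>i. q \<noteq> - axis i 1" for q
  proof -
    have "\<exists>j. (- q) $ j > 0 \<and> (is_root (- q) \<longrightarrow> \<not> is_root (axis j 1 + - q) \<and> axis j 1 + - q \<noteq> 0 \<and> e8form (axis j 1) (- q) = 1)"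
      using q by (intro e8_raising_direction) (auto simp: minus_equation_iff[of q])
    then obtain j where j: "(- q) $ j > 0" "is_root q \<longrightarrow> \<not> is_root (axis j 1 - q) \<and> axis j 1 - q \<noteq> 0 \<and> e8form (axis j 1) q = - 1"
      by (auto simp: e8form_simps)
    have m: "is_root (- axis j 1 + q) \<longleftrightarrow> is_root (axis j 1 - q)" "- axis j 1 + q = 0 \<longleftrightarrow> axis j 1 - q = 0"
      using is_root_minus[of "axis j 1 - q"] by (auto simp: algebra_simps)
    have "br (ev (- axis j 1)) x = 0 \<and> br (hv (coroot R j)) x = - x" if xq: "x \<in> eG q" for x
    proof -
      obtain c where x: "x = sc c (ev q)" using xq q by (auto simp: eG_def)
      show ?thesis using j(2) m unfolding x
        by (cases "is_root q") (auto simp: M.b_simps br_ee br_he ev_nonroot rf_hc M.scale_minus_left simp flip: hc_axis)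
    qed
    thus ?thesis using j(1) by (intro exI[of _ j] exI[of _ "- 1"]) (auto simp: M.b_minus_left M.scale_minus_left)
  qed
qed

theorem e8_presented:
  obtains \<phi> where "presents sc br UNIV eP {0} \<phi> (contragredient parity_e8 R)"
    "\<And>i. \<phi> (ev (axis i 1)) = chevalley_e parity_e8 R i"
  using contragredient_model.contragredient_presented[OF e8_contragredient_model] unfolding total_eP by blast

lemma e8_lie_superalgebra:
  assumes "presents sc br UNIV eP {0} \<phi> L" shows "lie_superalgebra L"
  by (rule M.presents_lie_superalgebra[OF _ lie_mod_e8]) (use assms in \<open>simp add: total_eP\<close>)

lemma finite_span: "\<exists>S. finite S \<and> M.span S = UNIV"
proof -
  obtain B where "finite_dimensional_vector_space (scale R) B"
    using realization by (auto simp: is_realization_def)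
  then interpret F: finite_dimensional_vector_space "scale R" B .
  let ?S = "hv ` B \<union> ev ` {a. is_root a}"
  have hv: "hv v \<in> M.span ?S" for v
  proof -
    have "v \<in> V.span B" using F.span_Basis by simp
    thus ?thesis
    proof (induction rule: V.span_induct_alt)
      case base show ?case using M.span_zero by (simp add: hv_simps)
    next
      case (step c x y)
      have "hv x \<in> M.span ?S" using step(1) by (intro M.span_base) blast
      thus ?case using step(2) by (simp add: hv_simps M.span_add M.span_scale)
    qed
  qed
  have "x \<in> M.span ?S" for x
  proof (induction x rule: M_induct)
    case (ev a) thus ?case by (intro M.span_base) blast
  qed (simp_all add: hv M.span_add M.span_scale)
  moreover have "finite ?S" using F.finite_Basis finite_roots by simp
  ultimately show ?thesis by blast
qed

lemma e8_finite_dimensional: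
  assumes "presents sc br UNIV eP {0} \<phi> L" shows "finite_dimensional L"
  using finite_span M.presents_finite_dimensional[OF assms] by blast

end

section \<open>Degrees modulo the simple roots 1, 2, 8\<close>

lemma exhaust_5:
  fixes i :: 5
  shows "i = 1 \<or> i = 2 \<or> i = 3 \<or> i = 4 \<or> i = 5"
proof (induct i)
  case (of_int z)
  hence "0 \<le> z" "z < 5" by simp_all
  hence "z = 0 \<or> z = 1 \<or> z = 2 \<or> z = 3 \<or> z = 4" by arith
  thus ?case by auto
qed

lemma UNIV_5: "(UNIV :: 5 set) = {1, 2, 3, 4, 5}"
proof (rule Set.set_eqI)
  show "i \<in> UNIV \<longleftrightarrow> i \<in> {1, 2, 3, 4, 5}" for i :: 5
    using exhaust_5[of i] by simp
qed

lemma forall_5: "(\<forall>i::5. Q i) \<longleftrightarrow> Q 1 \<and> Q 2 \<and> Q 3 \<and> Q 4 \<and> Q 5"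
proof -
  have "(\<forall>i::5. Q i) \<longleftrightarrow> (\<forall>i\<in>(UNIV :: 5 set). Q i)" by simp
  thus ?thesis unfolding UNIV_5 by simp
qed

lemma sum_5: "(\<Sum>i\<in>UNIV. f (i::5)) = f 1 + f 2 + f 3 + f 4 + f 5"
  unfolding UNIV_5 by (simp add: add.assoc)

text \<open>The simple roots of \<open>g(8,3)\<close> are the classes of \<open>\<alpha>\<^sub>3, \<dots>, \<alpha>\<^sub>7\<close>; \<open>partner j\<close> is the neighbour of
  \<open>node j\<close> among 1, 2, 8. It exists exactly for odd \<open>j\<close>, and is a junk value otherwise.\<close>

definition node :: "5 \<Rightarrow> 8"
  where "node j = (if j = 1 then 3 else if j = 2 then 4 else if j = 3 then 5 else if j = 4 then 6 else 7)"

definition partner :: "5 \<Rightarrow> 8"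
  where "partner j = (if j = 1 then 1 else if j = 2 then 2 else 8)"

abbreviation ends :: "8 set"
  where "ends \<equiv> {1, 2, 8}"

abbreviation simple :: "8 \<Rightarrow> int^8"
  where "simple i \<equiv> axis i 1"

abbreviation "odd_index j \<equiv> parity_g83 j = 1"

definition rdeg :: "int^8 \<Rightarrow> int^5"
  where "rdeg a = (\<chi> j. a $ node j)"

text \<open>The bracket of the classes of \<open>e\<^sub>j\<close> and \<open>f\<^sub>j\<close> of \<open>g(8,3)\<close> is the class of the coroot of \<open>kappa j\<close>:
  for odd \<open>j\<close> the bracket \<open>[e', f] - [e, f']\<close> gives \<open>- 2 h\<^bsub>node j\<^esub> - h\<^bsub>partner j\<^esub>\<close>, and \<open>- 2 = 1\<close>.\<close>

definition kappa :: "5 \<Rightarrow> int^8"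
  where "kappa j = (if odd_index j then simple (node j) - simple (partner j) else simple (node j))"

lemma rdeg_simps: "rdeg (a + c) = rdeg a + rdeg c" "rdeg (- a) = - rdeg a" "rdeg (a - c) = rdeg a - rdeg c" "rdeg 0 = 0"
  by (simp_all add: rdeg_def vec_eq_iff)

lemma rdeg_nth: "rdeg a $ j = a $ node j"
  by (simp add: rdeg_def)

lemma partner_ends: "partner j \<in> ends"
  by (simp add: partner_def)

lemma node_notin_ends: "node j \<notin> ends"
  using exhaust_5[of j] by (auto simp: node_def)

lemma node_inj: "node i = node j \<longleftrightarrow> i = j"
  using exhaust_5[of i] exhaust_5[of j] by (auto simp: node_def)

lemma node_surj: "i \<notin> ends \<Longrightarrow> \<exists>j. i = node j"
  using exhaust_8[of i] by (auto simp: node_def intro: exI[of _ "1::5"] exI[of _ "2::5"] exI[of _ "3::5"]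
      exI[of _ "4::5"] exI[of _ "5::5"])

lemma rdeg_end: "i \<in> ends \<Longrightarrow> rdeg (simple i) = 0"
  using node_notin_ends by (auto simp: vec_eq_iff rdeg_nth axis_def)

lemma rdeg_node: "rdeg (simple (node j)) = axis j 1"
  by (auto simp: vec_eq_iff rdeg_nth axis_def node_inj)

lemma form_ends: "i \<in> ends \<Longrightarrow> k \<in> ends \<Longrightarrow> e8form (simple i) (simple k) = (if i = k then 2 else 0)"
  unfolding e8form_axis by (auto simp: cartan_e8_simps)

lemma form_end_node:
  assumes "i \<in> ends"
  shows "e8form (simple i) (simple (node j)) = (if odd_index j \<and> i = partner j then - 1 else 0)"
proof -
  have "\<forall>j. \<forall>i\<in>ends. cartan_e8 $ i $ node j = (if odd_index j \<and> i = partner j then - 1 else 0)"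
    unfolding forall_5 by (simp add: cartan_e8_simps node_def partner_def parity_g83_def)
  thus ?thesis unfolding e8form_axis using assms by blast
qed

lemma same_degree_form:
  assumes "rdeg a = rdeg c"
  shows "e8form x c = e8form x a + (\<Sum>i\<in>ends. (c $ i - a $ i) * e8form x (simple i))"
proof -
  have z: "(c - a) $ node j = 0" for j using assms by (simp add: vec_eq_iff rdeg_nth)
  have "e8form (c - a) x = (\<Sum>i\<in>ends. (c - a) $ i * e8form (simple i) x)"
    unfolding e8form_sum[of "c - a"]
  proof (rule sum.mono_neutral_right)
    show "\<forall>i\<in>UNIV - ends. (c - a) $ i * e8form (simple i) x = 0"
    proof
      fix i assume "i \<in> UNIV - ends"
      then obtain j where "i = node j" using node_surj by blast
      thus "(c - a) $ i * e8form (simple i) x = 0" using z[of j] by simp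
    qed
  qed auto
  thus ?thesis by (simp only: e8form_simps e8form_sym[of x] vector_minus_component)
qed

text \<open>Two vectors of the same degree differ by a combination of alpha_1, alpha_2, alpha_8, and
  these are pairwise orthogonal, so only the i-th coefficient matters.\<close>

lemma same_degree_form_end:
  assumes "rdeg a = rdeg c" "i \<in> ends"
  shows "e8form (simple i) c = e8form (simple i) a + 2 * (c $ i - a $ i)"
proof -
  have "(\<Sum>k\<in>ends. (c $ k - a $ k) * e8form (simple i) (simple k)) = (\<Sum>k\<in>ends. if k = i then 2 * (c $ k - a $ k) else 0)"
    using assms(2) by (intro sum.cong refl) (auto simp: form_ends)
  also have "\<dots> = 2 * (c $ i - a $ i)" using assms(2) by (simp only: sum.delta finite.intros if_True)
  finally show ?thesis using same_degree_form[OF assms(1)] by simp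
qed

text \<open>A pairing equal to 2 or -2 would mean that a is alpha_i or - alpha_i, whose degree is
  0.\<close>

lemma form_end_bounds:
  assumes "is_root a" "rdeg a \<noteq> 0" "i \<in> ends"
  shows "- 1 \<le> e8form (simple i) a" "e8form (simple i) a \<le> 1"
proof -
  have "e8form (simple i) a \<noteq> 2"
    using root_eq[OF is_root_axis assms(1), of i] rdeg_end[OF assms(3)] assms(2) by metis
  moreover have "e8form (simple i) a \<noteq> - 2"
  proof
    assume "e8form (simple i) a = - 2"
    hence "simple i + a = 0" using root_add_zero[OF is_root_axis assms(1), of i] by simp
    from arg_cong[OF this, of rdeg] show False using rdeg_end[OF assms(3)] assms(2) by (simp add: rdeg_simps)
  qed
  ultimately show "- 1 \<le> e8form (simple i) a" "e8form (simple i) a \<le> 1"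
    using root_form_bounds[OF is_root_axis assms(1), of i] by auto
qed

text \<open>Both pairings with alpha_i lie in {-1, 0, 1} and differ by twice the coefficient of the
  difference. So they are equal, or opposite as for roots exchanged by the reflection in
  alpha_i.\<close>

lemma same_degree_coeff:
  assumes "is_root a" "is_root c" "rdeg a = rdeg c" "rdeg a \<noteq> 0" "i \<in> ends"
  shows "c $ i - a $ i = 0 \<or> c $ i - a $ i = - e8form (simple i) a"
  using form_end_bounds[OF assms(1,4,5)] form_end_bounds[OF assms(2) _ assms(5)] same_degree_form_end[OF assms(3,5)] assms(3,4)
  by auto

text \<open>Compare c with b = 3 a, which would have the same degree. With m_i = (alpha_i|a) and t_i
  = c_i - b_i, the norm of c is 18 plus the sum over i in {1, 2, 8} of 3 t_i m_i + t_i (3 m_i + 2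
  t_i). The bounds on m_i and on (alpha_i|c) = 3 m_i + 2 t_i make each summand at least -4, so the
  norm is at least 6, while a root has norm 2. This is what proves the cubic identity for odd
  classes.\<close>

lemma triple_degree:
  assumes a: "is_root a" "rdeg a \<noteq> 0" and c: "is_root c"
  shows "rdeg c \<noteq> rdeg a + (rdeg a + rdeg a)"
proof
  assume d: "rdeg c = rdeg a + (rdeg a + rdeg a)"
  define b where "b = a + (a + a)"
  have fb: "e8form x b = 3 * e8form x a" for x unfolding b_def e8form_simps by simp
  have deg: "rdeg b = rdeg c" unfolding b_def d rdeg_simps by simp
  define t where "t i = c $ i - b $ i" for i
  define m where "m i = e8form (simple i) a" for i
  have "rdeg c \<noteq> 0"
  proof
    assume "rdeg c = 0"
    hence "rdeg a = 0" using d by (simp add: vec_eq_iff)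
    thus False using a by simp
  qed
  have fc: "e8form (simple i) c = 3 * m i + 2 * t i" if "i \<in> ends" for i
    using same_degree_form_end[OF deg that] by (simp only: fb t_def m_def)
  have tm: "3 * m i + 2 * t i \<in> {- 1, 0, 1} \<and> m i \<in> {- 1, 0, 1}" if "i \<in> ends" for i
    using form_end_bounds[OF a that] form_end_bounds[OF c \<open>rdeg c \<noteq> 0\<close> that] fc[OF that]
    unfolding m_def by auto
  have "e8form c c = e8form c b + (\<Sum>i\<in>ends. t i * e8form c (simple i))"
    using same_degree_form[OF deg, of c] by (simp only: t_def)
  also have "e8form c b = 3 * e8form a c" by (simp only: fb e8form_sym[of c])
  also have "e8form a c = e8form a b + (\<Sum>i\<in>ends. t i * e8form a (simple i))"
    using same_degree_form[OF deg, of a] by (simp only: t_def)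
  also have "e8form a b = 6" using e8form_self[OF a(1)] by (simp add: fb)
  also have "(\<Sum>i\<in>ends. t i * e8form a (simple i)) = (\<Sum>i\<in>ends. t i * m i)" by (simp only: m_def e8form_sym[of a])
  also have "(\<Sum>i\<in>ends. t i * e8form c (simple i)) = (\<Sum>i\<in>ends. t i * (3 * m i + 2 * t i))"
    by (rule sum.cong[OF refl]) (simp only: fc e8form_sym[of c])
  finally have "2 = 3 * (6 + (\<Sum>i\<in>ends. t i * m i)) + (\<Sum>i\<in>ends. t i * (3 * m i + 2 * t i))"
    using e8form_self[OF c] by simp
  also have "\<dots> = 18 + (\<Sum>i\<in>ends. 3 * (t i * m i) + t i * (3 * m i + 2 * t i))"
    by (simp only: sum.distrib sum_distrib_left[symmetric] distrib_left)
  finally have "(\<Sum>i\<in>ends. 3 * (t i * m i) + t i * (3 * m i + 2 * t i)) = - 16" by simp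
  moreover have "(\<Sum>i\<in>ends. 3 * (t i * m i) + t i * (3 * m i + 2 * t i)) \<ge> (\<Sum>i\<in>ends. - 4)"
  proof (rule sum_mono)
    fix i assume "i \<in> ends"
    hence "m i = - 1 \<and> (t i = 1 \<or> t i = 2) \<or> m i = 0 \<and> t i = 0 \<or> m i = 1 \<and> (t i = - 1 \<or> t i = - 2)"
      using tm[of i] by auto
    thus "- 4 \<le> 3 * (t i * m i) + t i * (3 * m i + 2 * t i)" by auto
  qed
  ultimately show False by simp
qed

text \<open>If the pairing is 1, subtract alpha_i. This keeps the degree, and by orthogonality also
  the pairings with the other two end roots, so the three ends can be treated one after
  another.\<close>

lemma lower_end:
  assumes a: "is_root a" "rdeg a \<noteq> 0" and i: "i \<in> ends"
  shows "\<exists>c. is_root c \<and> rdeg c = rdeg a \<and> e8form (simple i) c \<le> 0 \<and>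
    (\<forall>k\<in>ends. k \<noteq> i \<longrightarrow> e8form (simple k) c = e8form (simple k) a)"
proof (cases "e8form (simple i) a \<le> 0")
  case False
  hence f: "e8form (simple i) a = 1" using form_end_bounds[OF a i] by simp
  hence "is_root (a - simple i)" using is_root_diff[OF a(1) is_root_axis, of i] by (simp add: e8form_sym)
  moreover have "e8form (simple k) (a - simple i) = e8form (simple k) a - (if k = i then 2 else 0)" if "k \<in> ends" for k
    using form_ends[OF that i] by (simp add: e8form_simps)
  ultimately show ?thesis using f i rdeg_end[OF i]
    by (intro exI[of _ "a - simple i"]) (auto simp: rdeg_simps)
qed (use a in blast)

lemma lowest_root:
  assumes a: "is_root a" "rdeg a \<noteq> 0"
  shows "\<exists>c. is_root c \<and> rdeg c = rdeg a \<and> (\<forall>i\<in>ends. e8form (simple i) c \<le> 0)"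
proof -
  obtain c where c: "is_root c" "rdeg c = rdeg a" "e8form (simple 1) c \<le> 0"
    using lower_end[OF a, of 1] by auto
  obtain d where d: "is_root d" "rdeg d = rdeg a" "e8form (simple 2) d \<le> 0" "e8form (simple 1) d \<le> 0"
    using lower_end[OF c(1), of 2] c a(2) by auto
  obtain e where "is_root e" "rdeg e = rdeg a" "e8form (simple 8) e \<le> 0" "e8form (simple 1) e \<le> 0" "e8form (simple 2) e \<le> 0"
    using lower_end[OF d(1), of 8] d a(2) by auto
  thus ?thesis by auto
qed

text \<open>At the lowest root r of the degree there is a node j with (alpha_{node j}|r) = 1. Let j
  be odd, let p be its partner, and let m = (alpha_p|r), which is 0 or -1. For another root c of the
  degree let t = c_p - r_p, which is 0 or - m. Then the pairings of c with alpha_{node j} and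
  alpha_{node j} + alpha_p are 1 - t and 1 + m + t, neither of which is -1, and its pairing with
  \<open>kappa j\<close> is 1 - m - 3 t. For even j the pairing with alpha_{node j} is 1 throughout
  and m is set to 0.\<close>

lemma degree_eigen:
  assumes a: "is_root a" "rdeg a = q" and q: "q \<noteq> 0" "\<forall>i. q $ i \<ge> 0" "\<forall>i. q \<noteq> axis i 1"
  shows "\<exists>j m. q $ j > 0 \<and> (m = 0 \<or> m = - 1) \<and> (\<forall>c. is_root c \<longrightarrow> rdeg c = q \<longrightarrow>
    \<not> is_root (simple (node j) + c) \<and>
    (odd_index j \<longrightarrow> \<not> is_root (simple (node j) + simple (partner j) + c)) \<and>
    3 dvd e8form (kappa j) c - (1 - m))"
proof -
  obtain r where r: "is_root r" "rdeg r = q" "\<forall>i\<in>ends. e8form (simple i) r \<le> 0"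
    using lowest_root[of a] a q(1) by auto
  obtain k where "q $ k > 0" using q(1,2) by (auto simp: vec_eq_iff order_less_le)
  hence "\<not> (\<forall>i. r $ i \<le> 0)" using r(2) rdeg_nth[of r k] by (metis not_le)
  hence nn: "\<forall>i. r $ i \<ge> 0" using root_one_sided[OF r(1)] by blast
  have "\<forall>i. r \<noteq> simple i"
  proof (intro allI notI)
    fix i assume i: "r = simple i"
    show False
    proof (cases "i \<in> ends")
      case True thus False using i r(2) rdeg_end q(1) by simp
    next
      case False
      then obtain j where "i = node j" using node_surj by blast
      thus False using i r(2) q(3)[rule_format, of j] rdeg_node by simp
    qed
  qed
  then obtain i where i: "i \<notin> ends" "r $ i > 0" "e8form (simple i) r = 1"
    using simple_neighbour[OF r(1) nn _ r(3)] by blast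
  obtain j where j: "i = node j" using node_surj[OF i(1)] by blast
  define p where "p = partner j"
  define m where "m = (if odd_index j then e8form (simple p) r else 0)"
  have p: "p \<in> ends" unfolding p_def by (rule partner_ends)
  have m: "m = 0 \<or> m = - 1"
    using form_end_bounds[OF r(1) _ p] r(2,3) p q(1) by (auto simp: m_def)
  have "\<not> is_root (simple (node j) + c) \<and>
    (odd_index j \<longrightarrow> \<not> is_root (simple (node j) + simple (partner j) + c)) \<and>
    3 dvd e8form (kappa j) c - (1 - m)" if c: "is_root c" "rdeg c = q" for c
  proof -
    have rc: "rdeg r = rdeg c" using r(2) c(2) by simp
    define t where "t = c $ p - r $ p"
    have "(\<Sum>i\<in>ends. (c $ i - r $ i) * e8form (simple (node j)) (simple i))
      = (\<Sum>i\<in>ends. if i = p then if odd_index j then - t else 0 else 0)"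
      by (intro sum.cong refl) (auto simp: e8form_sym[of "simple (node j)"] form_end_node p_def[symmetric] t_def)
    also have "\<dots> = (if odd_index j then - t else 0)" using p by (simp only: sum.delta finite.intros if_True)
    finally have f: "e8form (simple (node j)) c = 1 + (if odd_index j then - t else 0)"
      using same_degree_form[OF rc, of "simple (node j)"] i(3) j by simp
    have nr: "\<not> is_root (simple (node j) + c) \<longleftrightarrow> e8form (simple (node j)) c \<noteq> - 1"
      using is_root_add[OF is_root_axis c(1)] by simp
    show ?thesis
    proof (cases "odd_index j")
      case False
      thus ?thesis using f nr by (simp add: kappa_def m_def)
    next
      case True
      have t: "t = 0 \<or> t = - m"
        using same_degree_coeff[OF r(1) c(1) rc _ p] r(2) q(1) True by (auto simp: t_def m_def)
      have fp: "e8form (simple p) c = m + 2 * t"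
        using same_degree_form_end[OF rc p] True by (simp add: m_def t_def)
      have "is_root (simple (node j) + simple p)"
        using is_root_add[OF is_root_axis is_root_axis] form_end_node[OF p, of j] True p_def by (simp add: e8form_sym)
      moreover have "e8form (simple (node j) + simple p) c = 1 + m + t"
        using f fp True by (simp add: e8form_simps)
      ultimately have "is_root (simple (node j) + simple p + c) \<longleftrightarrow> 1 + m + t = - 1"
        using is_root_add[of "simple (node j) + simple p" c] c(1) by metis
      moreover have "e8form (kappa j) c - (1 - m) = - 3 * t"
        using f fp True by (simp add: kappa_def e8form_simps p_def[symmetric])
      ultimately show ?thesis using f nr t m True by (auto simp: p_def[symmetric])
    qed
  qed
  moreover have "q $ j > 0" using i(2) j r(2) rdeg_nth by metis
  ultimately show ?thesis using m by blast
qed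

text \<open>A trivial kernel means rank n, so the Cartan space has dimension 2 n - n = n, and the n
  independent coroots form a basis.\<close>

lemma realization_spanning:
  fixes R :: "('k::field, 'n::finite, 'v::ab_group_add) realization"
  assumes R: "is_realization A R"
    and ker: "\<And>x :: 'k^'n. (\<chi> i j. of_int (A $ i $ j)) *v x = 0 \<Longrightarrow> x = 0"
  shows "\<exists>c. v = (\<Sum>i\<in>UNIV. scale R (c i) (coroot R i))"
proof -
  let ?M = "(\<chi> i j. of_int (A $ i $ j)) :: 'k^'n^'n"
  have "vec.span (rows ?M) = UNIV"
    using ker matrix_left_invertible_ker[of ?M] matrix_left_invertible_span_rows_gen[of ?M] by blast
  hence "vec.dim (rows ?M) = CARD('n)" by (metis vec.dim_span vec_dim_card)
  hence "rank ?M = CARD('n)" by (simp add: row_rank_def_gen)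
  then obtain B where B: "finite_dimensional_vector_space (scale R) B" "card B = CARD('n)"
    using R by (auto simp: is_realization_def)
  interpret V: finite_dimensional_vector_space "scale R" B by (rule B(1))
  have ind: "(\<Sum>i\<in>UNIV. scale R (c i) (coroot R i)) = 0 \<Longrightarrow> c i = 0" for c i
    using R by (simp add: is_realization_def)
  have inj: "inj (coroot R)"
  proof (rule injI, rule ccontr)
    fix i j assume ij: "coroot R i = coroot R j" "i \<noteq> j"
    let ?c = "\<lambda>k. if k = i then 1 else if k = j then - 1 else 0"
    have "(\<Sum>k\<in>UNIV. scale R (?c k) (coroot R k)) = (\<Sum>k\<in>{i, j}. scale R (?c k) (coroot R k))"
      by (rule sum.mono_neutral_right) auto
    also have "\<dots> = 0" using ij by (simp add: V.scale_minus_left)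
    finally show False using ind[of ?c i] by simp
  qed
  have "V.independent (range (coroot R))"
  proof (rule V.independent_if_scalars_zero)
    fix f v assume f: "(\<Sum>v\<in>range (coroot R). scale R (f v) v) = 0" and v: "v \<in> range (coroot R)"
    have "(\<Sum>i\<in>UNIV. scale R (f (coroot R i)) (coroot R i)) = 0"
      using f inj by (simp add: sum.reindex)
    thus "f v = 0" using ind[of "\<lambda>i. f (coroot R i)"] v by auto
  qed simp
  moreover have "card (range (coroot R)) = CARD('n)" using inj by (simp add: card_image)
  ultimately have "UNIV \<subseteq> V.span (range (coroot R))"
    using V.card_eq_dim[of "range (coroot R)" UNIV] B(2) V.dim_UNIV by simp
  hence "v \<in> V.span (coroot R ` UNIV)" by blast
  then obtain u where u: "v = (\<Sum>w\<in>range (coroot R). scale R (u w) w)"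
    using V.span_finite[of "range (coroot R)"] by auto
  have "v = (\<Sum>i\<in>UNIV. scale R (u (coroot R i)) (coroot R i))"
    unfolding u using inj by (simp add: sum.reindex)
  thus ?thesis by (rule exI[of _ "\<lambda>i. u (coroot R i)"])
qed

text \<open>The binomial formula in characteristic 3: (p + q)^3 = p^3 + q^3 for commuting additive p
  and q.\<close>

lemma cube_sum_zero:
  fixes p q :: "'m::ab_group_add \<Rightarrow> 'm"
  assumes three: "\<And>x :: 'm. x + x + x = 0"
    and add: "\<And>x y. p (x + y) = p x + p y" "\<And>x y. q (x + y) = q x + q y"
    and comm: "\<And>x. p (q x) = q (p x)" and cube: "\<And>x. p (p (p x)) = 0" "\<And>x. q (q (q x)) = 0"
  shows "p (p (p x + q x) + q (p x + q x)) + q (p (p x + q x) + q (p x + q x)) = 0"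
proof -
  have "p (p (p x + q x) + q (p x + q x)) + q (p (p x + q x) + q (p x + q x))
    = p (p (p x)) + (p (p (q x)) + p (p (q x)) + p (p (q x))) + (p (q (q x)) + p (q (q x)) + p (q (q x))) + q (q (q x))"
    by (simp add: add comm add_ac)
  thus ?thesis by (simp add: cube three)
qed

section \<open>The derivation D and the grading that it preserves\<close>

locale e8_g83 = e8_realization R
  for R :: "('k::field, 8, 'v::ab_group_add) realization" +
  fixes S :: "('k, 5, 'w::ab_group_add) realization"
  assumes char: "CHAR('k) = 3" and S_realization: "is_realization cartan_g83 S"
begin

lemma of_int_mod3: "3 dvd a - c \<Longrightarrow> (of_int a :: 'k) = of_int c"
  using of_int_eq_0_iff_char_dvd[where ?'a = 'k, of "a - c"] char by simp

lemma three_k: "(3 :: 'k) = 0"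
  using of_nat_CHAR[where ?'a = 'k] char by simp

lemma two_k: "(2 :: 'k) = - 1" "(2 :: 'k) \<noteq> 0"
proof -
  have "(2 :: 'k) = 3 - 1" by simp
  thus *: "(2 :: 'k) = - 1" by (simp only: three_k diff_0)
  show "(2 :: 'k) \<noteq> 0" unfolding * by simp
qed

lemma M_three: "x + x + x = (0 :: 'v \<times> ('k^e8_root))"
proof -
  have "x + x + x = sc (1 + 1 + 1) x" by (simp only: M.scale_left_distrib M.scale_one)
  thus ?thesis by (simp add: three_k)
qed

definition D :: "'v \<times> ('k^e8_root) \<Rightarrow> 'v \<times> ('k^e8_root)"
  where "D = br (ev (simple 1) + ev (simple 2) + ev (simple 8))"

lemma D_sum: "D x = (\<Sum>i\<in>ends. br (ev (simple i)) x)"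
  by (simp add: D_def M.b_simps add.assoc)

lemma br_ends: "i \<in> ends \<Longrightarrow> k \<in> ends \<Longrightarrow> br (ev (simple i)) (ev (simple k)) = 0"
proof -
  assume ik: "i \<in> ends" "k \<in> ends"
  have f: "e8form (simple i) (simple k) \<noteq> - 1 \<and> e8form (simple i) (simple k) \<noteq> - 2" using form_ends[OF ik] by auto
  thus ?thesis using is_root_add[of "simple i" "simple k"] root_add_zero[of "simple i" "simple k"]
    by (simp add: br_ee ev_nonroot)
qed

lemma br_ends_commute:
  "i \<in> ends \<Longrightarrow> k \<in> ends \<Longrightarrow> br (ev (simple i)) (br (ev (simple k)) x) = br (ev (simple k)) (br (ev (simple i)) x)"
  using br_jacobi[of "ev (simple i)" "ev (simple k)" x] br_ends by simp

text \<open>Root strings are short in the simply laced case: the longest is - a, 0, a, so three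
  steps always lead out of it.\<close>

lemma br_simple_cube: "br (ev (simple i)) (br (ev (simple i)) (br (ev (simple i)) x)) = 0"
proof -
  let ?a = "simple i"
  have aa: "e8form ?a ?a = 2" by (rule e8form_self) simp
  have z: "br (ev ?a) (ev ?a) = 0"
    using aa is_root_add[of ?a ?a] root_add_zero[of ?a ?a] by (simp add: br_ee ev_nonroot)
  have hvz: "br (ev ?a) (br (ev ?a) (hv v)) = 0" for v by (simp add: br_eh M.b_simps z)
  show ?thesis
  proof (induction x rule: M_induct)
    case (hv v) thus ?case by (simp add: hvz)
  next
    case (ev c)
    show ?case
    proof (cases "?a + c = 0")
      case True thus ?thesis using ev hvz by (simp add: br_ee)
    next
      case False
      show ?thesis
      proof (cases "is_root (?a + c)")
        case True
        hence "e8form ?a (?a + c) = 1" using is_root_add[OF is_root_axis ev] aa by (simp add: e8form_simps)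
        hence "br (ev ?a) (ev (?a + c)) = 0"
          using is_root_add[OF is_root_axis True, of i] root_add_zero[OF is_root_axis True, of i]
          by (simp add: br_ee True ev_nonroot)
        thus ?thesis using ev False by (simp add: br_ee M.b_simps)
      next
        case nr: False
        thus ?thesis using ev False by (simp add: br_ee ev_nonroot)
      qed
    qed
  qed (simp_all add: M.b_simps)
qed

lemma D_cube: "D (D (D x)) = 0"
proof -
  let ?p = "br (ev (simple 1) + ev (simple 2))" and ?q = "br (ev (simple 8))"
  have add: "br z (x + y) = br z x + br z y" for x y z by (rule M.b_add_right)
  have p: "?p x = br (ev (simple 1)) x + br (ev (simple 2)) x" for x by (simp add: M.b_add_left)
  have cube: "?p (?p (?p x)) = 0" for x
    unfolding p using M_three by (rule cube_sum_zero) (simp_all add: add br_ends_commute[of 1 2] br_simple_cube)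
  have comm: "?p (?q x) = ?q (?p x)" for x
    unfolding p add using br_ends_commute[of 1 8 x] br_ends_commute[of 2 8 x] by simp
  have "?p (?p (?p x + ?q x) + ?q (?p x + ?q x)) + ?q (?p (?p x + ?q x) + ?q (?p x + ?q x)) = 0"
    by (rule cube_sum_zero[where p = ?p and q = ?q]) (rule M_three add comm cube br_simple_cube)+
  thus ?thesis by (simp add: D_def M.b_add_left[of _ "ev (simple 8)"])
qed

sublocale LD: lie_derivation sc br D
proof
  show "x + x + x = 0" for x :: "'v \<times> ('k^e8_root)" by (rule M_three)
  show "br x y = - br y x" for x y by (rule br_skew)
  show "br x (br y z) = br (br x y) z + br y (br x z)" for x y z by (rule br_jacobi)
  show "D (x + y) = D x + D y" "D (sc c x) = sc c (D x)" for x y c by (simp_all add: D_def M.b_simps)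
  show "D (br x y) = br (D x) y + br x (D y)" for x y unfolding D_def by (rule br_jacobi)
  show "D (D (D x)) = 0" for x by (rule D_cube)
qed

sublocale pair: bilinear_algebra LD.ss LD.bb by (rule LD.pair_bilinear)

lemma hv_diff: "hv (u - v) = hv u - hv v"
  by (simp add: hv_def)

lemma SP_1: "D (D y) = 0 \<Longrightarrow> (0, y) \<in> LD.SP 1"
  unfolding LD.SP_simps by blast

lemma D_hv: "D (hv v) = - (\<Sum>i\<in>ends. sc (rf (simple i) v) (ev (simple i)))"
  unfolding D_sum by (simp add: br_eh)

lemma D_simple: "i \<in> ends \<Longrightarrow> D (ev (simple i)) = 0"
  unfolding D_sum using br_ends[of _ i] by (intro sum.neutral) blast

lemma D_minus_simple:
  assumes "i \<in> ends" shows "D (ev (- simple i)) = - hv (hc (simple i))"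
proof -
  have "br (ev (simple k)) (ev (- simple i)) = (if k = i then - hv (hc (simple i)) else 0)" if "k \<in> ends" for k
    using form_ends[OF that assms] is_root_add[of "simple k" "- simple i"] root_add_zero[of "simple k" "- simple i"]
    by (auto simp: br_ee ev_nonroot e8form_simps hv_simps)
  hence "D (ev (- simple i)) = (\<Sum>k\<in>ends. if k = i then - hv (hc (simple i)) else 0)"
    unfolding D_sum by (intro sum.cong refl) blast
  also have "\<dots> = - hv (hc (simple i))" using assms by (simp only: sum.delta finite.intros if_True)
  finally show ?thesis .
qed

text \<open>[e_i, h_i] = - 2 e_i, and - 2 = 1. Together with \<open>D_minus_simple\<close> this
  shows that the sl_2 triple at i is a block J_3, which the semisimplification kills.\<close>

lemma D_hv_simple:
  assumes "i \<in> ends" shows "D (hv (hc (simple i))) = ev (simple i)"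
proof -
  have "D (hv (hc (simple i))) = - (\<Sum>k\<in>ends. if k = i then sc 2 (ev (simple i)) else 0)"
    unfolding D_hv using form_ends[OF assms]
    by (intro arg_cong[of _ _ uminus] sum.cong refl) (auto simp: rf_hc)
  also have "(\<Sum>k\<in>ends. if k = i then sc 2 (ev (simple i)) else 0) = sc 2 (ev (simple i))"
    using assms by (simp only: sum.delta finite.intros if_True)
  finally show ?thesis by (simp add: two_k M.scale_minus_left)
qed

lemma D_ev:
  assumes "is_root a" "rdeg a \<noteq> 0"
  shows "D (ev a) = (\<Sum>i\<in>ends. if e8form (simple i) a = - 1 then sc (e8sign (simple i) a) (ev (simple i + a)) else 0)"
  unfolding D_sum
proof (rule sum.cong[OF refl])
  fix i assume i: "i \<in> ends"
  have "simple i + a \<noteq> 0"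
  proof
    assume "simple i + a = 0"
    from arg_cong[OF this, of rdeg] show False using rdeg_end[OF i] assms(2) by (simp add: rdeg_simps)
  qed
  thus "br (ev (simple i)) (ev a) = (if e8form (simple i) a = - 1 then sc (e8sign (simple i) a) (ev (simple i + a)) else 0)"
    using is_root_add[OF is_root_axis assms(1), of i] assms(1) by (simp add: br_ee ev_nonroot)
qed

definition MG :: "int^5 \<Rightarrow> ('v \<times> ('k^e8_root)) set"
  where "MG q = {x. (q \<noteq> 0 \<longrightarrow> fst x = 0) \<and> (\<forall>\<alpha>. rdeg (root_vector \<alpha>) \<noteq> q \<longrightarrow> snd x $ \<alpha> = 0)}"

definition prM :: "int^5 \<Rightarrow> 'v \<times> ('k^e8_root) \<Rightarrow> 'v \<times> ('k^e8_root)"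
  where "prM q x = (if q = 0 then fst x else 0, \<chi> \<alpha>. if rdeg (root_vector \<alpha>) = q then snd x $ \<alpha> else 0)"

lemma MG_subspace: "M.subspace (MG q)"
  by (rule M.subspaceI) (auto simp: MG_def sc_def)

lemma hv_MG: "hv v \<in> MG 0"
  by (simp add: MG_def hv_def)

lemma ev_MG: "ev a \<in> MG (rdeg a)"
  by (auto simp: MG_def ev_def axis_def root_vector_Abs)

lemma MG_induct [consumes 1, case_names zero hv ev add scale]:
  assumes x: "x \<in> MG q" and "Q 0" and hv: "\<And>v. q = 0 \<Longrightarrow> Q (hv v)"
    and ev: "\<And>a. is_root a \<Longrightarrow> rdeg a = q \<Longrightarrow> Q (ev a)"
    and add: "\<And>x y. Q x \<Longrightarrow> Q y \<Longrightarrow> Q (x + y)" and scale: "\<And>c x. Q x \<Longrightarrow> Q (sc c x)"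
  shows "Q x"
proof -
  have "Q (\<Sum>\<alpha>\<in>A. sc (snd x $ \<alpha>) (ev (root_vector \<alpha>)))" for A
  proof (induction A rule: infinite_finite_induct)
    case (insert \<alpha> A)
    have "Q (sc (snd x $ \<alpha>) (ev (root_vector \<alpha>)))"
    proof (cases "snd x $ \<alpha> = 0")
      case True thus ?thesis using \<open>Q 0\<close> by simp
    next
      case False
      hence "rdeg (root_vector \<alpha>) = q" using x by (auto simp: MG_def)
      thus ?thesis using ev scale by simp
    qed
    thus ?case using insert add by simp
  qed (use \<open>Q 0\<close> in simp_all)
  moreover have "Q (hv (fst x))"
    using x hv \<open>Q 0\<close> by (cases "q = 0") (auto simp: MG_def hv_simps)
  ultimately show ?thesis using add decompose[of x] by metis
qed

lemma MG_mult:
  assumes "x \<in> MG p" "y \<in> MG q" shows "br x y \<in> MG (p + q)"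
proof -
  note sub = M.subspace_0[OF MG_subspace] M.subspace_add[OF MG_subspace] M.subspace_scale[OF MG_subspace]
    M.subspace_neg[OF MG_subspace]
  show ?thesis
    using assms(1)
  proof (induction x rule: MG_induct)
    case (hv v)
    show ?case using assms(2)
    proof (induction y rule: MG_induct)
      case (ev a) thus ?case using hv ev_MG[of a] sub by (simp add: br_he)
    qed (use sub in \<open>simp_all add: br_hh M.b_simps\<close>)
  next
    case (ev a)
    show ?case using assms(2)
    proof (induction y rule: MG_induct)
      case (hv v) thus ?case using ev ev_MG[of a] sub by (simp add: br_eh)
    next
      case (ev c)
      show ?case
      proof (cases "a + c = 0")
        case True
        have "rdeg a + rdeg c = 0" using arg_cong[OF True, of rdeg] unfolding rdeg_simps .
        hence "p + q = 0" using \<open>rdeg a = p\<close> \<open>rdeg c = q\<close> by simp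
        thus ?thesis using True \<open>is_root a\<close> \<open>is_root c\<close> hv_MG by (simp add: br_ee)
      next
        case False
        have "ev (a + c) \<in> MG (p + q)" using ev_MG[of "a + c"] \<open>rdeg a = p\<close> \<open>rdeg c = q\<close> by (simp add: rdeg_simps)
        thus ?thesis using False \<open>is_root a\<close> \<open>is_root c\<close> sub by (simp add: br_ee)
      qed
    qed (use sub in \<open>simp_all add: M.b_simps\<close>)
  qed (use sub in \<open>simp_all add: M.b_simps\<close>)
qed

lemma D_MG: "x \<in> MG q \<Longrightarrow> D x \<in> MG q"
proof -
  assume x: "x \<in> MG q"
  have "ev (simple i) \<in> MG 0" if "i \<in> ends" for i using ev_MG[of "simple i"] rdeg_end[OF that] by simp
  hence "ev (simple 1) + ev (simple 2) + ev (simple 8) \<in> MG 0"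
    by (intro M.subspace_add[OF MG_subspace]) simp_all
  from MG_mult[OF this x] show ?thesis by (simp add: D_def)
qed

lemma prM_linear: "prM q (x + y) = prM q x + prM q y" "prM q (sc c x) = sc c (prM q x)"
  by (simp_all add: prM_def sc_def prod_eq_iff vec_eq_iff)

lemma prM_zero: "prM q 0 = 0"
  by (simp add: prM_def prod_eq_iff vec_eq_iff)

lemma prM_same: "x \<in> MG q \<Longrightarrow> prM q x = x"
  by (auto simp: MG_def prM_def prod_eq_iff vec_eq_iff)

lemma prM_other:
  assumes "x \<in> MG p" "p \<noteq> q" shows "prM q x = 0"
proof -
  have "(\<chi> \<alpha>. if rdeg (root_vector \<alpha>) = q then snd x $ \<alpha> else 0) = 0"
    by (rule vec_eq_iff[THEN iffD2]) (use assms in \<open>auto simp: MG_def\<close>)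
  thus ?thesis using assms by (auto simp: prM_def MG_def prod_eq_iff)
qed

lemma prM_MG: "prM q x \<in> MG q"
  by (simp add: MG_def prM_def)

lemma prM_D: "prM q (D x) = D (prM q x)"
proof -
  have hom: "prM q (D x) = D (prM q x)" if "x \<in> MG p" for x p
  proof (cases "p = q")
    case True thus ?thesis using that D_MG prM_same by simp
  next
    case False thus ?thesis using that D_MG prM_other LD.D_zero by metis
  qed
  show ?thesis
    by (induction x rule: M_induct) (simp_all add: hom[OF hv_MG] hom[OF ev_MG] LD.D_simps prM_linear)
qed

text \<open>One finite set of degrees serves all x: 0 and the degrees of the finitely many
  roots.\<close>

lemma sum_prM: "\<exists>T. finite T \<and> (\<forall>x. (\<Sum>q\<in>T. prM q x) = x)"
proof (intro exI[of _ "insert 0 (range (\<lambda>\<alpha>. rdeg (root_vector \<alpha>)))"] conjI allI)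
  let ?T = "insert 0 (range (\<lambda>\<alpha>. rdeg (root_vector \<alpha>)))"
  show fin: "finite ?T" by simp
  have hom: "x = (\<Sum>q\<in>?T. prM q x)" if x: "x \<in> MG p" "p \<in> ?T" for x p
  proof -
    have "(\<Sum>q\<in>?T. prM q x) = (\<Sum>q\<in>?T. if q = p then x else 0)"
      using x(1) by (intro sum.cong refl) (simp add: prM_same prM_other)
    also have "\<dots> = x" using fin x(2) by (simp only: sum.delta if_True)
    finally show ?thesis by simp
  qed
  show "(\<Sum>q\<in>?T. prM q x) = x" for x
  proof (rule sym, induction x rule: M_induct)
    case (hv v) show ?case by (rule hom[OF hv_MG]) simp
  next
    case (ev a)
    have "rdeg a \<in> range (\<lambda>\<alpha>. rdeg (root_vector \<alpha>))"
      using root_vector_Abs[OF ev] by (intro image_eqI[of _ _ "Abs_root a"]) simp_all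
    thus ?case by (intro hom[OF ev_MG]) blast
  next
    case (add x y)
    have "(\<Sum>q\<in>?T. prM q (x + y)) = (\<Sum>q\<in>?T. prM q x) + (\<Sum>q\<in>?T. prM q y)"
      unfolding prM_linear by (rule sum.distrib)
    thus ?case using add by metis
  next
    case (scale c x)
    have "(\<Sum>q\<in>?T. prM q (sc c x)) = sc c (\<Sum>q\<in>?T. prM q x)"
      unfolding prM_linear by (rule M.scale_sum_right[symmetric])
    thus ?case using scale by metis
  qed
qed

lemma MG_no_root:
  assumes "q \<noteq> 0" "\<And>a. is_root a \<Longrightarrow> rdeg a \<noteq> q" "x \<in> MG q"
  shows "x = 0"
  using assms(3) by (induction x rule: MG_induct) (use assms(1,2) in auto)

text \<open>In degree 0 one has (alpha_i|a) = 2 a_i for i in {1, 2, 8}. If a is not plus or minus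
  one of these simple roots, the bounds on pairings leave only a_i = 0, and then a would have norm
  0.\<close>

lemma zero_degree_root:
  assumes a: "is_root a" "rdeg a = 0"
  shows "\<exists>i\<in>ends. a = simple i \<or> a = - simple i"
proof (rule ccontr)
  assume n: "\<not> (\<exists>i\<in>ends. a = simple i \<or> a = - simple i)"
  have d: "rdeg 0 = rdeg a" using a by (simp add: rdeg_simps)
  have f: "e8form (simple i) a = 2 * a $ i" if "i \<in> ends" for i
    using same_degree_form_end[OF d that] by (simp add: e8form_simps)
  have "a $ i = 0" if i: "i \<in> ends" for i
  proof -
    have "e8form (simple i) a \<noteq> 2" using root_eq[OF is_root_axis a(1), of i] n i by metis
    moreover have "e8form (simple i) a \<noteq> - 2"
    proof
      assume "e8form (simple i) a = - 2"
      hence "simple i + a = 0" using root_add_zero[OF is_root_axis a(1), of i] by simp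
      hence "a = - simple i" by (simp add: eq_neg_iff_add_eq_0 add.commute)
      thus False using n i by blast
    qed
    ultimately show ?thesis using root_form_bounds[OF is_root_axis a(1), of i] f[OF i] by auto
  qed
  hence "e8form a a = 0" using same_degree_form[OF d, of a] by (simp add: e8form_simps)
  thus False using e8form_self[OF a(1)] by simp
qed

lemma MG_zero:
  assumes "x \<in> MG 0"
  shows "\<exists>v p n. x = hv v + (\<Sum>i\<in>ends. sc (p i) (ev (simple i))) + (\<Sum>i\<in>ends. sc (n i) (ev (- simple i)))"
  using assms
proof (induction x rule: MG_induct)
  case zero
  show ?case by (intro exI[of _ 0] exI[of _ "\<lambda>_. 0"]) (simp add: hv_simps)
next
  case (hv v)
  show ?case by (intro exI[of _ v] exI[of _ "\<lambda>_. 0"]) simp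
next
  case (ev a)
  then obtain i where i: "i \<in> ends" "a = simple i \<or> a = - simple i" using zero_degree_root by blast
  have delta: "(\<Sum>k\<in>ends. sc (if k = i then 1 else 0) (g k)) = g i" for g :: "8 \<Rightarrow> 'v \<times> ('k^e8_root)"
  proof -
    have "(\<Sum>k\<in>ends. sc (if k = i then 1 else 0) (g k)) = (\<Sum>k\<in>ends. if k = i then g k else 0)"
      by (intro sum.cong refl) simp
    also have "\<dots> = g i" using i(1) by (simp only: sum.delta finite.intros if_True)
    finally show ?thesis .
  qed
  show ?case
    using i(2)
  proof
    assume "a = simple i"
    thus ?thesis using delta[of "\<lambda>k. ev (simple k)"]
      by (intro exI[of _ 0] exI[of _ "\<lambda>k. if k = i then 1 else 0"] exI[of _ "\<lambda>_. 0"]) (simp only: hv_simps M.scale_zero_left sum.neutral_const add_0 add_0_right)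
  next
    assume "a = - simple i"
    thus ?thesis using delta[of "\<lambda>k. ev (- simple k)"]
      by (intro exI[of _ 0] exI[of _ "\<lambda>_. 0"] exI[of _ "\<lambda>k. if k = i then 1 else 0"]) (simp only: hv_simps M.scale_zero_left sum.neutral_const add_0 add_0_right)
  qed
next
  case (add x y)
  then obtain v p n v' p' n' where
    "x = hv v + (\<Sum>i\<in>ends. sc (p i) (ev (simple i))) + (\<Sum>i\<in>ends. sc (n i) (ev (- simple i)))"
    "y = hv v' + (\<Sum>i\<in>ends. sc (p' i) (ev (simple i))) + (\<Sum>i\<in>ends. sc (n' i) (ev (- simple i)))" by blast
  thus ?case
    by (intro exI[of _ "v + v'"] exI[of _ "\<lambda>i. p i + p' i"] exI[of _ "\<lambda>i. n i + n' i"])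
      (simp only: hv_simps M.scale_left_distrib sum.distrib add_ac)
next
  case (scale c x)
  then obtain v p n where
    "x = hv v + (\<Sum>i\<in>ends. sc (p i) (ev (simple i))) + (\<Sum>i\<in>ends. sc (n i) (ev (- simple i)))" by blast
  thus ?case
    by (intro exI[of _ "scale R c v"] exI[of _ "\<lambda>i. c * p i"] exI[of _ "\<lambda>i. c * n i"])
      (simp only: hv_simps M.scale_right_distrib M.scale_sum_right M.scale_scale)
qed

lemma D_MG_zero:
  assumes "x = hv v + (\<Sum>i\<in>ends. sc (p i) (ev (simple i))) + (\<Sum>i\<in>ends. sc (n i) (ev (- simple i)))"
  shows "D x = hv (- (\<Sum>i\<in>ends. scale R (n i) (coroot R i))) + (\<Sum>i\<in>ends. sc (- rf (simple i) v) (ev (simple i)))"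
  unfolding assms
  by (simp add: LD.D_simps D_hv D_simple D_minus_simple hv_simps hv_diff hc_axis M.scale_minus_left M.scale_minus_right)

lemma ends_independent_hv:
  assumes z: "hv u + (\<Sum>i\<in>ends. sc (c i) (ev (simple i))) = 0"
  shows "u = 0"
proof -
  have f: "fst (sc k (ev a)) = 0" for k a by (simp add: sc_def ev_def)
  have "fst (hv u + (\<Sum>i\<in>ends. sc (c i) (ev (simple i)))) = fst (0 :: 'v \<times> ('k^e8_root))"
    by (rule arg_cong[OF z])
  thus ?thesis unfolding fst_add fst_sum f by (simp add: hv_def)
qed

lemma ends_independent_ev:
  assumes z: "hv u + (\<Sum>i\<in>ends. sc (c i) (ev (simple i))) = 0" and i: "i \<in> ends"
  shows "c i = 0"
proof -
  have s: "snd (sc (c k) (ev (simple k))) $ Abs_root (simple i) = (if k = i then c k else 0)" for k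
  proof -
    have "Abs_root (simple i) = Abs_root (simple k) \<longleftrightarrow> i = k"
      using Abs_root_inject[of "simple i" "simple k"] by (simp add: axis_eq_axis)
    moreover have "axis a (1 :: 'k) $ c = (if c = a then 1 else 0)" for a c :: e8_root by (simp add: axis_def)
    ultimately show ?thesis by (simp add: sc_def ev_def)
  qed
  have "snd (hv u + (\<Sum>i\<in>ends. sc (c i) (ev (simple i)))) $ Abs_root (simple i) = snd (0 :: 'v \<times> ('k^e8_root)) $ Abs_root (simple i)"
    by (rule arg_cong[OF z])
  hence "(\<Sum>k\<in>ends. if k = i then c k else 0) = 0"
    unfolding snd_add snd_sum vector_add_component sum_component s by (simp only: hv_def snd_conv snd_zero zero_index add_0)
  thus ?thesis using i by (simp only: sum.delta finite.intros if_True)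
qed

lemmas ends_independent = ends_independent_hv ends_independent_ev

lemma coroot_ends_independent:
  assumes "(\<Sum>i\<in>ends. scale R (c i) (coroot R i)) = 0" "i \<in> ends"
  shows "c i = 0"
proof -
  have "(\<Sum>i\<in>UNIV. scale R (if i \<in> ends then c i else 0) (coroot R i))
    = (\<Sum>i\<in>ends. scale R (if i \<in> ends then c i else 0) (coroot R i))"
    by (rule sum.mono_neutral_right) auto
  also have "\<dots> = (\<Sum>i\<in>ends. scale R (c i) (coroot R i))" by (intro sum.cong) auto
  finally show ?thesis
    using coroot_independent[of "\<lambda>i. if i \<in> ends then c i else 0" i] assms by simp
qed

lemma MG_zero_kernel:
  assumes x: "x \<in> MG 0" "D x = 0"
  shows "\<exists>v p. x = hv v + (\<Sum>i\<in>ends. sc (p i) (ev (simple i))) \<and> (\<forall>i\<in>ends. rf (simple i) v = 0)"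
proof -
  obtain v p n where e: "x = hv v + (\<Sum>i\<in>ends. sc (p i) (ev (simple i))) + (\<Sum>i\<in>ends. sc (n i) (ev (- simple i)))"
    using MG_zero[OF x(1)] by blast
  note z = x(2)[unfolded D_MG_zero[OF e]]
  have "n i = 0" if "i \<in> ends" for i
    using ends_independent(1)[OF z] by (intro coroot_ends_independent[OF _ that]) (simp only: neg_equal_0_iff_equal)
  moreover have "rf (simple i) v = 0" if "i \<in> ends" for i using ends_independent(2)[OF z that] by simp
  ultimately show ?thesis unfolding e by (intro exI[of _ v] exI[of _ p]) simp
qed

text \<open>There is no block J_2 in degree 0. The condition D (D y) = 0 removes the vectors of
  roots - alpha_i from y; then D y is a combination of the e_i, and each e_i is, up to sign, D^2 of
  the vector of root - alpha_i.\<close>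

lemma MG_zero_SZ:
  assumes y: "y \<in> MG 0" "D (D y) = 0"
  shows "(0, y) \<in> LD.SZ"
proof -
  obtain v p n where e: "y = hv v + (\<Sum>i\<in>ends. sc (p i) (ev (simple i))) + (\<Sum>i\<in>ends. sc (n i) (ev (- simple i)))"
    using MG_zero[OF y(1)] by blast
  have "D (\<Sum>i\<in>ends. sc (rf (simple i) v) (ev (- simple i))) = - (\<Sum>i\<in>ends. sc (rf (simple i) v) (hv (hc (simple i))))"
    by (simp add: LD.D_simps D_minus_simple M.scale_minus_right)
  hence DD: "D (D (\<Sum>i\<in>ends. sc (rf (simple i) v) (ev (- simple i)))) = - (\<Sum>i\<in>ends. sc (rf (simple i) v) (ev (simple i)))"
    by (simp add: LD.D_simps D_hv_simple)
  let ?n = "\<Sum>i\<in>ends. scale R (n i) (coroot R i)"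
  have "D (D y) = D (hv (- ?n) + (\<Sum>i\<in>ends. sc (- rf (simple i) v) (ev (simple i))))"
    by (simp only: D_MG_zero[OF e])
  also have "\<dots> = D (hv (- ?n))" by (simp add: LD.D_simps D_simple)
  also have "\<dots> = - (\<Sum>i\<in>ends. sc (n i) (ev (simple i)))"
    by (simp add: hv_simps hv_diff LD.D_simps D_hv_simple flip: hc_axis)
  finally have "- (\<Sum>i\<in>ends. sc (n i) (ev (simple i))) = 0" unfolding y(2) by (rule sym)
  hence z: "hv 0 + (\<Sum>i\<in>ends. sc (n i) (ev (simple i))) = 0"
    by (simp only: hv_simps(4) add_0 neg_equal_0_iff_equal)
  have n: "n i = 0" if "i \<in> ends" for i by (rule ends_independent(2)[OF z that])
  have "D y = D (D (\<Sum>i\<in>ends. sc (rf (simple i) v) (ev (- simple i))))"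
    unfolding D_MG_zero[OF e] DD by (simp add: n hv_simps M.scale_minus_left)
  moreover have "0 = D 0" by simp
  ultimately show ?thesis unfolding LD.in_SZ using LD.D_zero by blast
qed

section \<open>The cubic identity for odd classes\<close>

lemma zero_SZ: "(0, 0) \<in> LD.SZ"
  unfolding LD.in_SZ using LD.D_zero by metis

text \<open>The mixed terms of the expanded cube are 2 [u,[u,w]] + [w,[u,u]] for both orders of the
  summands. Each is an instance of the Jacobi identity at u, u, w, so the cubic identity needs
  checking on homogeneous elements only.\<close>

lemma cube_add:
  assumes y: "D (D y) = 0" "LD.bb (0, y) (LD.bb (0, y) (0, y)) \<in> LD.SZ"
    and z: "D (D z) = 0" "LD.bb (0, z) (LD.bb (0, z) (0, z)) \<in> LD.SZ"
  shows "LD.bb (0, y + z) (LD.bb (0, y + z) (0, y + z)) \<in> LD.SZ"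
proof -
  let ?b = LD.bb and ?y = "(0, y)" and ?z = "(0, z)"
  note add = pair.subspace_add[OF LD.SZ_subspace]
  have P: "?y \<in> LD.SP 1" "?z \<in> LD.SP 1" using y(1) z(1) SP_1 by blast+
  have k: "koszul_sign 1 1 = (- 1 :: 'k)" by (simp add: koszul_sign_def)
  have sk: "?b u w = ?b w u" if "u \<in> LD.SP 1" "w \<in> LD.SP 1" for u w
    using LD.bb_skew[OF that] by (simp add: k)
  have mix: "?b u (?b u w) + ?b u (?b w u) + ?b w (?b u u) \<in> LD.SZ" if "u \<in> LD.SP 1" "w \<in> LD.SP 1" for u w
  proof -
    have "?b (?b u u) w + ?b w (?b u u) = 0"
      using LD.bb_skew[OF LD.bb_closed[OF that(1,1)] that(2)] by (simp add: koszul_sign_def)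
    hence "?b (?b u u) w = - ?b w (?b u u)" by (simp add: eq_neg_iff_add_eq_0)
    thus ?thesis using LD.bb_jacobi[OF that(1,1,2)] sk[OF that] by (simp add: k algebra_simps)
  qed
  have "?b (?y + ?z) (?b (?y + ?z) (?y + ?z)) = ?b ?y (?b ?y ?y) + ?b ?z (?b ?z ?z)
     + (?b ?y (?b ?y ?z) + ?b ?y (?b ?z ?y) + ?b ?z (?b ?y ?y)) + (?b ?z (?b ?z ?y) + ?b ?z (?b ?y ?z) + ?b ?y (?b ?z ?z))"
    by (simp only: pair.b_add_left pair.b_add_right add_ac)
  also have "\<dots> \<in> LD.SZ"
    by (rule add[OF add[OF add[OF y(2) z(2)] mix[OF P]] mix[OF P(2,1)]])
  finally show ?thesis by simp
qed

text \<open>In degree 0 the odd class itself is trivial. In any other degree q the cube has degree 3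
  q, and \<open>triple_degree\<close> says that this degree carries no roots if q carries
  one.\<close>

lemma cube_homogeneous:
  assumes y: "y \<in> MG q" "D (D y) = 0"
  shows "LD.bb (0, y) (LD.bb (0, y) (0, y)) \<in> LD.SZ"
proof (cases "q = 0")
  case True
  hence z: "(0, y) \<in> LD.SZ" using MG_zero_SZ y by simp
  have "(0, y) \<in> LD.SP 1" using y(2) by (rule SP_1)
  thus ?thesis using LD.SZ_ideal_left z by blast
next
  case False
  have "br y (br (D y) y - br y (D y)) = 0"
  proof (cases "\<exists>a. is_root a \<and> rdeg a = q")
    case True
    have "br y (br (D y) y - br y (D y)) \<in> MG (q + (q + q))"
      by (intro MG_mult M.subspace_diff[OF MG_subspace] D_MG y(1))
    moreover have "rdeg c \<noteq> q + (q + q)" if "is_root c" for c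
      using triple_degree[OF _ _ that] True False by blast
    moreover have "q + (q + q) \<noteq> 0" using False by (simp add: vec_eq_iff)
    ultimately show ?thesis using MG_no_root by blast
  next
    case no: False
    hence "y = 0" using MG_no_root[OF False _ y(1)] by blast
    thus ?thesis by simp
  qed
  hence "LD.bb (0, y) (LD.bb (0, y) (0, y)) = (0, 0)" by (simp add: LD.bb_def)
  thus ?thesis using zero_SZ by simp
qed

lemma cube_SZ:
  assumes y: "D (D y) = 0"
  shows "LD.bb (0, y) (LD.bb (0, y) (0, y)) \<in> LD.SZ"
proof -
  obtain T where T: "finite T" "\<forall>x. (\<Sum>q\<in>T. prM q x) = x" using sum_prM by blast
  have h: "D (D (prM q y)) = 0" for q using y by (simp flip: prM_D add: prM_zero)
  have "D (D (\<Sum>q\<in>A. prM q y)) = 0 \<and> LD.bb (0, \<Sum>q\<in>A. prM q y) (LD.bb (0, \<Sum>q\<in>A. prM q y) (0, \<Sum>q\<in>A. prM q y)) \<in> LD.SZ"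
    if A: "finite A" for A
    using A
  proof (induction A)
    case empty
    show ?case using zero_SZ by (simp add: LD.bb_def)
  next
    case (insert q A)
    thus ?case using cube_add[OF h cube_homogeneous[OF prM_MG h], of "\<Sum>q\<in>A. prM q y"] h by (simp add: LD.D_simps)
  qed
  from this[OF T(1)] show ?thesis using T(2) by simp
qed

end

section \<open>The Lie superalgebra g(8,3)\<close>

lemma vector_5:
  "(vector [a, b, c, d, e] :: 'a::zero ^ 5) $ 1 = a" "(vector [a, b, c, d, e] :: 'a ^ 5) $ 2 = b"
  "(vector [a, b, c, d, e] :: 'a ^ 5) $ 3 = c" "(vector [a, b, c, d, e] :: 'a ^ 5) $ 4 = d"
  "(vector [a, b, c, d, e] :: 'a ^ 5) $ 5 = e"
  unfolding vector_def by simp_all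

lemmas cartan_g83_simps = cartan_g83_def vector_5

text \<open>The zeros on the diagonal of the Cartan matrix arise here: for odd j the pairing of
  \<open>kappa j\<close> with the root of its own node is 2 + 1 = 3.\<close>

lemma kappa_node: "3 dvd e8form (kappa j) (simple (node i)) - cartan_g83 $ j $ i"
proof -
  have "\<forall>j i. 3 dvd e8form (kappa j) (simple (node i)) - cartan_g83 $ j $ i"
    unfolding forall_5
    by (simp add: kappa_def parity_g83_def node_def partner_def e8form_simps e8form_axis cartan_e8_simps cartan_g83_simps)
  thus ?thesis by blast
qed

text \<open>Orthogonality to the ends modulo 3 puts the coroot of \<open>kappa j\<close> into the
  kernel of D, so that it represents an even class.\<close>

lemma kappa_end:
  assumes "i \<in> ends" shows "3 dvd e8form (kappa j) (simple i)"
proof -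
  have "\<forall>j. \<forall>i\<in>ends. 3 dvd e8form (kappa j) (simple i)"
    unfolding forall_5
    by (simp add: kappa_def parity_g83_def node_def partner_def e8form_simps e8form_axis cartan_e8_simps)
  thus ?thesis using assms by blast
qed

lemma cartan_g83_sym: "cartan_g83 $ i $ j = cartan_g83 $ j $ i"
proof -
  have "\<forall>i j. cartan_g83 $ i $ j = cartan_g83 $ j $ i"
    unfolding forall_5 by (simp add: cartan_g83_simps)
  thus ?thesis by blast
qed

text \<open>Elimination along the diagram expresses all coordinates by the first two and leaves 3
  x_1 = 2 x_2 and 10 x_1 = 7 x_2. The determinant of this system is 21 - 20 = 1, so it has only the
  zero solution over every field.\<close>

lemma cartan_e8_kernel:
  fixes x :: "'k::field^8"
  assumes "(\<chi> i j. of_int (cartan_e8 $ i $ j)) *v x = 0"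
  shows "x = 0"
proof -
  have raw: "(\<Sum>j\<in>UNIV. of_int (cartan_e8 $ i $ j) * x $ j) = 0" for i
    using assms by (simp add: vec_eq_iff matrix_vector_mult_def)
  have e: "x$3 = 2 * x$1" "x$4 = 2 * x$2" using raw[of 1] raw[of 2] unfolding sum_8 by (simp_all add: cartan_e8_simps)
  have a: "3 * x$1 = 2 * x$2"
    using raw[of 3] unfolding sum_8 by (simp add: cartan_e8_simps e)
  have x5: "x$5 = 3 * x$2 - 2 * x$1"
    using raw[of 4] unfolding sum_8 by (simp add: cartan_e8_simps e; algebra)
  have x6: "x$6 = 4 * x$2 - 4 * x$1"
    using raw[of 5] unfolding sum_8 by (simp add: cartan_e8_simps e x5; algebra)
  have x7: "x$7 = 5 * x$2 - 6 * x$1"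
    using raw[of 6] unfolding sum_8 by (simp add: cartan_e8_simps x5 x6; algebra)
  have x8: "x$8 = 6 * x$2 - 8 * x$1"
    using raw[of 7] unfolding sum_8 by (simp add: cartan_e8_simps x6 x7; algebra)
  have b: "10 * x$1 = 7 * x$2"
    using raw[of 8] unfolding sum_8 by (simp add: cartan_e8_simps x7 x8; algebra)
  have "x$1 = 7 * (3 * x$1) - 2 * (10 * x$1)" by simp
  hence x1: "x$1 = 0" unfolding a b by simp
  have "x$2 = 7 * x$2 - 3 * (2 * x$2)" by simp
  hence "x$2 = 0" unfolding a[symmetric] b[symmetric] by (simp add: x1)
  note x1 this
  moreover from this have "x$3 = 0" "x$4 = 0" using e(1,2) by simp_all
  moreover from calculation have "x$5 = 0" using x5 by simp
  moreover from calculation have "x$6 = 0" using x6 by simp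
  moreover from calculation have "x$7 = 0" using x7 by simp
  moreover from calculation have "x$8 = 0" using x8 by simp
  ultimately have "\<forall>i. x $ i = 0" unfolding forall_8 by blast
  thus ?thesis by (simp add: vec_eq_iff)
qed

lemma cartan_g83_kernel:
  fixes x :: "'k::field^5"
  assumes "(\<chi> i j. of_int (cartan_g83 $ i $ j)) *v x = 0" and two: "(2 :: 'k) \<noteq> 0"
  shows "x = 0"
proof -
  have raw: "(\<Sum>j\<in>UNIV. of_int (cartan_g83 $ i $ j) * x $ j) = 0" for i
    using assms(1) by (simp add: vec_eq_iff matrix_vector_mult_def)
  have "x$2 = 0" "x$4 = 0"
    using raw[of 1] raw[of 5] unfolding sum_5 by (simp_all add: cartan_g83_simps)
  moreover from this have "x$3 = 0"
    using raw[of 3] two unfolding sum_5 by (simp add: cartan_g83_simps)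
  moreover from calculation have "x$1 = 0" "x$5 = 0"
    using raw[of 2] raw[of 4] unfolding sum_5 by (simp_all add: cartan_g83_simps)
  ultimately have "\<forall>i. x $ i = 0" unfolding forall_5 by blast
  thus ?thesis by (simp add: vec_eq_iff)
qed

lemma end_add_node:
  assumes "odd_index j"
  shows "is_root (simple (partner j) + simple (node j))"
  using is_root_add[OF is_root_axis is_root_axis, of "partner j" "node j"] form_end_node[OF partner_ends, of j j] assms by simp

text \<open>By \<open>same_degree_coeff\<close> a root of this degree may differ from alpha_{node j}
  only at end nodes with nonzero pairing. That is the partner for odd j, where the pairing is -1 and
  the coefficient can rise by 1.\<close>

lemma rdeg_axis_root:
  assumes a: "is_root a" "rdeg a = axis j 1"
  shows "a = simple (node j) \<or> odd_index j \<and> a = simple (partner j) + simple (node j)"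
proof -
  have nz: "rdeg (simple (node j)) \<noteq> 0" "rdeg (simple (node j)) = rdeg a" by (simp_all add: rdeg_node a(2) axis_eq_0_iff)
  have node: "a $ node i = simple (node j) $ node i" for i using a(2) rdeg_nth[of a i] by (simp add: axis_def node_inj)
  have c: "a $ i - simple (node j) $ i = 0 \<or> odd_index j \<and> i = partner j \<and> a $ i - simple (node j) $ i = 1" if "i \<in> ends" for i
    using same_degree_coeff[OF is_root_axis a(1) nz(2,1) that] form_end_node[OF that, of j] by (auto split: if_splits)
  show ?thesis
  proof (cases "odd_index j \<and> a $ partner j - simple (node j) $ partner j = 1")
    case True
    have "a $ i = (simple (partner j) + simple (node j)) $ i" for i
    proof (cases "i \<in> ends")
      case i: True
      thus ?thesis using c[OF i] True by (cases "i = partner j") (auto simp: axis_def)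
    next
      case False
      then obtain k where "i = node k" using node_surj by blast
      moreover from this have "partner j \<noteq> i" using False partner_ends by blast
      ultimately show ?thesis using node[of k] by (simp add: axis_def)
    qed
    thus ?thesis using True by (simp add: vec_eq_iff)
  next
    case False
    have "a $ i = simple (node j) $ i" for i
    proof (cases "i \<in> ends")
      case i: True thus ?thesis using c[OF i] False by auto
    next
      case False
      then obtain k where "i = node k" using node_surj by blast
      thus ?thesis using node[of k] by simp
    qed
    thus ?thesis by (simp add: vec_eq_iff)
  qed
qed

section \<open>The Cartan subalgebra of g(8,3) inside that of E_8\<close>

context e8_g83
begin

lemma e8_span: "\<exists>c. v = (\<Sum>i\<in>UNIV. scale R (c i) (coroot R i))"
  by (rule realization_spanning[OF realization cartan_e8_kernel])

lemma S_span: "\<exists>c. w = (\<Sum>j\<in>UNIV. scale S (c j) (coroot S j))"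
  by (rule realization_spanning[OF S_realization cartan_g83_kernel[OF _ two_k(2)]])

sublocale W: vector_space "scale S"
  using S_realization unfolding is_realization_def finite_dimensional_vector_space_def by blast

lemma S_independent: "(\<Sum>i\<in>UNIV. scale S (c i) (coroot S i)) = 0 \<Longrightarrow> c i = 0"
  using S_realization by (simp add: is_realization_def)

lemma S_root: "root S i (\<Sum>j\<in>UNIV. scale S (c j) (coroot S j)) = (\<Sum>j\<in>UNIV. c j * of_int (cartan_g83 $ j $ i))"
proof -
  have "Vector_Spaces.linear (scale S) (*) (root S i)" using S_realization by (simp add: is_realization_def)
  then interpret L: Vector_Spaces.linear "scale S" "(*)" "root S i" .
  have "root S i (coroot S j) = of_int (cartan_g83 $ j $ i)" for j
    using S_realization by (simp add: is_realization_def)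
  thus ?thesis by (simp add: L.sum L.scale)
qed

definition coroot_coeff :: "'w \<Rightarrow> 5 \<Rightarrow> 'k"
  where "coroot_coeff w = (SOME c. w = (\<Sum>j\<in>UNIV. scale S (c j) (coroot S j)))"

lemma coroot_coeff_sum: "(\<Sum>j\<in>UNIV. scale S (coroot_coeff w j) (coroot S j)) = w"
  unfolding coroot_coeff_def by (rule someI_ex[OF S_span, symmetric])

lemma coroot_coeff_eqI:
  assumes "w = (\<Sum>j\<in>UNIV. scale S (c j) (coroot S j))"
  shows "coroot_coeff w j = c j"
proof -
  have "(\<Sum>j\<in>UNIV. scale S (coroot_coeff w j - c j) (coroot S j)) = w - w"
    unfolding W.scale_left_diff_distrib sum_subtractf coroot_coeff_sum by (simp only: assms)
  thus ?thesis using S_independent[of "\<lambda>j. coroot_coeff w j - c j" j] by simp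
qed

definition cartan_map :: "'w \<Rightarrow> 'v"
  where "cartan_map w = (\<Sum>j\<in>UNIV. scale R (coroot_coeff w j) (hc (kappa j)))"

lemma cartan_map_add: "cartan_map (u + w) = cartan_map u + cartan_map w"
proof -
  have "coroot_coeff (u + w) j = coroot_coeff u j + coroot_coeff w j" for j
    by (rule coroot_coeff_eqI) (simp add: W.scale_left_distrib sum.distrib coroot_coeff_sum)
  thus ?thesis by (simp add: cartan_map_def V.scale_left_distrib sum.distrib)
qed

lemma cartan_map_scale: "cartan_map (scale S c w) = scale R c (cartan_map w)"
proof -
  have "coroot_coeff (scale S c w) j = c * coroot_coeff w j" for j
    by (rule coroot_coeff_eqI) (simp add: coroot_coeff_sum flip: W.scale_scale W.scale_sum_right)
  thus ?thesis by (simp add: cartan_map_def V.scale_sum_right)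
qed

lemma cartan_map_coroot: "cartan_map (coroot S j) = hc (kappa j)"
proof -
  have "coroot S j = (\<Sum>i\<in>UNIV. if i = j then coroot S i else 0)" by simp
  also have "\<dots> = (\<Sum>i\<in>UNIV. scale S (if i = j then 1 else 0) (coroot S i))" by (intro sum.cong) auto
  finally have "coroot_coeff (coroot S j) i = (if i = j then 1 else 0)" for i by (rule coroot_coeff_eqI)
  hence "cartan_map (coroot S j) = (\<Sum>i\<in>UNIV. if i = j then hc (kappa i) else 0)"
    unfolding cartan_map_def by (intro sum.cong) auto
  thus ?thesis by simp
qed

lemma rf_cartan_map: "rf a (cartan_map w) = (\<Sum>j\<in>UNIV. coroot_coeff w j * of_int (e8form (kappa j) a))"
  by (simp add: cartan_map_def rf_sum rf_simps rf_hc)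

lemma rf_cartan_map_end: "i \<in> ends \<Longrightarrow> rf (simple i) (cartan_map w) = 0"
  using of_int_mod3[of "e8form (kappa _) (simple i)" 0] kappa_end[of i] by (simp add: rf_cartan_map)

lemma rf_cartan_map_node: "rf (simple (node i)) (cartan_map w) = root S i w"
proof -
  have "rf (simple (node i)) (cartan_map w) = (\<Sum>j\<in>UNIV. coroot_coeff w j * of_int (cartan_g83 $ j $ i))"
    unfolding rf_cartan_map using of_int_mod3[OF kappa_node] by simp
  also have "\<dots> = root S i w" using S_root[of i "coroot_coeff w"] by (simp add: coroot_coeff_sum)
  finally show ?thesis .
qed

text \<open>The root values of w can be read from \<open>cartan_map w\<close>, and they determine w
  because the Cartan matrix of g(8,3) is nondegenerate when 2 is not zero.\<close>

lemma cartan_map_inj: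
  assumes "cartan_map w = 0" shows "w = 0"
proof -
  have z: "(\<Sum>j\<in>UNIV. of_int (cartan_g83 $ i $ j) * coroot_coeff w j) = 0" for i
  proof -
    have "(\<Sum>j\<in>UNIV. of_int (cartan_g83 $ i $ j) * coroot_coeff w j) = (\<Sum>j\<in>UNIV. coroot_coeff w j * of_int (cartan_g83 $ j $ i))"
      by (rule sum.cong[OF refl]) (subst cartan_g83_sym, rule mult.commute)
    also have "\<dots> = root S i w" unfolding S_root[symmetric] coroot_coeff_sum ..
    also have "\<dots> = 0" unfolding rf_cartan_map_node[symmetric] assms by (rule rf_zero)
    finally show ?thesis .
  qed
  have "(\<chi> j. coroot_coeff w j) = 0"
  proof (rule cartan_g83_kernel[OF _ two_k(2)])
    show "(\<chi> i j. of_int (cartan_g83 $ i $ j)) *v (\<chi> j. coroot_coeff w j) = 0"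
      by (simp add: vec_eq_iff matrix_vector_mult_def z)
  qed
  hence "coroot_coeff w j = 0" for j by (simp add: vec_eq_iff)
  thus ?thesis using coroot_coeff_sum[of w] by simp
qed

lemma hc_diff: "hc (a - c) = hc a - hc c"
  using hc_simps(1)[of a "- c"] by (simp add: hc_simps(2))

lemma cartan_map_surj:
  assumes v: "\<And>i. i \<in> ends \<Longrightarrow> rf (simple i) v = 0"
  shows "\<exists>w. v = cartan_map w"
proof -
  obtain c where c: "v = (\<Sum>i\<in>UNIV. scale R (c i) (coroot R i))" using e8_span by blast
  have r: "rf (simple k) v = (\<Sum>i\<in>UNIV. c i * of_int (cartan_e8 $ i $ k))" for k
    unfolding c rf_sum by (simp add: rf_simps rf_hc e8form_axis flip: hc_axis)
  \<comment> \<open>The pairing with alpha_1 is 2 c_1 - c_3, and 2 = -1, hence c_1 = - c_3; nodes 2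
    and 8 are similar. These are the proportions in which simple coroots occur in
    \<open>hc (kappa j)\<close>.\<close>
  have e: "c 1 = - c 3" "c 2 = - c 4" "c 8 = - c 7"
    using v[of 1] v[of 2] v[of 8] unfolding r sum_8
    by (simp_all add: cartan_e8_simps two_k eq_neg_iff_add_eq_0 neg_eq_iff_add_eq_0 add.commute)
  define w where "w = (\<Sum>j\<in>UNIV. scale S (c (node j)) (coroot S j))"
  have "coroot_coeff w j = c (node j)" for j by (rule coroot_coeff_eqI) (simp add: w_def)
  hence "cartan_map w = (\<Sum>j\<in>UNIV. scale R (c (node j)) (hc (kappa j)))" by (simp add: cartan_map_def)
  also have "\<dots> = v"
    unfolding c sum_5 sum_8
    by (simp add: kappa_def parity_g83_def node_def partner_def hc_simps hc_axis e V.scale_minus_left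
        V.scale_right_diff_distrib V.scale_right_distrib hc_diff)
  finally show ?thesis by blast
qed

section \<open>Generators and homogeneous pieces of the semisimplification\<close>

text \<open>For odd \<open>j\<close> the sign makes \<open>fv j \<mapsto> - ev (- simple (node j))\<close> the action of \<open>D\<close> on a block \<open>J\<^sub>2\<close>.\<close>

definition fv :: "5 \<Rightarrow> 'v \<times> ('k^e8_root)"
  where "fv j = (if odd_index j then sc (e8sign (simple (partner j)) (simple (node j))) (ev (- (simple (partner j) + simple (node j))))
     else - ev (- simple (node j)))"

definition gi :: "bit \<Rightarrow> 'v \<times> ('k^e8_root) \<Rightarrow> ('v \<times> ('k^e8_root)) \<times> ('v \<times> ('k^e8_root))"
  where "gi p x = (if p = 0 then (x, 0) else (0, x))"

definition SG :: "int^5 \<Rightarrow> (('v \<times> ('k^e8_root)) \<times> ('v \<times> ('k^e8_root))) set"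
  where "SG q = {(x, y). x \<in> MG q \<and> y \<in> MG q \<and> D x = 0 \<and> D (D y) = 0}"

definition spr :: "int^5 \<Rightarrow> ('v \<times> ('k^e8_root)) \<times> ('v \<times> ('k^e8_root)) \<Rightarrow> ('v \<times> ('k^e8_root)) \<times> ('v \<times> ('k^e8_root))"
  where "spr q z = (prM q (fst z), prM q (snd z))"

lemma D_node:
  "D (ev (simple (node j))) = (if odd_index j
     then sc (e8sign (simple (partner j)) (simple (node j))) (ev (simple (partner j) + simple (node j))) else 0)"
proof -
  have nz: "rdeg (simple (node j)) \<noteq> 0" by (simp add: rdeg_node axis_eq_0_iff)
  have "D (ev (simple (node j))) = (\<Sum>i\<in>ends. if i = partner j then if odd_index j
     then sc (e8sign (simple i) (simple (node j))) (ev (simple i + simple (node j))) else 0 else 0)"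
    unfolding D_ev[OF is_root_axis nz] by (intro sum.cong refl) (simp add: form_end_node)
  thus ?thesis using partner_ends[of j] by (simp only: sum.delta finite.intros if_True)
qed

lemma D_end_node:
  assumes "odd_index j"
  shows "D (ev (simple (partner j) + simple (node j))) = 0"
proof -
  have nz: "rdeg (simple (partner j) + simple (node j)) \<noteq> 0"
    by (simp add: rdeg_simps rdeg_end[OF partner_ends] rdeg_node axis_eq_0_iff)
  show ?thesis unfolding D_ev[OF end_add_node[OF assms] nz]
    by (intro sum.neutral ballI) (simp add: e8form_simps form_ends[OF _ partner_ends] form_end_node)
qed

lemma D_minus_node: "D (ev (- simple (node j))) = 0"
proof -
  have "rdeg (- simple (node j)) \<noteq> 0" "is_root (- simple (node j))"
    by (simp_all add: rdeg_simps rdeg_node axis_eq_0_iff)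
  note D_ev[OF this(2,1)]
  thus ?thesis by (simp add: e8form_simps form_end_node)
qed

lemma D_fv: "D (fv j) = (if odd_index j then - ev (- simple (node j)) else 0)"
proof (cases "odd_index j")
  case False thus ?thesis by (simp add: fv_def LD.D_minus D_minus_node)
next
  case True
  let ?p = "simple (partner j)" and ?n = "simple (node j)"
  have nz: "rdeg (- (?p + ?n)) \<noteq> 0" by (simp add: rdeg_simps rdeg_end[OF partner_ends] rdeg_node axis_eq_0_iff)
  have root: "is_root (- (?p + ?n))" using end_add_node[OF True] unfolding is_root_minus .
  have "D (ev (- (?p + ?n))) = (\<Sum>i\<in>ends. if i = partner j
      then sc (e8sign (simple i) (- (?p + ?n))) (ev (simple i + - (?p + ?n))) else 0)"
    unfolding D_ev[OF root nz]
    by (intro sum.cong refl) (auto simp: e8form_simps form_ends[OF _ partner_ends] form_end_node True)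
  also have "\<dots> = sc (e8sign ?p (- (?p + ?n))) (ev (?p + - (?p + ?n)))"
    using partner_ends[of j] by (simp only: sum.delta finite.intros if_True)
  also have "\<dots> = - sc (e8sign ?p ?n) (ev (- ?n))"
    by (simp add: e8sign_minus(2) e8sign_add e8sign_self M.scale_minus_left del: minus_add_distrib)
  finally show ?thesis using True by (simp add: fv_def LD.D_scale e8sign_square M.scale_minus_right)
qed

lemma pair_lie: "pair.lie_mod LD.SP LD.SZ"
  by (rule LD.pair_lie_mod[OF cube_SZ])

lemma in_SG: "(x, y) \<in> SG q \<longleftrightarrow> x \<in> MG q \<and> y \<in> MG q \<and> D x = 0 \<and> D (D y) = 0"
  by (simp add: SG_def)

lemma SG_total: "SG q \<subseteq> pair.total LD.SP"
proof
  fix z assume "z \<in> SG q"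
  thus "z \<in> pair.total LD.SP" unfolding SG_def using LD.pair_total by blast
qed

lemma SG_subspace: "pair.subspace (SG q)"
proof (rule pair.subspaceI)
  note sub = M.subspace_0[OF MG_subspace] M.subspace_add[OF MG_subspace] M.subspace_scale[OF MG_subspace]
  have "(0, 0) \<in> SG q" unfolding in_SG using sub(1) LD.D_zero by metis
  thus "0 \<in> SG q" by (simp only: zero_prod_def)
  show "z + w \<in> SG q" if "z \<in> SG q" "w \<in> SG q" for z w
  proof -
    obtain x y x' y' where e: "z = (x, y)" "w = (x', y')" by (cases z; cases w)
    show ?thesis using that sub(2) unfolding e add_Pair in_SG by (simp add: LD.D_add)
  qed
  show "LD.ss c z \<in> SG q" if "z \<in> SG q" for c z
  proof -
    obtain x y where e: "z = (x, y)" by (cases z)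
    show ?thesis using that sub(3) unfolding e LD.ss_def fst_conv snd_conv in_SG by (simp add: LD.D_scale)
  qed
qed

lemma SG_mult:
  assumes "z \<in> SG p" "w \<in> SG q"
  shows "LD.bb z w \<in> SG (p + q)"
proof -
  obtain x y x' y' where e: "z = (x, y)" "w = (x', y')" by (cases z; cases w)
  obtain u v where uv: "LD.bb z w = (u, v)" by (cases "LD.bb z w")
  have "LD.bb z w \<in> pair.total LD.SP"
    using pair.lie_mod_total(1)[OF pair_lie] SG_total assms unfolding pair.subalgebra_def by blast
  hence D: "D u = 0" "D (D v) = 0" unfolding uv LD.pair_total by simp_all
  have m: "x \<in> MG p" "y \<in> MG p" "D y \<in> MG p" "x' \<in> MG q" "y' \<in> MG q" "D y' \<in> MG q"
    using assms D_MG unfolding e in_SG by blast+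
  have uv': "u = br x x' + (br (D y) y' - br y (D y'))" "v = br x y' + br y x'"
    using uv unfolding e LD.bb_def by simp_all
  have "u \<in> MG (p + q)" "v \<in> MG (p + q)" unfolding uv'
    by (intro M.subspace_add[OF MG_subspace] M.subspace_diff[OF MG_subspace] MG_mult m)+
  thus ?thesis unfolding uv in_SG using D by blast
qed

lemma SG_zero:
  assumes "q \<noteq> 0" "\<And>a. is_root a \<Longrightarrow> rdeg a \<noteq> q" "z \<in> SG q"
  shows "z = 0"
proof -
  obtain x y where e: "z = (x, y)" by (cases z)
  have "x = 0" "y = 0" using MG_no_root[OF assms(1,2)] assms(3) unfolding e in_SG by blast+
  thus ?thesis by (simp add: e zero_prod_def)
qed

lemma SP_0: "D x = 0 \<Longrightarrow> (x, 0) \<in> LD.SP 0"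
  unfolding LD.SP_simps by blast

lemma gi_SP: "(if p = 0 then D x = 0 else D (D x) = 0) \<Longrightarrow> gi p x \<in> LD.SP p"
  by (cases p) (simp_all add: gi_def SP_0 SP_1)

lemma gi_SG:
  assumes "x \<in> MG q" "if p = 0 then D x = 0 else D (D x) = 0"
  shows "gi p x \<in> SG q"
  using assms M.subspace_0[OF MG_subspace] by (cases p) (auto simp: gi_def in_SG)

lemma gi_minus: "gi p (- x) = - gi p x"
  and gi_scale: "gi p (sc c x) = LD.ss c (gi p x)"
  by (simp_all add: gi_def LD.ss_def)

lemma h_gi: "LD.bb (gi 0 u) (gi p x) = gi p (br u x)"
  by (cases p) (simp_all add: gi_def LD.bb_def)

text \<open>The bracket with an odd class involves D u besides u, hence the second condition. D y
  has the same degree as y, so the term [u, D y] is covered by the first.\<close>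

lemma generator_annihilates:
  assumes z: "z \<in> SG q" and g: "\<And>x. x \<in> MG q \<Longrightarrow> br u x = 0" "\<And>x. x \<in> MG q \<Longrightarrow> br (D u) x = 0"
  shows "LD.bb (gi p u) z = 0"
proof -
  obtain x y where e: "z = (x, y)" by (cases z)
  have "x \<in> MG q" "y \<in> MG q" "D y \<in> MG q" using z D_MG unfolding e in_SG by blast+
  hence "LD.bb (gi p u) z = (0, 0)" by (simp add: e gi_def LD.bb_def g)
  thus ?thesis by (simp only: zero_prod_def)
qed

lemma br_ev_MG_zero:
  assumes u: "is_root u" and q: "q \<noteq> 0" "rdeg u + q \<noteq> 0"
    and c: "\<And>c. is_root c \<Longrightarrow> rdeg c = q \<Longrightarrow> \<not> is_root (u + c)" and x: "x \<in> MG q"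
  shows "br (ev u) x = 0"
  using x
proof (induction x rule: MG_induct)
  case (ev a)
  have "u + a \<noteq> 0"
  proof
    assume "u + a = 0"
    from arg_cong[OF this, of rdeg] show False using q(2) ev(2) unfolding rdeg_simps by simp
  qed
  thus ?case using c[OF ev] u ev(1) by (simp add: br_ee ev_nonroot)
qed (use q in \<open>simp_all add: M.b_simps\<close>)

lemma br_hc_MG:
  assumes q: "q \<noteq> 0" and c: "\<And>c. is_root c \<Longrightarrow> rdeg c = q \<Longrightarrow> 3 dvd e8form k c - n" and x: "x \<in> MG q"
  shows "br (hv (hc k)) x = sc (of_int n) x"
  using x
proof (induction x rule: MG_induct)
  case (ev a) thus ?case using of_int_mod3[OF c[OF ev]] by (simp add: br_he rf_hc)
next
  case (scale c x) thus ?case by (simp add: M.b_simps mult.commute)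
qed (use q in \<open>simp_all add: M.b_simps M.scale_right_distrib\<close>)

lemma coroot_eigen:
  assumes q: "q \<noteq> 0" and c: "\<And>c. is_root c \<Longrightarrow> rdeg c = q \<Longrightarrow> 3 dvd e8form (kappa j) c - n" and z: "z \<in> SG q"
  shows "LD.bb (gi 0 (hv (cartan_map (coroot S j)))) z = LD.ss (of_int n) z"
proof -
  obtain x y where e: "z = (x, y)" by (cases z)
  have "x \<in> MG q" "y \<in> MG q" using z unfolding e in_SG by blast+
  thus ?thesis using br_hc_MG[OF q c] by (simp add: e gi_def LD.bb_def LD.ss_def cartan_map_coroot)
qed

lemma MG_two:
  assumes x: "x \<in> MG q" and q: "q \<noteq> 0"
    and a: "\<And>a. is_root a \<Longrightarrow> rdeg a = q \<Longrightarrow> \<exists>c d. ev a = sc c u + sc d w"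
  shows "\<exists>c d. x = sc c u + sc d w"
  using x
proof (induction x rule: MG_induct)
  case zero show ?case by (intro exI[of _ 0]) simp
next
  case (add x y)
  then obtain c d c' d' where "x = sc c u + sc d w" "y = sc c' u + sc d' w" by blast
  thus ?case by (intro exI[of _ "c + c'"] exI[of _ "d + d'"]) (simp add: M.scale_left_distrib)
next
  case (scale k x)
  then obtain c d where "x = sc c u + sc d w" by blast
  thus ?case by (intro exI[of _ "k * c"] exI[of _ "k * d"]) (simp add: M.scale_right_distrib)
qed (use a q in blast)+

text \<open>A degree consisting of a single block, J_1 spanned by u or J_2 spanned by u and w,
  contributes one line to the semisimplification, the class of u. Multiples of w are negligible in
  both components, as w is in the kernel and is a multiple of D u.\<close>

lemma one_generator:
  assumes z: "z \<in> SG q" and span: "\<And>x. x \<in> MG q \<Longrightarrow> \<exists>c d. x = sc c u + sc d w"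
    and w: "if p = 0 then D u = 0 \<and> w = 0 else D w = 0 \<and> w \<noteq> 0 \<and> (\<exists>k. k \<noteq> 0 \<and> D u = sc k w)"
  shows "\<exists>c. z - LD.ss c (gi p u) \<in> LD.SZ"
proof -
  obtain x y where e: "z = (x, y)" by (cases z)
  have m: "x \<in> MG q" "y \<in> MG q" "D x = 0" using z unfolding e in_SG by blast+
  obtain c d where x: "x = sc c u + sc d w" using span m by blast
  obtain c' d' where y: "y = sc c' u + sc d' w" using span m by blast
  show ?thesis
  proof (cases "p = 0")
    case True
    hence "z - LD.ss c (gi p u) = (0, y)" using w by (simp add: e x gi_def LD.ss_def)
    moreover have "D y = 0" using w True by (simp add: y LD.D_simps)
    hence "(0, y) \<in> LD.SZ" unfolding LD.in_SZ using LD.D_zero by metis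
    ultimately show ?thesis by (intro exI[of _ c]) simp
  next
    case False
    then obtain k where k: "D w = 0" "w \<noteq> 0" "k \<noteq> 0" "D u = sc k w" using w by auto
    have "sc (c * k) w = 0" using m(3) by (simp add: x LD.D_simps k)
    hence "c = 0" using k by simp
    hence a: "x = D (sc (d / k) u)" using k by (simp add: x LD.D_simps)
    have b: "D (sc d' w) = D (D 0)" using k by (simp add: LD.D_simps)
    have "(x, sc d' w) \<in> LD.SZ" unfolding LD.in_SZ using m(3) a b by blast
    moreover have "z - LD.ss c' (gi p u) = (x, sc d' w)" using False by (simp add: e y gi_def LD.ss_def)
    ultimately show ?thesis by metis
  qed
qed

lemma ev_nonzero: "is_root a \<Longrightarrow> ev a \<noteq> 0"
  by (simp add: ev_def zero_prod_def axis_eq_0_iff)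

lemma SG_pos:
  assumes z: "z \<in> SG (axis j 1)"
  shows "\<exists>c. z - LD.ss c (gi (parity_g83 j) (ev (simple (node j)))) \<in> LD.SZ"
proof (rule one_generator[OF z])
  let ?w = "if odd_index j then ev (simple (partner j) + simple (node j)) else 0"
  show "\<exists>c d. x = sc c (ev (simple (node j))) + sc d ?w" if "x \<in> MG (axis j 1)" for x
  proof (rule MG_two[OF that])
    fix a assume "is_root a" "rdeg a = axis j 1"
    from rdeg_axis_root[OF this] show "\<exists>c d. ev a = sc c (ev (simple (node j))) + sc d ?w"
    proof (elim disjE conjE)
      assume "a = simple (node j)" thus ?thesis by (intro exI[of _ 1] exI[of _ 0]) simp
    next
      assume "odd_index j" "a = simple (partner j) + simple (node j)"
      thus ?thesis by (intro exI[of _ 0] exI[of _ 1]) simp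
    qed
  qed (simp add: axis_eq_0_iff)
  show "if parity_g83 j = 0 then D (ev (simple (node j))) = 0 \<and> ?w = 0
    else D ?w = 0 \<and> ?w \<noteq> 0 \<and> (\<exists>k. k \<noteq> 0 \<and> D (ev (simple (node j))) = sc k ?w)"
  proof (cases "odd_index j")
    case True
    thus ?thesis using D_end_node[OF True] ev_nonzero[OF end_add_node[OF True]] e8sign_nonzero D_node[of j] by auto
  next
    case False
    hence "parity_g83 j = 0" by (cases "parity_g83 j") simp_all
    thus ?thesis using D_node[of j] by simp
  qed
qed

lemma SG_neg:
  assumes z: "z \<in> SG (- axis j 1)"
  shows "\<exists>c. z - LD.ss c (gi (parity_g83 j) (fv j)) \<in> LD.SZ"
proof (rule one_generator[OF z])
  let ?w = "if odd_index j then ev (- simple (node j)) else 0"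
  show "\<exists>c d. x = sc c (fv j) + sc d ?w" if "x \<in> MG (- axis j 1)" for x
  proof (rule MG_two[OF that])
    fix a assume a: "is_root a" "rdeg a = - axis j 1"
    have "is_root (- a)" "rdeg (- a) = axis j 1" using a by (simp_all add: rdeg_simps)
    from rdeg_axis_root[OF this] show "\<exists>c d. ev a = sc c (fv j) + sc d ?w"
    proof (elim disjE conjE)
      assume "- a = simple (node j)"
      hence n: "a = - simple (node j)" by (metis minus_minus)
      show ?thesis
      proof (cases "odd_index j")
        case True thus ?thesis by (intro exI[of _ 0] exI[of _ 1]) (simp add: n)
      next
        case False
        thus ?thesis by (intro exI[of _ "- 1"] exI[of _ 0]) (simp add: n fv_def M.scale_minus_left)
      qed
    next
      assume o: "odd_index j" and "- a = simple (partner j) + simple (node j)"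
      hence "a = - (simple (partner j) + simple (node j))" by (metis minus_minus)
      thus ?thesis using o
        by (intro exI[of _ "e8sign (simple (partner j)) (simple (node j))"] exI[of _ 0])
          (simp add: fv_def e8sign_square)
    qed
  qed (simp add: axis_eq_0_iff)
  show "if parity_g83 j = 0 then D (fv j) = 0 \<and> ?w = 0
    else D ?w = 0 \<and> ?w \<noteq> 0 \<and> (\<exists>k. k \<noteq> 0 \<and> D (fv j) = sc k ?w)"
  proof (cases "odd_index j")
    case True
    moreover have "ev (- simple (node j)) \<noteq> 0" by (rule ev_nonzero) simp
    ultimately show ?thesis using D_minus_node[of j] D_fv[of j]
      by (auto intro!: exI[of _ "- 1"] simp: M.scale_minus_left)
  next
    case False
    hence "parity_g83 j = 0" by (cases "parity_g83 j") simp_all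
    thus ?thesis using D_fv[of j] by simp
  qed
qed

text \<open>By \<open>MG_zero_kernel\<close> an even representative is a Cartan element orthogonal
  to the ends plus a combination of the e_i; the latter is D of coroots, hence negligible. By
  \<open>MG_zero_SZ\<close> the odd component is negligible too.\<close>

lemma SG_0:
  assumes "z \<in> SG 0"
  shows "\<exists>w. z - gi 0 (hv (cartan_map w)) \<in> LD.SZ"
proof -
  obtain x y where e: "z = (x, y)" by (cases z)
  have m: "x \<in> MG 0" "y \<in> MG 0" "D x = 0" "D (D y) = 0" using assms unfolding e in_SG by blast+
  obtain v p where x: "x = hv v + (\<Sum>i\<in>ends. sc (p i) (ev (simple i)))" "\<forall>i\<in>ends. rf (simple i) v = 0"
    using MG_zero_kernel[OF m(1,3)] by blast
  obtain w where w: "v = cartan_map w" using cartan_map_surj x(2) by blast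
  let ?u = "\<Sum>i\<in>ends. sc (p i) (hv (hc (simple i)))"
  have Du: "(\<Sum>i\<in>ends. sc (p i) (ev (simple i))) = D ?u"
    by (simp add: LD.D_simps D_hv_simple)
  have DDu: "D (D ?u) = 0" by (simp add: LD.D_simps D_hv_simple D_simple)
  have "\<exists>u. D y = D (D u)" using MG_zero_SZ[OF m(2,4)] unfolding LD.in_SZ by blast
  hence "(D ?u, y) \<in> LD.SZ" unfolding LD.in_SZ using DDu by blast
  moreover have "z - gi 0 (hv (cartan_map w)) = (D ?u, y)" unfolding e x(1) w Du gi_def by simp
  ultimately show ?thesis by (intro exI[of _ w]) (simp only:)
qed

text \<open>If \<open>cartan_map w\<close> is in the image of D, it is - sum n_k h_k over k in {1,
  2, 8}. It pairs to 0 with alpha_k, which forces 2 n_k = 0.\<close>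

lemma h_SZ:
  assumes "gi 0 (hv (cartan_map w)) \<in> LD.SZ"
  shows "w = 0"
proof -
  have "(hv (cartan_map w), 0) \<in> LD.SZ" using assms by (simp add: gi_def)
  then obtain u where u: "hv (cartan_map w) = D u" unfolding LD.in_SZ by blast
  have h: "hv (cartan_map w) = D (prM 0 u)" using prM_same[OF hv_MG, of "cartan_map w"] unfolding u prM_D by simp
  obtain v p n where
    e: "prM 0 u = hv v + (\<Sum>i\<in>ends. sc (p i) (ev (simple i))) + (\<Sum>i\<in>ends. sc (n i) (ev (- simple i)))"
    using MG_zero[OF prM_MG] by blast
  have "hv (- cartan_map w) + (hv (- (\<Sum>i\<in>ends. scale R (n i) (coroot R i)))
      + (\<Sum>i\<in>ends. sc (- rf (simple i) v) (ev (simple i)))) = 0"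
    unfolding hv_simps(3) h[unfolded D_MG_zero[OF e]] by (rule left_minus)
  hence "hv (- cartan_map w + - (\<Sum>i\<in>ends. scale R (n i) (coroot R i))) + (\<Sum>i\<in>ends. sc (- rf (simple i) v) (ev (simple i))) = 0"
    unfolding hv_simps(1) add.assoc .
  from ends_independent(1)[OF this]
  have h: "cartan_map w = - (\<Sum>i\<in>ends. scale R (n i) (coroot R i))"
    unfolding add_eq_0_iff minus_minus by (rule sym)
  have "n k = 0" if k: "k \<in> ends" for k
  proof -
    have "(\<Sum>i\<in>ends. n i * rf (simple k) (hc (simple i))) = (\<Sum>i\<in>ends. if i = k then 2 * n k else 0)"
      by (intro sum.cong refl) (auto simp: rf_hc form_ends[OF _ k])
    also have "\<dots> = 2 * n k" using k by (simp only: sum.delta finite.intros if_True)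
    finally have "2 * n k = - rf (simple k) (cartan_map w)" unfolding h rf_minus minus_minus rf_sum
      by (simp only: rf_simps flip: hc_axis)
    thus ?thesis using rf_cartan_map_end[OF k] two_k(2) by simp
  qed
  hence "cartan_map w = 0" unfolding h by simp
  thus ?thesis by (rule cartan_map_inj)
qed

lemma node_partner_bracket:
  assumes o: "odd_index j"
  shows "br (D (ev (simple (node j)))) (fv j) - br (ev (simple (node j))) (D (fv j)) = hv (hc (kappa j))"
proof -
  let ?p = "simple (partner j)" and ?n = "simple (node j)"
  have r: "is_root (?p + ?n)" "is_root (- (?p + ?n))"
    using end_add_node[OF o] unfolding is_root_minus by blast+
  have "br (D (ev ?n)) (fv j) = hv (- hc (?p + ?n))"
    unfolding D_node fv_def if_P[OF o] M.b_scale_left M.b_scale_right M.scale_scale e8sign_square M.scale_one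
      br_ee[OF r] right_minus by simp
  moreover have "br (ev ?n) (D (fv j)) = hv (hc ?n)"
    unfolding D_fv if_P[OF o] by (simp add: M.b_minus_right br_ee hv_simps)
  moreover have "hv (- hc (?p + ?n)) - hv (hc ?n) = - hv (hc ?p) + (- hv (hc ?n) - hv (hc ?n))"
    by (simp add: hc_simps hv_simps hv_diff)
  ultimately show ?thesis using o unfolding LD.neg_double by (simp add: kappa_def hc_diff hv_diff)
qed

lemma even_index: "\<not> odd_index j \<Longrightarrow> parity_g83 j = 0"
  by (cases "parity_g83 j") simp_all

lemma ef_same: "LD.bb (gi (parity_g83 j) (ev (simple (node j)))) (gi (parity_g83 j) (fv j)) = gi 0 (hv (cartan_map (coroot S j)))"
proof (cases "odd_index j")
  case True
  thus ?thesis using node_partner_bracket[OF True] by (simp add: gi_def LD.bb_def cartan_map_coroot)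
next
  case False
  thus ?thesis using even_index[OF False]
    by (simp add: gi_def LD.bb_def cartan_map_coroot fv_def kappa_def M.b_minus_right br_ee hv_simps)
qed

lemma e_kernel: "if parity_g83 j = 0 then D (ev (simple (node j))) = 0 else D (D (ev (simple (node j)))) = 0"
proof (cases "odd_index j")
  case True thus ?thesis using D_end_node[OF True] by (simp add: D_node LD.D_scale)
next
  case False thus ?thesis using even_index[OF False] by (simp add: D_node)
qed

lemma f_kernel: "if parity_g83 j = 0 then D (fv j) = 0 else D (D (fv j)) = 0"
proof (cases "odd_index j")
  case True thus ?thesis by (simp add: D_fv LD.D_minus D_minus_node)
next
  case False thus ?thesis using even_index[OF False] by (simp add: D_fv)
qed

lemma D_hv_cartan_map: "D (hv (cartan_map w)) = 0"
  by (simp add: D_hv rf_cartan_map_end)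

lemma e_MG: "ev (simple (node j)) \<in> MG (axis j 1)"
  using ev_MG[of "simple (node j)"] by (simp only: rdeg_node)

lemma f_MG: "fv j \<in> MG (- axis j 1)"
proof -
  have d: "rdeg (- (simple (partner j) + simple (node j))) = - axis j 1" "rdeg (- simple (node j)) = - axis j 1"
    unfolding rdeg_simps rdeg_end[OF partner_ends] rdeg_node by simp_all
  show ?thesis unfolding fv_def
    using ev_MG[of "- (simple (partner j) + simple (node j))"] ev_MG[of "- simple (node j)"] unfolding d
    using M.subspace_scale[OF MG_subspace] M.subspace_neg[OF MG_subspace] by (cases "odd_index j") simp_all
qed

lemma br_h_f: "br (hv (cartan_map w)) (fv j) = - sc (root S j w) (fv j)"
proof (cases "odd_index j")
  case True
  have "rf (- (simple (partner j) + simple (node j))) (cartan_map w) = - root S j w"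
    unfolding rf_simps(1,2) rf_cartan_map_end[OF partner_ends] rf_cartan_map_node by simp
  thus ?thesis unfolding fv_def if_P[OF True] M.b_scale_right br_he
    by (simp add: M.scale_minus_left M.scale_minus_right mult.commute)
next
  case False
  have "rf (- simple (node j)) (cartan_map w) = - root S j w" unfolding rf_simps(2) rf_cartan_map_node ..
  thus ?thesis using False
    by (simp add: fv_def M.b_minus_right br_he M.scale_minus_left M.scale_minus_right)
qed

text \<open>\<open>degree_eigen\<close> says that neither e_j nor D e_j moves a root vector of
  degree q anywhere, and that the coroot acts on the whole degree by one scalar. In a degree without
  roots the piece is zero and any scalar will do.\<close>

lemma SG_pos_eigen:
  assumes q: "q \<noteq> 0" "\<forall>i. q $ i \<ge> 0" "\<forall>i. q \<noteq> axis i 1"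
  shows "\<exists>j c. q $ j > 0 \<and> c \<noteq> 0 \<and> (\<forall>z\<in>SG q. LD.bb (gi (parity_g83 j) (ev (simple (node j)))) z = 0 \<and>
    LD.bb (gi 0 (hv (cartan_map (coroot S j)))) z = LD.ss c z)"
proof (cases "\<exists>a. is_root a \<and> rdeg a = q")
  case False
  obtain j where "q $ j \<noteq> 0" using q(1) by (auto simp: vec_eq_iff)
  hence j: "q $ j > 0" using q(2) by (simp add: order_less_le)
  have zero: "\<forall>z\<in>SG q. LD.bb g z = 0 \<and> LD.bb h z = LD.ss 1 z" for g h
  proof
    fix z assume "z \<in> SG q"
    hence "z = 0" using SG_zero[OF q(1)] False by blast
    thus "LD.bb g z = 0 \<and> LD.bb h z = LD.ss 1 z" by simp
  qed
  show ?thesis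
  proof (rule exI[of _ j], rule exI[of _ "1 :: 'k"], intro conjI)
    show "q $ j > 0" "(1 :: 'k) \<noteq> 0" using j by simp_all
  qed (rule zero)
next
  case True
  then obtain a where a: "is_root a" "rdeg a = q" by blast
  obtain j m where j: "q $ j > 0" and m: "m = 0 \<or> m = - 1" and c0: "\<forall>c. is_root c \<longrightarrow> rdeg c = q \<longrightarrow>
      \<not> is_root (simple (node j) + c) \<and> (odd_index j \<longrightarrow> \<not> is_root (simple (node j) + simple (partner j) + c)) \<and>
      3 dvd e8form (kappa j) c - (1 - m)"
    using degree_eigen[OF a q] by (elim exE conjE)
  have c: "\<not> is_root (simple (node j) + c)"
    "odd_index j \<Longrightarrow> \<not> is_root (simple (node j) + simple (partner j) + c)"
    "3 dvd e8form (kappa j) c - (1 - m)" if "is_root c" "rdeg c = q" for c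
    using c0[rule_format, OF that] by simp_all
  have "(axis j 1 + q) $ j \<noteq> 0" using j by (simp add: axis_def)
  hence nz: "axis j 1 + q \<noteq> 0" by (metis zero_index)
  have e: "br (ev (simple (node j))) x = 0" if "x \<in> MG q" for x
    by (rule br_ev_MG_zero[OF is_root_axis q(1) _ c(1) that]) (simp_all add: rdeg_node nz)
  have De: "br (D (ev (simple (node j)))) x = 0" if x: "x \<in> MG q" for x
  proof (cases "odd_index j")
    case True
    have "br (ev (simple (partner j) + simple (node j))) x = 0"
    proof (rule br_ev_MG_zero[OF end_add_node[OF True] q(1) _ _ x])
      show "rdeg (simple (partner j) + simple (node j)) + q \<noteq> 0"
        using nz by (simp add: rdeg_simps rdeg_node rdeg_end[OF partner_ends])
    qed (use c(2) True in \<open>simp add: add.commute\<close>)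
    thus ?thesis using True by (simp add: D_node M.b_scale_left)
  next
    case False thus ?thesis by (simp add: D_node)
  qed
  \<comment> \<open>1 - m is 1 or 2, and 2 is not zero in characteristic 3.\<close>
  have "(of_int (1 - m) :: 'k) \<noteq> 0" using m two_k(2) by auto
  moreover have "\<forall>z\<in>SG q. LD.bb (gi (parity_g83 j) (ev (simple (node j)))) z = 0 \<and>
      LD.bb (gi 0 (hv (cartan_map (coroot S j)))) z = LD.ss (of_int (1 - m)) z"
    using generator_annihilates[OF _ e De] coroot_eigen[OF q(1) c(3)] by blast
  ultimately show ?thesis using j by blast
qed

text \<open>\<open>degree_eigen\<close> is applied to - q, and the roots are negated afterwards; the
  eigenvalue becomes m - 1.\<close>

lemma SG_neg_eigen:
  assumes q: "q \<noteq> 0" "\<forall>i. q $ i \<le> 0" "\<forall>i. q \<noteq> - axis i 1"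
  shows "\<exists>j c. q $ j < 0 \<and> c \<noteq> 0 \<and> (\<forall>z\<in>SG q. LD.bb (gi (parity_g83 j) (fv j)) z = 0 \<and>
    LD.bb (gi 0 (hv (cartan_map (coroot S j)))) z = LD.ss c z)"
proof (cases "\<exists>a. is_root a \<and> rdeg a = q")
  case False
  obtain j where "q $ j \<noteq> 0" using q(1) by (auto simp: vec_eq_iff)
  hence j: "q $ j < 0" using q(2) by (simp add: order_less_le)
  have zero: "\<forall>z\<in>SG q. LD.bb g z = 0 \<and> LD.bb h z = LD.ss 1 z" for g h
  proof
    fix z assume "z \<in> SG q"
    hence "z = 0" using SG_zero[OF q(1)] False by blast
    thus "LD.bb g z = 0 \<and> LD.bb h z = LD.ss 1 z" by simp
  qed
  show ?thesis
  proof (rule exI[of _ j], rule exI[of _ "1 :: 'k"], intro conjI)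
    show "q $ j < 0" "(1 :: 'k) \<noteq> 0" using j by simp_all
  qed (rule zero)
next
  case True
  then obtain a where a: "is_root (- a)" "rdeg (- a) = - q" unfolding is_root_minus rdeg_simps by blast
  have q': "- q \<noteq> 0" "\<forall>i. (- q) $ i \<ge> 0" "\<forall>i. - q \<noteq> axis i 1"
    using q by (auto simp: minus_equation_iff[of q])
  obtain j m where j: "(- q) $ j > 0" and m: "m = 0 \<or> m = - 1" and c0: "\<forall>c. is_root c \<longrightarrow> rdeg c = - q \<longrightarrow>
      \<not> is_root (simple (node j) + c) \<and> (odd_index j \<longrightarrow> \<not> is_root (simple (node j) + simple (partner j) + c)) \<and>
      3 dvd e8form (kappa j) c - (1 - m)"
    using degree_eigen[OF a q'] by (elim exE conjE)
  have c': "\<not> is_root (simple (node j) + c)"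
    "odd_index j \<Longrightarrow> \<not> is_root (simple (node j) + simple (partner j) + c)"
    "3 dvd e8form (kappa j) c - (1 - m)" if "is_root c" "rdeg c = - q" for c
    using c0[rule_format, OF that] by simp_all
  have neg: "is_root (- c)" "rdeg (- c) = - q" if "is_root c" "rdeg c = q" for c
    using that by (simp_all add: rdeg_simps)
  have c: "\<not> is_root (- simple (node j) + c)"
    "odd_index j \<Longrightarrow> \<not> is_root (- (simple (partner j) + simple (node j)) + c)"
    "3 dvd e8form (kappa j) c - (m - 1)" if "is_root c" "rdeg c = q" for c
  proof -
    have "simple (node j) + - c = - (- simple (node j) + c)" by simp
    thus "\<not> is_root (- simple (node j) + c)" using c'(1)[OF neg[OF that]] by (metis is_root_minus)
    have "simple (node j) + simple (partner j) + - c = - (- (simple (partner j) + simple (node j)) + c)" by simp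
    thus "\<not> is_root (- (simple (partner j) + simple (node j)) + c)" if "odd_index j"
      using c'(2)[OF neg[OF \<open>is_root c\<close> \<open>rdeg c = q\<close>] that] by (metis is_root_minus)
    show "3 dvd e8form (kappa j) c - (m - 1)"
      using c'(3)[OF neg[OF that]] unfolding e8form_simps by presburger
  qed
  have "(- axis j 1 + q) $ j \<noteq> 0" using j by (simp add: axis_def)
  hence nz: "- axis j 1 + q \<noteq> 0" by (metis zero_index)
  have root: "is_root (- simple (node j))" by simp
  have d: "rdeg (- simple (node j)) + q \<noteq> 0" "rdeg (- (simple (partner j) + simple (node j))) + q \<noteq> 0"
    using nz unfolding rdeg_simps rdeg_node rdeg_end[OF partner_ends] by simp_all
  have n: "br (ev (- simple (node j))) x = 0" if "x \<in> MG q" for x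
    by (rule br_ev_MG_zero[OF root q(1) d(1) c(1) that])
  have f: "br (fv j) x = 0" if x: "x \<in> MG q" for x
  proof (cases "odd_index j")
    case True
    have "is_root (- (simple (partner j) + simple (node j)))" using end_add_node[OF True] unfolding is_root_minus .
    hence "br (ev (- (simple (partner j) + simple (node j)))) x = 0"
      using br_ev_MG_zero[OF _ q(1) d(2) c(2)[OF _ _ True] x] by blast
    thus ?thesis unfolding fv_def if_P[OF True] M.b_scale_left by (simp only: M.scale_zero_right)
  next
    case False thus ?thesis using n[OF x] by (simp add: fv_def M.b_minus_left)
  qed
  have Df: "br (D (fv j)) x = 0" if "x \<in> MG q" for x
    using n[OF that] by (simp add: D_fv M.b_minus_left)
  have "(of_int (m - 1) :: 'k) \<noteq> 0" using m two_k(2) by auto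
  moreover have "\<forall>z\<in>SG q. LD.bb (gi (parity_g83 j) (fv j)) z = 0 \<and>
      LD.bb (gi 0 (hv (cartan_map (coroot S j)))) z = LD.ss (of_int (m - 1)) z"
    using generator_annihilates[OF _ f Df] coroot_eigen[OF q(1) c(3)] by blast
  moreover have "q $ j < 0" using j by simp
  ultimately show ?thesis by blast
qed

lemma spr_props:
  "spr q (z + w) = spr q z + spr q w" "z \<in> SG q \<Longrightarrow> spr q z = z" "z \<in> SG p \<Longrightarrow> p \<noteq> q \<Longrightarrow> spr q z = 0"
  "z \<in> LD.SZ \<Longrightarrow> spr q z \<in> LD.SZ"
proof -
  obtain x y x' y' where e: "z = (x, y)" "w = (x', y')" by (cases z; cases w)
  show "spr q (z + w) = spr q z + spr q w" by (simp add: e spr_def prM_linear)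
  show "spr q z = z" if "z \<in> SG q" using that prM_same unfolding e spr_def in_SG by simp
  show "spr q z = 0" if z: "z \<in> SG p" "p \<noteq> q"
  proof -
    have "x \<in> MG p" "y \<in> MG p" using z(1) unfolding e in_SG by blast+
    hence "spr q z = (0, 0)" using prM_other[OF _ z(2)] by (simp add: e spr_def)
    thus ?thesis by (simp only: zero_prod_def)
  qed
  show "spr q z \<in> LD.SZ" if z: "z \<in> LD.SZ"
  proof -
    obtain u v where "D x = 0" "x = D u" "D y = D (D v)" using z unfolding e LD.in_SZ by blast
    hence "D (prM q x) = 0" "prM q x = D (prM q u)" "D (prM q y) = D (D (prM q v))"
      by (simp_all add: prM_zero flip: prM_D)
    thus ?thesis unfolding e spr_def fst_conv snd_conv LD.in_SZ by blast
  qed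
qed

lemma SG_decomposition:
  assumes "z \<in> pair.total LD.SP"
  shows "\<exists>T g. finite T \<and> (\<forall>q\<in>T. g q \<in> SG q) \<and> z = sum g T"
proof -
  obtain T where T: "finite T" "\<forall>x. (\<Sum>q\<in>T. prM q x) = x" using sum_prM by blast
  obtain x y where e: "z = (x, y)" by (cases z)
  have "D x = 0" "D (D y) = 0" using assms unfolding e LD.pair_total by blast+
  hence piece: "spr q z \<in> SG q" for q
    unfolding e spr_def fst_conv snd_conv in_SG by (simp add: prM_MG prM_zero flip: prM_D)
  have sum: "z = (\<Sum>q\<in>T. spr q z)"
    by (rule prod_eqI) (simp_all only: spr_def fst_sum snd_sum fst_conv snd_conv T(2)[rule_format])
  show ?thesis
    by (rule exI[of _ T], rule exI[of _ "\<lambda>q. spr q z"], intro conjI ballI) (rule T(1) piece sum)+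
qed

lemma g83_contragredient_model:
  "contragredient_model LD.ss LD.bb LD.SP LD.SZ parity_g83 S
     (\<lambda>j. gi (parity_g83 j) (ev (simple (node j)))) (\<lambda>j. gi (parity_g83 j) (fv j)) (\<lambda>w. gi 0 (hv (cartan_map w))) SG spr"
proof
  note Z0 = pair.subspace_0[OF LD.SZ_subspace]
  have mixed: "SG q \<subseteq> LD.SZ" if "q $ i > 0" "q $ j < 0" for q i j
  proof
    fix z assume z: "z \<in> SG q"
    have "q \<noteq> 0" using that by auto
    moreover have "rdeg a \<noteq> q" if "is_root a" for a
      using root_one_sided[OF that] \<open>q $ i > 0\<close> \<open>q $ j < 0\<close> rdeg_nth[of a] by (metis not_le)
    ultimately have "z = 0" using SG_zero z by blast
    thus "z \<in> LD.SZ" using Z0 by simp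
  qed
  have eG: "gi (parity_g83 j) (ev (simple (node j))) \<in> SG (axis j 1)" for j
    by (rule gi_SG[OF e_MG e_kernel])
  have fG: "gi (parity_g83 j) (fv j) \<in> SG (- axis j 1)" for j
    by (rule gi_SG[OF f_MG f_kernel])
  show "pair.lie_mod LD.SP LD.SZ" by (rule pair_lie)
  show "gi (parity_g83 j) (ev (simple (node j))) \<in> LD.SP (parity_g83 j)" for j by (rule gi_SP[OF e_kernel])
  show "gi (parity_g83 j) (fv j) \<in> LD.SP (parity_g83 j)" for j by (rule gi_SP[OF f_kernel])
  show "gi 0 (hv (cartan_map w)) \<in> LD.SP 0" for w by (rule gi_SP) (simp add: D_hv_cartan_map)
  show "gi 0 (hv (cartan_map (u + w))) = gi 0 (hv (cartan_map u)) + gi 0 (hv (cartan_map w))" for u w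
    by (simp add: gi_def cartan_map_add hv_simps)
  show "gi 0 (hv (cartan_map (scale S c w))) = LD.ss c (gi 0 (hv (cartan_map w)))" for c w
    by (simp only: cartan_map_scale hv_simps gi_scale)
  show "LD.bb (gi (parity_g83 i) (ev (simple (node i)))) (gi (parity_g83 j) (fv j))
      - (if i = j then gi 0 (hv (cartan_map (coroot S i))) else 0) \<in> LD.SZ" for i j
  proof (cases "i = j")
    case True thus ?thesis using Z0 by (simp add: ef_same)
  next
    case False
    have "(axis i 1 + - axis j 1 :: int^5) $ i > 0" "(axis i 1 + - axis j 1 :: int^5) $ j < 0"
      using False by (auto simp: axis_def)
    from mixed[OF this] show ?thesis using SG_mult[OF eG fG, of i j] False by auto
  qed
  show "LD.bb (gi 0 (hv (cartan_map w))) (gi (parity_g83 j) (ev (simple (node j))))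
      - LD.ss (root S j w) (gi (parity_g83 j) (ev (simple (node j)))) \<in> LD.SZ" for w j
    using Z0 by (simp add: h_gi br_he rf_cartan_map_node gi_scale)
  show "LD.bb (gi 0 (hv (cartan_map w))) (gi (parity_g83 j) (fv j)) + LD.ss (root S j w) (gi (parity_g83 j) (fv j)) \<in> LD.SZ" for w j
    using Z0 by (simp add: h_gi br_h_f gi_minus gi_scale)
  show "LD.bb (gi 0 (hv (cartan_map u))) (gi 0 (hv (cartan_map w))) \<in> LD.SZ" for u w
    using zero_SZ by (simp add: h_gi br_hh) (simp add: gi_def)
  show "w = 0" if "gi 0 (hv (cartan_map w)) \<in> LD.SZ" for w using that by (rule h_SZ)
  show "c = 0" if "scale S c (coroot S i) = 0" for c i
  proof -
    have "(\<Sum>j\<in>UNIV. scale S (if j = i then c else 0) (coroot S j)) = (\<Sum>j\<in>UNIV. if j = i then scale S c (coroot S j) else 0)"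
      by (intro sum.cong) auto
    also have "\<dots> = 0" using that by simp
    finally show "c = 0" using S_independent[of "\<lambda>j. if j = i then c else 0" i] by simp
  qed
  show "pair.subspace (SG q)" "SG q \<subseteq> pair.total LD.SP" for q by (rule SG_subspace SG_total)+
  show "gi (parity_g83 j) (ev (simple (node j))) \<in> SG (axis j 1)" "gi (parity_g83 j) (fv j) \<in> SG (- axis j 1)" for j
    by (rule eG fG)+
  show "gi 0 (hv (cartan_map w)) \<in> SG 0" for w by (rule gi_SG[OF hv_MG]) (simp add: D_hv_cartan_map)
  show "LD.bb z w \<in> SG (p + q)" if "z \<in> SG p" "w \<in> SG q" for z w p q using that by (rule SG_mult)
  show "spr q (z + w) = spr q z + spr q w" for q z w by (rule spr_props)
  show "spr q z = z" if "z \<in> SG q" for z q using that by (rule spr_props)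
  show "spr q z = 0" if "z \<in> SG p" "p \<noteq> q" for z p q using that by (rule spr_props)
  show "spr q z \<in> LD.SZ" if "z \<in> LD.SZ" for z q using that by (rule spr_props)
  show "\<exists>T g. finite T \<and> (\<forall>q\<in>T. g q \<in> SG q) \<and> z = sum g T" if "z \<in> pair.total LD.SP" for z
    using that by (rule SG_decomposition)
  show "\<exists>w. z - gi 0 (hv (cartan_map w)) \<in> LD.SZ" if "z \<in> SG 0" for z using that by (rule SG_0)
  show "\<exists>c. z - LD.ss c (gi (parity_g83 j) (ev (simple (node j)))) \<in> LD.SZ" if "z \<in> SG (axis j 1)" for z j
    using that by (rule SG_pos)
  show "\<exists>c. z - LD.ss c (gi (parity_g83 j) (fv j)) \<in> LD.SZ" if "z \<in> SG (- axis j 1)" for z j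
    using that by (rule SG_neg)
  show "SG q \<subseteq> LD.SZ" if "q $ i > 0" "q $ j < 0" for q i j using that by (rule mixed)
  show "\<exists>j c. q $ j > 0 \<and> c \<noteq> 0 \<and> (\<forall>z\<in>SG q. LD.bb (gi (parity_g83 j) (ev (simple (node j)))) z \<in> LD.SZ \<and>
      LD.bb (gi 0 (hv (cartan_map (coroot S j)))) z - LD.ss c z \<in> LD.SZ)"
    if "q \<noteq> 0" "\<forall>i. q $ i \<ge> 0" "\<forall>i. q \<noteq> axis i 1" for q
  proof -
    from SG_pos_eigen[OF that] obtain j c where "q $ j > 0" "c \<noteq> 0"
      "\<forall>z\<in>SG q. LD.bb (gi (parity_g83 j) (ev (simple (node j)))) z = 0 \<and> LD.bb (gi 0 (hv (cartan_map (coroot S j)))) z = LD.ss c z"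
      by blast
    thus ?thesis using Z0 by (intro exI[of _ j] exI[of _ c]) simp
  qed
  show "\<exists>j c. q $ j < 0 \<and> c \<noteq> 0 \<and> (\<forall>z\<in>SG q. LD.bb (gi (parity_g83 j) (fv j)) z \<in> LD.SZ \<and>
      LD.bb (gi 0 (hv (cartan_map (coroot S j)))) z - LD.ss c z \<in> LD.SZ)"
    if "q \<noteq> 0" "\<forall>i. q $ i \<le> 0" "\<forall>i. q \<noteq> - axis i 1" for q
  proof -
    from SG_neg_eigen[OF that] obtain j c where "q $ j < 0" "c \<noteq> 0"
      "\<forall>z\<in>SG q. LD.bb (gi (parity_g83 j) (fv j)) z = 0 \<and> LD.bb (gi 0 (hv (cartan_map (coroot S j)))) z = LD.ss c z"
      by blast
    thus ?thesis using Z0 by (intro exI[of _ j] exI[of _ c]) simp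
  qed
qed

theorem g83_presented:
  obtains \<psi> where "presents LD.ss LD.bb (pair.total LD.SP) LD.SP LD.SZ \<psi> (contragredient parity_g83 S)"
  using contragredient_model.contragredient_presented[OF g83_contragredient_model] by blast

end

theorem corollary4p6p1:
  fixes R :: "('k::alg_closed_field, 8, 'v::ab_group_add) realization"
    and S :: "('k, 5, 'w::ab_group_add) realization"
  assumes "CHAR('k) = 3"
    and "is_realization cartan_e8 R"
    and "is_realization cartan_g83 S"
  defines "e8 \<equiv> contragredient parity_e8 R"
    and "e \<equiv> chevalley_e parity_e8 R"
  defines "ad_x \<equiv> (\<lambda>y. (e 1 \<oplus>\<^bsub>e8\<^esub> e 2 \<oplus>\<^bsub>e8\<^esub> e 8) \<otimes>\<^bsub>e8\<^esub> y)"
  shows "lie_algebra_in_Rep_alpha3 e8 ad_x \<and>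
    isomorphic_superalgebras (semisimplification e8 ad_x) (contragredient parity_g83 S)"
proof -
  interpret e8_g83 R S by unfold_locales (rule assms)+
  obtain \<phi> where \<phi>: "presents sc br UNIV eP {0} \<phi> e8" and \<phi>_e: "\<And>i. \<phi> (ev (simple i)) = e i"
    using e8_presented unfolding e8_def e_def by blast
  note P = presentsD[OF \<phi>]
  \<comment> \<open>\<open>\<phi>\<close> matches root vectors with Chevalley generators, so it
    carries the model derivation D to \<open>ad_x\<close>.\<close>
  have d: "ad_x (\<phi> x) = \<phi> (D x)" for x
    unfolding ad_x_def D_def \<phi>_e[symmetric] by (simp only: P(5,6)[OF UNIV_I UNIV_I])
  have "lie_algebra_in_Rep_alpha3 e8 ad_x"
    by (rule LD.lie_algebra_in_Rep_alpha3I[OF \<phi> eP_simps(2) e8_lie_superalgebra[OF \<phi>] e8_finite_dimensional[OF \<phi>] d])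
  moreover have "semisimplification_model sc br D e8 eP \<phi> ad_x"
  proof (rule semisimplification_model.intro[OF LD.lie_derivation_axioms semisimplification_model_axioms.intro])
    show "presents sc br UNIV eP {0} \<phi> e8" "finite_dimensional e8" by (rule \<phi> e8_finite_dimensional[OF \<phi>])+
  qed (rule two_k(2), rule d, rule cube_SZ)
  note semi = semisimplification_model.semisimplification_presented[OF this]
  obtain \<psi> where \<psi>: "presents LD.ss LD.bb (pair.total LD.SP) LD.SP LD.SZ \<psi> (contragredient parity_g83 S)"
    by (rule g83_presented)
  note T = pair.lie_mod_total[OF pair_lie]
  \<comment> \<open>Both sides are now the quotient of the same pairs by the same
    \<open>SZ\<close>.\<close>
  have "isomorphic_superalgebras (semisimplification e8 ad_x) (contragredient parity_g83 S)"
  proof (rule presents_isomorphic[OF semi \<psi>])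
    fix x y c p assume x: "x \<in> pair.total LD.SP" and y: "y \<in> pair.total LD.SP"
    show "x + y \<in> pair.total LD.SP" using T(1) x y pair.subspace_add unfolding pair.subalgebra_def by blast
    show "LD.ss c x \<in> pair.total LD.SP" using T(1) x pair.subspace_scale unfolding pair.subalgebra_def by blast
    show "LD.bb x y \<in> pair.total LD.SP" using T(1) x y unfolding pair.subalgebra_def by blast
  qed (rule T(3))
  ultimately show ?thesis by blast
qed

end
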